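(* Let $(v_1,v_2,v_3,v_4)\in\mathbb{Z}^4$ with $1\le v_1<v_2<v_3<v_4$, $\gcd(v_1,v_2,v_3,v_4)=1$ and $v_1+v_2+v_3+v_4\le195$ (there are $2\,133\,561$ such vectors). Then every strong Lonely Runner zonotope $Z\subset\mathbb{R}^3$ whose volume vector, with entries listed in increasing order, equals $(v_1,v_2,v_3,v_4)$ satisfies $\mu(Z)\le\frac35$.
   Context: A Lonely Runner (LR) zonotope in $\mathbb{R}^{n-1}$ is a zonotope $Z=c+\sum_{i=1}^n[0,u_i]$ (Minkowski sum of segments, $c\in\mathbb{R}^{n-1}$) generated by $n$ integer vectors $u_1,\dots,u_n\in\mathbb{Z}^{n-1}$ such that every $n-1$ of them form a linear basis of $\mathbb{R}^{n-1}$. Its volume vector is $(v_1,\dots,v_n)$ with $v_i=|\det(u_j : j\neq i)|$. It is a strong LR (sLR) zonotope if the entries of its volume vector are pairwise distinct. Here $n=4$. The covering radius $\mu(Z)$ is the smallest $\rho>0$ such that $\rho Z+\mathbb{Z}^3=\mathbb{R}^3$. *)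

theory Defs
  imports "HOL-Analysis.Analysis"
begin

definition integer_lattice :: "(real^'n) set" where
  "integer_lattice = {x. \<forall>i. x $ i \<in> \<int>}"

(* Addition of sets, here and below, is the Minkowski sum of HOL-Library.Set_Algebras. *)
definition zonotope :: "real^'n \<Rightarrow> (real^'n) list \<Rightarrow> (real^'n) set" where
  "zonotope c us = {c} + (\<Sum>u\<leftarrow>us. closed_segment 0 u)"

(* For a compact Z with nonempty interior the minimum is attained, so LEAST is meaningful. *)
definition covering_radius :: "(real^'n) set \<Rightarrow> real" where
  "covering_radius Z =
     (LEAST \<rho>. \<rho> > 0 \<and> ((*\<^sub>R) \<rho> ` Z) + integer_lattice = UNIV)"

definition omit_nth :: "nat \<Rightarrow> 'a list \<Rightarrow> 'a list" where
  "omit_nth i xs = take i xs @ drop (Suc i) xs"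

(* A finite family is a basis iff it has no repetitions and its set of members is
   independent and spanning; "distinct" excludes families with repeated members. *)
definition basis_list :: "(real^'n) list \<Rightarrow> bool" where
  "basis_list bs \<longleftrightarrow> distinct bs \<and> independent (set bs) \<and> span (set bs) = UNIV"

definition LR_generators :: "(real^'n) list \<Rightarrow> bool" where
  "LR_generators us \<longleftrightarrow>
     length us = CARD('n) + 1 \<and>
     set us \<subseteq> integer_lattice \<and>
     (\<forall>i < length us. basis_list (omit_nth i us))"

(* The matrix has the vectors of the list as its rows; the determinant is the same for columns. *)
definition volume_vector :: "(real^3) list \<Rightarrow> real list" where
  "volume_vector us =
     map (\<lambda>i. \<bar>det (vector (omit_nth i us) :: real^3^3)\<bar>) [0..<length us]"

(* The generators are kept as an argument because the volume vector is read off from them. *)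
definition sLR_zonotope :: "(real^3) set \<Rightarrow> real^3 \<Rightarrow> (real^3) list \<Rightarrow> bool" where
  "sLR_zonotope Z c us \<longleftrightarrow>
     Z = zonotope c us \<and> LR_generators us \<and> distinct (volume_vector us)"

definition admissible_vectors :: "(int \<times> int \<times> int \<times> int) set" where
  "admissible_vectors =
     {(v1, v2, v3, v4). 1 \<le> v1 \<and> v1 < v2 \<and> v2 < v3 \<and> v3 < v4 \<and>
        Gcd {v1, v2, v3, v4} = 1 \<and> v1 + v2 + v3 + v4 \<le> 195}"

end

theory Submission
  imports Defs
begin

text \<open>
  The generators of a Lonely Runner zonotope satisfy one linear relation, whose coefficients are up to sign the
  entries of the volume vector. Moving the coordinates of a point along this relation shows that \<open>3/5 Z\<close> covers
  space as soon as four runners with pairwise distinct speeds and arbitrary starting points have a common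
  time at which all of them are at distance at least \<open>1/5\<close> from the integers.

  This is proved for all real speeds, together with the analogues for two runners (distance \<open>1/3\<close>) and three
  runners (distance \<open>1/4\<close>). If there is no such time, the periodic open gaps in which some runner is close to an
  integer cover the line. Each endpoint of a gap then lies in a gap of another runner; branching over the
  possibilities yields linear inequalities in the reciprocal speeds and the gap centres, and after finitely many
  branchings Farkas multipliers show every system to be infeasible. The search tree with its multipliers
  is a certificate that a verified checker evaluates. The tree becomes infinite near velocities for which the problem
  degenerates (nearly equal speeds, or speeds of different magnitude); these regions are treated by hand,
  by synchronising fast runners whose relative positions were arranged with the theorem for fewer runners.
\<close>

section \<open>Certificates for coverings by periodic gaps\<close>

text \<open>The constant 3/5 is 1 - 2/5: a coefficient that, after adding 1/5, is at distance at
  least 1/5 from the integers lies in [0, 3/5] modulo 1. Rescaling time multiplies reciprocal speeds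
  and gap centres by a common factor, so only three ratios of speeds matter, and these are what the
  boxes subdivide. The centres are never subdivided: they are constrained only by inequalities
  linear in centres and reciprocal speeds jointly, so one set of multipliers serves all starting
  points and a whole box of speeds. Translating all centres, or moving one by its own period,
  preserves the covering; hence the centres can be normalised independently on each box. One
  normalisation starts at a time that is good, with the larger distance, for all runners but the
  fastest, which forces the order two, three, four runners. Nearly equal speeds are the obstacle:
  the relative position of such runners drifts so slowly that a search gap by gap would run through
  unboundedly many periods. The arguments by hand regard this drift as a slow problem and the common
  motion as a fast clock.\<close>

text \<open>In a suitable time scale the gaps of runner \<open>k\<close> are the open intervals with centres
  \<open>c k + (D - 1) D j Q k\<close> for integers \<open>j\<close> and radius \<open>(D - 1) Q k\<close>, where \<open>Q k\<close> is proportional to the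
  reciprocal speed. An edge \<open>Ed a x b y\<close> stands for the inequality \<open>c a + x Q a \<le> c b + y Q b\<close>, where the
  node \<open>Og\<close> is the origin of time. A component \<open>(n, d, n', d')\<close> of a box bounds the ratio of two consecutive
  entries of \<open>Q\<close> by \<open>n / d\<close> from below and by \<open>n' / d'\<close> from above; \<open>d' = 0\<close> means that there is no upper bound.

  In a certificate \<open>Pt\<close> names an endpoint of a gap and has one subtree for each gap that may contain it (or shows that
  the current inequalities are contradictory), \<open>Sp\<close> bisects the box, \<open>Ex\<close> refers to a region treated by hand, and
  \<open>Ro\<close> selects a normalisation of the gap centres.\<close>

datatype node = Og | R1 | R2 | R3 | R4
datatype edge = Ed node int node int
datatype form = Fm int int int int int int int int
datatype cert = Pt int "cert list" | Sp int cert cert | Ex int | Ro int cert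
type_synonym box = "(int \<times> int \<times> int \<times> int) list"

section \<open>Linear forms in gap centres and reciprocal speeds\<close>

fun point_val :: "(node \<Rightarrow> real) \<Rightarrow> (node \<Rightarrow> real) \<Rightarrow> node \<Rightarrow> int \<Rightarrow> real" where
  "point_val Q c Og x = 0"
| "point_val Q c k x = c k + x * Q k"

fun edge_val :: "(node \<Rightarrow> real) \<Rightarrow> (node \<Rightarrow> real) \<Rightarrow> edge \<Rightarrow> real" where
  "edge_val Q c (Ed a x b y) = point_val Q c b y - point_val Q c a x"

fun form_val :: "(node \<Rightarrow> real) \<Rightarrow> (node \<Rightarrow> real) \<Rightarrow> form \<Rightarrow> real" where
  "form_val Q c (Fm x y z w p q r s) =
     x * c R1 + y * c R2 + z * c R3 + w * c R4 + (p * Q R1 + q * Q R2 + r * Q R3 + s * Q R4)"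

fun add_node :: "node \<Rightarrow> int \<Rightarrow> int \<Rightarrow> form \<Rightarrow> form" where
  "add_node Og m n f = f"
| "add_node R1 m n (Fm x y z w p q r s) = Fm (x + m) y z w (p + n) q r s"
| "add_node R2 m n (Fm x y z w p q r s) = Fm x (y + m) z w p (q + n) r s"
| "add_node R3 m n (Fm x y z w p q r s) = Fm x y (z + m) w p q (r + n) s"
| "add_node R4 m n (Fm x y z w p q r s) = Fm x y z (w + m) p q r (s + n)"

fun add_edge :: "int \<Rightarrow> edge \<Rightarrow> form \<Rightarrow> form" where
  "add_edge m (Ed a x b y) f = add_node b m (m * y) (add_node a (- m) (- (m * x)) f)"

lemma form_val_add_node: "form_val Q c (add_node a m (m * x) f) = m * point_val Q c a x + form_val Q c f"
  by (cases a; cases f) (simp_all add: algebra_simps)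

lemma form_val_add_edge: "form_val Q c (add_edge m e f) = m * edge_val Q c e + form_val Q c f"
proof (cases e)
  case (Ed a x b y)
  then show ?thesis using form_val_add_node[of Q c a "- m" x f] form_val_add_node[of Q c b m y]
    by (simp add: algebra_simps)
qed

definition zero_form :: form where "zero_form = Fm 0 0 0 0 0 0 0 0"

section \<open>Upper bounds for linear forms on a box of ratios\<close>

text \<open>An upper bound for a multiple of a linear form in units of the last variable; the value 1 only signals failure.\<close>

fun box_max :: "box \<Rightarrow> int list \<Rightarrow> int" where
  "box_max [] [z] = z"
| "box_max ((n, d, n', d') # bs) (p # q # rs) =
     (if p > 0 then if d' = 0 then 1 else box_max bs ((p * n' + q * d') # map ((*) d') rs)
      else box_max bs ((p * n + q * d) # map ((*) d) rs))"
| "box_max _ _ = 1"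

fun in_box :: "box \<Rightarrow> real list \<Rightarrow> bool" where
  "in_box ((n, d, n', d') # bs) (x # y # xs) \<longleftrightarrow>
     0 < d \<and> 0 \<le> d' \<and> n * y \<le> d * x \<and> d' * x \<le> n' * y \<and> in_box bs (y # xs)"
| "in_box _ _ \<longleftrightarrow> True"

definition lin :: "int list \<Rightarrow> real list \<Rightarrow> real" where
  "lin ps xs = (\<Sum>(p, x)\<leftarrow>zip ps xs. real_of_int p * x)"

lemma lin_Cons [simp]: "lin (p # ps) (x # xs) = p * x + lin ps xs" and lin_Nil [simp]: "lin [] xs = 0"
  by (simp_all add: lin_def)

lemma lin_map_mult: "lin (map ((*) k) ps) xs = k * lin ps xs"
proof (induction ps arbitrary: xs)
  case (Cons p ps) then show ?case by (cases xs) (simp_all add: lin_def algebra_simps)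
qed simp

text \<open>Each variable is eliminated at the end of its ratio interval that maximises the form,
  which is sharp because the ratios in a box vary independently. The factor \<open>k\<close>
  collects the cleared denominators. Since it may be arbitrarily small, the failure value 1 also
  satisfies the claim, and no separate success flag has to be tracked.\<close>

lemma box_max:
  fixes xs :: "real list"
  assumes "in_box bs xs" "length ps = length xs" "length xs = Suc (length bs)"
    "\<forall>x\<in>set xs. 0 < x"
  shows "\<exists>k>0. k * lin ps xs \<le> box_max bs ps * last xs"
  using assms
proof (induction bs ps arbitrary: xs rule: box_max.induct)
  case (1 z)
  then obtain x where "xs = [x]" by (cases xs) auto
  then show ?case by (auto intro: exI[of _ 1])
next
  case (2 n d n' d' bs p q rs)
  then obtain x y ys where xs: "xs = x # y # ys" by (cases xs; cases "tl xs") auto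
  note b = "2.prems"[unfolded xs]
  have pos: "0 < x" "0 < y" "0 < last (y # ys)" using b(4) last_in_set[of "y # ys"] by fastforce+
  show ?case
  proof (cases "p > 0")
    case True
    show ?thesis
    proof (cases "d' = 0")
      case d: True
      show ?thesis
      proof (cases "lin (p # q # rs) xs \<le> 0")
        case True
        then show ?thesis using pos xs \<open>p > 0\<close> d by (intro exI[of _ 1]) auto
      next
        case False
        then show ?thesis using pos xs \<open>p > 0\<close> d
          by (intro exI[of _ "last xs / lin (p # q # rs) xs"]) auto
      qed
    next
      case d: False
      have "\<exists>k>0. k * lin ((p * n' + q * d') # map ((*) d') rs) (y # ys)
          \<le> box_max bs ((p * n' + q * d') # map ((*) d') rs) * last (y # ys)"
        using b by (intro "2.IH"(1)[OF True d]) auto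
      then obtain k where k: "k > 0" "k * lin ((p * n' + q * d') # map ((*) d') rs) (y # ys)
          \<le> box_max bs ((p * n' + q * d') # map ((*) d') rs) * last (y # ys)" by blast
      have "p * (d' * x) \<le> p * (n' * y)" using True b(1) by (intro mult_left_mono) auto
      then have "d' * lin (p # q # rs) xs \<le> lin ((p * n' + q * d') # map ((*) d') rs) (y # ys)"
        by (simp add: xs lin_map_mult algebra_simps)
      then have "k * (d' * lin (p # q # rs) xs) \<le> k * lin ((p * n' + q * d') # map ((*) d') rs) (y # ys)"
        using k(1) by (intro mult_left_mono) auto
      then have "(k * d') * lin (p # q # rs) xs
          \<le> box_max bs ((p * n' + q * d') # map ((*) d') rs) * last (y # ys)"
        using k(2) unfolding mult.assoc by (rule order_trans)
      moreover have "0 < k * d'" using k(1) d b(1) by auto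
      ultimately show ?thesis using True d unfolding xs by (intro exI[of _ "k * d'"]) (simp del: lin_Cons)
    qed
  next
    case False
    have "\<exists>k>0. k * lin ((p * n + q * d) # map ((*) d) rs) (y # ys)
        \<le> box_max bs ((p * n + q * d) # map ((*) d) rs) * last (y # ys)"
      using b by (intro "2.IH"(2)[OF False]) auto
    then obtain k where k: "k > 0" "k * lin ((p * n + q * d) # map ((*) d) rs) (y # ys)
        \<le> box_max bs ((p * n + q * d) # map ((*) d) rs) * last (y # ys)" by blast
    have "p * (d * x) \<le> p * (n * y)" using False b(1) by (intro mult_left_mono_neg) auto
    then have "d * lin (p # q # rs) xs \<le> lin ((p * n + q * d) # map ((*) d) rs) (y # ys)"
      by (simp add: xs lin_map_mult algebra_simps)
    then have "k * (d * lin (p # q # rs) xs) \<le> k * lin ((p * n + q * d) # map ((*) d) rs) (y # ys)"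
      using k(1) by (intro mult_left_mono) auto
    then have "(k * d) * lin (p # q # rs) xs
        \<le> box_max bs ((p * n + q * d) # map ((*) d) rs) * last (y # ys)"
      using k(2) unfolding mult.assoc by (rule order_trans)
    moreover have "0 < k * d" using k(1) b(1) by auto
    ultimately show ?thesis using False unfolding xs by (intro exI[of _ "k * d"]) (simp del: lin_Cons)
  qed
qed auto

definition ratios :: "(node \<Rightarrow> real) \<Rightarrow> real list" where "ratios Q = [Q R1, Q R2, Q R3, Q R4]"

text \<open>A box restricts only \<open>Q\<close>, so a form in which some centre has not cancelled
  cannot be bounded; the value 1 again signals failure.\<close>

fun form_max :: "box \<Rightarrow> form \<Rightarrow> int" where
  "form_max b (Fm x y z w p q r s) =
     (if x = 0 \<and> y = 0 \<and> z = 0 \<and> w = 0 then box_max b [p, q, r, s] else 1)"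

definition box_ok :: "box \<Rightarrow> (node \<Rightarrow> real) \<Rightarrow> bool" where
  "box_ok b Q \<longleftrightarrow> length b = 3 \<and> in_box b (ratios Q) \<and> (\<forall>k. 0 < Q k)"

text \<open>Only the sign of the bound is transferred, and the unknown positive factor from
  \<open>box_max\<close> does not affect it.\<close>

lemma form_max:
  assumes "box_ok b Q" "form_max b f \<le> 0"
  shows "form_val Q c f \<le> 0" "form_max b f < 0 \<Longrightarrow> form_val Q c f < 0"
proof -
  obtain x y z w p q r s where f: "f = Fm x y z w p q r s" by (cases f)
  from assms(2) f have z: "x = 0" "y = 0" "z = 0" "w = 0" by (auto split: if_splits)
  have v: "form_val Q c f = lin [p, q, r, s] (ratios Q)" by (simp add: f z ratios_def)
  have "\<exists>k>0. k * lin [p, q, r, s] (ratios Q) \<le> box_max b [p, q, r, s] * last (ratios Q)"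
    using assms(1) by (intro box_max) (auto simp: box_ok_def ratios_def)
  then obtain k where k: "k > 0" "k * lin [p, q, r, s] (ratios Q) \<le> box_max b [p, q, r, s] * last (ratios Q)"
    by blast
  have k2: "k * form_val Q c f \<le> form_max b f * Q R4"
    using k(2) unfolding v by (simp add: f z ratios_def)
  have Q: "Q R4 > 0" using assms(1) by (auto simp: box_ok_def)
  have "form_max b f * Q R4 \<le> 0" using assms(2) Q by (simp add: mult_nonpos_nonneg)
  with k(1) k2 show "form_val Q c f \<le> 0" by (meson linorder_not_less mult_pos_pos order_trans)
  show "form_val Q c f < 0" if "form_max b f < 0"
  proof -
    have "form_max b f * Q R4 < 0" using that Q by (simp add: mult_neg_pos)
    with k2 have "k * form_val Q c f < 0" by linarith
    with k(1) show ?thesis by (simp add: mult_less_0_iff)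
  qed
qed

section \<open>Decoding the certificate streams\<close>

text \<open>The numerals of a certificate are bit streams, least significant bit first. A number is encoded by its
  binary digits after the leading one, each preceded by the bit 1, and is terminated by the bit 0.\<close>

fun read_num :: "num \<Rightarrow> num \<Rightarrow> num \<times> num" where
  "read_num (num.Bit1 (num.Bit0 r)) v = read_num r (num.Bit0 v)"
| "read_num (num.Bit1 (num.Bit1 r)) v = read_num r (num.Bit1 v)"
| "read_num (num.Bit0 r) v = (v, r)"
| "read_num _ v = (v, num.One)"

text \<open>Decoders never lengthen their stream. This is what the termination proofs of
  \<open>combine\<close> and \<open>covers\<close> rest on.\<close>

lemma read_num_size: "read_num r v = (k, r') \<Longrightarrow> size r' \<le> size r"
  by (induction r v arbitrary: k r' rule: read_num.induct) (auto intro: le_SucI)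

text \<open>The last binary digit is the sign, the digits before it are the absolute value, and the
  number 1 encodes zero.\<close>

fun read_int :: "num \<Rightarrow> int \<times> num" where
  "read_int r = (case read_num r num.One of (v, r') \<Rightarrow>
     (case v of num.One \<Rightarrow> 0 | num.Bit0 k \<Rightarrow> Int.Pos k | num.Bit1 k \<Rightarrow> Int.Neg k, r'))"

lemma read_int_size: "read_int r = (k, r') \<Longrightarrow> size r' \<le> size r"
  by (auto split: prod.splits dest: read_num_size)

text \<open>This drops \<open>k - 1\<close> entries. The recursion follows the binary digits of
  \<open>k\<close>, so that \<open>k\<close> is never converted to unary.\<close>

fun skip :: "num \<Rightarrow> 'a list \<Rightarrow> 'a list" where
  "skip num.One xs = xs"
| "skip (num.Bit0 k) xs = skip k (skip k (tl xs))"
| "skip (num.Bit1 k) xs = skip k (skip k (tl (tl xs)))"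

lemma set_skip: "set (skip k xs) \<subseteq> set xs"
proof (induction k xs rule: skip.induct)
  case (2 k xs)
  then show ?case by (metis order_trans list.set_sel(2) set_empty subset_iff tl_Nil skip.simps(2))
next
  case (3 k xs)
  then show ?case by (metis order_trans list.set_sel(2) set_empty subset_iff tl_Nil skip.simps(3))
qed simp

text \<open>Literals can be written in \<open>int\<close> but not in \<open>num\<close>. The binary
  representation of the literal is the stream itself, and the code equation below hands it over
  without computation.\<close>

definition num_of :: "int \<Rightarrow> num" where "num_of i = (THE r. i = numeral r)"

lemma num_of_code [code]: "num_of (Int.Pos r) = r"
  unfolding num_of_def by (rule the_equality) (simp_all add: Int.Pos_def)

lemma num_of_numeral: "num_of (numeral r) = r"
  by (metis Int.Pos_def num_of_code)

text \<open>A Farkas combination. Each entry is a bit 1, the position of an edge counted from the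
  last edge used, and its multiplier; a bit 0 ends the list. Multipliers have type
  \<open>num\<close> and are thus positive by construction.\<close>

function (sequential) combine :: "edge list \<Rightarrow> num \<Rightarrow> form \<Rightarrow> form \<times> num" where
  "combine es (num.Bit1 r) f = (case read_num r num.One of (k, r1) \<Rightarrow> case read_num r1 num.One of (m, r2) \<Rightarrow>
     (case skip k es of [] \<Rightarrow> (f, r2) | e # es' \<Rightarrow> combine es' r2 (add_edge (Int.Pos m) e f)))"
| "combine es (num.Bit0 r) f = (f, r)"
| "combine es num.One f = (f, num.One)"
  by pat_completeness auto
termination
  by (relation "Wellfounded.measure (\<lambda>(es, r, f). size r)") (auto dest!: read_num_size[OF sym])

lemma combine_size: "combine es r f = (g, r') \<Longrightarrow> size r' \<le> size r"
proof (induction es r f arbitrary: g r' rule: combine.induct)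
  case (1 es r f)
  then show ?case by (fastforce split: prod.splits list.splits dest!: read_num_size)
qed auto

lemma combine_val:
  assumes "combine es r f = (g, r')" "\<forall>e\<in>set es. 0 \<le> edge_val Q c e"
  shows "form_val Q c f \<le> form_val Q c g"
  using assms
proof (induction es r f arbitrary: g r' rule: combine.induct)
  case (1 es r f)
  obtain k r1 where 2: "read_num r num.One = (k, r1)" by fastforce
  obtain m r2 where 3: "read_num r1 num.One = (m, r2)" by fastforce
  show ?case
  proof (cases "skip k es")
    case Nil
    with 1 2 3 show ?thesis by simp
  next
    case (Cons e es')
    have sub: "e \<in> set es" "set es' \<subseteq> set es" using set_skip[of k es] Cons by auto
    have "form_val Q c f \<le> form_val Q c (add_edge (Int.Pos m) e f)"
      using sub 1(3) by (simp add: form_val_add_edge)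
    also have "\<dots> \<le> form_val Q c g"
      using "1.IH"[OF 2[symmetric] 3[symmetric] Cons] 1(2-3) 2 3 Cons sub by auto
    finally show ?thesis .
  qed
qed auto

section \<open>Farkas proofs from branch and root inequalities\<close>

type_synonym roots = "num \<Rightarrow> edge list"

text \<open>The bit after the combination of branch edges tells whether root edges follow. A bit 1
  stays in the stream, because it is at the same time the marker that \<open>combine\<close> expects
  before the first root entry.\<close>

definition combine_root :: "roots \<Rightarrow> num \<Rightarrow> edge list \<Rightarrow> num \<Rightarrow> form \<Rightarrow> form \<times> num" where
  "combine_root R t es r f = (case combine es r f of (g, r1) \<Rightarrow>
     (case r1 of num.Bit1 r2 \<Rightarrow> combine (R t) r1 g | num.Bit0 r2 \<Rightarrow> (g, r2) | num.One \<Rightarrow> (g, r1)))"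

lemma combine_root_size: "combine_root R t es r f = (g, r') \<Longrightarrow> size r' \<le> size r"
  unfolding combine_root_def
  by (auto split: prod.splits num.splits simp del: combine.simps dest!: combine_size)

definition edges_ok :: "(node \<Rightarrow> real) \<Rightarrow> (node \<Rightarrow> real) \<Rightarrow> edge list \<Rightarrow> bool" where
  "edges_ok Q c es \<longleftrightarrow> (\<forall>e\<in>set es. 0 \<le> edge_val Q c e)"

lemma combine_root_val:
  assumes "combine_root R t es r f = (g, r')" "edges_ok Q c es" "edges_ok Q c (R t)"
  shows "form_val Q c f \<le> form_val Q c g"
proof -
  obtain g1 r1 where 1: "combine es r f = (g1, r1)" by fastforce
  then have "form_val Q c f \<le> form_val Q c g1" using combine_val assms(2) by (auto simp: edges_ok_def)
  also have "\<dots> \<le> form_val Q c g"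
    using assms(1,3) 1 combine_val[of "R t" r1 g1 g r' Q c]
    by (cases r1) (auto simp: combine_root_def edges_ok_def)
  finally show ?thesis .
qed

text \<open>The frequent case of a Farkas proof without multipliers: a single known edge joins the
  same two nodes in the opposite direction. The centres cancel in the sum, and the ratios of
  \<open>Q\<close> alone decide.\<close>

fun auto_bound :: "box \<Rightarrow> edge \<Rightarrow> edge list \<Rightarrow> bool" where
  "auto_bound b (Ed i x k y) (Ed i' x' k' y' # es) =
     (if i = k' \<and> k = i' then
        if form_max b (add_edge 1 (Ed i' x' k' y') (add_edge 1 (Ed i x k y) zero_form)) \<le> 0 then True
        else auto_bound b (Ed i x k y) es
      else auto_bound b (Ed i x k y) es)"
| "auto_bound b e [] = False"

text \<open>All variants prove the value of \<open>e\<close> nonpositive. The prefix 00 searches the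
  branch edges, 01 searches the root edges, and 1 introduces explicit multipliers.\<close>

fun bound :: "roots \<Rightarrow> num \<Rightarrow> box \<Rightarrow> edge list \<Rightarrow> edge \<Rightarrow> num \<Rightarrow> bool \<times> num" where
  "bound R t b es e (num.Bit0 (num.Bit0 r)) = (auto_bound b e es, r)"
| "bound R t b es e (num.Bit0 (num.Bit1 r)) = (auto_bound b e (R t), r)"
| "bound R t b es e (num.Bit1 r) = (case read_num r num.One of (m, r1) \<Rightarrow>
     case combine_root R t es r1 (add_edge (Int.Pos m) e zero_form) of (f, r2) \<Rightarrow> (form_max b f \<le> 0, r2))"
| "bound R t b es e r = (False, r)"

text \<open>Both multipliers are stored increased by 1, so that one of them may be 0. Both being 0
  is rejected, since such a combination would refute nothing.\<close>

fun dead :: "roots \<Rightarrow> num \<Rightarrow> box \<Rightarrow> edge list \<Rightarrow> edge \<Rightarrow> edge \<Rightarrow> num \<Rightarrow> bool \<times> num" where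
  "dead R t b es e1 e2 r = (case read_num r num.One of (m1, r1) \<Rightarrow> case read_num r1 num.One of (m2, r2) \<Rightarrow>
     case combine_root R t es r2 (add_edge (Int.Pos m1 - 1) e1 (add_edge (Int.Pos m2 - 1) e2 zero_form)) of (f, r3) \<Rightarrow>
     (if m1 = num.One \<and> m2 = num.One then False else form_max b f \<le> 0, r3))"

lemma bound_size: "bound R t b es e r = (ok, r') \<Longrightarrow> size r' \<le> size r"
  by (induction R t b es e r arbitrary: ok r' rule: bound.induct)
    (auto split: prod.splits dest!: read_num_size combine_root_size)

lemma dead_size: "dead R t b es e1 e2 r = (ok, r') \<Longrightarrow> size r' \<le> size r"
  by (auto split: prod.splits dest!: read_num_size combine_root_size)

section \<open>Branching over the gaps that may contain an endpoint\<close>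

definition left_end :: "int \<Rightarrow> int \<Rightarrow> int" where "left_end D j = (D - 1) * (D * j - 1)"
definition right_end :: "int \<Rightarrow> int \<Rightarrow> int" where "right_end D j = (D - 1) * (D * j + 1)"

text \<open>Runs through the gaps of the runners \<open>k # ks\<close>, starting with the \<open>j\<close>-th gap of \<open>k\<close>. A gap that may contain the
  endpoint \<open>n\<close> of \<open>i\<close> is recorded as a branch; \<open>dead\<close> refutes a single gap, and \<open>bound\<close> all those beyond a given
  one.\<close>

function (sequential) covers :: "int \<Rightarrow> roots \<Rightarrow> num \<Rightarrow> box \<Rightarrow> edge list \<Rightarrow> node \<Rightarrow> int \<Rightarrow> node \<Rightarrow> node list \<Rightarrow> int \<Rightarrow> num
    \<Rightarrow> (edge \<times> edge) list \<Rightarrow> (edge \<times> edge) list option" where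
  "covers D R t b es i n k ks j (num.Bit1 (num.Bit1 r)) acc = covers D R t b es i n k ks (j + 1) r
     ((Ed k (left_end D j) i n, Ed i n k (right_end D j)) # acc)"
| "covers D R t b es i n k ks j (num.Bit1 (num.Bit0 r)) acc =
     (case dead R t b es (Ed k (left_end D j) i n) (Ed i n k (right_end D j)) r of (ok, r1) \<Rightarrow>
       if ok then covers D R t b es i n k ks (j + 1) r1 acc else None)"
| "covers D R t b es i n k ks j (num.Bit0 r) acc = (case bound R t b es (Ed k (left_end D j) i n) r of (ok, r1) \<Rightarrow>
     if ok then (case ks of [] \<Rightarrow> Some acc | k' # ks' \<Rightarrow> (case read_int r1 of (j', r2) \<Rightarrow>
       case bound R t b es (Ed i n k' (right_end D (j' - 1))) r2 of (ok', r3) \<Rightarrow>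
       if ok' then covers D R t b es i n k' ks' j' r3 acc else None))
     else None)"
| "covers D R t b es i n k ks j r acc = None"
  by pat_completeness auto
termination
  by (relation "Wellfounded.measure (\<lambda>(D, R, t, b, es, i, n, k, ks, j, r, acc). size r)")
    (auto split: prod.splits simp del: read_int.simps bound.simps dead.simps
      dest!: read_int_size[OF sym] bound_size[OF sym] dead_size[OF sym])

fun split_box :: "num \<Rightarrow> num \<Rightarrow> num \<Rightarrow> box \<Rightarrow> box \<times> box" where
  "split_box num.One n d ((n1, d1, n2, d2) # b)
      = ((n1, d1, Int.Pos n, Int.Pos d) # b, (Int.Pos n, Int.Pos d, n2, d2) # b)"
| "split_box (num.Bit0 num.One) n d (x # (n1, d1, n2, d2) # b) =
     (x # (n1, d1, Int.Pos n, Int.Pos d) # b, x # (Int.Pos n, Int.Pos d, n2, d2) # b)"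
| "split_box _ n d (x # y # (n1, d1, n2, d2) # b) =
     (x # y # (n1, d1, Int.Pos n, Int.Pos d) # b, x # y # (Int.Pos n, Int.Pos d, n2, d2) # b)"
| "split_box _ n d b = (b, b)"

definition read_split :: "num \<Rightarrow> box \<Rightarrow> box \<times> box" where
  "read_split r b = (case read_num r num.One of (i, r1) \<Rightarrow> case read_num r1 num.One of (n, r2) \<Rightarrow>
     case read_num r2 num.One of (d, r3) \<Rightarrow> split_box i n d b)"

fun all_nonpos :: "box \<Rightarrow> form list \<Rightarrow> bool" where
  "all_nonpos b [] = True"
| "all_nonpos b (f # fs) = (if form_max b f \<le> 0 then all_nonpos b fs else False)"

fun delete :: "node \<Rightarrow> node list \<Rightarrow> node list" where
  "delete k [] = []"
| "delete k (x # xs) = (if k = x then delete k xs else x # delete k xs)"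

lemma set_delete: "set (delete k xs) = set xs - {k}"
  by (induction xs) auto

text \<open>The prefix 0 announces that the collected inequalities are contradictory; the empty list
  of branches then leaves nothing to verify. The prefix 1 names an endpoint by runner, gap and side.
  That runner is removed from the list because its own gaps do not contain the endpoint
  (\<open>ends_disjoint\<close>).\<close>

fun point :: "int \<Rightarrow> node list \<Rightarrow> roots \<Rightarrow> num \<Rightarrow> box \<Rightarrow> edge list \<Rightarrow> num \<Rightarrow> (edge \<times> edge) list option" where
  "point D ks R t b es (num.Bit0 r) = (case combine_root R t es r zero_form of (f, r1) \<Rightarrow>
     if form_max b f < 0 then Some [] else None)"
| "point D ks R t b es num.One = None"
| "point D ks R t b es (num.Bit1 r) = (case read_num r num.One of (i', r1) \<Rightarrow> case read_int r1 of (j, r2) \<Rightarrow>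
     case read_int r2 of (s, r3) \<Rightarrow> case read_int r3 of (j', r4) \<Rightarrow>
     (case skip i' ks of [] \<Rightarrow> None | i # _ \<Rightarrow> (case delete i ks of [] \<Rightarrow> None | k # ks' \<Rightarrow>
       let n = (if s = 0 then left_end D j else right_end D j) in
       (case bound R t b es (Ed i n k (right_end D (j' - 1))) r4 of (ok, r5) \<Rightarrow>
       if ok then covers D R t b es i n k ks' j' r5 [] else None))))"

fun check :: "int \<Rightarrow> node list \<Rightarrow> roots \<Rightarrow> num \<Rightarrow> box \<Rightarrow> edge list \<Rightarrow> cert \<Rightarrow> bool"
  and check_all :: "int \<Rightarrow> node list \<Rightarrow> roots \<Rightarrow> num \<Rightarrow> box \<Rightarrow> edge list \<Rightarrow> (edge \<times> edge) list \<Rightarrow> cert list \<Rightarrow> bool" where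
  "check D ks R t b es (Pt r cs) = (case point D ks R t b es (num_of r) of None \<Rightarrow> False
     | Some ps \<Rightarrow> check_all D ks R t b es ps cs)"
| "check D ks R t b es (Sp r c1 c2) = (case read_split (num_of r) b of (b1, b2) \<Rightarrow>
     check D ks R t b1 es c1 \<and> check D ks R t b2 es c2)"
| "check D ks R t b es _ = False"
| "check_all D ks R t b es [] _ = True"
| "check_all D ks R t b es ((e1, e2) # ps) (c # cs) =
     (check D ks R t b (e1 # e2 # es) c \<and> check_all D ks R t b es ps cs)"
| "check_all D ks R t b es (_ # _) [] = False"

text \<open>Splits at this level precede the choice of a normalisation. Splits inside
  \<open>check\<close> come after it and keep the inequalities collected so far.\<close>

fun check_top :: "int \<Rightarrow> node list \<Rightarrow> (num \<Rightarrow> form list) \<Rightarrow> roots \<Rightarrow> box \<Rightarrow> cert \<Rightarrow> bool" where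
  "check_top D ks X R b (Sp r c1 c2) = (case read_split (num_of r) b of (b1, b2) \<Rightarrow>
     check_top D ks X R b1 c1 \<and> check_top D ks X R b2 c2)"
| "check_top D ks X R b (Ex r) = all_nonpos b (X (num_of r))"
| "check_top D ks X R b (Ro r c) = check D ks R (num_of r) b [] c"
| "check_top D ks X R b (Pt r cs) = False"

section \<open>Soundness of the checker\<close>

definition covered :: "int \<Rightarrow> node list \<Rightarrow> (node \<Rightarrow> real) \<Rightarrow> (node \<Rightarrow> real) \<Rightarrow> real \<Rightarrow> bool" where
  "covered D ks Q c T \<longleftrightarrow>
     (\<exists>k\<in>set ks. \<exists>j. c k + real_of_int (left_end D j) * Q k < T \<and> T < c k + real_of_int (right_end D j) * Q k)"

definition covering :: "int \<Rightarrow> node list \<Rightarrow> (node \<Rightarrow> real) \<Rightarrow> (node \<Rightarrow> real) \<Rightarrow> bool" where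
  "covering D ks Q c \<longleftrightarrow> (\<forall>T. covered D ks Q c T)"

lemma point_val [simp]: "k \<noteq> Og \<Longrightarrow> point_val Q c k x = c k + x * Q k"
  by (cases k) auto

lemma split_box:
  assumes "box_ok b Q" "split_box i n d b = (b1, b2)"
  shows "box_ok b1 Q \<or> box_ok b2 Q"
proof -
  obtain n1 d1 n1' d1' n2 d2 n2' d2' n3 d3 n3' d3' where
    b: "b = [(n1, d1, n1', d1'), (n2, d2, n2', d2'), (n3, d3, n3', d3')]"
    using assms(1) by (auto simp: box_ok_def numeral_3_eq_3 length_Suc_conv)
  have "split_box i n d b \<in> {split_box num.One n d b, split_box (num.Bit0 num.One) n d b,
      split_box (num.Bit1 num.One) n d b}"
    unfolding b by (cases i; cases "case i of num.Bit0 x \<Rightarrow> x | _ \<Rightarrow> num.One") auto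
  then show ?thesis using assms by (auto simp: b box_ok_def ratios_def)
qed

lemma read_split: "box_ok b Q \<Longrightarrow> read_split r b = (b1, b2) \<Longrightarrow> box_ok b1 Q \<or> box_ok b2 Q"
  by (auto simp: read_split_def split: prod.splits dest: split_box)

lemma edge_val_auto_bound:
  assumes "auto_bound b e es" "box_ok b Q" "edges_ok Q c es"
  shows "edge_val Q c e \<le> 0"
  using assms
proof (induction b e es rule: auto_bound.induct)
  case (1 b i x k y i' x' k' y' es)
  show ?case
  proof (cases "form_max b (add_edge 1 (Ed i' x' k' y') (add_edge 1 (Ed i x k y) zero_form)) \<le> 0")
    case True
    from form_max(1)[OF 1(4) True, of c] 1(5) show ?thesis
      by (simp add: form_val_add_edge edges_ok_def zero_form_def del: edge_val.simps add_edge.simps)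
  qed (use 1 in \<open>auto simp: edges_ok_def split: if_splits\<close>)
qed simp

lemma all_nonpos: "all_nonpos b fs \<Longrightarrow> box_ok b Q \<Longrightarrow> \<forall>f\<in>set fs. form_val Q c f \<le> 0"
  by (induction b fs rule: all_nonpos.induct) (auto simp: form_max split: if_splits)

lemma bound_sound:
  assumes "bound R t b es e r = (True, r')" "box_ok b Q" "edges_ok Q c es" "edges_ok Q c (R t)"
  shows "edge_val Q c e \<le> 0"
  using assms
proof (induction R t b es e r rule: bound.induct)
  case (3 R t b es e r)
  obtain m r1 where 1: "read_num r num.One = (m, r1)" by fastforce
  obtain f r2 where 2: "combine_root R t es r1 (add_edge (Int.Pos m) e zero_form) = (f, r2)" by fastforce
  with 3(1) 1 have f: "form_max b f \<le> 0" by auto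
  have "numeral m * edge_val Q c e \<le> 0"
    using combine_root_val[OF 2 3(3,4)] form_max(1)[OF 3(2) f, of c]
    by (simp add: zero_form_def form_val_add_edge del: edge_val.simps)
  then show ?case by (simp add: mult_le_0_iff del: edge_val.simps)
qed (auto intro: edge_val_auto_bound)

text \<open>If both values were positive, a combination with nonnegative multipliers, not both 0,
  would be positive, and adding multiples of known edges can only increase it.\<close>

lemma dead_sound:
  assumes "dead R t b es e1 e2 r = (True, r')" "box_ok b Q" "edges_ok Q c es" "edges_ok Q c (R t)"
  shows "\<not> (0 < edge_val Q c e1 \<and> 0 < edge_val Q c e2)"
proof
  assume pos: "0 < edge_val Q c e1 \<and> 0 < edge_val Q c e2"
  obtain m1 r1 where 1: "read_num r num.One = (m1, r1)" by fastforce
  obtain m2 r2 where 2: "read_num r1 num.One = (m2, r2)" by fastforce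
  obtain f r3 where 3: "combine_root R t es r2 (add_edge (Int.Pos m1 - 1) e1 (add_edge (Int.Pos m2 - 1) e2 zero_form))
      = (f, r3)"
    by fastforce
  from assms(1) 1 2 3 have m: "\<not> (m1 = num.One \<and> m2 = num.One)" and f: "form_max b f \<le> 0"
    by (auto split: if_splits)
  have "(Int.Pos m1 - 1) * edge_val Q c e1 + (Int.Pos m2 - 1) * edge_val Q c e2 \<le> 0"
    using combine_root_val[OF 3 assms(3,4)] form_max(1)[OF assms(2) f, of c]
    by (simp add: zero_form_def form_val_add_edge del: edge_val.simps)
  moreover have m0: "real_of_int (Int.Pos m - 1) \<ge> 0" "real_of_int (Int.Pos m - 1) = 0 \<longleftrightarrow> m = num.One" for m
    by (cases m; simp add: Int.Pos_def)+
  moreover have "(Int.Pos m1 - 1) * edge_val Q c e1 \<ge> 0" "(Int.Pos m2 - 1) * edge_val Q c e2 \<ge> 0"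
    using pos by (blast intro: mult_nonneg_nonneg m0(1) less_imp_le)+
  ultimately have "(Int.Pos m1 - 1) * edge_val Q c e1 = 0" "(Int.Pos m2 - 1) * edge_val Q c e2 = 0"
    by linarith+
  then show False using m m0(2) pos by (metis mult_eq_0_iff order_less_irrefl)
qed

lemma left_end_mono:
  fixes q :: real
  assumes "1 \<le> D" "j \<le> m" "0 < q"
  shows "left_end D j * q \<le> left_end D m * q"
proof -
  have "left_end D j \<le> left_end D m"
    unfolding left_end_def using assms by (intro mult_left_mono diff_right_mono) auto
  with assms(3) show ?thesis by simp
qed

lemma right_end_mono:
  fixes q :: real
  assumes "1 \<le> D" "j \<le> m" "0 < q"
  shows "right_end D j * q \<le> right_end D m * q"
proof -
  have "right_end D j \<le> right_end D m"
    unfolding right_end_def using assms by (intro mult_left_mono add_right_mono) auto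
  with assms(3) show ?thesis by simp
qed

abbreviation in_gap :: "int \<Rightarrow> (node \<Rightarrow> real) \<Rightarrow> (node \<Rightarrow> real) \<Rightarrow> node \<Rightarrow> int \<Rightarrow> real \<Rightarrow> bool" where
  "in_gap D Q c k j T \<equiv> c k + real_of_int (left_end D j) * Q k < T \<and> T < c k + real_of_int (right_end D j) * Q k"

text \<open>The contrapositive form lets the accumulator be carried through the induction: if every
  returned branch fails, then so do the accumulated branches and all gaps that the run still has to
  visit.\<close>

lemma covers_sound:
  fixes Q c :: "node \<Rightarrow> real"
  assumes "covers D R t b es i n k ks j r acc = Some ps" "box_ok b Q" "edges_ok Q c es" "edges_ok Q c (R t)"
    "i \<noteq> Og" "k \<noteq> Og" "Og \<notin> set ks" "1 \<le> D"
    "\<forall>(e1, e2)\<in>set ps. \<not> (0 < edge_val Q c e1 \<and> 0 < edge_val Q c e2)"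
  shows "(\<forall>(e1, e2)\<in>set acc. \<not> (0 < edge_val Q c e1 \<and> 0 < edge_val Q c e2)) \<and>
    (\<forall>m\<ge>j. \<not> in_gap D Q c k m (c i + n * Q i)) \<and> (\<forall>k'\<in>set ks. \<forall>m. \<not> in_gap D Q c k' m (c i + n * Q i))"
  using assms
proof (induction D R t b es i n k ks j r acc rule: covers.induct)
  case (1 D R t b es i n k ks j r acc)
  then have IH: "(\<forall>(e1, e2)\<in>set ((Ed k (left_end D j) i n, Ed i n k (right_end D j)) # acc).
      \<not> (0 < edge_val Q c e1 \<and> 0 < edge_val Q c e2)) \<and>
    (\<forall>m\<ge>j+1. \<not> in_gap D Q c k m (c i + n * Q i)) \<and> (\<forall>k'\<in>set ks. \<forall>m. \<not> in_gap D Q c k' m (c i + n * Q i))"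
    by simp
  have "m = j \<or> m \<ge> j + 1" if "m \<ge> j" for m using that by linarith
  with IH 1 show ?case by force
next
  case (2 D R t b es i n k ks j r acc)
  obtain r1 where d: "dead R t b es (Ed k (left_end D j) i n) (Ed i n k (right_end D j)) r = (True, r1)"
    using 2(2) by (auto split: prod.splits if_splits simp del: dead.simps)
  have IH: "(\<forall>(e1, e2)\<in>set acc. \<not> (0 < edge_val Q c e1 \<and> 0 < edge_val Q c e2)) \<and>
    (\<forall>m\<ge>j+1. \<not> in_gap D Q c k m (c i + n * Q i)) \<and> (\<forall>k'\<in>set ks. \<forall>m. \<not> in_gap D Q c k' m (c i + n * Q i))"
    using 2(2-) d by (intro "2.IH"[OF d[symmetric]]) (simp_all del: dead.simps)
  have "m = j \<or> m \<ge> j + 1" if "m \<ge> j" for m using that by linarith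
  with IH dead_sound[OF d 2(3-5)] 2 show ?case by force
next
  case (3 D R t b es i n k ks j r acc)
  obtain r1 where b1: "bound R t b es (Ed k (left_end D j) i n) r = (True, r1)"
    using 3(2) by (auto split: prod.splits if_splits simp del: bound.simps)
  have pos: "Q k > 0" for k using 3 by (auto simp: box_ok_def)
  have "c i + n * Q i \<le> c k + left_end D j * Q k"
    using bound_sound[OF b1 3(3-5)] 3 by simp
  \<comment> \<open>Left ends increase with the index, so one inequality disposes of all gaps from
    \<open>j\<close> on.\<close>
  then have up: "\<not> in_gap D Q c k m (c i + n * Q i)" if "m \<ge> j" for m
    using left_end_mono[of D j m "Q k"] that 3(9) pos[of k] by linarith
  show ?case
  proof (cases ks)
    case Nil
    with 3(2,10) b1 up show ?thesis by (auto simp del: bound.simps)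
  next
    case (Cons k' ks')
    obtain j' r2 where r2: "read_int r1 = (j', r2)" by fastforce
    obtain r3 where b2: "bound R t b es (Ed i n k' (right_end D (j' - 1))) r2 = (True, r3)"
      using 3(2) b1 Cons r2 by (auto split: prod.splits if_splits simp del: bound.simps read_int.simps)
    have "covers D R t b es i n k' ks' j' r3 acc = Some ps"
      using 3(2) b1 Cons r2 b2 by (simp del: bound.simps read_int.simps)
    then have IH: "(\<forall>(e1, e2)\<in>set acc. \<not> (0 < edge_val Q c e1 \<and> 0 < edge_val Q c e2)) \<and>
      (\<forall>m\<ge>j'. \<not> in_gap D Q c k' m (c i + n * Q i)) \<and> (\<forall>k'\<in>set ks'. \<forall>m. \<not> in_gap D Q c k' m (c i + n * Q i))"
      using 3(3-) Cons by (intro "3.IH"[OF b1[symmetric] TrueI Cons r2[symmetric] b2[symmetric] TrueI]) auto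
    have "i \<noteq> Og" "k' \<noteq> Og" using 3(6,8) Cons by auto
    then have "c k' + right_end D (j' - 1) * Q k' \<le> c i + n * Q i"
      using bound_sound[OF b2 3(3-5)] by simp
    then have "\<not> in_gap D Q c k' m (c i + n * Q i)" if "m < j'" for m
      using right_end_mono[of D m "j' - 1" "Q k'"] that 3(9) pos[of k'] by linarith
    with IH have "\<not> in_gap D Q c k' m (c i + n * Q i)" for m by (cases "m < j'") auto
    with IH up Cons show ?thesis by auto
  qed
qed simp_all

text \<open>Divided by \<open>D - 1\<close>, the centres are the multiples of \<open>D\<close> and
  the radius is 1. An end of gap \<open>j\<close> strictly inside gap \<open>m\<close> would give
  \<open>D * (j - m)\<close> the value 1 or -1.\<close>

lemma ends_disjoint:
  fixes q :: real
  assumes "3 \<le> D" "0 < q" "left_end D m * q < x * q" "x * q < right_end D m * q"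
  shows "x \<noteq> left_end D j" "x \<noteq> right_end D j"
proof -
  have *: "left_end D m < x" "x < right_end D m" using assms by auto
  have D: "D * k \<noteq> 1" "D * k \<noteq> -1" for k
    using assms(1) by (metis zdvd1_eq dvd_triv_left abs_of_nonneg linorder_not_less one_less_numeral_iff
        order_trans semiring_norm(77) zero_le_numeral dvd_minus_iff)+
  show "x \<noteq> left_end D j"
  proof
    assume "x = left_end D j"
    with * assms(1) have "D * m - 1 < D * j - 1" "D * j - 1 < D * m + 1"
      by (simp_all add: left_end_def right_end_def)
    then have "D * (j - m) = 1" by (simp add: algebra_simps)
    with D show False by blast
  qed
  show "x \<noteq> right_end D j"
  proof
    assume "x = right_end D j"
    with * assms(1) have "D * m - 1 < D * j + 1" "D * j + 1 < D * m + 1"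
      by (simp_all add: left_end_def right_end_def)
    then have "D * (j - m) = -1" by (simp add: algebra_simps)
    with D show False by blast
  qed
qed

text \<open>In a covering the chosen endpoint lies in some gap. The gap belongs to another runner,
  and the scan by \<open>covers\<close> has either recorded it as a branch or refuted it.\<close>

lemma point_sound:
  fixes Q c :: "node \<Rightarrow> real"
  assumes "point D ks R t b es r = Some ps" "box_ok b Q" "edges_ok Q c es" "edges_ok Q c (R t)"
    "covering D ks Q c" "Og \<notin> set ks" "3 \<le> D"
  shows "\<exists>(e1, e2)\<in>set ps. 0 < edge_val Q c e1 \<and> 0 < edge_val Q c e2"
  using assms
proof (induction D ks R t b es r rule: point.induct)
  case (1 D ks R t b es r)
  obtain f r1 where f: "combine_root R t es r zero_form = (f, r1)" by fastforce
  with 1 have "form_max b f < 0" by (auto split: if_splits)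
  with combine_root_val[OF f 1(3,4)] form_max(2)[OF 1(2), of f c] have False by (simp add: zero_form_def)
  then show ?case ..
next
  case (3 D ks R t b es r)
  obtain i' r1 where 1: "read_num r num.One = (i', r1)" by fastforce
  obtain j r2 where 2: "read_int r1 = (j, r2)" by fastforce
  obtain s r3 where r3: "read_int r2 = (s, r3)" by fastforce
  obtain j' r4 where 4: "read_int r3 = (j', r4)" by fastforce
  define n where "n = (if s = 0 then left_end D j else right_end D j)"
  note unfold = 1 2 r3 4
  from 3(1) unfold obtain i ks2 where i': "skip i' ks = i # ks2"
    by (auto split: list.splits simp del: read_int.simps)
  from 3(1) unfold i' obtain k ks' where del: "delete i ks = k # ks'"
    by (auto split: list.splits simp del: read_int.simps)
  from 3(1) unfold i' del obtain r5 where b: "bound R t b es (Ed i n k (right_end D (j' - 1))) r4 = (True, r5)"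
    and cov: "covers D R t b es i n k ks' j' r5 [] = Some ps"
    by (auto simp: Let_def n_def[symmetric] split: prod.splits if_splits simp del: read_int.simps bound.simps)
  have set: "set (k # ks') = set ks - {i}" using del set_delete[of i ks] by simp
  have "i \<in> set ks" using set_skip[of i' ks] i' by auto
  then have ne: "i \<noteq> Og" "k \<noteq> Og" "Og \<notin> set ks'" "1 \<le> D" using set 3(6,7) by auto
  have pos: "Q k > 0" for k using 3(2) by (auto simp: box_ok_def)
  show ?case
  proof (rule ccontr)
    assume "\<not> ?case"
    then have *: "\<forall>m\<ge>j'. \<not> in_gap D Q c k m (c i + n * Q i)" "\<forall>k'\<in>set ks'. \<forall>m. \<not> in_gap D Q c k' m (c i + n * Q i)"
      using covers_sound[OF cov 3(2-4) ne] by auto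
    have "c k + right_end D (j' - 1) * Q k \<le> c i + n * Q i"
      using bound_sound[OF b 3(2-4)] ne by simp
    then have "\<not> in_gap D Q c k m (c i + n * Q i)" if "m < j'" for m
      using right_end_mono[of D m "j' - 1" "Q k"] that ne(4) pos[of k] by linarith
    with * have **: "\<forall>k'\<in>set (k # ks'). \<forall>m. \<not> in_gap D Q c k' m (c i + n * Q i)"
      by (metis linorder_not_less set_ConsD)
    have "covered D ks Q c (c i + n * Q i)" using 3(5) by (auto simp: covering_def)
    then obtain k' m where k': "k' \<in> set ks" "in_gap D Q c k' m (c i + n * Q i)" by (auto simp: covered_def)
    \<comment> \<open>Every other runner has been ruled out, and for \<open>i\<close> itself
      \<open>ends_disjoint\<close> applies.\<close>
    with ** set have "k' = i" by auto
    with k' ends_disjoint[of D "Q i" m n j] pos[of i] 3(7) show False by (auto simp: n_def split: if_splits)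
  qed
qed simp

text \<open>The strict inequalities of a branch enter the edge list in weak form only, so the final
  contradiction has to be a strictly negative combination.\<close>

lemma check_sound:
  "check D ks R t b es z \<Longrightarrow> Og \<notin> set ks \<Longrightarrow> 3 \<le> D \<Longrightarrow> box_ok b Q \<Longrightarrow> covering D ks Q c \<Longrightarrow>
     edges_ok Q c es \<Longrightarrow> edges_ok Q c (R t) \<Longrightarrow> False"
  "check_all D ks R t b es ps zs \<Longrightarrow> Og \<notin> set ks \<Longrightarrow> 3 \<le> D \<Longrightarrow> box_ok b Q \<Longrightarrow> covering D ks Q c \<Longrightarrow>
     edges_ok Q c es \<Longrightarrow> edges_ok Q c (R t) \<Longrightarrow>
     \<exists>(e1, e2)\<in>set ps. 0 < edge_val Q c e1 \<and> 0 < edge_val Q c e2 \<Longrightarrow> False"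
proof (induction D ks R t b es z and D ks R t b es ps zs rule: check_check_all.induct)
  case (1 D ks R t b es r cs)
  then show ?case using point_sound[of D ks R t b es "num_of r"]
    by (auto split: option.splits simp del: point.simps edge_val.simps)
next
  case (2 D ks R t b es r c1 c2)
  then show ?case using read_split[of b Q "num_of r"] by (auto split: prod.splits)
next
  case (5 D ks R t b es e1 e2 ps z zs)
  then show ?case by (auto simp: edges_ok_def less_imp_le simp del: edge_val.simps)
qed auto

text \<open>Boxes and excluded regions speak only of \<open>Q\<close>, hence the centres may be
  chosen after the top splits. This is why the last assumption asks for centres \<open>c'\<close>
  depending on the root \<open>t\<close>, all for the same \<open>Q\<close>.\<close>

lemma check_top_sound:
  assumes "check_top D ks X R b z" "Og \<notin> set ks" "3 \<le> D" "box_ok b Q" "covering D ks Q c"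
    "\<And>k. \<exists>f\<in>set (X k). 0 < form_val Q (\<lambda>_. 0) f"
    "\<And>t. \<exists>c'. covering D ks Q c' \<and> edges_ok Q c' (R t)"
  shows False
  using assms
proof (induction D ks X R b z rule: check_top.induct)
  case (1 D ks X R b r c1 c2)
  then show ?case using read_split[of b Q "num_of r"] by (auto split: prod.splits)
next
  case (2 D ks X R b r)
  then show ?case using all_nonpos[of b "X (num_of r)" Q "\<lambda>_. 0"] by (metis check_top.simps(2) linorder_not_less)
next
  case (3 D ks X R b r z)
  then show ?case using check_sound(1)[of D ks R "num_of r" b "[]" z Q]
    by (metis check_top.simps(3) edges_ok_def empty_iff list.set(1))
qed simp

section \<open>Distances to the nearest integer\<close>

definition far :: "real \<Rightarrow> real \<Rightarrow> bool" where
  "far \<theta> x \<longleftrightarrow> (\<forall>j::int. \<theta> \<le> \<bar>x - j\<bar>)"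

lemma farI: "real_of_int m + \<theta> \<le> x \<Longrightarrow> x \<le> real_of_int m + 1 - \<theta> \<Longrightarrow> far \<theta> x"
  unfolding far_def
proof
  fix j :: int
  assume *: "real_of_int m + \<theta> \<le> x" "x \<le> real_of_int m + 1 - \<theta>"
  show "\<theta> \<le> \<bar>x - j\<bar>"
  proof (cases "j \<le> m")
    case True
    then have "real_of_int j \<le> m" by simp
    with * show ?thesis by linarith
  next
    case False
    then have "real_of_int m + 1 \<le> j" by linarith
    with * show ?thesis by linarith
  qed
qed

lemma far_minus: "far \<theta> (- x) \<longleftrightarrow> far \<theta> x"
proof -
  have "far \<theta> y" if "far \<theta> (- y)" for y
    unfolding far_def
  proof
    fix j :: int
    from that have "\<theta> \<le> \<bar>- y - real_of_int (- j)\<bar>" unfolding far_def by blast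
    then show "\<theta> \<le> \<bar>y - j\<bar>" by simp
  qed
  from this[of x] this[of "- x"] show ?thesis by auto
qed

lemma far_add_int: "far \<theta> (x + real_of_int k) \<longleftrightarrow> far \<theta> x"
proof -
  have "far \<theta> (y + real_of_int k)" if "far \<theta> y" for y k
    unfolding far_def
  proof
    fix j :: int
    from that have "\<theta> \<le> \<bar>y - real_of_int (j - k)\<bar>" unfolding far_def by blast
    then show "\<theta> \<le> \<bar>y + k - j\<bar>" by (simp add: algebra_simps)
  qed
  from this[of x k] this[of "x + k" "- k"] show ?thesis by auto
qed

lemma far_near: "far \<theta> x \<Longrightarrow> \<bar>y - x\<bar> \<le> \<theta> - \<theta>' \<Longrightarrow> far \<theta>' y"
  unfolding far_def
proof
  fix j :: int
  assume "\<forall>j::int. \<theta> \<le> \<bar>x - j\<bar>" and *: "\<bar>y - x\<bar> \<le> \<theta> - \<theta>'"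
  then have "\<theta> \<le> \<bar>x - j\<bar>" by blast
  with * show "\<theta>' \<le> \<bar>y - j\<bar>" by linarith
qed

lemma far_half: "\<theta> \<le> 1/2 \<Longrightarrow> far \<theta> (real_of_int k + 1/2)"
  by (rule farI[of k]) auto

text \<open>Half a turn exchanges being far from the integers with being near them. In this way a
  theorem about loneliness also produces meetings.\<close>

lemma far_half_near: "far \<theta> (x + 1/2) \<Longrightarrow> \<exists>j::int. \<bar>x - j\<bar> \<le> 1/2 - \<theta>"
proof -
  assume f: "far \<theta> (x + 1/2)"
  define j where "j = \<lfloor>x + 1/2\<rfloor>"
  have "real_of_int j \<le> x + 1/2" "x + 1/2 < j + 1" unfolding j_def by linarith+
  moreover have "\<theta> \<le> \<bar>x + 1/2 - j\<bar>" "\<theta> \<le> \<bar>x + 1/2 - real_of_int (j + 1)\<bar>" using f unfolding far_def by blast+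
  ultimately show ?thesis by (intro exI[of _ j]) auto
qed

lemma nearest_multiple:
  fixes x p :: real
  assumes "0 < p"
  shows "\<exists>k::int. \<bar>x + k * p\<bar> \<le> p / 2"
proof -
  define k where "k = - round (x / p)"
  have "\<bar>of_int (round (x / p)) - x / p\<bar> \<le> 1/2" by (rule of_int_round_abs_le)
  then have "\<bar>of_int (round (x / p)) - x / p\<bar> * p \<le> 1/2 * p" using assms by (intro mult_right_mono) auto
  moreover have "\<bar>of_int (round (x / p)) - x / p\<bar> * p = \<bar>x + k * p\<bar>"
    using assms by (simp add: k_def abs_mult[symmetric] left_diff_distrib abs_minus_commute del: abs_mult flip:
        abs_mult)
      (simp add: abs_if field_simps)
  ultimately show ?thesis by auto
qed

lemma between_points:
  fixes p q :: real
  assumes "\<bar>p - q\<bar> \<le> \<alpha> + \<beta>" "0 \<le> \<alpha>" "0 \<le> \<beta>"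
  shows "\<exists>t. \<bar>t - p\<bar> \<le> \<alpha> \<and> \<bar>t - q\<bar> \<le> \<beta>"
proof (cases "p \<le> q")
  case True
  with assms show ?thesis by (intro exI[of _ "min q (p + \<alpha>)"]) (auto simp: min_def)
next
  case False
  with assms show ?thesis by (intro exI[of _ "max q (p - \<alpha>)"]) (auto simp: max_def)
qed

section \<open>Two runners\<close>

lemma lonely2:
  assumes "0 < a" "a < b"
  shows "\<exists>t. far (1/3) (a * t + s) \<and> far (1/3) (b * t + u)"
proof -
  define A B where "A = 1 / a" and "B = 1 / b"
  have AB: "0 < B" "B < A" using assms by (auto simp: A_def B_def field_simps)
  \<comment> \<open>These are the times at which the runners are halfway between integers; 1/2 - 1/3
    allows each a deviation of a sixth of its period. For \<open>A\<close> at least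
    \<open>2 * B\<close> a nearest \<open>q l\<close> is close enough. Otherwise equal indices are
    used: \<open>p k - q k\<close> moves in steps of \<open>A - B\<close>, and half a step suffices
    exactly when \<open>A\<close> is at most \<open>2 * B\<close>.\<close>
  define p q where "p k = (of_int k + 1/2 - s) * A" and "q l = (of_int l + 1/2 - u) * B" for k l :: int
  have "\<exists>k l. \<bar>p k - q l\<bar> \<le> A / 6 + B / 6"
  proof (cases "A \<ge> 2 * B")
    case True
    obtain l where "\<bar>(q 0 - p 0) + of_int l * B\<bar> \<le> B / 2" using nearest_multiple[OF AB(1)] by blast
    then have "\<bar>p 0 - q l\<bar> \<le> B / 2" by (simp add: q_def algebra_simps abs_if split: if_splits)
    with True AB show ?thesis by (intro exI[of _ 0] exI[of _ l]) linarith
  next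
    case False
    have "A - B > 0" using AB by simp
    then obtain k where "\<bar>(p 0 - q 0) + of_int k * (A - B)\<bar> \<le> (A - B) / 2" using nearest_multiple by blast
    then have "\<bar>p k - q k\<bar> \<le> (A - B) / 2" by (simp add: p_def q_def algebra_simps)
    moreover have "(A - B) / 2 \<le> A / 6 + B / 6" using False by (simp add: field_simps)
    ultimately show ?thesis by (meson order_trans)
  qed
  then obtain k l where kl: "\<bar>p k - q l\<bar> \<le> A / 6 + B / 6" by blast
  obtain t where t: "\<bar>t - p k\<bar> \<le> A / 6" "\<bar>t - q l\<bar> \<le> B / 6"
    using between_points[OF kl] AB by auto
  have "\<bar>a * (t - p k)\<bar> \<le> 1/6" "\<bar>b * (t - q l)\<bar> \<le> 1/6"
    using t assms mult_left_mono[OF t(1), of a] mult_left_mono[OF t(2), of b]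
    by (simp_all add: abs_mult A_def B_def)
  moreover have "a * (t - p k) = a * t + s - (of_int k + 1/2)" "b * (t - q l) = b * t + u - (of_int l + 1/2)"
    using assms by (simp_all add: p_def q_def A_def B_def field_simps)
  ultimately have "far (1/3) (a * t + s)" "far (1/3) (b * t + u)"
    by (auto intro: far_near[OF far_half[of "1/2"]])
  then show ?thesis by blast
qed

lemma far_uminus_velocity: "far \<theta> (- a * t + s) \<longleftrightarrow> far \<theta> (a * t + - s)"
  using far_minus[of \<theta> "a * t + - s"] by (simp add: algebra_simps)

lemma far_abs_velocity: "\<exists>s'. \<forall>t. far \<theta> (a * t + s) \<longleftrightarrow> far \<theta> (\<bar>a\<bar> * t + s')"
proof (cases "a \<ge> 0")
  case False
  then show ?thesis using far_uminus_velocity[of \<theta> "- a" _ s] by (intro exI[of _ "- s"]) simp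
qed auto

lemma lonely2_signed:
  assumes "a \<noteq> 0" "b \<noteq> 0" "\<bar>a\<bar> \<noteq> \<bar>b\<bar>"
  shows "\<exists>t. far (1/3) (a * t + s) \<and> far (1/3) (b * t + u)"
proof -
  obtain s' where s': "\<forall>t. far (1/3) (a * t + s) \<longleftrightarrow> far (1/3) (\<bar>a\<bar> * t + s')"
    using far_abs_velocity[of "1/3" a s] by blast
  obtain u' where u': "\<forall>t. far (1/3) (b * t + u) \<longleftrightarrow> far (1/3) (\<bar>b\<bar> * t + u')"
    using far_abs_velocity[of "1/3" b u] by blast
  have "\<exists>t. far (1/3) (\<bar>a\<bar> * t + s') \<and> far (1/3) (\<bar>b\<bar> * t + u')"
  proof (cases "\<bar>a\<bar> < \<bar>b\<bar>")
    case True
    then show ?thesis using lonely2[of "\<bar>a\<bar>" "\<bar>b\<bar>" s' u'] assms(1) by simp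
  next
    case False
    then show ?thesis using lonely2[of "\<bar>b\<bar>" "\<bar>a\<bar>" u' s'] assms(2,3) by fastforce
  qed
  then show ?thesis unfolding s'[rule_format] u'[rule_format] .
qed

lemma lonely2_meet:
  assumes "0 < a" "0 < b" "1/6 \<le> \<theta>" "\<theta> \<le> 1/3"
  shows "\<exists>t. \<exists>j::int. far \<theta> (a * t + s) \<and> \<bar>b * t + u - j\<bar> \<le> \<theta>"
proof (cases "a = b")
  case False
  then obtain t where t: "far (1/3) (a * t + s)" "far (1/3) (b * t + (u + 1/2))"
    using lonely2_signed[of a b s "u + 1/2"] assms by auto
  from t(2) obtain j :: int where "\<bar>b * t + u - j\<bar> \<le> 1/2 - 1/3"
    using far_half_near[of "1/3" "b * t + u"] by (auto simp: add.assoc)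
  moreover have "far \<theta> (a * t + s)" by (rule far_near[OF t(1)]) (use assms in auto)
  ultimately show ?thesis using assms by (intro exI[of _ t] exI[of _ j]) auto
next
  case True
  have "\<exists>\<delta>. \<bar>\<delta>\<bar> \<le> \<theta> \<and> far \<theta> (s - u + \<delta>)"
  proof (cases "far \<theta> (s - u)")
    case True then show ?thesis using assms by (intro exI[of _ 0]) auto
  next
    case False
    then obtain j :: int where j: "\<bar>s - u - j\<bar> < \<theta>" unfolding far_def by (auto simp: not_le)
    have *: "far \<theta> (s - u + (j + \<theta> - (s - u)))" "far \<theta> (s - u + (j - \<theta> - (s - u)))"
      using assms by (intro farI[of j] farI[of "j - 1"]; simp)+
    show ?thesis
    proof (cases "s - u \<ge> j")
      case True
      with j have "\<bar>j + \<theta> - (s - u)\<bar> \<le> \<theta>" by (simp add: abs_if)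
      with * show ?thesis by blast
    next
      case False
      with j have "\<bar>j - \<theta> - (s - u)\<bar> \<le> \<theta>" by (simp add: abs_if)
      with * show ?thesis by blast
    qed
  qed
  then obtain \<delta> where d: "\<bar>\<delta>\<bar> \<le> \<theta>" "far \<theta> (s - u + \<delta>)" by blast
  have "a * ((\<delta> - u) / a) + s = s - u + \<delta>" "b * ((\<delta> - u) / a) + u - real_of_int 0 = \<delta>"
    using assms True by simp_all
  then show ?thesis using d by metis
qed

text \<open>The correction takes at most half a turn of the runner with speed \<open>u\<close>, and
  a slow runner hardly moves in that time.\<close>

lemma clock:
  fixes u \<psi> \<alpha> :: real
  assumes "0 < u"
  shows "\<exists>\<sigma>. \<exists>k::int. \<bar>u * \<sigma>\<bar> \<le> 1/2 \<and> \<psi> + u * \<sigma> = k + \<alpha>"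
proof -
  obtain k :: int where k: "\<bar>\<alpha> - \<psi> + of_int k * 1\<bar> \<le> 1 / 2" using nearest_multiple[of 1 "\<alpha> - \<psi>"] by auto
  then show ?thesis using assms by (intro exI[of _ "(\<alpha> - \<psi> + k) / u"] exI[of _ k]) simp
qed

text \<open>A forbidden arc has length \<open>2 * \<theta>\<close>, so a runner that starts inside
  it leaves it after at most this distance.\<close>

lemma far_in_window:
  assumes "0 < v" "2 * \<theta> \<le> v * l" "\<theta> \<le> 1/2" "0 \<le> l"
  shows "\<exists>\<sigma>. 0 \<le> \<sigma> \<and> \<sigma> \<le> l \<and> far \<theta> (x + v * \<sigma>)"
proof (cases "far \<theta> x")
  case True then show ?thesis using assms by (intro exI[of _ 0]) auto
next
  case False
  then obtain j :: int where j: "\<bar>x - j\<bar> < \<theta>" unfolding far_def by (auto simp: not_le)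
  define \<sigma> where "\<sigma> = (j + \<theta> - x) / v"
  have "0 \<le> \<sigma>" using j assms by (auto simp: \<sigma>_def)
  moreover have "v * \<sigma> = j + \<theta> - x" using assms by (simp add: \<sigma>_def)
  moreover from this have "v * \<sigma> \<le> v * l" using j assms(2) by linarith
  then have "\<sigma> \<le> l" using assms(1) by simp
  ultimately show ?thesis using assms(3) by (intro exI[of _ \<sigma>]) (auto intro: farI[of j])
qed

section \<open>From lonely runners to coverings\<close>

lemma covering_move:
  assumes "covering D ks Q c" "\<And>k. k \<in> set ks \<Longrightarrow> \<exists>m::int. c' k = c k - \<tau> + m * (real_of_int ((D - 1) * D) * Q k)"
  shows "covering D ks Q c'"
  unfolding covering_def
proof
  fix T
  from assms(1) obtain k j where k: "k \<in> set ks" "in_gap D Q c k j (T + \<tau>)"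
    unfolding covering_def covered_def by blast
  from assms(2)[OF k(1)] obtain m :: int where "c' k = c k - \<tau> + m * (real_of_int ((D - 1) * D) * Q k)" by blast
  then have "in_gap D Q c' k (j - m) T"
    using k(2) by (simp add: left_end_def right_end_def algebra_simps)
  with k(1) show "covered D ks Q c' T" unfolding covered_def by blast
qed

lemma covering_reflect:
  assumes "covering D ks Q c"
  shows "covering D ks Q (\<lambda>k. - c k)"
  unfolding covering_def
proof
  fix T
  from assms obtain k j where k: "k \<in> set ks" "in_gap D Q c k j (- T)"
    unfolding covering_def covered_def by blast
  then have "in_gap D Q (\<lambda>k. - c k) k (- j) T"
    by (simp add: left_end_def right_end_def algebra_simps)
  with k(1) show "covered D ks Q (\<lambda>k. - c k) T" unfolding covered_def by blast
qed

text \<open>The relative position of two runners can be chosen freely modulo the difference of their periods, by counting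
  the gaps of both from another one. A reflection makes it nonnegative.\<close>

lemma meet_root:
  fixes Q :: "node \<Rightarrow> real" and D :: int
  assumes cov: "covering D ks Q c" and pos: "\<And>k. 0 < Q k" and D: "3 \<le> D"
    and ij: "i \<in> set ks" "j \<in> set ks" "Q j < Q i"
  defines "h \<equiv> real_of_int (D * (D - 1)) / 2"
  shows "\<exists>c'. covering D ks Q c' \<and> 0 \<le> c' i - c' j \<and> c' i - c' j \<le> h * (Q i - Q j) \<and> c' j = x * Q j \<and>
    (\<forall>k. k \<noteq> i \<and> k \<noteq> j \<longrightarrow> - (h * Q k) \<le> c' k \<and> c' k \<le> h * Q k)"
proof -
  have h: "h > 0" using D by (simp add: h_def)
  have "\<exists>c. covering D ks Q c \<and> 0 \<le> c i - c j \<and> c i - c j \<le> h * (Q i - Q j)"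
  proof -
    have "0 < 2 * h * (Q i - Q j)" using h ij by simp
    then obtain m :: int where m: "\<bar>c i - c j + m * (2 * h * (Q i - Q j))\<bar> \<le> 2 * h * (Q i - Q j) / 2"
      using nearest_multiple by blast
    \<comment> \<open>Each centre moves by \<open>m\<close> of its own periods, which changes the
      difference of the centres of \<open>i\<close> and \<open>j\<close> by \<open>m\<close> times
      the difference of their periods.\<close>
    define c1 where "c1 k = c k + m * (2 * h * Q k)" for k
    have c1: "covering D ks Q c1"
      by (rule covering_move[OF cov, of _ 0]) (intro exI[of _ m], simp add: c1_def h_def mult_ac)
    have *: "\<bar>c1 i - c1 j\<bar> \<le> h * (Q i - Q j)" using m by (simp add: c1_def algebra_simps)
    show ?thesis
    proof (cases "c1 i \<ge> c1 j")
      case True with c1 * show ?thesis by (intro exI[of _ c1]) auto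
    next
      case False with covering_reflect[OF c1] * show ?thesis by (intro exI[of _ "\<lambda>k. - c1 k"]) auto
    qed
  qed
  then obtain c1 where c1: "covering D ks Q c1" "0 \<le> c1 i - c1 j" "c1 i - c1 j \<le> h * (Q i - Q j)" by blast
  \<comment> \<open>The common translation puts the centre of \<open>j\<close> exactly at
    \<open>x * Q j\<close> and preserves the difference just arranged. The other runners are then
    reduced modulo their periods.\<close>
  define \<tau> where "\<tau> = c1 j - x * Q j"
  have "\<forall>k. \<exists>m::int. \<bar>c1 k - \<tau> + m * (2 * h * Q k)\<bar> \<le> 2 * h * Q k / 2"
    by (intro allI nearest_multiple mult_pos_pos) (use h pos in auto)
  then obtain m :: "node \<Rightarrow> int" where m: "\<And>k. \<bar>c1 k - \<tau> + m k * (2 * h * Q k)\<bar> \<le> h * Q k" by (auto dest!: choice)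
  define c2 where "c2 k = c1 k - \<tau> + (if k = i \<or> k = j then 0 else m k) * (2 * h * Q k)" for k
  have "covering D ks Q c2"
  proof (rule covering_move[OF c1(1), of c2 \<tau>])
    fix k
    show "\<exists>n::int. c2 k = c1 k - \<tau> + n * (real_of_int ((D - 1) * D) * Q k)"
      by (rule exI[of _ "if k = i \<or> k = j then 0 else m k"]) (simp add: c2_def h_def mult_ac)
  qed
  moreover have "- (h * Q k) \<le> c2 k \<and> c2 k \<le> h * Q k" if "k \<noteq> i \<and> k \<noteq> j" for k
    using m[of k] that by (simp add: c2_def abs_le_iff)
  ultimately show ?thesis using c1(2,3) by (intro exI[of _ c2]) (auto simp: c2_def \<tau>_def)
qed

text \<open>The origin of time is moved to a moment at which all runners but \<open>l\<close> are even at distance \<open>1 / (D - 1)\<close>, so that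
  only \<open>l\<close> can cover it.\<close>

lemma good_root:
  fixes Q :: "node \<Rightarrow> real" and D :: int
  assumes cov: "covering D (ks @ [l]) Q c" and pos: "\<And>k. 0 < Q k" and D: "3 \<le> D" and l: "l \<notin> set ks"
    and good: "\<And>k j. k \<in> set ks \<Longrightarrow> real_of_int D * Q k \<le> \<bar>T - c k - real_of_int ((D - 1) * D * j) * Q k\<bar>"
  shows "\<exists>c'. covering D (ks @ [l]) Q c' \<and> 0 \<le> c' l \<and> c' l \<le> real_of_int (D - 1) * Q l \<and>
    (\<forall>k\<in>set ks. real_of_int D * Q k \<le> c' k \<and> c' k \<le> real_of_int (D * (D - 2)) * Q k)"
proof -
  have "\<exists>m::int. D * Q k \<le> c k - T + m * (real_of_int ((D - 1) * D) * Q k) \<and>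
     c k - T + m * (real_of_int ((D - 1) * D) * Q k) \<le> real_of_int (D * (D - 2)) * Q k" if k: "k \<in> set ks" for k
  proof -
    define p where "p = real_of_int ((D - 1) * D) * Q k"
    have p: "p > 0" using pos D by (simp add: p_def)
    define m where "m = - \<lfloor>(c k - T) / p\<rfloor>"
    have "of_int (- m) \<le> (c k - T) / p" "(c k - T) / p < of_int (- m) + 1" unfolding m_def by simp_all
    then have "of_int (- m) * p \<le> c k - T" "c k - T < (of_int (- m) + 1) * p" using p by (simp_all add: field_simps)
    then have 1: "0 \<le> c k - T + m * p" "c k - T + m * p < p" by (simp_all add: algebra_simps)
    \<comment> \<open>After the move these are the two gap centres on either side of the origin;
      goodness keeps the representative away from both ends of the period.\<close>
    have 2: "D * Q k \<le> \<bar>T - c k - m * p\<bar>" "D * Q k \<le> \<bar>T - c k - (m - 1) * p\<bar>"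
      using good[OF k, of m] good[OF k, of "m - 1"] by (simp_all add: p_def mult_ac)
    have "real_of_int (D * (D - 2)) * Q k = p - D * Q k" by (simp add: p_def algebra_simps)
    then show ?thesis using 1 2 unfolding p_def[symmetric]
        by (intro exI[of _ m]) (auto simp: algebra_simps abs_if split: if_splits)
  qed
  then obtain m :: "node \<Rightarrow> int" where m: "\<And>k. k \<in> set ks \<Longrightarrow>
      D * Q k \<le> c k - T + m k * (real_of_int ((D - 1) * D) * Q k) \<and>
     c k - T + m k * (real_of_int ((D - 1) * D) * Q k) \<le> real_of_int (D * (D - 2)) * Q k" by metis
  from cov obtain k j where kj: "k \<in> set (ks @ [l])" "in_gap D Q c k j T"
    unfolding covering_def covered_def by blast
  have "k \<notin> set ks"
  proof
    assume "k \<in> set ks"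
    with good[of k j] have "D * Q k \<le> \<bar>T - c k - real_of_int ((D - 1) * D * j) * Q k\<bar>" by blast
    moreover have "\<bar>T - c k - real_of_int ((D - 1) * D * j) * Q k\<bar> < (D - 1) * Q k"
      unfolding abs_less_iff using kj(2) by (simp add: left_end_def right_end_def algebra_simps)
    ultimately show False using pos[of k] by (simp add: algebra_simps)
  qed
  with kj have j: "in_gap D Q c l j T" by auto
  define c1 where "c1 k = c k - T + (if k = l then j else m k) * (real_of_int ((D - 1) * D) * Q k)" for k
  have c1: "covering D (ks @ [l]) Q c1"
    by (rule covering_move[OF cov, of _ T]) (auto simp: c1_def)
  have 1: "D * Q k \<le> c1 k \<and> c1 k \<le> real_of_int (D * (D - 2)) * Q k" if "k \<in> set ks" for k
    using m[OF that] that l by (auto simp: c1_def)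
  have 2: "\<bar>c1 l\<bar> \<le> real_of_int (D - 1) * Q l"
    unfolding abs_le_iff using j by (simp add: c1_def left_end_def right_end_def algebra_simps)
  show ?thesis
  proof (cases "c1 l \<ge> 0")
    case True with c1 1 2 show ?thesis by (intro exI[of _ c1]) auto
  next
    case False
    \<comment> \<open>Reflection followed by one period \<open>D * (D - 1) * Q k\<close> maps the
      interval from \<open>D * Q k\<close> to \<open>D * (D - 2) * Q k\<close> onto itself.\<close>
    define c2 where "c2 k = - c1 k + (if k = l then 0 else 1) * (real_of_int ((D - 1) * D) * Q k)" for k
    have "covering D (ks @ [l]) Q c2"
      by (rule covering_move[OF covering_reflect[OF c1], of _ 0]) (auto simp: c2_def intro: exI[of _ 0] exI[of _ 1])
    moreover have "D * Q k \<le> c2 k \<and> c2 k \<le> real_of_int (D * (D - 2)) * Q k" if "k \<in> set ks" for k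
      using 1[OF that] that l by (auto simp: c2_def algebra_simps)
    ultimately show ?thesis using False 2 by (intro exI[of _ c2]) (auto simp: c2_def)
  qed
qed

text \<open>Runner \<open>k\<close> with velocity \<open>v k\<close> starting at \<open>s k\<close> is encoded by \<open>Q k = 1 / ((D - 1) v k)\<close> and
  \<open>c k = - D s k / v k\<close> in the time scale \<open>T = D t\<close>.\<close>

lemma covering_runners:
  fixes v s :: "node \<Rightarrow> real" and D :: int
  assumes D: "3 \<le> D" and v: "\<And>k. 0 < v k"
    and no: "\<And>t. \<exists>k\<in>set ks. \<not> far (1 / D) (v k * t + s k)"
  shows "covering D ks (\<lambda>k. 1 / (real_of_int (D - 1) * v k)) (\<lambda>k. - real_of_int D * s k / v k)"
  unfolding covering_def covered_def
proof
  fix T :: real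
  obtain k j where k: "k \<in> set ks" "\<bar>v k * (T / D) + s k - real_of_int j\<bar> < 1 / D"
    using no[of "T / D"] unfolding far_def by (auto simp: not_le)
  have D': "real_of_int D > 0" "real_of_int (D - 1) > 0" using D by simp_all
  have "\<bar>v k * (T / D) + s k - j\<bar> * D < 1" using k(2) D' by (simp add: field_simps)
  also have "\<bar>v k * (T / D) + s k - j\<bar> * D = \<bar>(v k * (T / D) + s k - j) * D\<bar>"
    using D' by (simp add: abs_mult)
  also have "(v k * (T / D) + s k - j) * D = v k * T + D * s k - D * j"
    using D' by (simp add: field_simps)
  finally have *: "\<bar>v k * T + D * s k - D * j\<bar> < 1" .
  have "left_end D j * (1 / (real_of_int (D - 1) * v k)) = (D * j - 1) / v k"
    "right_end D j * (1 / (real_of_int (D - 1) * v k)) = (D * j + 1) / v k"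
    using D' by (simp_all add: left_end_def right_end_def)
  moreover have "(- D * s k + (D * j - 1)) / v k < T" "T < (- D * s k + (D * j + 1)) / v k"
    using * v[of k] by (simp_all add: pos_divide_less_eq pos_less_divide_eq abs_less_iff mult.commute)
  then have "- real_of_int D * s k / v k + (D * j - 1) / v k < T"
      "T < - real_of_int D * s k / v k + (D * j + 1) / v k"
    by (simp_all only: add_divide_distrib)
  ultimately show "\<exists>k\<in>set ks. \<exists>j. in_gap D (\<lambda>k. 1 / (real_of_int (D - 1) * v k)) (\<lambda>k. - real_of_int D * s k / v k) k j
      T"
    using k(1) by (metis (no_types, lifting))
qed

text \<open>This explains the factor \<open>D - 1\<close> in \<open>Q\<close>: the distances
  \<open>1 / D\<close> and \<open>1 / (D - 1)\<close> become the integer multiples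
  \<open>D - 1\<close> and \<open>D\<close> of \<open>Q k\<close>, so that all normalisations have
  integer coefficients.\<close>

lemma good_runners:
  fixes v c :: "node \<Rightarrow> real" and D :: int and t :: real
  assumes D: "3 \<le> D" and v: "0 < v k" and f: "far (1 / (D - 1)) (v k * t - v k * c k / D)"
  shows "D * (1 / (real_of_int (D - 1) * v k))
      \<le> \<bar>D * t - c k - real_of_int ((D - 1) * D * j) * (1 / (real_of_int (D - 1) * v k))\<bar>"
proof -
  have D': "real_of_int D > 0" "real_of_int (D - 1) > 0" using D by simp_all
  from f have "1 / (D - 1) \<le> \<bar>v k * t - v k * c k / D - j\<bar>" unfolding far_def by blast
  then have "D / v k * (1 / (D - 1)) \<le> D / v k * \<bar>v k * t - v k * c k / D - j\<bar>"
    using D' v by (intro mult_left_mono) auto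
  also have "\<dots> = \<bar>D / v k * (v k * t - v k * c k / D - j)\<bar>" using D' v by (simp add: abs_mult)
  also have "D / v k * (v k * t - v k * c k / D - j)
      = D * t - c k - real_of_int ((D - 1) * D * j) * (1 / (real_of_int (D - 1) * v k))"
    using D' v by (simp add: field_simps)
  finally show ?thesis by (simp add: mult.commute)
qed

section \<open>Synchronising runners of nearly equal speed\<close>

lemma drift:
  fixes u w \<sigma> c :: real
  assumes "0 < u" "\<bar>u * \<sigma>\<bar> \<le> 1/2" "\<bar>w\<bar> \<le> c * u"
  shows "\<bar>w * \<sigma>\<bar> \<le> c / 2"
proof -
  have "0 \<le> c" using assms(1,3) by (meson abs_ge_zero mult_less_0_iff not_less order_trans)
  have "\<bar>w * \<sigma>\<bar> = \<bar>w\<bar> * \<bar>\<sigma>\<bar>" by (rule abs_mult)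
  also have "\<dots> \<le> c * u * \<bar>\<sigma>\<bar>" using assms(3) by (intro mult_right_mono) auto
  also have "\<dots> = c * \<bar>u * \<sigma>\<bar>" using assms(1) by (simp add: abs_mult)
  also have "\<dots> \<le> c * (1/2)" using assms(2) \<open>0 \<le> c\<close> by (intro mult_left_mono)
  finally show ?thesis by simp
qed

text \<open>Around time \<open>\<tau>\<close> all runners whose velocity is close to \<open>u\<close> move almost rigidly, so their common
  position can be adjusted to any phase \<open>\<alpha>\<close> of the reference runner \<open>(v, s)\<close>.\<close>

lemma sync:
  fixes u \<tau> v s \<alpha> :: real
  assumes "0 < u"
  shows "\<exists>t. (\<forall>w r c \<theta>. \<bar>w - u\<bar> \<le> c * u \<longrightarrow> far \<theta> ((w - v) * \<tau> + (r - s) + \<alpha>) \<longrightarrow> far (\<theta> - c / 2) (w * t + r)) \<and>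
    (\<forall>w r c \<theta>. \<bar>w\<bar> \<le> c * u \<longrightarrow> far \<theta> (w * \<tau> + r) \<longrightarrow> far (\<theta> - c / 2) (w * t + r))"
proof -
  obtain \<sigma> and k :: int where \<sigma>: "\<bar>u * \<sigma>\<bar> \<le> 1/2" "v * \<tau> + s + u * \<sigma> = k + \<alpha>"
    using clock[OF assms] by blast
  have "far (\<theta> - c / 2) (w * (\<tau> + \<sigma>) + r)"
    if "\<bar>w - u\<bar> \<le> c * u" and f: "far \<theta> ((w - v) * \<tau> + (r - s) + \<alpha>)" for w r c \<theta>
  proof (rule far_near)
    show "far \<theta> ((w - v) * \<tau> + (r - s) + \<alpha> + k)" using f far_add_int by blast
    \<comment> \<open>The phase of the reference runner was advanced with speed \<open>u\<close>
      instead of \<open>v\<close>. Therefore the error of every runner, the reference included, is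
      its speed relative to \<open>u\<close> times \<sigma>.\<close>
    have "w * (\<tau> + \<sigma>) + r - ((w - v) * \<tau> + (r - s) + \<alpha> + k) = (w - u) * \<sigma>"
      using \<sigma>(2) by (simp add: algebra_simps)
    then show "\<bar>w * (\<tau> + \<sigma>) + r - ((w - v) * \<tau> + (r - s) + \<alpha> + k)\<bar> \<le> \<theta> - (\<theta> - c / 2)"
      using drift[OF assms \<sigma>(1) that(1)] by simp
  qed
  moreover have "far (\<theta> - c / 2) (w * (\<tau> + \<sigma>) + r)"
    if "\<bar>w\<bar> \<le> c * u" and f: "far \<theta> (w * \<tau> + r)" for w r c \<theta>
    by (rule far_near[OF f]) (use drift[OF assms \<sigma>(1) that(1)] in \<open>simp add: algebra_simps\<close>)
  ultimately show ?thesis by blast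
qed

text \<open>All runners are in the wanted interval from the latest entry to the earliest exit. The
  slack \<open>g\<close> is what the spread of the phases leaves of its width, and
  \<open>g * p\<close> is the time to traverse it at the highest speed. A phase may start up to
  \<open>m\<close> outside the interval; over this distance unequal speeds cost at most
  \<open>m * (p' - p)\<close>.\<close>

lemma common_window:
  fixes v \<phi> :: "'a \<Rightarrow> real"
  assumes I: "finite I" "I \<noteq> {}" and v: "\<And>i. i \<in> I \<Longrightarrow> 0 < v i" "\<And>i. i \<in> I \<Longrightarrow> p \<le> 1 / v i" "\<And>i. i \<in> I \<Longrightarrow> 1 / v i \<le> p'"
    and p: "0 < p" "p \<le> p'"
    and \<phi>: "\<And>i j. i \<in> I \<Longrightarrow> j \<in> I \<Longrightarrow> \<phi> i - \<phi> j \<le> 1 - 2 * \<theta> - g" "\<And>i. i \<in> I \<Longrightarrow> \<phi> i \<le> 1 - \<theta> + m"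
      "\<And>i. i \<in> I \<Longrightarrow> \<theta> - m \<le> \<phi> i"
    and gm: "0 \<le> g" "0 \<le> m" "l \<le> g * p - m * (p' - p)"
  shows "\<exists>L. \<forall>\<sigma>. L \<le> \<sigma> \<longrightarrow> \<sigma> \<le> L + l \<longrightarrow> (\<forall>i\<in>I. \<theta> \<le> \<phi> i + v i * \<sigma> \<and> \<phi> i + v i * \<sigma> \<le> 1 - \<theta>)"
proof -
  define L where "L = Max ((\<lambda>j. (\<theta> - \<phi> j) / v j) ` I)"
  have "L \<in> (\<lambda>j. (\<theta> - \<phi> j) / v j) ` I" unfolding L_def using I by (intro Max_in) auto
  then obtain j where j: "j \<in> I" "L = (\<theta> - \<phi> j) / v j" by auto
  have lower: "(\<theta> - \<phi> i) / v i \<le> L" if "i \<in> I" for i unfolding L_def using I that by auto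
  have key: "l \<le> (1 - \<theta> - \<phi> i) / v i - L" if i: "i \<in> I" for i
  proof -
    define A B where "A = 1 - \<theta> - \<phi> i" and "B = \<theta> - \<phi> j"
    define x y where "x = 1 / v i" and "y = 1 / v j"
    have AB: "g \<le> A - B" "- m \<le> A" "B \<le> m" using \<phi> i j by (auto simp: A_def B_def algebra_simps)
    have xy: "p \<le> x" "x \<le> p'" "p \<le> y" "y \<le> p'" using v i j by (auto simp: x_def y_def)
    have gp: "g * p \<le> (A - B) * p" using AB p by (intro mult_right_mono) auto
    have mp: "0 \<le> m * (p' - p)" using gm p by simp
    \<comment> \<open>The right-hand side is bilinear, so it is smallest at extreme values of
      \<open>x\<close> and \<open>y\<close>, selected by the signs of \<open>A\<close> and
      \<open>B\<close>. Negative \<open>A\<close> with positive \<open>B\<close> cannot occur, as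
      \<open>A - B\<close> is at least \<open>g\<close>.\<close>
    have "g * p - m * (p' - p) \<le> A * x - B * y"
    proof (cases "A \<ge> 0")
      case A: True
      then have Ax: "A * p \<le> A * x" using xy by (intro mult_left_mono)
      show ?thesis
      proof (cases "B \<le> 0")
        case True
        then have "B * y \<le> B * p" using xy by (intro mult_left_mono_neg)
        with Ax gp mp show ?thesis by (simp add: algebra_simps)
      next
        case False
        then have "B * y \<le> B * p'" using xy by (intro mult_left_mono) auto
        moreover have "B * (p' - p) \<le> m * (p' - p)" using AB p by (intro mult_right_mono) auto
        ultimately show ?thesis using Ax gp by (simp add: algebra_simps)
      qed
    next
      case False
      then have "A * p' \<le> A * x" using xy by (intro mult_left_mono_neg) auto
      moreover have "- m * (p' - p) \<le> A * (p' - p)" using AB p by (intro mult_right_mono) auto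
      moreover have "B * y \<le> B * p" using xy AB gm False by (intro mult_left_mono_neg) auto
      ultimately show ?thesis using gp by (simp add: algebra_simps)
    qed
    then show ?thesis using gm(3) by (simp add: A_def B_def x_def y_def j(2))
  qed
  have "\<theta> \<le> \<phi> i + v i * \<sigma> \<and> \<phi> i + v i * \<sigma> \<le> 1 - \<theta>" if "L \<le> \<sigma>" "\<sigma> \<le> L + l" "i \<in> I" for \<sigma> i
  proof
    have "(\<theta> - \<phi> i) / v i \<le> \<sigma>" using lower[OF that(3)] that(1) by linarith
    then show "\<theta> \<le> \<phi> i + v i * \<sigma>" using v(1)[OF that(3)] by (simp add: pos_divide_le_eq mult.commute)
    have "\<sigma> \<le> (1 - \<theta> - \<phi> i) / v i" using key[OF that(3)] that(2) by linarith
    then show "\<phi> i + v i * \<sigma> \<le> 1 - \<theta>" using v(1)[OF that(3)] by (simp add: pos_le_divide_eq mult.commute)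
  qed
  then show ?thesis by blast
qed

lemma far_int_shift: "\<theta> \<le> \<phi> \<Longrightarrow> \<phi> \<le> 1 - \<theta> \<Longrightarrow> x = real_of_int k + \<phi> \<Longrightarrow> far \<theta> x"
  by (rule farI[of k]) auto

text \<open>\<open>lonely2_meet\<close> is applied to runner 1 and the relative motion of runners 2
  and 3. It brings these two within \<delta> of each other at a time when runner 1 is at distance
  \<delta>. They then run into the wanted interval together, while runner 1 is too slow to lose more
  than \<open>\<delta> - \<theta>\<close>.\<close>

lemma slow_pair_window:
  fixes v1 v2 v3 s1 s2 s3 \<theta> \<delta> l :: real
  assumes v: "0 < v1" "0 < v2" "v2 < v3" and \<delta>: "1/6 \<le> \<delta>" "\<delta> \<le> 1/3" "\<theta> + \<delta> \<le> 3/5" "\<delta> \<le> 1 - 2 * \<theta>"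
    and l: "l \<le> (1 - 2 * \<theta> - \<delta>) / v3 - (\<theta> + \<delta>) * (1 / v2 - 1 / v3)" "0 \<le> \<theta>"
    and slow: "(1 - \<theta>) * v1 \<le> (\<delta> - \<theta>) * v2" "\<theta> \<le> \<delta>"
  shows "\<exists>t. \<forall>\<sigma>. 0 \<le> \<sigma> \<longrightarrow> \<sigma> \<le> l \<longrightarrow>
    far \<theta> (v1 * (t + \<sigma>) + s1) \<and> far \<theta> (v2 * (t + \<sigma>) + s2) \<and> far \<theta> (v3 * (t + \<sigma>) + s3)"
proof -
  obtain \<tau> and j :: int where \<tau>: "far \<delta> (v1 * \<tau> + s1)" "\<bar>(v3 - v2) * \<tau> + (s3 - s2) - j\<bar> \<le> \<delta>"
    using lonely2_meet[of v1 "v3 - v2" \<delta> s1 "s3 - s2"] v \<delta> by auto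
  define d where "d = (v3 - v2) * \<tau> + (s3 - s2) - j"
  define k where "k = \<lfloor>v2 * \<tau> + s2\<rfloor>"
  define \<alpha> where "\<alpha> = v2 * \<tau> + s2 - k"
  have \<alpha>: "0 \<le> \<alpha>" "\<alpha> \<le> 1" unfolding \<alpha>_def k_def by linarith+
  have d: "\<bar>d\<bar> \<le> \<delta>" using \<tau>(2) by (simp add: d_def)
  define w where "w b = (if b then v3 else v2)" for b
  define \<phi> where "\<phi> b = (if b then \<alpha> + d else \<alpha>)" for b
  \<comment> \<open>With \<alpha> in [0, 1] and \<open>d\<close> between -\<delta> and \<delta>, the
    phases spread by at most \<delta> and lie at most \<open>\<theta> + \<delta>\<close> outside the
    wanted interval.\<close>
  have "\<exists>L. \<forall>\<sigma>. L \<le> \<sigma> \<longrightarrow> \<sigma> \<le> L + l \<longrightarrow> (\<forall>i\<in>UNIV. \<theta> \<le> \<phi> i + w i * \<sigma> \<and> \<phi> i + w i * \<sigma> \<le> 1 - \<theta>)"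
    by (rule common_window[where p = "1 / v3" and p' = "1 / v2" and g = "1 - 2 * \<theta> - \<delta>" and m = "\<theta> + \<delta>"])
      (use v \<delta> l \<alpha> d in \<open>auto simp: w_def \<phi>_def field_simps abs_le_iff\<close>)
  then obtain L where L: "\<And>\<sigma> i. L \<le> \<sigma> \<Longrightarrow> \<sigma> \<le> L + l \<Longrightarrow> \<theta> \<le> \<phi> i + w i * \<sigma> \<and> \<phi> i + w i * \<sigma> \<le> 1 - \<theta>" by blast
  have "far \<theta> (v1 * (\<tau> + L + \<sigma>) + s1) \<and> far \<theta> (v2 * (\<tau> + L + \<sigma>) + s2) \<and> far \<theta> (v3 * (\<tau> + L + \<sigma>) + s3)"
    if \<sigma>: "0 \<le> \<sigma>" "\<sigma> \<le> l" for \<sigma>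
  proof -
    define \<rho> where "\<rho> = L + \<sigma>"
    have 2: "\<theta> \<le> \<alpha> + v2 * \<rho>" "\<alpha> + v2 * \<rho> \<le> 1 - \<theta>" and 3: "\<theta> \<le> \<alpha> + d + v3 * \<rho>" "\<alpha> + d + v3 * \<rho> \<le> 1 - \<theta>"
      using L[of \<rho> False] L[of \<rho> True] \<sigma> by (auto simp: \<rho>_def w_def \<phi>_def)
    have f2: "far \<theta> (v2 * (\<tau> + \<rho>) + s2)"
      by (rule far_int_shift[OF 2, of _ k]) (simp add: \<alpha>_def algebra_simps)
    have f3: "far \<theta> (v3 * (\<tau> + \<rho>) + s3)"
      by (rule far_int_shift[OF 3, of _ "k + j"]) (simp add: \<alpha>_def d_def algebra_simps)
    \<comment> \<open>Runner 2 moves from a phase in [0, 1] to one between \<theta> and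
      \<open>1 - \<theta>\<close>, which limits the elapsed time.\<close>
    have "\<bar>v2 * \<rho>\<bar> \<le> 1 - \<theta>" using 2 \<alpha> by linarith
    then have "v1 * (v2 * \<bar>\<rho>\<bar>) \<le> v1 * (1 - \<theta>)" using v by (simp add: abs_mult)
    also have "\<dots> \<le> (\<delta> - \<theta>) * v2" using slow by (simp add: mult.commute)
    finally have "\<bar>v1 * \<rho>\<bar> * v2 \<le> (\<delta> - \<theta>) * v2" using v by (simp add: abs_mult mult_ac)
    then have "\<bar>v1 * \<rho>\<bar> \<le> \<delta> - \<theta>" using v(2) by simp
    then have f1: "far \<theta> (v1 * (\<tau> + \<rho>) + s1)"
      by (intro far_near[OF \<tau>(1)]) (simp add: algebra_simps)
    from f1 f2 f3 show ?thesis by (simp add: \<rho>_def add.assoc)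
  qed
  then show ?thesis by (intro exI[of _ "\<tau> + L"]) blast
qed

section \<open>Degenerate speeds of three runners\<close>

definition lonely :: "real \<Rightarrow> node set \<Rightarrow> (node \<Rightarrow> real) \<Rightarrow> (node \<Rightarrow> real) \<Rightarrow> bool" where
  "lonely \<theta> I v s \<longleftrightarrow> (\<exists>t. \<forall>k\<in>I. far \<theta> (v k * t + s k))"

text \<open>Runner 1 is the reference. \<open>lonely2\<close> on the relative speeds, shifted by
  half a turn, makes the other two good when the reference has phase 1/2. Setting this phase with
  the mean speed \<open>u\<close> of runners 2 and 3 costs the reference at most 1/4 of its 1/2 and
  the others at most 1/12 of their 1/3; the hypotheses \<open>c\<close> guarantee these
  budgets.\<close>

lemma lonely_slowest_pair:
  assumes v: "0 < v R1" "v R1 < v R2" "v R2 < v R3" and c: "5 * v R3 \<le> 7 * v R2" "v R3 \<le> 2 * v R1"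
  shows "lonely (1/4) {R1, R2, R3} v s"
proof -
  obtain \<tau> where \<tau>: "far (1/3) ((v R2 - v R1) * \<tau> + (s R2 - s R1 + 1/2))"
      "far (1/3) ((v R3 - v R1) * \<tau> + (s R3 - s R1 + 1/2))"
    using lonely2[of "v R2 - v R1" "v R3 - v R1"] v by auto
  define u where "u = (v R2 + v R3) / 2"
  have u2: "2 * u = v R2 + v R3" by (simp add: u_def)
  have u: "0 < u" using v by (simp add: u_def)
  obtain t where t: "\<And>w r c \<theta>. \<bar>w - u\<bar> \<le> c * u \<Longrightarrow> far \<theta> ((w - v R1) * \<tau> + (r - s R1) + 1/2) \<Longrightarrow>
      far (\<theta> - c / 2) (w * t + r)"
    using sync[OF u, of "v R1" \<tau> "s R1" "1/2"] by blast
  have "\<bar>v R1 - u\<bar> \<le> 1/2 * u" using v c u2 by (simp add: abs_le_iff)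
  then have "far (1/4) (v R1 * t + s R1)"
    using t[of "v R1" "1/2" "1/2" "s R1"] far_half[of "1/2" 0] by simp
  moreover have "\<bar>v R2 - u\<bar> \<le> 1/6 * u" "\<bar>v R3 - u\<bar> \<le> 1/6 * u" using v c u2 by (simp_all add: abs_le_iff)
  then have "far (1/4) (v R2 * t + s R2)" "far (1/4) (v R3 * t + s R3)"
    using t[of "v R2" "1/6" "1/3" "s R2"] t[of "v R3" "1/6" "1/3" "s R3"] \<tau> by (simp_all add: add.assoc)
  ultimately show ?thesis by (auto simp: lonely_def)
qed

text \<open>The argument of \<open>lonely_slowest_pair\<close> with the fastest runner as reference.
  The relative speeds are now negative, hence \<open>lonely2_signed\<close>.\<close>

lemma lonely_fastest_pair:
  assumes v: "0 < v R1" "v R1 < v R2" "v R2 < v R3" and c: "5 * v R2 \<le> 7 * v R1" "2 * v R3 \<le> 3 * v R1"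
  shows "lonely (1/4) {R1, R2, R3} v s"
proof -
  obtain \<tau> where \<tau>: "far (1/3) ((v R1 - v R3) * \<tau> + (s R1 - s R3 + 1/2))"
      "far (1/3) ((v R2 - v R3) * \<tau> + (s R2 - s R3 + 1/2))"
    using lonely2_signed[of "v R1 - v R3" "v R2 - v R3"] v by auto
  define u where "u = (v R1 + v R2) / 2"
  have u2: "2 * u = v R1 + v R2" by (simp add: u_def)
  have u: "0 < u" using v by (simp add: u_def)
  obtain t where t: "\<And>w r c \<theta>. \<bar>w - u\<bar> \<le> c * u \<Longrightarrow> far \<theta> ((w - v R3) * \<tau> + (r - s R3) + 1/2) \<Longrightarrow>
      far (\<theta> - c / 2) (w * t + r)"
    using sync[OF u, of "v R3" \<tau> "s R3" "1/2"] by blast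
  have "\<bar>v R3 - u\<bar> \<le> 1/2 * u" using v c u2 by (simp add: abs_le_iff)
  then have "far (1/4) (v R3 * t + s R3)"
    using t[of "v R3" "1/2" "1/2" "s R3"] far_half[of "1/2" 0] by simp
  moreover have "\<bar>v R1 - u\<bar> \<le> 1/6 * u" "\<bar>v R2 - u\<bar> \<le> 1/6 * u" using v c u2 by (simp_all add: abs_le_iff)
  then have "far (1/4) (v R1 * t + s R1)" "far (1/4) (v R2 * t + s R2)"
    using t[of "v R1" "1/6" "1/3" "s R1"] t[of "v R2" "1/6" "1/3" "s R2"] \<tau> by (simp_all add: add.assoc)
  ultimately show ?thesis by (auto simp: lonely_def)
qed

text \<open>\<open>slow_pair_window\<close> with a window of length 0. The value 3/10, between 1/4
  and 1/3, trades the closeness of runners 2 and 3 against the reserve 1/20 of runner 1.\<close>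

lemma lonely_slow_runner:
  assumes v: "0 < v R1" "v R1 < v R2" "v R2 < v R3" and c: "11 * v R3 \<le> 15 * v R2" "15 * v R1 \<le> v R2"
  shows "lonely (1/4) {R1, R2, R3} v s"
proof -
  have "0 \<le> (1 - 2 * (1/4) - 3/10) / v R3 - (1/4 + 3/10) * (1 / v R2 - 1 / v R3)"
    using v c by (simp add: field_simps)
  then obtain t where "\<forall>\<sigma>. 0 \<le> \<sigma> \<longrightarrow> \<sigma> \<le> 0 \<longrightarrow> far (1/4) (v R1 * (t + \<sigma>) + s R1) \<and> far (1/4) (v R2 * (t + \<sigma>) + s R2) \<and>
      far (1/4) (v R3 * (t + \<sigma>) + s R3)"
    using slow_pair_window[of "v R1" "v R2" "v R3" "3/10" "1/4" 0 "s R1" "s R2" "s R3"] v c by auto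
  then show ?thesis by (auto simp: lonely_def intro!: exI[of _ t])
qed

text \<open>The reserve 1/3 - 1/4 = 1/12 of runners 1 and 2 gives a window of length
  \<open>1 / (6 * v R2)\<close>. In it runner 3 covers at least half a turn, the length of its
  forbidden arc.\<close>

lemma lonely_fast_runner:
  assumes v: "0 < v R1" "v R1 < v R2" "v R2 < v R3" and c: "3 * v R2 \<le> v R3"
  shows "lonely (1/4) {R1, R2, R3} v s"
proof -
  obtain t where t: "far (1/3) (v R1 * t + s R1)" "far (1/3) (v R2 * t + s R2)"
    using lonely2[of "v R1" "v R2"] v by auto
  define t0 l where "t0 = t - 1 / (12 * v R2)" and "l = 1 / (6 * v R2)"
  have "2 * (1/4) \<le> v R3 * l" "0 \<le> l" using v c by (simp_all add: l_def field_simps)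
  then obtain \<sigma> where \<sigma>: "0 \<le> \<sigma>" "\<sigma> \<le> l" "far (1/4) (v R3 * t0 + s R3 + v R3 * \<sigma>)"
    using far_in_window[of "v R3" "1/4" l "v R3 * t0 + s R3"] v by auto
  have "\<bar>t0 + \<sigma> - t\<bar> \<le> 1 / (12 * v R2)" using \<sigma> by (simp add: t0_def l_def abs_le_iff)
  then have "v R2 * \<bar>t0 + \<sigma> - t\<bar> \<le> 1/12" using v by (simp add: field_simps)
  moreover have "v R1 * \<bar>t0 + \<sigma> - t\<bar> \<le> v R2 * \<bar>t0 + \<sigma> - t\<bar>" using v by (intro mult_right_mono) auto
  ultimately have d: "\<bar>v R1 * (t0 + \<sigma> - t)\<bar> \<le> 1/12" "\<bar>v R2 * (t0 + \<sigma> - t)\<bar> \<le> 1/12" using v by (simp_all add: abs_mult)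
  have "far (1/4) (v R1 * (t0 + \<sigma>) + s R1)" "far (1/4) (v R2 * (t0 + \<sigma>) + s R2)"
    by (rule far_near[OF t(1)], use d(1) in \<open>simp add: algebra_simps\<close>)
      (rule far_near[OF t(2)], use d(2) in \<open>simp add: algebra_simps\<close>)
  with \<sigma>(3) show ?thesis by (auto simp: lonely_def algebra_simps intro!: exI[of _ "t0 + \<sigma>"])
qed

section \<open>Normalisations as lists of edges, and the passage from certificates to
  runners\<close>

definition meet_edges :: "int \<Rightarrow> node list \<Rightarrow> node \<Rightarrow> node \<Rightarrow> int \<Rightarrow> edge list" where
  "meet_edges h ks i j x = Ed j 0 i 0 # Ed i (- h) j (- h) #
     concat (map (\<lambda>k. if k = j then [Ed Og 0 k (- x), Ed k (- x) Og 0] else [Ed Og 0 k h, Ed k (- h) Og 0])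
         (delete i ks))"

definition good_edges :: "int \<Rightarrow> node list \<Rightarrow> node \<Rightarrow> edge list" where
  "good_edges D ks l = concat (map (\<lambda>k. [Ed Og 0 k (- D), Ed k (- (D * (D - 2))) Og 0]) ks) @ [Ed Og 0 l 0,
      Ed l (1 - D) Og 0]"

text \<open>\<open>h\<close> is half the period in units of \<open>Q\<close>. It is an integer
  because \<open>D * (D - 1)\<close> is even, so the conclusion of \<open>meet_root\<close> can be
  written with integer edges; its equation becomes two opposite edges.\<close>

lemma meet_edges:
  fixes Q :: "node \<Rightarrow> real" and D :: int
  assumes "covering D ks Q c" "\<And>k. 0 < Q k" "3 \<le> D" "i \<in> set ks" "j \<in> set ks" "Q j < Q i" "Og \<notin> set ks"
    "2 * h = D * (D - 1)"
  shows "\<exists>c'. covering D ks Q c' \<and> edges_ok Q c' (meet_edges h ks i j x)"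
proof -
  have h: "real_of_int (D * (D - 1)) / 2 = h" unfolding assms(8)[symmetric] by simp
  obtain c' where c': "covering D ks Q c'" "0 \<le> c' i - c' j" "c' i - c' j \<le> h * (Q i - Q j)" "c' j = x * Q j"
    "\<forall>k. k \<noteq> i \<and> k \<noteq> j \<longrightarrow> - (h * Q k) \<le> c' k \<and> c' k \<le> h * Q k"
    using meet_root[OF assms(1-6), of "real_of_int x"] unfolding h by blast
  have ne: "k \<noteq> Og" if "k \<in> set ks" for k using that assms(7) by auto
  have "edges_ok Q c' (meet_edges h ks i j x)"
    using c'(2-) ne assms(4,5) by (fastforce simp: edges_ok_def meet_edges_def set_delete algebra_simps)
  with c'(1) show ?thesis by blast
qed

lemma good_edges:
  fixes Q :: "node \<Rightarrow> real" and D :: int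
  assumes "covering D (ks @ [l]) Q c" "\<And>k. 0 < Q k" "3 \<le> D" "l \<notin> set ks" "Og \<notin> set (ks @ [l])"
    "\<And>k j. k \<in> set ks \<Longrightarrow> real_of_int D * Q k \<le> \<bar>T - c k - real_of_int ((D - 1) * D * j) * Q k\<bar>"
  shows "\<exists>c'. covering D (ks @ [l]) Q c' \<and> edges_ok Q c' (good_edges D ks l)"
proof -
  obtain c' where c': "covering D (ks @ [l]) Q c'" "0 \<le> c' l" "c' l \<le> real_of_int (D - 1) * Q l"
    "\<forall>k\<in>set ks. real_of_int D * Q k \<le> c' k \<and> c' k \<le> real_of_int (D * (D - 2)) * Q k"
    using good_root[OF assms(1-4,6)] by blast
  have ne: "l \<noteq> Og" "\<And>k. k \<in> set ks \<Longrightarrow> k \<noteq> Og" using assms(5) by auto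
  have "edges_ok Q c' (good_edges D ks l)"
    using c'(2-) ne by (auto simp: edges_ok_def good_edges_def algebra_simps)
  with c'(1) show ?thesis by blast
qed

lemma lonely_by_certificate:
  fixes v s :: "node \<Rightarrow> real" and D :: int
  defines "Q \<equiv> \<lambda>k. 1 / (real_of_int (D - 1) * v k)"
  assumes z: "check_top D (ks @ [l]) X R b z" and D: "3 \<le> D" and v: "\<And>k. 0 < v k"
    and l: "l \<notin> set ks" "Og \<notin> set (ks @ [l])" and IH: "\<And>s. lonely (1 / (D - 1)) (set ks) v s"
    and b: "box_ok b Q" and X: "\<And>k. \<exists>f\<in>set (X k). 0 < form_val Q (\<lambda>_. 0) f"
    and R: "\<And>t. R t = good_edges D ks l \<or>
      (\<exists>i j x. i \<in> set (ks @ [l]) \<and> j \<in> set (ks @ [l]) \<and> v i < v j \<and> R t = meet_edges (D * (D - 1) div 2) (ks @ [l]) i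
          j x)"
  shows "lonely (1 / D) (set (ks @ [l])) v s"
proof (rule ccontr)
  assume no: "\<not> lonely (1 / D) (set (ks @ [l])) v s"
  define c where "c k = - real_of_int D * s k / v k" for k
  have D1: "real_of_int (D - 1) > 0" using D by simp
  have Q: "0 < Q k" for k unfolding Q_def using v[of k] D1 by simp
  have cov: "covering D (ks @ [l]) Q c"
    unfolding Q_def c_def by (rule covering_runners[OF D v]) (use no in \<open>auto simp: lonely_def\<close>)
  \<comment> \<open>By \<open>c_def\<close>, \<open>- v k * c k / D\<close> is the starting point
    \<open>s k\<close>, written in the form that \<open>good_runners\<close> expects.\<close>
  obtain t where t: "\<And>k. k \<in> set ks \<Longrightarrow> far (1 / (D - 1)) (v k * t + - v k * c k / D)"
    using IH[of "\<lambda>k. - v k * c k / D"] by (auto simp: lonely_def)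
  have g: "real_of_int D * Q k \<le> \<bar>D * t - c k - real_of_int ((D - 1) * D * j) * Q k\<bar>" if "k \<in> set ks" for k j
    using good_runners[where k = k and t = t and c = c and j = j and v = v, OF D v] t[OF that] by (simp add: Q_def)
  have h: "2 * (D * (D - 1) div 2) = D * (D - 1)" by simp
  have "\<exists>c'. covering D (ks @ [l]) Q c' \<and> edges_ok Q c' (R t)" for t
  proof (cases "R t = good_edges D ks l")
    case True
    then show ?thesis using good_edges[OF cov Q D l g] by simp
  next
    case False
    with R[of t] obtain i j x where "i \<in> set (ks @ [l])" "j \<in> set (ks @ [l])" "v i < v j"
      "R t = meet_edges (D * (D - 1) div 2) (ks @ [l]) i j x" by blast
    moreover from this have "Q j < Q i" using v[of i] v[of j] D1 by (simp add: Q_def divide_strict_left_mono)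
    ultimately show ?thesis using meet_edges[OF cov Q D _ _ _ l(2) h, of i j x] by simp
  qed
  then show False using check_top_sound[OF z l(2) D b cov X] by blast
qed

section \<open>Three runners\<close>

text \<open>Root 1 is the good moment. In the others two consecutive runners meet, and the parameter
  -3, 3 or 0 of \<open>meet_edges\<close> puts the right end, the left end or the centre of a gap of
  the faster one at the origin. The default repeats root 1, so that every index is
  realisable.\<close>

fun roots3 :: "num \<Rightarrow> edge list" where
  "roots3 num.One = [Ed Og 0 R1 (-4), Ed R1 (-8) Og 0, Ed Og 0 R2 (-4), Ed R2 (-8) Og 0, Ed Og 0 R3 0,
      Ed R3 (-3) Og 0]"
| "roots3 (num.Bit0 num.One) = [Ed R2 0 R1 0, Ed R1 (-6) R2 (-6), Ed Og 0 R2 3, Ed R2 3 Og 0, Ed Og 0 R3 6,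
    Ed R3 (-6) Og 0]"
| "roots3 (num.Bit1 num.One) = [Ed R2 0 R1 0, Ed R1 (-6) R2 (-6), Ed Og 0 R2 (-3), Ed R2 (-3) Og 0, Ed Og 0 R3 6,
    Ed R3 (-6) Og 0]"
| "roots3 (num.Bit0 (num.Bit0 num.One)) = [Ed R2 0 R1 0, Ed R1 (-6) R2 (-6), Ed Og 0 R2 0, Ed R2 0 Og 0, Ed Og 0 R3 6,
    Ed R3 (-6) Og 0]"
| "roots3 (num.Bit1 (num.Bit0 num.One)) = [Ed R3 0 R2 0, Ed R2 (-6) R3 (-6), Ed Og 0 R1 6, Ed R1 (-6) Og 0,
    Ed Og 0 R3 3, Ed R3 3 Og 0]"
| "roots3 (num.Bit0 (num.Bit1 num.One)) = [Ed R3 0 R2 0, Ed R2 (-6) R3 (-6), Ed Og 0 R1 6, Ed R1 (-6) Og 0,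
    Ed Og 0 R3 (-3), Ed R3 (-3) Og 0]"
| "roots3 (num.Bit1 (num.Bit1 num.One)) = [Ed R3 0 R2 0, Ed R2 (-6) R3 (-6), Ed Og 0 R1 6, Ed R1 (-6) Og 0,
    Ed Og 0 R3 0, Ed R3 0 Og 0]"
| "roots3 _ = [Ed Og 0 R1 (-4), Ed R1 (-8) Og 0, Ed Og 0 R2 (-4), Ed R2 (-8) Og 0, Ed Og 0 R3 0, Ed R3 (-3) Og 0]"

text \<open>The hypotheses of \<open>lonely_slowest_pair\<close>, \<open>lonely_fastest_pair\<close>
  and \<open>lonely_slow_runner\<close>, rewritten in reciprocal speeds. A lemma applies where all
  forms of its list are nonpositive.\<close>

fun excluded3 :: "num \<Rightarrow> form list" where
  "excluded3 num.One = [Fm 0 0 0 0 0 5 (-7) 0, Fm 0 0 0 0 1 0 (-2) 0]"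
| "excluded3 (num.Bit0 num.One) = [Fm 0 0 0 0 5 (-7) 0 0, Fm 0 0 0 0 2 0 (-3) 0]"
| "excluded3 (num.Bit1 num.One) = [Fm 0 0 0 0 0 11 (-15) 0, Fm 0 0 0 0 (-1) 15 0 0]"
| "excluded3 _ = [Fm 0 0 0 0 0 5 (-7) 0, Fm 0 0 0 0 1 0 (-2) 0]"

text \<open>As an example of the coding, \<open>Sp 0x9d7a\<close> reads as the numbers 1, 11, 10:
  the first ratio is split at 11/10. The numbers after \<open>Ex\<close> and \<open>Ro\<close> are
  plain indices.\<close>

definition cert3 :: cert where "cert3 =
  Sp 0x9d7a (Ro 2 (Pt 0x1118cb1c64a449 [Pt 0x431588690127 [Pt 0x8177d3177d36eeabfed932d3 []]])) (Sp 0xb57a (Ro 2 (Pt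
  0x44632f1c64a449 [Pt 0x4526ccd421a40497 [],Pt 0x431588690127 [Pt 0x45cb8a026665418a37 []]])) (Ro 1 (Pt
  0x4739622cb1b258e32c7 [Pt 0x408b21b258e3227 [Pt 0x4631b258cb7 [Pt 0x118c6c96337 [Pt
  0x857da845921336558e6772e9ee7cb26477 [Pt 0x20722bedd3857d99439245 []],Pt 0x46292cdd9991b2585c69257 [Pt
  0x461185c5a457 [Pt 0x21eca838e4b0b8b1a493 [Pt 0x10146113 [Pt 0x10d94b2ae058b4e39150525 []]],Pt
  0x10d9570e42d3836e55c392525 []],Pt 0x118078cc0f26497 [Pt 0x8b728bb828e481e499923 []]]],Pt 0x4011961c6b2d [Pt
  0x4606145a497 [Pt 0x8a4b1b2682b3d685db637053946b4b5 [],Pt 0x10e32a0e0166ca9453 []]]]],Pt 0x4739622c80e3227 [Pt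
  0x22a65a99a96b1a3b9ccf2d638cb4d7 [Pt 0x8c68ee733cf58d2d7 [Pt 0x40c638cb37 [Pt 0x40ee733ced61cac77398ed9c6b4d [Pt
  0x101c9eb40cd3 []]],Pt 0x1118e871999b446438c5666d35 []],Pt 0x463058cc38cb37 [Pt 0x20769312dd82ce5308cb33 []]]]])))"

text \<open>The lower bounds 1 express the order of the speeds. The bound 3 on the second ratio
  comes from \<open>lonely_fast_runner\<close>, the first ratio is unbounded because runner 1 may be
  arbitrarily slow, and the last ratio is pinned to 1 as there are only three runners.\<close>

lemma cert3: "check_top 4 [R1, R2, R3] excluded3 roots3 [(1, 1, 1, 0), (1, 1, 3, 1), (1, 1, 1, 1)] cert3"
  by code_simp

theorem lonely3:
  fixes v s :: "node \<Rightarrow> real"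
  assumes v: "0 < v R1" "v R1 < v R2" "v R2 < v R3"
  shows "lonely (1/4) {R1, R2, R3} v s"
proof (rule ccontr)
  assume no: "\<not> lonely (1/4) {R1, R2, R3} v s"
  \<comment> \<open>The remaining nodes also need a positive speed; \<open>v R3\<close> makes the
    last ratio equal to 1, as the box demands.\<close>
  define w where "w k = (if k \<in> {R1, R2, R3} then v k else v R3)" for k
  have w: "0 < w k" for k using v by (cases k) (auto simp: w_def)
  have ww: "w R1 = v R1" "w R2 = v R2" "w R3 = v R3" "w R4 = v R3" by (simp_all add: w_def)
  have "lonely (1 / real_of_int 4) (set ([R1, R2] @ [R3])) w s"
  proof (rule lonely_by_certificate[where X = excluded3 and R = roots3 and z = cert3])
    show "check_top 4 ([R1, R2] @ [R3]) excluded3 roots3 [(1, 1, 1, 0), (1, 1, 3, 1), (1, 1, 1, 1)] cert3"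
      using cert3 by simp
    show "lonely (1 / real_of_int (4 - 1)) (set [R1, R2]) w s" for s
      using lonely2[of "w R1" "w R2" "s R1" "s R2"] v by (simp add: lonely_def ww)
    have "\<not> 3 * v R2 \<le> v R3" using lonely_fast_runner[OF v] no by blast
    then show "box_ok [(1, 1, 1, 0), (1, 1, 3, 1), (1, 1, 1, 1)] (\<lambda>k. 1 / (real_of_int (4 - 1) * w k))"
      using v w by (simp add: box_ok_def ratios_def ww field_simps)
    have "\<not> (5 * v R3 \<le> 7 * v R2 \<and> v R3 \<le> 2 * v R1)" using lonely_slowest_pair[OF v] no by blast
    moreover have "\<not> (5 * v R2 \<le> 7 * v R1 \<and> 2 * v R3 \<le> 3 * v R1)" using lonely_fastest_pair[OF v] no by blast
    moreover have "\<not> (11 * v R3 \<le> 15 * v R2 \<and> 15 * v R1 \<le> v R2)" using lonely_slow_runner[OF v] no by blast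
    ultimately show "\<exists>f\<in>set (excluded3 k). 0 < form_val (\<lambda>k. 1 / (real_of_int (4 - 1) * w k)) (\<lambda>_. 0) f" for k
      using v by (cases k rule: excluded3.cases) (auto simp: ww field_simps not_le)
    show "roots3 t = good_edges 4 [R1, R2] R3 \<or> (\<exists>i j x. i \<in> set ([R1, R2] @ [R3]) \<and> j \<in> set ([R1, R2] @ [R3]) \<and>
        w i < w j \<and>
      roots3 t = meet_edges (4 * (4 - 1) div 2) ([R1, R2] @ [R3]) i j x)" for t
    proof -
      have "roots3 t = good_edges 4 [R1, R2] R3 \<or> (\<exists>x. roots3 t = meet_edges 6 [R1, R2, R3] R1 R2 x) \<or>
        (\<exists>x. roots3 t = meet_edges 6 [R1, R2, R3] R2 R3 x)"
        by (cases t rule: roots3.cases) (auto simp: good_edges_def meet_edges_def intro: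
            exI[of _ 3] exI[of _ "-3"] exI[of _ 0])
      then show ?thesis using v ww by fastforce
    qed
  qed (use w in auto)
  then show False using no by (simp add: lonely_def ww)
qed

section \<open>Four runners\<close>

lemma lonely3_distinct:
  assumes "0 < a" "0 < b" "0 < c" "a \<noteq> b" "a \<noteq> c" "b \<noteq> (c::real)"
  shows "\<exists>t. far (1/4) (a * t + r) \<and> far (1/4) (b * t + s) \<and> far (1/4) (c * t + u)"
proof -
  have sorted: "\<exists>t. far (1/4) (a * t + r) \<and> far (1/4) (b * t + s) \<and> far (1/4) (c * t + u)"
    if "0 < a" "a < b" "b < c" for a b c r s u :: real
    using lonely3[of "\<lambda>k. case k of R1 \<Rightarrow> a | R2 \<Rightarrow> b | _ \<Rightarrow> c" "\<lambda>k. case k of R1 \<Rightarrow> r | R2 \<Rightarrow> s | _ \<Rightarrow> u"] that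
    by (auto simp: lonely_def)
  consider "a < b" "b < c" | "a < c" "c < b" | "b < a" "a < c" | "b < c" "c < a" | "c < a" "a < b" | "c < b" "b < a"
    using assms by linarith
  then show ?thesis
    by cases (use sorted[of a b c r s u] sorted[of a c b r u s] sorted[of b a c s r u] sorted[of b c a s u r]
      sorted[of c a b u r s] sorted[of c b a u s r] assms in blast)+
qed

lemma lonely3_signed:
  assumes "a \<noteq> 0" "b \<noteq> 0" "c \<noteq> 0" "\<bar>a\<bar> \<noteq> \<bar>b\<bar>" "\<bar>a\<bar> \<noteq> \<bar>c\<bar>" "\<bar>b\<bar> \<noteq> \<bar>c\<bar>"
  shows "\<exists>t. far (1/4) (a * t + r) \<and> far (1/4) (b * t + s) \<and> far (1/4) (c * t + u)"
proof -
  obtain r' where r': "\<forall>t. far (1/4) (a * t + r) \<longleftrightarrow> far (1/4) (\<bar>a\<bar> * t + r')"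
    using far_abs_velocity[of "1/4" a r] by blast
  obtain s' where s': "\<forall>t. far (1/4) (b * t + s) \<longleftrightarrow> far (1/4) (\<bar>b\<bar> * t + s')"
    using far_abs_velocity[of "1/4" b s] by blast
  obtain u' where u': "\<forall>t. far (1/4) (c * t + u) \<longleftrightarrow> far (1/4) (\<bar>c\<bar> * t + u')"
    using far_abs_velocity[of "1/4" c u] by blast
  show ?thesis using lonely3_distinct[of "\<bar>a\<bar>" "\<bar>b\<bar>" "\<bar>c\<bar>" r' s' u'] r' s' u' assms by auto
qed

section \<open>Degenerate speeds of four runners\<close>

lemma lonely_slowest_triple:
  assumes v: "0 < v R1" "v R1 < v R2" "v R2 < v R3" "v R3 < v R4" and c: "9 * v R4 \<le> 11 * v R2" "2 * v R4 \<le> 5 * v R1"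
  shows "lonely (1/5) {R1, R2, R3, R4} v s"
proof -
  obtain \<tau> where \<tau>: "far (1/4) ((v R2 - v R1) * \<tau> + (s R2 - s R1 + 1/2))"
    "far (1/4) ((v R3 - v R1) * \<tau> + (s R3 - s R1 + 1/2))" "far (1/4) ((v R4 - v R1) * \<tau> + (s R4 - s R1 + 1/2))"
    using lonely3_signed[of "v R2 - v R1" "v R3 - v R1" "v R4 - v R1" "s R2 - s R1 + 1/2" "s R3 - s R1 + 1/2"
        "s R4 - s R1 + 1/2"] v by auto
  define u where "u = (v R2 + v R4) / 2"
  have u2: "2 * u = v R2 + v R4" by (simp add: u_def)
  have u: "0 < u" using v by (simp add: u_def)
  obtain t where t: "\<And>w r c \<theta>. \<bar>w - u\<bar> \<le> c * u \<Longrightarrow> far \<theta> ((w - v R1) * \<tau> + (r - s R1) + 1/2) \<Longrightarrow>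
      far (\<theta> - c / 2) (w * t + r)"
    using sync[OF u, of "v R1" \<tau> "s R1" "1/2"] by blast
  \<comment> \<open>The reference runner 1 may lose 3/10 of its 1/2, the others 1/20 of the 1/4
    obtained from three runners. The mean speed of runners 2 and 4 serves runner 3 as well, since
    its speed lies between them.\<close>
  have "\<bar>v R1 - u\<bar> \<le> 3/5 * u" "\<bar>v R2 - u\<bar> \<le> 1/10 * u" "\<bar>v R3 - u\<bar> \<le> 1/10 * u" "\<bar>v R4 - u\<bar> \<le> 1/10 * u"
    using v c u2 unfolding abs_le_iff by linarith+
  then have "far (1/5) (v R1 * t + s R1)" "far (1/5) (v R2 * t + s R2)" "far (1/5) (v R3 * t + s R3)"
      "far (1/5) (v R4 * t + s R4)"
    using t[of "v R1" "3/5" "1/2" "s R1"] far_half[of "1/2" 0] t[of "v R2" "1/10" "1/4" "s R2"]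
      t[of "v R3" "1/10" "1/4" "s R3"] t[of "v R4" "1/10" "1/4" "s R4"] \<tau> by (simp_all add: add.assoc)
  then show ?thesis by (auto simp: lonely_def)
qed

text \<open>The same losses 3/10 and 1/20 as in \<open>lonely_slowest_triple\<close>, now with
  runner 4 as the reference.\<close>

lemma lonely_fastest_triple:
  assumes v: "0 < v R1" "v R1 < v R2" "v R2 < v R3" "v R3 < v R4" and c: "9 * v R3 \<le> 11 * v R1" "5 * v R4 \<le> 8 * v R1"
  shows "lonely (1/5) {R1, R2, R3, R4} v s"
proof -
  obtain \<tau> where \<tau>: "far (1/4) ((v R1 - v R4) * \<tau> + (s R1 - s R4 + 1/2))"
    "far (1/4) ((v R2 - v R4) * \<tau> + (s R2 - s R4 + 1/2))" "far (1/4) ((v R3 - v R4) * \<tau> + (s R3 - s R4 + 1/2))"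
    using lonely3_signed[of "v R1 - v R4" "v R2 - v R4" "v R3 - v R4" "s R1 - s R4 + 1/2" "s R2 - s R4 + 1/2"
        "s R3 - s R4 + 1/2"] v by auto
  define u where "u = (v R1 + v R3) / 2"
  have u2: "2 * u = v R1 + v R3" by (simp add: u_def)
  have u: "0 < u" using v by (simp add: u_def)
  obtain t where t: "\<And>w r c \<theta>. \<bar>w - u\<bar> \<le> c * u \<Longrightarrow> far \<theta> ((w - v R4) * \<tau> + (r - s R4) + 1/2) \<Longrightarrow>
      far (\<theta> - c / 2) (w * t + r)"
    using sync[OF u, of "v R4" \<tau> "s R4" "1/2"] by blast
  have "\<bar>v R4 - u\<bar> \<le> 3/5 * u" "\<bar>v R1 - u\<bar> \<le> 1/10 * u" "\<bar>v R2 - u\<bar> \<le> 1/10 * u" "\<bar>v R3 - u\<bar> \<le> 1/10 * u"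
    using v c u2 unfolding abs_le_iff by linarith+
  then have "far (1/5) (v R4 * t + s R4)" "far (1/5) (v R1 * t + s R1)" "far (1/5) (v R2 * t + s R2)"
      "far (1/5) (v R3 * t + s R3)"
    using t[of "v R4" "3/5" "1/2" "s R4"] far_half[of "1/2" 0] t[of "v R1" "1/10" "1/4" "s R1"]
      t[of "v R2" "1/10" "1/4" "s R2"] t[of "v R3" "1/10" "1/4" "s R3"] \<tau> by (simp_all add: add.assoc)
  then show ?thesis by (auto simp: lonely_def)
qed

text \<open>\<open>lonely2\<close> on the speeds relative to runner 1 brings runners 2 and 3 within
  1/6 of it. The three phases then spread over at most 1/3, which yields the slack 4/15 = 1 - 2/5 -
  1/3 and the excess 11/30 = 1/5 + 1/6 for \<open>common_window\<close>. Hypothesis \<open>c\<close>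
  makes the window long enough for runner 4 to move 2/5 of a turn.\<close>

lemma lonely_close_triple:
  assumes v: "0 < v R1" "v R1 < v R2" "v R2 < v R3" "v R3 < v R4" and c: "11 / v R1 + 12 / v R4 \<le> 19 / v R3"
  shows "lonely (1/5) {R1, R2, R3, R4} v s"
proof -
  obtain \<tau> where \<tau>: "far (1/3) ((v R2 - v R1) * \<tau> + (s R2 - s R1) + 1/2)"
      "far (1/3) ((v R3 - v R1) * \<tau> + (s R3 - s R1) + 1/2)"
    using lonely2[of "v R2 - v R1" "v R3 - v R1" "s R2 - s R1 + 1/2" "s R3 - s R1 + 1/2"] v by (auto simp: add.assoc)
  obtain j2 :: int where j2: "\<bar>(v R2 - v R1) * \<tau> + (s R2 - s R1) - j2\<bar> \<le> 1/2 - 1/3" using far_half_near[OF \<tau>(1)]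
      by blast
  obtain j3 :: int where j3: "\<bar>(v R3 - v R1) * \<tau> + (s R3 - s R1) - j3\<bar> \<le> 1/2 - 1/3" using far_half_near[OF \<tau>(2)]
      by blast
  define j where "j k = (case k of R2 \<Rightarrow> j2 | R3 \<Rightarrow> j3 | _ \<Rightarrow> 0)" for k
  define m where "m = \<lfloor>v R1 * \<tau> + s R1\<rfloor>"
  define \<phi> where "\<phi> k = v k * \<tau> + s k - m - j k" for k
  have "\<phi> R1 = v R1 * \<tau> + s R1 - \<lfloor>v R1 * \<tau> + s R1\<rfloor>" by (simp add: \<phi>_def m_def j_def)
  then have \<phi>1: "0 \<le> \<phi> R1" "\<phi> R1 \<le> 1" by linarith+
  have \<phi>23: "\<bar>\<phi> R2 - \<phi> R1\<bar> \<le> 1/6" "\<bar>\<phi> R3 - \<phi> R1\<bar> \<le> 1/6"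
    using j2 j3 by (simp_all add: \<phi>_def j_def algebra_simps)
  define l where "l = 2 / (5 * v R4)"
  have l: "l \<le> 4/15 * (1 / v R3) - 11/30 * (1 / v R1 - 1 / v R3)"
  proof -
    have "2/5 * z \<le> 4/15 * y - 11/30 * (x - y)" if "11 * x + 12 * z \<le> 19 * y" for x y z :: real using that
        unfolding right_diff_distrib by linarith
    from this[of "1 / v R1" "1 / v R4" "1 / v R3"] show ?thesis using c by (simp add: l_def)
  qed
  have "\<exists>L. \<forall>\<sigma>. L \<le> \<sigma> \<longrightarrow> \<sigma> \<le> L + l \<longrightarrow> (\<forall>i\<in>{R1, R2, R3}. 1/5 \<le> \<phi> i + v i * \<sigma> \<and> \<phi> i + v i * \<sigma> \<le> 1 - 1/5)"
  proof (rule common_window[where p = "1 / v R3" and p' = "1 / v R1" and g = "4/15"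
      and m = "11/30", OF _ _ _ _ _ _ _ _ _ _ _ _ l])
    show "1 / v R3 \<le> 1 / v i" "1 / v i \<le> 1 / v R1" if "i \<in> {R1, R2, R3}" for i
      using that v by (auto simp: field_simps)
    show "\<phi> i - \<phi> k \<le> 1 - 2 * (1/5) - 4/15" if "i \<in> {R1, R2, R3}" "k \<in> {R1, R2, R3}" for i k
      using that \<phi>23[unfolded abs_le_iff] by auto
    show "\<phi> i \<le> 1 - 1/5 + 11/30" "1/5 - 11/30 \<le> \<phi> i" if "i \<in> {R1, R2, R3}" for i
      using that \<phi>1 \<phi>23[unfolded abs_le_iff] by auto
  qed (use v in \<open>auto simp: field_simps\<close>)
  then obtain L where L: "\<And>\<sigma> i. L \<le> \<sigma> \<Longrightarrow> \<sigma> \<le> L + l \<Longrightarrow> i \<in> {R1, R2, R3} \<Longrightarrow> 1/5 \<le> \<phi> i + v i * \<sigma> \<and> \<phi> i + v i * \<sigma> \<le> 1 - 1/5"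
    by blast
  have "2 * (1/5) \<le> v R4 * l" "0 \<le> l" using v by (simp_all add: l_def)
  then obtain \<sigma> where \<sigma>: "0 \<le> \<sigma>" "\<sigma> \<le> l" "far (1/5) (v R4 * (\<tau> + L) + s R4 + v R4 * \<sigma>)"
    using far_in_window[of "v R4" "1/5" l "v R4 * (\<tau> + L) + s R4"] v by auto
  have "far (1/5) (v i * (\<tau> + L + \<sigma>) + s i)" if "i \<in> {R1, R2, R3}" for i
  proof (rule far_int_shift)
    show "1/5 \<le> \<phi> i + v i * (L + \<sigma>)" "\<phi> i + v i * (L + \<sigma>) \<le> 1 - 1/5" using L[of "L + \<sigma>" i] \<sigma> that by auto
    show "v i * (\<tau> + L + \<sigma>) + s i = real_of_int (m + j i) + (\<phi> i + v i * (L + \<sigma>))" by (simp add: \<phi>_def algebra_simps)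
  qed
  moreover have "far (1/5) (v R4 * (\<tau> + L + \<sigma>) + s R4)" using \<sigma>(3) by (simp add: algebra_simps)
  ultimately show ?thesis by (auto simp: lonely_def intro!: exI[of _ "\<tau> + L + \<sigma>"])
qed

text \<open>Runner 1 should be good at a time when the relative positions of runners 2, 3 and 4
  admit a common phase \<psi>; \<open>sync\<close> sets this phase at a cost of 1/20 for everyone.
  Three runners with \<psi> = 1/2 provide the time, unless runner 1 is as fast as one of the
  relative motions. That coincidence needs its own construction.\<close>

lemma lonely_slow_and_triple:
  assumes v: "0 < v R1" "v R1 < v R2" "v R2 < v R3" "v R3 < v R4" and c: "9 * v R4 \<le> 11 * v R2" "10 * v R1 \<le> v R2"
  shows "lonely (1/5) {R1, R2, R3, R4} v s"
proof -
  define y where "y k t = (v k - v R2) * t + (s k - s R2)" for k t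
  have "\<exists>\<tau> \<psi>. far (1/4) (v R1 * \<tau> + s R1) \<and> far (1/4) \<psi> \<and> far (1/4) (y R3 \<tau> + \<psi>) \<and> far (1/4) (y R4 \<tau> + \<psi>)"
  proof (cases "v R1 = v R3 - v R2 \<or> v R1 = v R4 - v R2")
    case False
    then obtain \<tau> where "far (1/4) (v R1 * \<tau> + s R1)" "far (1/4) ((v R3 - v R2) * \<tau> + (s R3 - s R2 + 1/2))"
      "far (1/4) ((v R4 - v R2) * \<tau> + (s R4 - s R2 + 1/2))"
      using lonely3_distinct[of "v R1" "v R3 - v R2" "v R4 - v R2" "s R1" "s R3 - s R2 + 1/2" "s R4 - s R2 + 1/2"] v
          by auto
    then show ?thesis using far_half[of "1/4" 0] by (intro exI[of _ \<tau>] exI[of _ "1/2"]) (simp add: y_def add.assoc)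
  next
    case True
    \<comment> \<open>While runner 1 stays in the good half, runners 2 and 4 change their distance by at least \<open>1/2\<close>, so
      at some moment they coincide or are opposite to each other.\<close>
    then have w: "v R1 \<le> v R4 - v R2" using v by auto
    \<comment> \<open>Runner 1 enters its good half at \<open>t0\<close>, with phase 1/4, and
      \<delta> is the first delay after which twice the relative position of runner 4 is an
      integer.\<close>
    define t0 where "t0 = (1/4 - s R1) / v R1"
    define \<delta> where "\<delta> = (of_int \<lceil>2 * y R4 t0\<rceil> - 2 * y R4 t0) / (2 * (v R4 - v R2))"
    define \<tau> where "\<tau> = t0 + \<delta>"
    have num: "0 \<le> of_int \<lceil>2 * y R4 t0\<rceil> - 2 * y R4 t0" "of_int \<lceil>2 * y R4 t0\<rceil> - 2 * y R4 t0 \<le> 1" by linarith+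
    have \<delta>: "0 \<le> \<delta>" using num w v by (simp add: \<delta>_def)
    have "2 * (v R4 - v R2) * \<delta> = of_int \<lceil>2 * y R4 t0\<rceil> - 2 * y R4 t0" using v by (simp add: \<delta>_def)
    then have y4: "2 * y R4 \<tau> = of_int \<lceil>2 * y R4 t0\<rceil>" and "2 * ((v R4 - v R2) * \<delta>) \<le> 1"
      using num by (simp_all add: \<tau>_def y_def algebra_simps)
    moreover have "v R1 * \<delta> \<le> (v R4 - v R2) * \<delta>" using w \<delta> by (intro mult_right_mono)
    ultimately have "v R1 * \<delta> \<le> 1/2" "0 \<le> v R1 * \<delta>" using \<delta> v by simp_all
    moreover have "v R1 * \<tau> + s R1 = 1/4 + v R1 * \<delta>" using v by (simp add: \<tau>_def t0_def distrib_left)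
    ultimately have f1: "far (1/4) (v R1 * \<tau> + s R1)" by (intro farI[of 0]; linarith)
    define n where "n = \<lceil>2 * y R4 t0\<rceil>"
    have n: "y R4 \<tau> = of_int n / 2" using y4 by (simp add: n_def)
    define m where "m = \<lfloor>y R3 \<tau>\<rfloor>"
    have m: "of_int m \<le> y R3 \<tau>" "y R3 \<tau> < of_int m + 1" unfolding m_def by linarith+
    \<comment> \<open>The phases 1/4 and 3/4 both suit runner 2 and, at a relative position that is
      a multiple of 1/2, also runner 4. The half turn containing runner 3 decides between
      them.\<close>
    have quarters: "far (1/4) (1/4)" "far (1/4) (3/4)" by (rule farI[of 0]; simp)+
    have f4: "far (1/4) (y R4 \<tau> + 1/4)" "far (1/4) (y R4 \<tau> + 3/4)"
    proof -
      define q where "q = n div 2"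
      have "n = 2 * q \<or> n = 2 * q + 1" unfolding q_def by presburger
      then have "y R4 \<tau> = of_int q \<or> y R4 \<tau> = of_int q + 1/2" using n by auto
      then show "far (1/4) (y R4 \<tau> + 1/4)" "far (1/4) (y R4 \<tau> + 3/4)"
        by (auto intro: farI[of q] farI[of "q + 1"])
    qed
    show ?thesis
    proof (cases "y R3 \<tau> \<le> m + 1/2")
      case True
      then have "far (1/4) (y R3 \<tau> + 1/4)" using m by (intro farI[of m]) auto
      then show ?thesis using f1 f4 quarters by blast
    next
      case False
      then have "far (1/4) (y R3 \<tau> + 3/4)" using m by (intro farI[of "m + 1"]) auto
      then show ?thesis using f1 f4 quarters by blast
    qed
  qed
  then obtain \<tau> \<psi> where \<tau>: "far (1/4) (v R1 * \<tau> + s R1)" "far (1/4) \<psi>" "far (1/4) (y R3 \<tau> + \<psi>)"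
      "far (1/4) (y R4 \<tau> + \<psi>)" by blast
  define u where "u = (v R2 + v R4) / 2"
  have u2: "2 * u = v R2 + v R4" by (simp add: u_def)
  have u: "0 < u" using v by (simp add: u_def)
  obtain t where t: "\<And>w r c \<theta>. \<bar>w - u\<bar> \<le> c * u \<Longrightarrow> far \<theta> ((w - v R2) * \<tau> + (r - s R2) + \<psi>) \<Longrightarrow>
      far (\<theta> - c / 2) (w * t + r)"
    and t': "\<And>w r c \<theta>. \<bar>w\<bar> \<le> c * u \<Longrightarrow> far \<theta> (w * \<tau> + r) \<Longrightarrow> far (\<theta> - c / 2) (w * t + r)"
    using sync[OF u, of "v R2" \<tau> "s R2" \<psi>] by blast
  have "\<bar>v R1\<bar> \<le> 1/10 * u" "\<bar>v R2 - u\<bar> \<le> 1/10 * u" "\<bar>v R3 - u\<bar> \<le> 1/10 * u" "\<bar>v R4 - u\<bar> \<le> 1/10 * u"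
    using v c u2 unfolding abs_le_iff by linarith+
  then have "far (1/5) (v R1 * t + s R1)" "far (1/5) (v R2 * t + s R2)" "far (1/5) (v R3 * t + s R3)"
      "far (1/5) (v R4 * t + s R4)"
    using t'[of "v R1" "1/10" "1/4" "s R1"] t[of "v R2" "1/10" "1/4" "s R2"]
      t[of "v R3" "1/10" "1/4" "s R3"] t[of "v R4" "1/10" "1/4" "s R4"] \<tau> by (simp_all add: y_def)
  then show ?thesis by (auto simp: lonely_def)
qed

text \<open>\<open>slow_pair_window\<close> at closeness 7/25, which leaves runner 1 the reserve
  7/25 - 1/5 = 2/25. The window lets runner 4 move 2/5 of a turn, the length of its forbidden
  arc.\<close>

lemma lonely_slow_and_pair:
  assumes v: "0 < v R1" "v R1 < v R2" "v R2 < v R3" "v R3 < v R4" and c: "6 / v R2 + 5 / v R4 \<le> 10 / v R3"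
      "10 * v R1 \<le> v R2"
  shows "lonely (1/5) {R1, R2, R3, R4} v s"
proof -
  define l where "l = 2 / (5 * v R4)"
  have "2/5 * z \<le> 8/25 * y - 12/25 * (x - y)" if "6 * x + 5 * z \<le> 10 * y" for x y z :: real using that
      unfolding right_diff_distrib by linarith
  from this[of "1 / v R2" "1 / v R4" "1 / v R3"] c(1) have "l
      \<le> (1 - 2 * (1/5) - 7/25) / v R3 - (1/5 + 7/25) * (1 / v R2 - 1 / v R3)" by (simp add: l_def)
  then obtain t where t: "\<And>\<sigma>. 0 \<le> \<sigma> \<Longrightarrow> \<sigma> \<le> l \<Longrightarrow>
      far (1/5) (v R1 * (t + \<sigma>) + s R1) \<and> far (1/5) (v R2 * (t + \<sigma>) + s R2) \<and> far (1/5) (v R3 * (t + \<sigma>) + s R3)"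
    using slow_pair_window[of "v R1" "v R2" "v R3" "7/25" "1/5" l "s R1" "s R2" "s R3"] v c(2) by auto
  have "2 * (1/5) \<le> v R4 * l" "0 \<le> l" using v by (simp_all add: l_def)
  then obtain \<sigma> where \<sigma>: "0 \<le> \<sigma>" "\<sigma> \<le> l" "far (1/5) (v R4 * t + s R4 + v R4 * \<sigma>)"
    using far_in_window[of "v R4" "1/5" l "v R4 * t + s R4"] v by auto
  then have "far (1/5) (v R4 * (t + \<sigma>) + s R4)" by (simp add: algebra_simps)
  with t[OF \<sigma>(1,2)] show ?thesis by (auto simp: lonely_def intro!: exI[of _ "t + \<sigma>"])
qed

lemma window_of_good_time:
  assumes "0 < v" "0 < w" "w \<le> v" "far \<theta> (w * t + s)" "v * e \<le> \<theta> - \<theta>'" "t - e \<le> x" "x \<le> t + e"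
  shows "far \<theta>' (w * x + s)"
proof (rule far_near[OF assms(4)])
  have "\<bar>x - t\<bar> \<le> e" using assms(6,7) by (simp add: abs_le_iff)
  then have "w * \<bar>x - t\<bar> \<le> v * e" using assms(1-3) by (intro mult_mono) auto
  then show "\<bar>w * x + s - (w * t + s)\<bar> \<le> \<theta> - \<theta>'" using assms(2,5) by (simp add: abs_mult flip: right_diff_distrib)
qed

text \<open>The reserve 1/3 - 1/5 = 2/15 keeps runners 1 and 2 good for a time \<open>2 * e\<close>.
  Within one of its periods runner 3 reaches phase 1/5; it then stays good for 3/5 of a turn, during
  which the faster runner 4 can leave its forbidden arc of 2/5. So 8/5 periods of runner 3 have to
  fit into \<open>2 * e\<close>, whence the factor 6.\<close>

lemma lonely_fast_pair:
  assumes v: "0 < v R1" "v R1 < v R2" "v R2 < v R3" "v R3 < v R4" and c: "6 * v R2 \<le> v R3"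
  shows "lonely (1/5) {R1, R2, R3, R4} v s"
proof -
  obtain t where t: "far (1/3) (v R1 * t + s R1)" "far (1/3) (v R2 * t + s R2)"
    using lonely2[of "v R1" "v R2"] v by auto
  define e where "e = 2 / (15 * v R2)"
  have e: "v R2 * e \<le> 1/3 - 1/5" "0 < e" using v by (simp_all add: e_def)
  have good: "far (1/5) (v R1 * x + s R1)" "far (1/5) (v R2 * x + s R2)" if "t - e \<le> x" "x \<le> t + e" for x
    using window_of_good_time[OF _ _ _ t(1) e(1) that] window_of_good_time[OF _ _ _ t(2) e(1) that] v by auto
  \<comment> \<open>The clock is started half a period after the left end of the window, since it
    may have to be corrected by half a period in either direction.\<close>
  obtain \<sigma>0 and k :: int where \<sigma>0: "\<bar>v R3 * \<sigma>0\<bar> \<le> 1/2" "v R3 * (t - e + 1 / (2 * v R3)) + s R3 + v R3 * \<sigma>0 = k + 1/5"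
    using clock[of "v R3" "v R3 * (t - e + 1 / (2 * v R3)) + s R3" "1/5"] v by auto
  define a where "a = t - e + 1 / (2 * v R3) + \<sigma>0"
  have a: "t - e \<le> a" "a \<le> t - e + 1 / v R3" using \<sigma>0(1) v by (simp_all add: a_def abs_le_iff field_simps)
  have xa: "v R3 * a + s R3 = k + 1/5" using \<sigma>0(2) by (simp add: a_def algebra_simps)
  define l where "l = 3 / (5 * v R3)"
  have "2 * (1/5) \<le> v R4 * l" "0 \<le> l" using v by (simp_all add: l_def field_simps)
  then obtain \<sigma> where \<sigma>: "0 \<le> \<sigma>" "\<sigma> \<le> l" "far (1/5) (v R4 * a + s R4 + v R4 * \<sigma>)"
    using far_in_window[of "v R4" "1/5" l "v R4 * a + s R4"] v by auto
  have "v R3 * \<sigma> \<le> 3/5" "0 \<le> v R3 * \<sigma>" using \<sigma> v by (simp_all add: l_def field_simps)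
  then have "far (1/5) (v R3 * (a + \<sigma>) + s R3)" using xa by (intro farI[of k]) (simp_all add: algebra_simps)
  moreover have "1 / v R3 + l \<le> 2 * e" using v c by (simp add: l_def e_def field_simps)
  then have "far (1/5) (v R1 * (a + \<sigma>) + s R1)" "far (1/5) (v R2 * (a + \<sigma>) + s R2)"
    using a \<sigma> by (intro good; linarith)+
  moreover have "far (1/5) (v R4 * (a + \<sigma>) + s R4)" using \<sigma>(3) by (simp add: algebra_simps)
  ultimately show ?thesis by (auto simp: lonely_def intro!: exI[of _ "a + \<sigma>"])
qed

text \<open>The reserve 1/4 - 1/5 = 1/20 gives a window of length \<open>1 / (10 * v R3)\<close>, in
  which runner 4 has to move 2/5 of a turn. Hence the factor 4.\<close>

lemma lonely_very_fast_runner: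
  assumes v: "0 < v R1" "v R1 < v R2" "v R2 < v R3" "v R3 < v R4" and c: "4 * v R3 \<le> v R4"
  shows "lonely (1/5) {R1, R2, R3, R4} v s"
proof -
  obtain t where t: "far (1/4) (v R1 * t + s R1)" "far (1/4) (v R2 * t + s R2)" "far (1/4) (v R3 * t + s R3)"
    using lonely3[of v s] v by (auto simp: lonely_def)
  define e where "e = 1 / (20 * v R3)"
  have e: "v R3 * e \<le> 1/4 - 1/5" "0 < e" using v by (simp_all add: e_def)
  have good: "far (1/5) (v R1 * x + s R1)" "far (1/5) (v R2 * x + s R2)" "far (1/5) (v R3 * x + s R3)"
      if "t - e \<le> x" "x \<le> t + e" for x
    using window_of_good_time[OF _ _ _ t(1) e(1) that] window_of_good_time[OF _ _ _ t(2) e(1) that]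
      window_of_good_time[OF _ _ _ t(3) e(1) that] v by auto
  have "2 * (1/5) \<le> v R4 * (2 * e)" "0 \<le> 2 * e" using v c by (simp_all add: e_def field_simps)
  then obtain \<sigma> where \<sigma>: "0 \<le> \<sigma>" "\<sigma> \<le> 2 * e" "far (1/5) (v R4 * (t - e) + s R4 + v R4 * \<sigma>)"
    using far_in_window[of "v R4" "1/5" "2 * e" "v R4 * (t - e) + s R4"] v by auto
  then have "far (1/5) (v R4 * (t - e + \<sigma>) + s R4)" by (simp add: algebra_simps)
  with good[of "t - e + \<sigma>"] \<sigma> show ?thesis by (auto simp: lonely_def intro!: exI[of _ "t - e + \<sigma>"])
qed

text \<open>Arranged like \<open>roots3\<close>, with gap radius 4 and half period 10. Roots 2 to 4,
  5 to 7 and 8 to 10 belong to the three pairs of consecutive runners.\<close>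

fun roots4 :: "num \<Rightarrow> edge list" where
  "roots4 num.One = [Ed Og 0 R1 (-5), Ed R1 (-15) Og 0, Ed Og 0 R2 (-5), Ed R2 (-15) Og 0, Ed Og 0 R3 (-5),
      Ed R3 (-15) Og 0, Ed Og 0 R4 0, Ed R4 (-4) Og 0]"
| "roots4 (num.Bit0 num.One) = [Ed R2 0 R1 0, Ed R1 (-10) R2 (-10), Ed Og 0 R2 4, Ed R2 4 Og 0, Ed Og 0 R3 10,
    Ed R3 (-10) Og 0, Ed Og 0 R4 10, Ed R4 (-10) Og 0]"
| "roots4 (num.Bit1 num.One) = [Ed R2 0 R1 0, Ed R1 (-10) R2 (-10), Ed Og 0 R2 (-4), Ed R2 (-4) Og 0, Ed Og 0 R3 10,
    Ed R3 (-10) Og 0, Ed Og 0 R4 10, Ed R4 (-10) Og 0]"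
| "roots4 (num.Bit0 (num.Bit0 num.One)) = [Ed R2 0 R1 0, Ed R1 (-10) R2 (-10), Ed Og 0 R2 0, Ed R2 0 Og 0,
    Ed Og 0 R3 10, Ed R3 (-10) Og 0, Ed Og 0 R4 10, Ed R4 (-10) Og 0]"
| "roots4 (num.Bit1 (num.Bit0 num.One)) = [Ed R3 0 R2 0, Ed R2 (-10) R3 (-10), Ed Og 0 R1 10, Ed R1 (-10) Og 0,
    Ed Og 0 R3 4, Ed R3 4 Og 0, Ed Og 0 R4 10, Ed R4 (-10) Og 0]"
| "roots4 (num.Bit0 (num.Bit1 num.One)) = [Ed R3 0 R2 0, Ed R2 (-10) R3 (-10), Ed Og 0 R1 10, Ed R1 (-10) Og 0,
    Ed Og 0 R3 (-4), Ed R3 (-4) Og 0, Ed Og 0 R4 10, Ed R4 (-10) Og 0]"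
| "roots4 (num.Bit1 (num.Bit1 num.One)) = [Ed R3 0 R2 0, Ed R2 (-10) R3 (-10), Ed Og 0 R1 10, Ed R1 (-10) Og 0,
    Ed Og 0 R3 0, Ed R3 0 Og 0, Ed Og 0 R4 10, Ed R4 (-10) Og 0]"
| "roots4 (num.Bit0 (num.Bit0 (num.Bit0 num.One))) = [Ed R4 0 R3 0, Ed R3 (-10) R4 (-10), Ed Og 0 R1 10,
    Ed R1 (-10) Og 0, Ed Og 0 R2 10, Ed R2 (-10) Og 0, Ed Og 0 R4 4, Ed R4 4 Og 0]"
| "roots4 (num.Bit1 (num.Bit0 (num.Bit0 num.One))) = [Ed R4 0 R3 0, Ed R3 (-10) R4 (-10), Ed Og 0 R1 10,
    Ed R1 (-10) Og 0, Ed Og 0 R2 10, Ed R2 (-10) Og 0, Ed Og 0 R4 (-4), Ed R4 (-4) Og 0]"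
| "roots4 (num.Bit0 (num.Bit1 (num.Bit0 num.One))) = [Ed R4 0 R3 0, Ed R3 (-10) R4 (-10), Ed Og 0 R1 10,
    Ed R1 (-10) Og 0, Ed Og 0 R2 10, Ed R2 (-10) Og 0, Ed Og 0 R4 0, Ed R4 0 Og 0]"
| "roots4 _ = [Ed Og 0 R1 (-5), Ed R1 (-15) Og 0, Ed Og 0 R2 (-5), Ed R2 (-15) Og 0, Ed Og 0 R3 (-5),
    Ed R3 (-15) Og 0, Ed Og 0 R4 0, Ed R4 (-4) Og 0]"

text \<open>In this order, the regions of \<open>lonely_slowest_triple\<close>,
  \<open>lonely_fastest_triple\<close>, \<open>lonely_close_triple\<close>,
  \<open>lonely_slow_and_triple\<close> and \<open>lonely_slow_and_pair\<close> in reciprocal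
  speeds.\<close>

fun excluded4 :: "num \<Rightarrow> form list" where
  "excluded4 num.One = [Fm 0 0 0 0 0 9 0 (-11), Fm 0 0 0 0 2 0 0 (-5)]"
| "excluded4 (num.Bit0 num.One) = [Fm 0 0 0 0 9 0 (-11) 0, Fm 0 0 0 0 5 0 0 (-8)]"
| "excluded4 (num.Bit1 num.One) = [Fm 0 0 0 0 11 0 (-19) 12]"
| "excluded4 (num.Bit0 (num.Bit0 num.One)) = [Fm 0 0 0 0 0 9 0 (-11), Fm 0 0 0 0 (-1) 10 0 0]"
| "excluded4 (num.Bit1 (num.Bit0 num.One)) = [Fm 0 0 0 0 0 6 (-10) 5, Fm 0 0 0 0 (-1) 10 0 0]"
| "excluded4 _ = [Fm 0 0 0 0 0 9 0 (-11), Fm 0 0 0 0 2 0 0 (-5)]"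

section \<open>The certificate for four runners, in 21 pieces\<close>

definition cert4_1 :: cert where "cert4_1 =
  Sp 0x2fd2b9 (Sp 0xbf4ae (Sp 0x275eb (Ex 1) (Sp 0x27f5fe9 (Sp 0x2d5eb (Ex 2) (Sp 0x9fd7fa (Sp 0x256b (Ex 2) (Sp
  0x2d7b (Ex 2) (Sp 139 (Sp 0xb6b (Sp 603 (Ex 2) (Sp 0xb4ab (Ro 7 (Pt 0x4479639b2e41ce588b2cb7 [Pt 0x101644739622c917
  [Pt 0x40d93032d7 []],Pt 0x111e58e6c9910117 [Pt 0x101e4501457 []]])) (Ex 3))) (Ex 3)) (Ex 3)))) (Sp 0x256b (Ex 2)
  (Sp 0x2d7b (Ex 2) (Sp 139 (Sp 0xb6b (Ro 4 (Pt 0x11c632c6c64b44632c7192e4cd [Pt 0x11cd9788f2d0c5086b0334b [Pt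
  0x118f0c32845960ca118cb37 [Pt 0x44586831b588b20c71a90b3 []],Pt 0x1181ce4218d0e3240c68b7 [Pt 0x40e32290d940cea449
  []]],Pt 0x4718cb1b19250164525 [Pt 0x46006449 [Pt 0x443418eb10f418da90b3 []]]])) (Ex 3)) (Ex 3)))))) (Sp 0x2d5eb (Ex
  2) (Sp 0x256b (Ex 2) (Sp 0x2d7b (Ex 2) (Sp 139 (Sp 0xb6b (Ro 5 (Pt 0x4458cb1c592911c8cb139223 [Pt
  0x10c50869011b3978e2c88b [Pt 0x102eebae5dd752eeba62eeba6f57d56af7a18650ae55999b5783287232f3d [],Pt
  0x10c742168018ccb [Pt 0x110f58e6cb641ce588b2cb7 [Pt 0x861a0b22831eb1392493 [Pt 0x226365ca0c4ce56a18a062d680c316b4bd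
  []],Pt 0x11840445061a49 [Pt 0x234f2ab1e0478ac4741acacb5 [Pt 0x206a046b3ad11b41aceb4bd []]]]]],Pt
  0x111e58e6c99110d062917 [Pt 0x461e4510b418e9457 [Pt 0x4051141869446ca0c45a51cb []]]])) (Sp 0xb5ab (Sp 0x9fd7fa (Ex
  3) (Ro 5 (Pt 0x4458cb1c592911c8cb139223 [Pt 0x431421a404723158e2c88b [Pt 0x10c74216b40d18f2f4b [Pt
  0x206a22c842c6b419d02c6b4bd []]],Pt 0x111e58e6c99110d062917 [Pt 0x20222830d223958e2c84b [Pt
  0x431c68071a0c2d00c45a2cb []]]]))) (Ex 3))) (Ex 3))))))) (Sp 0x275eb (Ex 1) (Sp 0x2d5eb (Ex 2) (Ro 5 (Pt
  0x4458cb1c592911c8cb139223 [Pt 0x10c50869011b3978e2c88b [Pt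
  0x103abbe6555755f73abaaefa555755f31555d57cdaebabaeb5f7ffb430ca1ce583287232cd [],Pt 0x431d623c9184604b [Pt
  0x406369910e5611a17 [Pt 0x44c2cbac322861a1392493 [Pt 0x8536d94dc18d8b4a22c8289c90616945 []]],Pt
  0x88a0c6d322239588b217 [Pt 0x82cbac322861a1392493 [Pt 0x8536d94dc18d8b4a22c8289c90616945 []]],Pt
  0x47365887ac6318d4a6b34b [Pt 0x10c6c6611f2611b19831f2618ccb [Pt 0x218eb11c635f260b1eb11cad33 [Pt
  0x11390d616d96bcd5d5aba6d5533dd4daaaf9d33aeb09b22633615d7ccaafa7b5757e9b57de0564c66cb5 [Pt
  0x8ff5c79554c6d5b1a564da9bf64f4195da584e4bd3d3 [Pt 0x10c5086bd03d09db74155d4cfbbb5b5d4caaea6ffd5bd3f4b []]],Pt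
  0x22318796d0eeba9ebffaa6ff75d573bae96dff5f533faab6a18a1f7d1f5cdbba5b55cbfb9bf55b40d3d []]],Pt
  0x1131b19851f260d8cc1f2618ccb [Pt 0x8c38c6be4c163d61cad33 [Pt
  0x44e43585b65af35756ae9b554cf7536aabe74cebac26c898cd8575f32abe9ed5d5fa6d5f783e4966cb5 [Pt
  0x23fd71e55531b56c6e7dabf64f4195da584e4bd3d3 [Pt 0x10c5086bd03d09db74155d4cfbbb5b5d4caaea6ffd5bd3f4b []]],Pt
  0x1098b2da0faa9b55577a5b57532ada862857f47d736ee96d576fae657fb40d3d []]],Pt
  0x234c6d57f6345314d964b0858b414d964b02c5a2d [Pt 0x4cccc9e570858b1a098f26058b1a00b4b []]]]],Pt
  0x111e5f8e6c99110d062917 [Pt 0x205278a114292c62847285258c328b4b [],Pt 0x8088a0c3488e5638b214b [Pt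
  0x430b588b18b934ac8a22d989b370493 [Pt 0x9ab99bead5cdbe96587d553eaa5975f531ff7db7eafebd5f65591c4c4ce505253 []]],Pt
  0x20222830d223958e2c84b [Pt 0x10c45af172d898d68636818d00c31a2d [Pt
  0x8ebbbb98ebbbb9bf554ffeab97757d5afbfbc0c6343f7f5caaaefdf55fbfb0618c6802cb [],Pt
  0x1375774cdd5dd5babbad9df5d7bbbf0cc66711643df774defbfa65554defbbb28157f533d4cabfa99577d32ab9bd55d945 []]]]])))))
  (Sp 0x275eb (Ex 1) (Sp 0x2d5eb (Ex 2) (Ro 2 (Pt 0x11c632f1b192118cb1c64a449 [Pt 0x219264c5588f20c508690124b [Pt
  0x11c590bbffefb977ffdf37bafbfe67bafbfeefddf6551c586845931326591453 []],Pt 0x47365e23c831421a4048b [Pt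
  0x9bb6c5562318e9430ca1164a0ca118c9457 [Pt 0x109942bebee577df52aeff99577fcc55dff77baea9b7f57ec30ce8459033a118c87 []],
  Pt 0x46031d621691844b [Pt 0x4606ce5887a46124b [Pt 0x4051ce58878d2136e3303c6927 [Pt
  0x13755fccdd57f37ffff9efffff4eff0eaeaae75755735d5d75deeeeae59d5d567c0e72791c73 []],Pt
  0x4692d6699ae5da9b4739085b72b819b42616dcae37 [Pt 0x20b666c1e55a8e7210b2e73638c906165ce6cd7 [Pt
  0x20c8d63bbb9ddd2abae62abae6fdf72b6abaa9dd5fb442db96dc39cb90b3 [Pt 0x119ecc99b1aaf9e5ff55efb6e873e8299dab6f64d4bd3
  [Pt 0x11ebe9f737fbb6f5f5baec17d33bef56a997d9d1ce41cd69c719215757d4cdd7f7f77bbafebb777fd6defaaa95757d67257 []]]]],Pt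
  0x11a4b585ce55a39c8d0b6e570336816dcae37 [Pt 0x88e46b0ccf2eb4d0b6e5dc39cb90b3 [Pt
  0x1112c632b1a5b2cce872847369c472816dcb6e7257 [Pt 0x10672b3ff5d3ff5ccfa67ddd53e9bf7db74473e8d4d4eb9736bef64d4bd3 [Pt
  0x9a6564c155fddfa9955fcdaaea575e55144c59cc39c95915153 []]]]]],Pt 0x4063690e5611a9113 [Pt
  0x119a6696d266c7390066d061a37 [Pt 0x40b970f69b039cb90b3 []]],Pt 0x88a0c6d223958e729113 [Pt 0x223ac332cbad039cb90b3
  [Pt 0x4fddccfdddf6fbea67dd78334b2b6bc0e72d932d3 []]]]],Pt 0x4718c57e36321a0c508690127 [Pt
  0x808e3298a655c38b244799957031a494b [],Pt 0x4046ce58e2c906560c6924b [Pt 0x8616578d9c32b431b40ca00b7 [Pt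
  0x216cac2e34e18fa0674a030ce9497 [Pt 0x22625b32eb0c2b29d066d0e72791c73 [Pt
  0x114c52ca9cae875cc75cf7e9bfd4eb9976fc31ed033ebc7ff4cfd752cebe59ffd4bea6d77830cfaf357 []]],Pt
  0x8bad9757bef99ffee6fff737fbfb97e37dd335f54dfafa9b7dd4feba65f79d430ce8f5d733fffcdabbe6f5d74ff997de564549d []],Pt
  0x20b2b1994dab0c6d087a00b7 [Pt 0x88646874cd5537fe6fdcca76cfd57455df37eabad7537eabc39cb90b3 []]],Pt
  0x1011b39086348d8c9031a48b []]]))))"

text \<open>Here and below the box is the one that the splits of \<open>cert4\<close> assign to the
  piece, so the pieces can be evaluated independently of each other.\<close>

lemma cert4_1: "check_top 5 [R1, R2, R3, R4] excluded4 roots4 [(1, 1, 11, 10), (1, 1, 11, 10), (1, 1, 4, 1)] cert4_1"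
  by code_simp

definition cert4_2 :: cert where "cert4_2 =
  Ro 5 (Pt 0x4458cb1c592911c8cb139223 [Pt 0x10c50869011b3978e2c88b [Pt 0x10c742b9566665528c23918e8db6e6a6524b [Pt
  0x8e4628d06dcab3336eb0c33a1ce40ce872321 []],Pt 0x431d623c9184604b [Pt 0x406369910e5611a17 [Pt
  0x1130b2ebc322861a1392493 [Pt 0x45314b6da14cd2caaccc52db685314b6ac7777dccf7d55553efe59dddf736afeba9955ddfb0e3cad3cb
  [Pt
  0x9aeebfa67baaa9b5dd7f4b6bbafe99ddd5bbeeb0d5fd5f2eaaf9bd75d6f44590ebfaaa63fb9b57d574b3afeaaadf75537ffbf689c91a6696546b4bd
  []],Pt 0x810d280a3066c6924b [Pt 0x118df25ad930c3d032b33 [Pt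
  0x23aaae63aaae655d773aaae6f7ff5fbaec37b26959150c2b414ac6d26e7273 []]]]],Pt 0x88a0c6d322239588b217 [Pt
  0x230a5b75b2618684e4b33 [Pt 0x862843581863958d34b [Pt 0x2305b737c9a0c684e4b4d3 [Pt 0x218a10f5a06833958f3cb [Pt
  0x42fb2b40cbd935bc9e8ccd94f2684e4bd3d3 []]]]]],Pt 0x431b588f24611824b [Pt 0x1130f2ac434b22831eb1392493 [Pt
  0x10f93586b2a5647096cb1b826cf2e5253 [Pt 0x22e98f6dd4bb0869c07059cac6fab9bfdfdf6fab9bfdfe5254b [Pt
  0x11bbdb5cac35db799536bafed931afa595fcb3bb6d5ebf032b33 []]],Pt 0x8d2cad955e6629edd6b266625b5d9b4c333 [Pt
  0x8fab98bbbe7d5cb7efaf5560bfb65fd6f9bfe76470c2cb9b305253 [],Pt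
  0x4f5d53355f77aea9b7554cfa5d60b646970c7426e5c6e7018597366715 []]],Pt 0x41e55859147965d76e9761392493 [Pt
  0x10f93586b2a5647059739826cf2e5253 [Pt 0x22e98f6dd4bb0869c07059cac6fab9bfdfdf6fab9bfdfe5254b [Pt
  0x232cba1af936a6d64d0aaeb9f572dbfe6fdd5aeb032b4d3 []]]],Pt 0x8e6cb11ce3430e71a035d998cb [Pt
  0x473641ce500c739431162b34b [Pt 0x266665f26e0133e33063a18cb4b [Pt 0x852b6993b0c5314d959cb071a0a6cec960c71a2d []]],
  Pt 0x239b211ce500e72862722b34b [Pt 0x266665f26e347665c133e33018cb4b [Pt
  0x10a56d327618a629b2b3961472e330536764b071a2d []]]]]]],Pt 0x11cd9623c91c592c458c91b3978e2c84b [Pt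
  0x207361999110b5863a17 [Pt 0x23172d8eb0e350063687 [Pt 0x801ce5061a0e5611accb [Pt
  0x8bab98babadd533eea6f5f2cfec2eff98bbfe6fd74baa9b5d54caefe657fbcccdc9e868fee66eaae7f73dfb0d35 []]]],Pt
  0x445639b29110b5863a17 [Pt 0x45cb61a02e4b21a0c342e4b21635833accb [Pt 0x1333729b34187a56454f4cf4caa6d36c18fa7157 []],
  Pt 0x239b0da336191430d0493 [Pt 0x471645b666c31ca431f4140616945 [Pt 0x239c98b94b26831d3c8e262ecf41477 []]]],Pt
  0x4472b1cd948885a1ce30c9917 [Pt 0x45cb61a02e4b21a0c342e4b216358ccb [Pt 0x10c339343419c9a0c2d68726831c5ad3cb []]],Pt
  0x4311ac479211ac458c91824b [Pt 0x861656108d61ca4049 [Pt 0x230c3ca644195831a17 [Pt 0x10c35e22964518493 [Pt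
  0x134cd72a85d572ea9675475dcbd6d64ccc56e4c333 [],Pt 0x10c5086940518494b [Pt
  0x11b9dabc5d4ba5974cd55dbcec8a88b2628f307273 [Pt 0x21c65633cbac31fd0757ceffa97d5cdeadb754beaf00eaed76de9d62d [Pt
  0x8be98be99ddb6aaedd60978b69b64cccdf194c333 []],Pt 0x1058cc0b265647185253 [Pt 0x10ed395b070c50476940525 []]]],Pt
  0x23cddb6166e7022d06287 [Pt 0x2008ac30d04d9422c63a0b [Pt 0x811d032a0622b403 []],Pt
  0x4037d1fd6bb9fccfbaf7e0c3413651986d29b8cb [],Pt 0x10d95e39b139d6004d9403 [Pt 0x41940009b19423c33a0b [],Pt
  0x42ebbaff7f72ebb9bfdfcdaa9df83aaa59d5577ee9bdd9d11c696ca3705253 []]]],Pt 0x88b262f8d78b96c71ad0c6b40061a2d [Pt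
  0x10e4c9b8ffd33ff5dee5cb7aea7d783e2d4018f687 [],Pt
  0x9a669672ed30fd75abe657dcdabf66ebee62fbfa967d7ddfffabb7df55faaf062326b0db4c1c9acd4b []]],Pt
  0x88b262795e2e5b0cad0c7d0018a2d [Pt 0x41949b8ffd33ff52e6f6deba9f5e079d4018d687 [],Pt
  0x2699a58c9b4c3f5db6afa57dcdabf66ebee62fbfa967d7cdfffa9b7df55faaf063649ac30b16d303c9acd4b []]],Pt
  0x11c59156164518493 [Pt 0x431421a501461b1a494b [Pt 0x4259cab09b74ac8e176e3705253 [Pt
  0x475ceb975ccd5f57ebabe7df5bea67f785552aadbd7537d54f3bfabd7ec3faff5f6aadcdab0536558df2eb063cad3cb [Pt
  0x8db6abee7b555d36bd5f826dd99b793c7baaa5bfd36fbeadf5ccffac3cf3 []]]],Pt 0x11163158d729955862b10d60458c5ce62d [Pt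
  0x2155dfb9bf737aa5d869eccca863a34576e37380aedc6e715 [],Pt 0x4527879347fe8ebbae55f536afebff33ab6811cdad10d0d35 []]],
  Pt 0x47851165887a4049 [Pt 0x8d2da61a18fa11e2808b18a2d [],Pt 0x88b1588f241e560f1a40494b [Pt
  0x8f196d732a18d68478993281165314da5945 [Pt 0x861d94141d9418e940474b [],Pt 0x861d94141d95863a40454b [Pt
  0x218b931a149630d05c98d0a4b261a184f3acb4b [Pt
  0x23bfbaa77f752cefeea63eabba56fdd54efeea5bfdf758618fe8193366022c635a2d []]]],Pt 0x427936ac3c8a0b66530493 [Pt
  0x8eebee775f73aafee66afbfea7b57dff577fbfeb997d5ff85258c507d7f3cfafeefd7537ffb0cb667405259313cda2cb []]],Pt
  0x4525931716bf1cd8af0c7d0018a2d [Pt 0x114c5736d2c11a0a9f6960c46802cb [],Pt 0x4ccd3e5704682e6c98311a00b4b [],Pt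
  0x8e6c83926b1333c99418e49ac02c9acdcb []]]]]])"

lemma cert4_2: "check_top 5 [R1, R2, R3, R4] excluded4 roots4 [(11, 10, 11, 9), (1, 1, 11, 10), (1, 1, 4, 1)] cert4_2"
  by code_simp

definition cert4_3 :: cert where "cert4_3 =
  Sp 0x275eb (Ex 1) (Sp 0x2d5eb (Ro 4 (Pt 0x11c5963672c459639cb90b3 [Pt 0x47365e23cb0045061a2cb [Pt
  0x4634459032b932d3 [Pt 0x463c459032b64d2f3 [Pt 0x40f11642e972cd7f2dafeb7ded934f3 []]],Pt 0x100739031a1c64830c68b7
  []],Pt 0x223cbc6ce1ac01141868b7 [Pt 0x8e2cb065238b1419113 [Pt 0x10336935a819949ad64f353 []],Pt
  0x1006ce40c68432b0c31a2cb [Pt 0x88a1b392219419113 []]]])) (Sp 0x256b (Ro 4 (Pt 0x11c5963672c459639cb90b3 [Pt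
  0x47365e23cb0045061a2cb [Pt 0x4634459032b932d3 [Pt 0x103c459032b64d2f3 []],Pt 0x100739031a1c64830c68b7 []],Pt
  0x223cbc6ce1ac01141868b7 [Pt 0x8e2c8194a38b1419113 [],Pt 0x1006ce40c68432b0c31a2cb [Pt 0x222819d2219419113 []]]]))
  (Sp 0x2d7b (Ro 4 (Pt 0x11c5963672c459639cb90b3 [Pt 0x118d11658e72d932d3 [Pt 0x103c459639cbe4d2f3 [Pt
  0x461cbaf40d64f353 [Pt 0x10e506ceb5035114186bcf4b []]],Pt 0x4235872b00474185a2cb [Pt 0x800163423a0c2c68b7 []]],Pt
  0x223cbc6ce1ac01141868b7 [Pt 0x8e2c8194a38b1419113 [],Pt 0x4006560c68432b0c31a2cb [Pt
  0x22ad957355033af1db3b86f50d932d3 [],Pt 0x88ac19d2219419113 [Pt 0x8beaa2faa6ddf5fb0f534366543780cad4b73 []]]]]))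
  (Sp 139 (Ro 6 (Pt 0x4458cbc7164b64c7232c4e4b33 [Pt 0x10c508f200723158e2c88b [Pt 0x218e854a58c772300458c32924b [Pt
  0x4458c82c888b185a06519923 []]],Pt 0x431421ac0c7231589c86b34b [Pt 0x10c7588f2c0182cb [Pt 0x887a120862d0468b7 [],Pt
  0x118d64d062d0e2c8acd3 [Pt 0x8e6c84dda3485b1a06fddfa536c85164d044b []]]],Pt 0x4479639b2e410d618acb7 [Pt
  0x2008a0c3423958e2cb2cb [Pt 0x10c45a022c818d00c31a2d []],Pt 0x88b18eb1cd86b00061a2d [Pt 0x239b206340b2830c6802cb
  []]]])) (Sp 155 (Ro 5 (Pt 0x4458cb1c592911c8cb139223 [Pt 0x431421a4046ce58e2c88b [Pt 0x10c742168018cb4b [Pt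
  0x1030c33a10b1a06740b1a2d []]],Pt 0x4736588f246ce2b1163247164358e2c84b [Pt 0x239b2038b2418a172591ca0c328b4b [],Pt
  0x111439b264442d0e6c32917 [],Pt 0x239b2c479638b25872b18cb4b [Pt 0x811e421a1163211e18d08b18da2cb [],Pt
  0x21868479011632058d08b18da2cb [],Pt 0x431c68479071a1163218ccb [Pt 0x86363423cb067268458cb033cb []]]]])) (Sp
  0xb55ba (Ex 3) (Sp 0x2fd2b9 (Ex 3) (Sp 0x27df9 (Ex 3) (Sp 0x25db9 (Ex 3) (Sp 0x97b (Sp 0x95bb (Ro 6 (Pt
  0x11cd908f2c71648458cb1b39638b2cd4b [Pt 0x4736423c91c5921163240494b []])) (Ex 3)) (Ex 3)))))))))))"

lemma cert4_3: "check_top 5 [R1, R2, R3, R4] excluded4 roots4 [(11, 9, 5, 4), (1, 1, 11, 10), (1, 1, 4, 1)] cert4_3"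
  by code_simp

definition cert4_4 :: cert where "cert4_4 =
  Sp 0x275eb (Ex 1) (Sp 0x2d5eb (Ro 5 (Pt 0x4458cb1c592911c8cb139223 [Pt 0x10c50869011b3978e2c88b [Pt
  0x4738a0c74b228e720c329457 [],Pt 0x431d085a00632cb [Pt 0x118645058d033a493 [Pt 0x10c508694050124b []]]],Pt
  0x111632f1c592591c05253 [Pt 0x862b11e4811632439584684b [Pt 0x10c740062839d098632a2cb [],Pt
  0x88f2c31d6c988f0d0636b2d7 [Pt 0x8180c358c31b1acb4b [Pt 0x21999da8475f866db54dc196ca10cad4b73 []]]],Pt
  0x4736421a701c3958469494b [Pt 0x442d0e6c964510f588b2457 [Pt 0x42346beed7db1dd3b9bfed93172d8acd063eb2d7 []]]]])) (Sp
  0x256b (Ro 5 (Pt 0x4458cb1c592911c8cb139223 [Pt 0x431421a404723158e2c88b [Pt 0x431d085a00632cb [Pt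
  0x400c33a10b1a06740b1a2d []]],Pt 0x111e58e6c99110d618a17 [Pt 0x20222830d223958e2c84b [Pt 0x405647063586369477 [Pt
  0x436505403169c450715 []]],Pt 0x111e58e6c9e47018e9477 [Pt 0x20388a0c34e1ca0c71a51cb []]]])) (Sp 0x2d7b (Ro 4 (Pt
  0x11c5963672c459639cb90b3 [Pt 0x118d11658e72d932d3 [Pt 0x11cd9788f2c0114185a2cb [Pt 0x10019422c84328463227 [],Pt
  0x1001940b1a10ca0c2c68b7 []],Pt 0x4235872b00474185a2cb [Pt 0x800163423a0c2c68b7 []]],Pt 0x223cbc6ce1ac01141868b7
  [Pt 0x8e2c8194a38b1419113 [],Pt 0x4006560c68432b0c31a2cb [Pt 0x22ad957355033af1db3b86f50d932d3 [],Pt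
  0x88ac19d2219419113 [Pt 0x810ca9cd13664c160329453 []]]]])) (Sp 139 (Ro 5 (Pt 0x4458cb1c592911c8cb139223 [Pt
  0x431421a404723158e2c88b [Pt 0x10c742168018ccb [Pt 0x461645058d033a493 [Pt 0x4335b95886b46b7282f9580e2cacbcb [Pt
  0x22256341591c163d08964665253 []]]]],Pt 0x111e58e6c99110d618a17 [Pt 0x20222830d223958e2c84b [Pt
  0x478d64c18d0636b2d7 [Pt 0x20b2602ea6b995aee755bec1868098a2c662cb [],Pt 0x8188a0c3580c6c6b2d4b []]],Pt
  0x447978e6cb593018eb2d7 [Pt 0x20622830d61ca0c71acbcb [],Pt 0x8188a0c35872831c6b2d4b []]]])) (Sp 155 (Ro 5 (Pt
  0x4458cb1c592911c8cb139223 [Pt 0x431421a4046ce58e2c88b [Pt 0x10c742168018cb4b [Pt 0x1030c33a10b1a06740b1a2d []]],Pt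
  0x4736588f247164b1163247164358e2c84b [Pt 0x239b2038b2418a172591ca0c328b4b [],Pt 0x11cd908a1c59202e4b28e50328b4b [],
  Pt 0x239b2c479638b25872b18cb4b [Pt 0x811e421a1163211e18d08b18da2cb [],Pt 0x430d08f2022c640c63308b18da2cb [],Pt
  0x431c68479071a1163218ccb [Pt 0x86363423cb067268458cb033cb []]]]])) (Ro 5 (Pt 0x11cd908f2471648458c91b3978e2c84b
  [Pt 0x103672473628739238b228723245 [],Pt 0x4736423c871648458c86334b [Pt 0x4736588f2c7164b11632c0cf4b [Pt
  0x1039b17264459072913920c7291 [],Pt 0x2071645c991164239489c907291 []]]])))))))"

lemma cert4_4: "check_top 5 [R1, R2, R3, R4] excluded4 roots4 [(5, 4, 7, 5), (1, 1, 11, 10), (1, 1, 4, 1)] cert4_4"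
  by code_simp

definition cert4_5 :: cert where "cert4_5 =
  Sp 0x275eb (Sp 34 (Ex 1) (Sp 570 (Sp 138 (Ro 5 (Pt 0x4458cb1c592911c8cb139223 [Pt 0x431421a404723158e2c88b [Pt
  0x10c7421680182cb [Pt 0x47365887ac6300b4b [Pt 0x80c7d2c8a1b2830b3a457 [],Pt 0x445063e964511b2830b3a457 []]]],Pt
  0x111e58e6cb904358628b7 [Pt 0x10045061a11cac311a2cb [Pt 0x40c474185ac60b4b [Pt 0x88f941911ce40b2917 []]],Pt
  0x111e58e6cb64c42d02d7 [Pt 0x40c45061ac3958468b4b [Pt 0x223e50644739032917 []]]]])) (Ro 7 (Pt
  0x111e58e6cb90739622c8b7 [Pt 0x10c3422b931c8cb139233 [Pt 0x100474185a111ac31ca2cb [Pt 0x10311b4187ac60b4b [Pt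
  0x4619110f583ca17 [Pt 0x430ed08a59146093 [Pt 0x80e23a0c2f4e223581cb [Pt 0x861fa11b5b268616340d3 []]],Pt
  0x8c2b22a33dad3303ce9157 [Pt 0x80a88ac30d38d6bb530454b [Pt 0x10c341c061fa70e7581cb [Pt 0x10c2ad0d9342340d3
  []]]]]]]],Pt 0x4479639b25645461157 [Pt 0x463793d18cb77 [Pt 0x430b588a6450c3d6236893 [Pt 0x80a88da0a8736b11b1a454b
  [Pt 0x1021694050e7d08d9c9924b []],Pt 0x231ac9e21a34d6d998b57 [Pt 0x81e22b0c35e239469adb32662d4b [Pt
  0x405446b4289ed4a8a193650a85b3caa454b []]]],Pt 0x463e4d1964db02f7 [Pt 0x81a7aa896d557ab061ad0e5611e8bcb [Pt
  0x430b588eb593c4c2c7984328f3 [Pt 0x1186450c2f41364ca493 [Pt 0x221a0c880a6cb6917 []]]]]],Pt 0x111e58e6c964506330457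
  [Pt 0x20288a0c34a0ce53046914b []]]]))) (Ex 4))) (Sp 0x2d5eb (Sp 34 (Ro 5 (Pt 0x4458cb1c592911c8cb139223 [Pt
  0x431421a404723158e2c88b [Pt 0x10c74216801e32cb [Pt 0x40430b284316905940c5a49 [],Pt 0x2008b210b1a06740b1a2d []]],Pt
  0x4479639b2e410d618acb7 [Pt 0x8022830d08e578e2cb2cb [Pt 0x21b2b11d6c9810ca33 [Pt 0x110d064442b40ce917 []],Pt
  0x10c45a022c818d00c31a2d []],Pt 0x88b18eb1cd86b0c740061a2d [Pt 0x10c2ca06340b2830c6802cb []]]])) (Sp 570 (Ro 5 (Pt
  0x4458cb1c592911c8cb139223 [Pt 0x431421a404723158e2c88b [Pt 0x10c7421680182cb [Pt 0x111e586369911ce588b217 [Pt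
  0x20452c8a0c7ac432893 [Pt 0x40876b11d0c60b4b [Pt 0x1185e474d4d6bb4c0b291d7 [Pt 0x443f43593c43d08a72e8b57 []]]],Pt
  0x442b5863ebd93c66665b49acb57 [Pt 0x10c6b430186b1872da34b [Pt 0x40f0185af186b2a2f4b [Pt
  0x10666db7ca9d4165199b6d7da65505e5066e4b2a7c5 []]],Pt 0x4479618d6b64c18cc336a562d7 [Pt
  0x1022b933d314ca5b4ce5bf843ca33 []]]]]],Pt 0x111e58e6cb904358628b7 [Pt 0x10045061a11cac311a2cb [Pt
  0x10311d6185ac60b4b [Pt 0x408ac46d0c6218ca34b [Pt 0x4532cba11d38a259d073535da7b4d81cb [Pt
  0x11991b846b5ac9e1c6839468f3 []]],Pt 0x118de4d442b588e4b2acbd7 [Pt 0x40f93418d62392cba2f7 [Pt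
  0x103511d6185ad446b3a05972a2dcb [Pt 0x408dadc453b2ae9e8147b2e8bd3 []]],Pt 0x118f93418b198163262f7 [Pt
  0x10c3b422b64d0c2b16610b28d3 []]]]],Pt 0x88f2f1cd92b22a69b9561157 [Pt 0x40544508b192a69b932b11e3a474b [Pt
  0x88f20f228858c6606326457 []],Pt 0x23172d8b99110f5817 [Pt 0x80e55ec9a8856b1515dadacbd7 [Pt
  0x2187a11d3c8e314db199253 [Pt 0x10c2b4236b930cfd4acefd6bc235a33 []]],Pt 0x118de4d46171acbd7 [Pt
  0x1058cc0b26d93182d7 [Pt 0x80a88fac30b4e12d941ca454b [Pt 0x861a0e030ed384b675873a1cb [Pt
  0x10aba59f7573ebeefd5cdff05fd56d9b5f55cbaea6f6fd50bee965f77ebee575cdff03c6b7f3fdf7455df752cababbbfd775dcaaffba6ff7de0c3b1afdcbd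
  []]]],Pt 0x10c3d6236964713372614db199253 [Pt 0x810d380e15b9cc29b63266494b []]]],Pt 0x223cb1cd92c8a216330326457 [Pt
  0x80a22830d28859ca606499914b []]]]])) (Sp 0xbcab (Sp 0x2fd2b9 (Ex 4) (Ro 1 (Pt 0x4736588f2c6ce58e2cb1f2436320b [Pt
  0x1023c86ce58e2c87c90d8c88b [Pt 0x81ce169c39439c9472588c853 [Pt 0x8c639c839d6364838ca2d7 [Pt
  0x81a39c816568d9206328f7 []]]],Pt 0x11cd9623c80e2c87c90d8c88b [Pt 0x47164311641cac72588cb2d3 [Pt
  0x11c5961d11641ce9d0232153 [Pt 0x80f8e6c341cda5c62321d3 [Pt 0x222c4f1686a84f1686a85c65072b3d4b []]]]]]))) (Ro 1 (Pt
  0x4736588f2c6ce58e2cb1f2436320b [Pt 0x1023c86ce58e2c87c90d8c88b [Pt 0x111e431ce41cac6c9638cb2d7 [Pt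
  0x111e4151ce41ce9c0e32257 []]],Pt 0x11cd9623c80e2c87c90d8c88b [Pt 0x47164311641cac72588cb2d3 [Pt
  0x408b0f4e1ceb08b48723438c857 [Pt 0x11c59040408c83 []]]]]))))) (Sp 34 (Sp 0x256b (Ro 5 (Pt
  0x4458cb1c592911c8cb139223 [Pt 0x431421a404723158e2c88b [Pt 0x10c7421680182cb [Pt 0x40430b284316905940c5a49 []]],Pt
  0x4479639b2e410d618acb7 [Pt 0x8022830d08e578e2cb2cb [Pt 0x4056473535ca6550329477 [],Pt 0x10c45a022c818d00c31a2d []],
  Pt 0x223cb1cd93c8e05531557a6d9477 [Pt 0x4071141869c39584691cb [Pt 0x80bc8e86393268531567a71d7 []]]]])) (Sp 0x2d7b
  (Ro 6 (Pt 0x111e58e6cb64c739622cb2d7 [Pt 0x20622830d63672f1161acb4b [Pt 0x100475861686ce410b [Pt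
  0x102369911ce165046923 []],Pt 0x4011d6185a180b [Pt 0x204508da004e43262cb [],Pt 0x40c16560c5ac4e4b0c316b2d [Pt
  0x4164ca079482ce822167418a49 [],Pt 0x110b664c21e520b3a1148859d049 []]]],Pt 0x111e58e6cb9060b7 [Pt
  0x10045061a0e5611a2cb [Pt 0x10111d061691844b [Pt 0x2020b28221650615a45 []]],Pt 0x4478ac73616b40c450616b2d [Pt
  0x106502c6b10ca0c2c6b00b4b []]]])) (Sp 139 (Ro 5 (Pt 0x4458cb1c592911c8cb139223 [Pt 0x431421a404723158e2c88b [Pt
  0x431d085a0078ccb [Pt 0x40430b284316905940c5a49 [],Pt 0x8c2c8a0b1a09b466493 [Pt 0x8dd7caab61ab5caf64f0e565a0a72b4f3
  []]]],Pt 0x111e58e6c99110d618a17 [Pt 0x20222830d223958e2c84b [Pt 0x2185ac474b228618d0493 [Pt 0x40501461b1a494b [Pt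
  0x86196ca82b2380e4da65253 []]]],Pt 0x111632fc7164991430d0493 [Pt 0x2292c62831423c54022c87 [],Pt
  0x218a10d280a18e5071a494b [],Pt 0x8ae52c86e10d0ae52ca86e039b0b41c68cb []]]])) (Sp 155 (Sp 0x96b (Sp 0x95ab (Ro 5
  (Pt 0x4458cb1c592911c8cb139223 [Pt 0x431421a4046ce58e2c88b [Pt 0x10c742168018cb4b [Pt 0x8188b210b1a06740b1a2d []]],
  Pt 0x111e58e6cb6410d618acb7 [Pt 0x401141868472b0c468cb [Pt 0x8088e83652239d044b []],Pt 0x8e2cbc7361ad0c740061a2d
  [Pt 0x222c6368458c2cab431b430185acd [],Pt 0x8e6c818d02ca0c31a00b4b []]]])) (Ro 7 (Pt
  0x4736423c871648458c86ce5e38b2ccb [Pt 0x4736423c91c5921163246124b [Pt 0x11cd90e7148e2c90e46291844b [Pt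
  0x40473628739238b228723245 []]],Pt 0x44586847909c868458c8632cb [Pt 0x11c590116423c34272422c61a2d []]]))) (Ro 5 (Pt
  0x11cd908f2471648458c91b3978e2c84b [Pt 0x103672473628739238b228723245 [],Pt 0x4736423c871648458c878cb4b [Pt
  0x4736423c5cab1c5921163172ac05da8f4b [],Pt 0x103116423c34272422c61a2d []]]))) (Ro 7 (Pt
  0x4736423c871648458c86ce5e38b2cb4b [Pt 0x4736423c91c5921163246114b [Pt 0x118473628739238b228723245 [Pt
  0x40c7361a1ce438b21a1c8c89 []]],Pt 0x11c5963116423c34272422c61a2d [Pt 0x111628479627228458cb032f4b []]])))))) (Sp
  0x256b (Ro 1 (Pt 0x4736588f2c6ce58e2cb1f258d8cb0b [Pt 0x408f21b39638b21f258d8c88b [Pt 0x101c739072946c9638c897 [Pt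
  0x44790c739073ac6c9632d7 [Pt 0x111e4151ce41cda718257 [Pt 0x2047923084f18cc363224b [Pt 0x1010f650e7209e3394c23223
  []]]]],Pt 0x2047963672c722b1f240cb [Pt 0x40c3650e72c725846b33 [Pt 0x21c686ce5e1b3a1ce5e11934116b2f3 []]]],Pt
  0x4736588f2038b21f258d8c88b [Pt 0x47164311641cac72588cb2d3 [Pt 0x103439d08b2d1b258e32cd7 [Pt 0x118439b422c918e3217
  [Pt 0x404158d08b218e3227 [Pt 0x84b9302c56b05930722b582b39432d []],Pt 0x2008b2c739606aaed54c9bd4cfaf5633 [Pt
  0x100ec6bc39ad0f18cf7 [Pt
  0x8ddab6b6a61babbd52aed9fcdeb9d6dc3935950fdd777eeba55555b2aae9b5ddcaabde8d76adada987aef52bb6fccaed6f4b5 []]]]]],Pt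
  0x239b2c47960722b1f240cb [Pt 0x1030d9422cb1b25846b37 [Pt
  0x8e2c854a59ae5729af44590aaeaa55754b3f7fd77effaefdff4dfbbda9b95166e5341cdad3d3 []]]],Pt
  0x4718684792230d638b20363224b [Pt 0x101445908f0d238b0b423223 []]])) (Sp 0x2d7b (Sp 570 (Sp 138 (Ro 6 (Pt
  0x111e58e6cb90739622c8b7 [Pt 0x8022830d0d9cb1161a2cb [Pt 0x10111d061691e04b [Pt
  0x1015dab505941d536afbbfd53ab7885942f98be6dfd76aaa5fbcd [],Pt 0x10311b5861eb00b4b [Pt 0x1114364c47281945a2d7 []]]],
  Pt 0x4479639b2d93182d7 [Pt 0x40c45061ac3958468b4b [Pt 0x4011d6185a0e7580b [Pt 0x1022b446d0d11c96503cb [],Pt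
  0x231f2680651a2f7 [Pt 0x103445061ad00bcb []]]],Pt 0x4458cbc7164a4430b422923 [Pt 0x862843480862e328446924b [],Pt
  0x218a10d2023672111a48b []]]])) (Ro 1 (Pt 0x4736588f2c6ce58e2cb1f2436320b [Pt 0x408f21b39638b21f258d8c88b [Pt
  0x111e41c739072946c9638c897 [Pt 0x44790c739073ac6c9632d7 [Pt 0x2308736873921ce3423213 [Pt
  0x102b95c52b66b50563439cb50d92634232cb53 []]]],Pt 0x111e431ce588b2d1b241ca2d7 [Pt 0x8e2c81635818e48391a2d3 []]],Pt
  0x4736588f2038b21f258d8c88b [Pt 0x47164311641cac72588cb2d3 [Pt 0x8c21ce845921c8d0e3217 [Pt 0x222c34111640f1a408c83
  []]],Pt 0x239b2c47960722b1f240cb [Pt 0x47164311641b2b1c9073a2d3 []]]]))) (Ro 1 (Pt 0x4736588f2c6ce58e2cb1f2436320b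
  [Pt 0x1023c86ce58e2c87c90d8c88b [Pt 0x111e431ce41cac6c9638cb2d7 [Pt 0x111e41c739073a5038c897 []]],Pt
  0x11cd9623c80e2c87c90d8c88b [Pt 0x47164311641cac72588cb2d3 [Pt 0x8c21ce845921c8d0e3217 [Pt
  0x408b13c6845903c680e30f1a33 []]]]]))) (Sp 570 (Sp 139 (Sp 138 (Ro 6 (Pt 0x111e58e6cb90739622c8b7 [Pt
  0x8022830d0d9cb1161a2cb [Pt 0x40c4758616b1834b [Pt 0x8a25b508dad64d0e5611acd3 [Pt 0x811f5b260272633 []],Pt
  0x10c3d62369911c8cb139223 [Pt 0x43141011aedcd824b [Pt 0x80a0b368431a419d031a49 []],Pt 0x408d8d682ce84358859d631 [Pt
  0x11514b696d508d6b793c1a9a5b56598f3 []]]]],Pt 0x111632f1c592910c3588a23 [Pt 0x862843400d9cb111a0b [Pt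
  0x10c742169011824b [Pt 0x461e45058d08fa493 [Pt 0x8628434a028d696611f1a49cb []]]],Pt 0x218a10d2023672c44688b [Pt
  0x4736421694716485c96532d29a6b36998445a494b []],Pt 0x111e5e39b2f9310d02d7 [Pt 0x40c45061ac36561c68b4b [Pt
  0x40a8aed32abe4d023932a2f7 []],Pt 0x20622830d66aed4b7afa7afb9ddd7afc1c68bcb []]]])) (Sp 0xb6b (Ro 1 (Pt
  0x4736588f2c6ce58e2cb1f2436320b [Pt 0x408f21b39638b21f258d8c88b [Pt 0x111e41473907291b258e3227 [Pt
  0x8c6873a1ce58e48738a33 [Pt 0x239c343473903c6b1b240d7 []]],Pt 0x111e42b654d72ab1ce588b2d1b241ca2d7 [Pt
  0x471642b654d72a35818e48391a2d3 []]],Pt 0x4736588f2038b21f258d8c88b [Pt 0x471641445907291c9623223 [Pt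
  0x81cd961ce845963648458a37 []],Pt 0x239142b9535caac459639cb47241ca2d3 [Pt 0x111e42b9535ca8d6063648391a2d7 []]]]))
  (Sp 0xb5ab (Ro 1 (Pt 0x4736588f2c6ce58e2cb1f2436320b [Pt 0x204790d9cb1c590d90d0d8c88b [Pt
  0x111e41473907291b258e3227 [Pt 0x44790d1ce5873ad1b240d7 [Pt 0x403c6b0e6d0c72411a33 []]]],Pt
  0x8e6cb11e407164390d0d8c88b [Pt 0x461445907291c9623223 [Pt 0x1039b2706508b246c9638c897 [Pt 0x81163ac19d08b2c6c9037
  []],Pt 0x231a1ce845963648458a37 [Pt 0x1039b2f078d08b2d1b258e32cd7 [Pt 0x101078b422c80e3227 []]]]]])) (Ro 5 (Pt
  0x111e58e6c9911ce588b217 [Pt 0x40445061a46ce58e2c84b [Pt 0x1004758616860cb [Pt 0x106a296d5788da34cb2abc63354b [Pt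
  0x88597423ebe4c3946610cda33 []],Pt 0x40d11b5861eb460f4b [Pt 0x1022b447d0d18858ca2dcb [Pt
  0x2289ed7763764d436741ca353 [Pt 0x88d6ccc3dc4dad99a6e0f1a0f9328b73 []]],Pt 0x230fc8a832d940f29157 [Pt
  0x40711418769c0474b []]]]],Pt 0x4479639b2d9060b7 [Pt 0x4011418683958468b4b [Pt 0x40c4758616b183cb [Pt
  0x81532caaf11b43c39b58cb54b [Pt 0x88597423ebd9342341168d3 []],Pt 0x8c6ac9e0392ca8b57 [Pt
  0x81e22830d7873e838b2e8b54b []]]],Pt 0x4479639b279146057 [Pt 0x40511418694365611a1cb [Pt 0x8c3ac8e8d69b4cc11d7 [Pt
  0x1015114187a54047a47cb []]],Pt 0x447978e6c9791501157 [Pt 0x405445061a5439584687cb [Pt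
  0x81f4f9e6b6d36b62363422c638c6b01c5a3cb []],Pt 0x405445061a5439584685cb [Pt 0x11cd89683634fa22e4c9a8b87264d04977
  []]]]]]))))) (Sp 155 (Sp 0x96b (Sp 0x95ab (Ro 5 (Pt 0x4458cb1c592911c8cb139223 [Pt 0x431421a4046ce58e2c88b [Pt
  0x431d085a0060b4b [Pt 0x431b423c94050b9581cb [Pt 0x11cd90856b03182d4b [Pt 0x223cbc7364fc8a887972873629157 [Pt
  0x4054450542e741154b [],Pt 0x10150186950b9d047cb []]]]]],Pt 0x4479639b2d904358628b7 [Pt 0x401141868472b0c468b4b [Pt
  0x10311d0616b182d4b [Pt 0x202236830f488e6d604b [Pt 0x40d11f58615ad182dcb [Pt 0x102a295b52ac8a8d6b94c1c69273 [],Pt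
  0x23c3b2383cb940aca477 [Pt 0x101c45061a70b9d045cb [],Pt 0x101c45061a70b9d0474b []]]]]],Pt
  0x11cd9623c91c592c458c91c590b58e2c84b [Pt 0x11cd9051c5920c528e2ca2e75832894b [Pt 0x239b21a6bb4b22ba0c75a3099468dcb
  [Pt 0x8c38b92ca39306369c2e50474b [Pt 0x40ae56cd5af27a039468b77 []]]],Pt
  0x8e6c8452a38b246ecb68aa547165173ac57296d436a925cb [Pt 0x102b94b2a6ebd9345729654f54b3ae7d6ec2a2991b8d3 []],Pt
  0x223cbc7364fc8a9a6e5d61157 [Pt 0x405445061a5447892d61c69154b [Pt 0x40511d08b19280e72649cb []],Pt
  0x1015114186951871a47cb [Pt 0x4736433765942cc185ac7beab67775abec1c5a2d4b []],Pt
  0x4736588f251c592c458c940a4f0b2649cb [Pt 0x8e6c8621ac3158d7265703ca2d4b [Pt 0x83765b454ec8e1866c9843cd99253 []],Pt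
  0x8e6c84562e4b28a18a6b932b843ca2d4b []]]]]])) (Sp 138 (Ro 7 (Pt 0x4736423c871648458c86ce5e38b2ccb [Pt
  0x11cd908f2471648458c91824b [Pt 0x4736588f2d1c592c458cb402d4b [Pt 0x88f21f2623c2d071a2d7 [],Pt
  0x88b1908b18a6ed64d0e50afa95f4b2be99abaaab5df532aaaa657778d3 []]],Pt 0x11161a11e42721a11632038b22cb []])) (Ro 1 (Pt
  0x4736588f2c6ce58e2cb1f2436320b [Pt 0x1023c86ce58e2c87c90d8c88b [Pt 0x44790d1ce41cac6c9638cb2d7 [Pt
  0x4639c3d3873a1ce48723423213 [Pt 0x1023c901058b436321cb []]]],Pt 0x11cd9623c80e2c87c90d8c88b [Pt
  0x8116169c39422c91b258e3217 [Pt 0x238b2c788b20e758e4838ca2d3 [Pt 0x473643031f240ce8bcb []]]]])))) (Ro 1 (Pt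
  0x4736588f2c6ce58e2cb1f2436320b [Pt 0x408f21b39638b21f258d8c88b [Pt 0x4479051ce41ca46c9638c87 [Pt
  0x8c6ce5a1ce873963921ce28b3 [Pt 0x8e70d0c73903c686c9037 []]],Pt 0x81b2291b3966672a6e55205532bb657515ddbead91cb [Pt
  0x106db71361b2873963921b38e8b3 []]],Pt 0x4736588f2038b21f258d8c88b [Pt 0x204585ac39422cb1b258e32cb7 [Pt
  0x238b2c288b20e7488b0d08c83 [Pt 0x20458a5059422c80e3227 []]],Pt 0x11cd96364520572a6e5520552caee57515ddbead91cb [Pt
  0x814962d95a1b28459636487363a37 []]]]))) (Ro 1 (Pt 0x4736588f2c6ce58e2cb1f2436320b [Pt 0x204790d9cb1c590d90d0d8c88b
  [Pt 0x44790c73907286c9638cb37 [Pt 0x118e70f4a1ce87390723423223 [Pt 0x88f20e4b2a5473903c6918e3227 [Pt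
  0x11a595d0b97173eb70e7d0e72d0e4b6508cb2d3 []]]]],Pt 0x8e6cb11e407164390d0d8c88b [Pt 0x204585a50e508b21b258e3227 [Pt
  0x471642ae54b353d622c839d0e4838ca33 []]]])))) (Sp 0x2fd2b9 (Ex 5) (Sp 0x27df9 (Ex 5) (Sp 139 (Sp 0xb6b (Sp 603 (Ro
  1 (Pt 0x4736588f2c6ce58e2cb1f2436320b [Pt 0x1023c86ce58e2c87c90d8c88b [Pt 0x111e41473907291b258e3227 [Pt
  0x81b396873a1ce5a39209ca2d3 []]],Pt 0x11cd9623c80e2c87c90d8c88b [Pt 0x471641445907291c9623223 [Pt
  0x207365873a11658d9209ca37 []]]])) (Ex 5)) (Ex 5)) (Ex 5)))))))))"

lemma cert4_5: "check_top 5 [R1, R2, R3, R4] excluded4 roots4 [(7, 5, 1, 0), (1, 1, 11, 10), (1, 1, 4, 1)] cert4_5"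
  by code_simp

definition cert4_6 :: cert where "cert4_6 =
  Ro 3 (Pt 0x471658d9c8459639ca703 [Pt 0x11cd9788f2c0115861a0b [Pt 0x11818c4758616b2cb [Pt 0x2318c458ac46d62318acb4b
  [Pt 0x1006311f58615accb [Pt 0x42acb4372da5059719826576e348a165c66152997f33f5cdeebbbd7577fa65fe497 [],Pt
  0x2176da092d68986dcae4d08b2c30db95c9a118cb37 []],Pt 0x463059d0ccad92c21674299995b2587 [Pt 0x2318ccad9cb60c6b90b3
  [Pt 0x212b3956372fa50f97260994f6e5228f9726152997f33f5cdeeb9ef5d5dfea5fe497 [Pt 0x11bd97587194a14acecca83e5ce659113
  [Pt 0x11ed6d732ab5cdfc36cbad0b8d0ccbb7369bfe9effb9ffcdbff0999976e6d2f4b []]],Pt 0x100b1ac01141868b7 []]],Pt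
  0x8c60b3a3d54dfd4caabb6f552aaf0859d199995b2587 [Pt 0x8c30b59eaa6fea6555db7aae555ec30c6b90b3 [Pt
  0x212b3956372fa50f97260994f6e5228f9726152997f33f5cdeeb9ef5d5dfea5fe497 [Pt 0x11bd97587194a14acecca83e5ce659113 [Pt
  0x11ed6d732ab5cdfc36cbad0b8d0ccbb7369bee9ffb657d577bba65f761a56caeed2f4b []]],Pt
  0x10aed7d19999366bc753a657315d2cae655572fe18a94cbe98ae9b77f2deee657f52dffc186b2d7 []]]],Pt 0x100459611a90b3 [Pt
  0x23098c96b41672845962722a118cb37 [Pt 0x11964f585b234a6b2c5d059113 [Pt 0x218bd9468a78dd861e852ed4d32b6f4b2da4cd
  []]]],Pt 0x2030d08b2c311a90b3 [Pt 0x8c4c4c64b5a22c5422cb059ca118cb37 [Pt 0x8df265585b234a6b2c5d059113 [Pt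
  0x862f650629e376187a1f754fba962ffa96757577afeadd577fea7575a4cd []]]]],Pt 0x102e5c4d9a06560c6b1c64b118cb37 [Pt
  0x40ae5714d9691ce168664c9a47190b41999326924b [],Pt 0x815cae29b2d239c2d0999932691c642d19999326924b []],Pt
  0x408e84632c719206541 [Pt 0x47365832808e846d02cb [Pt 0x11e341e5085a007 [Pt 0x1006305958ccb [Pt
  0x1117c6847b49a3b5db93306449 [],Pt 0x85f1a11ed21738d06449 []],Pt 0x200144c6ccc0b2818c9a34b []]]]],Pt
  0x11c58afc6ce1ad0045618687 [Pt 0x46306560c6b10cac30c6b2cb [Pt 0x4018c46d6187acb7 [Pt 0x1063d60c68090b3 [Pt
  0x8e2c85c966ac0b92c2dab932d3 []],Pt 0x20c7ac30c68061a90b3 [Pt 0x8e2c85c966ac0b92c2dab932d3 []]],Pt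
  0x8007162610d0e326260b [],Pt 0x10019d622b038c6260b [Pt
  0x229a4d0bbae5dd768aa6fdd37ade38b1b24d0fbae7dd73aa7a98caee6f5be4f3d []]],Pt 0x100195831ac6c64b0c31accb [Pt
  0x429b4ca6b002631a446d6187a17 [Pt 0x43b33046ce1a09631a46c6434189631a497 [],Pt
  0x102eeae99abffa9bf7d54dbfbea65dd5d33ebb78cca652d0999e4d69eaa3fe9b55536aaa5bd584c4f1ad2f7 []],Pt
  0x45314da6535801898c6906342eaa98baaa6ff737fb9b775917 [Pt 0x21d99823670d06258c691b190d0989631a497 []]],Pt
  0x100194367132686c6486c8c4c9a34b [],Pt 0x8e2c32bc6c64b023a06541 [Pt 0x106508e340c65086800b [],Pt
  0x8328db6654729a1b390b64da6680b64ca668b4b []]],Pt 0x47162bc6c64b1162b1c64801 [Pt 0x47365e23cb065086800b [Pt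
  0x2318319588b2c195831ac7 [Pt 0x40066d621eb18ccb [Pt
  0x22896326b1992d283393198753a586d3299e44726330fa9f4b1fcdbf9b7733e99fe497 [Pt
  0x115d72bae5575155d3dffe5b5d6c19ca51ced4d2c65769829b72e58113 [Pt
  0x23cb6bb955ae6fe1b65d684b1a10b2d975a3a9badb572dfa9bfe0596cbad2f4b []]],Pt
  0x21365ac2d926bc23665326845960d994c9a118cb37 [Pt 0x899e4b58323c6945d52ea58bf9bfcb2fe6ff32eb09864c6658113 [Pt
  0x46bb6f36b99536b9bf869ecb32a1863d07696366ccca0c7a1bb4b1b36665257 []]]],Pt
  0x887acd7774d77733fbf99fdfcdbab688b2149666b032d3 [Pt 0x9befa9befafbfd54ffbc33663329acb12d058113 []],Pt
  0x4614da6535846326845960c64d0cb7 [Pt 0x10175cb2ebbbffd5efb68596576a1165a32caed41f2b4d7 []]],Pt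
  0x26b3cd3363419d6216b18ccb [Pt 0x100739622cb067582c6b37 [Pt 0x8144b19348e70b4289631a47190b42258c6924b [],Pt
  0x202eb96fff4cbae6f7db42cb66534218f5a32d994d031eb4f7 []],Pt
  0x41efeeef7f732fafa2faf99dd5736a9bfd761ce5872b06758316b37 [Pt 0x2311e439c3d1a664b26911724d0a664b26924b [Pt
  0x26aabbb555ccbfaaa2feaadb776aab995dd857df72bef99f75747dd5ccefeb9bdd533abe96ff76d34cc9e370a264b65ad032d3 []],Pt
  0x10c74332965358062c9ac0cd []],Pt 0x4623c87385a355517dcb7ba6d5591c642d057dd4b7fbe6d77d924b [Pt
  0x8e32258b4147390ea75deeba6bee9b33faa6575cdbbbc8e3243f77736aa6d5dd36ebf99f555927 []]]],Pt
  0x8e6cb332ed36a699819421a00cb [Pt 0x118c19d1aeeeb6d7774cbbeba2efae5bdd581bffab6dffd4dbffaa2baae5bdd58bcb [Pt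
  0x22bad95d32ba8aebb770566bd1ce42aafbaad9557dd532eebeea8bbafbabbdffd5febfa65ddf605942aaaaaad955555532aaaaaa8bbbeeabbf7f55eebba65ddf62d7
  []]],Pt 0x4716195f8d8c86b419421a007 [Pt 0x20031958e2cb06560c6b0b [Pt 0x238b2172599ac43d0b92c366b032d3 [],Pt
  0x8e2c85c9b3335887a1726cc366b032d3 []],Pt 0x401b39638b2c195831accb [Pt 0x11534da6535886844c63584449 [Pt
  0x1186c69021a4048b [Pt 0x41ed3046ce28431a46c645031a497 []],Pt
  0x47573abbff57547fd7d533aebba6d5f5d5cbeabebd7f60b8b6a5345366cb417da9c4525 []],Pt 0x10a6d329ac0336844c6348098c6917
  [Pt 0x10eccc11b386844b18d236321a09631a497 []]],Pt 0x401b390d8ca264d03286c644c9a34b []]]])"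

lemma cert4_6: "check_top 5 [R1, R2, R3, R4] excluded4 roots4 [(1, 1, 11, 10), (11, 10, 6, 1), (1, 1, 4, 1)] cert4_6"
  by code_simp

definition cert4_7 :: cert where "cert4_7 =
  Sp 0x2d5e9 (Ro 2 (Pt 0x11c632f1b192118cb1c64a449 [Pt 0x1118c5788f20c508690124b [Pt
  0x8ae53298a65788c63ad1c64c4ca11640ca118c87 [Pt 0x40131319308b0d03194231868cb [],Pt
  0x100d9986ce46b318eccc05264c7268bcb []],Pt 0x1180c75885a45c993374114b [Pt 0x8a4f34dc11ce1ac43d20c8d611cb [Pt
  0x4628c586b1313ca17258680b931868b4b [Pt 0x2318635a15ca59b6d2c0572994cdb69634b [Pt 0x8c78e721c585681d9438c615a37 [Pt
  0x81317158cce2163b58e729113 [Pt 0x27a66a7bd6b3198af6cd9a570c34189e6c5a791c95 []]]]],Pt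
  0x4518b0b5899a7b4da38b0b439cb90b3 [Pt 0x8ae52cdb2ae1ce1ac001868b4b []]],Pt
  0x45fdcbf9b7d337d729bd87531d4b6eb6c7162e4c39cb90b3 []]],Pt 0x47365e23c831421a4048b [Pt 0x8e5162ac31d222cb0c3299113
  [Pt 0x466b2c536a15b2a31c9b854a58a6d43671c6854a6314da8b4b [Pt 0x4755dbe6d73556965e0262e2d08b140ce342318a34b []],Pt
  0x23c5cb63ad18067418687 [Pt 0x1005b2e164c22c340c594231868cb [],Pt 0x1004c4c59308b0d0316508c61a34b [],Pt
  0x10699a652daac010d0628b7 []]],Pt 0x4611ce5886348e3240c6927 [Pt 0x40431b5887a46124b [Pt
  0x8ccbaf16cb8655e39c81932819b418d932637 [Pt 0x818e71583235831e56334b [Pt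
  0x85c5ac21726343719941671687fffbbefdddd77eeee9bfffde51cb [Pt
  0x232c8b29a0afaabbff7d2dfabdfa14dad8db0f32efe997774dae6f7ddb79353d3 []],Pt
  0x85f39342aaaae98bbafafadf732eebebe655555d36fbeaecb899a65599330e72791c73 []],Pt
  0x469969a1d6ceb9abaff0b9bd46f615b2b86d26b79353d3 []],Pt 0x439cac26dd38e7210ca5066d0329497 [Pt
  0x11a5936a61a795d7a332992c14d96ccabe4d35 []]],Pt 0x479b6dc4dab47390067418a37 [Pt 0x119655851ce41419b418e9497 [Pt
  0x20639c74131650316741898b28cb []],Pt 0x40c738a0c2daccc0c5946616d66634b []]]],Pt 0x111e5fe36321a0c508690127 [Pt
  0x11c590bae5d37b99ee6f75f2a38b1418e99113 [],Pt 0x80861958e2c911e26d3031a494b [Pt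
  0x136db9a9bc5c9b3336e9d1c589930e72591453 [Pt 0x426cda61312c8cca0288a13119945cb [],Pt
  0x11994cab85314b2ccb280a228cc49b9474b []]],Pt 0x4046ce58e2c906560c6924b [Pt 0x230186758067586288b [Pt
  0x84b6af16cb865d78e72098ca01898ca37 [Pt 0x1031ce2b08c6b056560ac6b34b [Pt
  0x2157ddb6bbe6fd5ec2acb296e746995d9933031a791c73 [Pt 0x11fb9bddfb9654dfc177dd36bbe6f75fb7066b436ca64c6be4d2f3 []],
  Pt 0x137d5d4cd5d755b6faba997555615555d31555732ebeafad552cbafbae65555f36aaebb2e266995d99330e72791c73 []],Pt
  0x4699da6875b3ae6adaff0b9bd71bd856cae1b726b79353d3 []],Pt 0x46159ac165639cb90b3 [Pt
  0x8c18b2b1ce43ff33aeedcdffc07ff4cd75cffe995f573ea6fd7e37 [Pt 0x21d5cb6eaedfe0eed2ce6d9c2ba6555da6cdbac11a591453 []],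
  Pt 0x46652da81e5384c9650591453 []],Pt 0x899a4d78506758e72591453 [Pt 0x8cca595761014451afe98ae6756aba6f55e51cb [Pt
  0x13334bb6d998cccd9933639c818d00c31a37 []],Pt 0x230c718d639c83634031b1a37 [Pt
  0x8aeae62eea9b7d5f6caeae6d7fd4cbbf1999b71b2d78ab99ea677d6cab99dd36fc3e4d35 []],Pt 0x81aea6ffcb7fe9db00cdac450cd7
  []]],Pt 0x11853699558e7210ca00ca37 [Pt 0x11996682aae9bdfd4daeea6d5fb6a0ce869b4ca8d6b045369951af3d []]],Pt
  0x4046ce5886348d8c9031a48b [Pt 0x22d97350d9c946ce1950e72591453 []]]])) (Ro 3 (Pt 0x471658d9c8459639ca703 [Pt
  0x11cd9788f2c0115861a0b [Pt 0x118c19422c8432b118c87 [Pt 0x1006311b5e187accb [Pt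
  0x2309b2d60f26b1a6aaa2ba9ed754daab061b4da5acbcb [Pt 0x2332be55c13d96bc4590cc595cab932d3 [],Pt
  0x23ee9f72cfdf736fbfb6d7d7fbc1fdcadffaa6d5f6d44590a94b0dbe9b5f2db995b64d2f3 []],Pt 0x2047d60ca1c6481e541 [],Pt
  0x84d9685fcc5fccbeef4bf9bd5b4464c3664d08b2c30d994c9a118cb37 []],Pt 0x419588dac086740c6541 [Pt 0x41942899c9a021a00cb
  []]],Pt 0x102e5c4d9a06560c6b1c64b118cb37 [Pt 0x20664d9a418d0cc9934886341999326924b [],Pt
  0x814c536994d62618c9a062d6186326830c5acd7 []],Pt 0x1188eb1cd8ac719206541 [Pt 0x4458daf1c6d1766b41a8aed340d3729a3cb
  [Pt 0x46340eaaba7555ddaefeafa8bfbafeaed77f57d73aaaebfd5f780ebaba9d7575ceeabaaa8bfaafaaed7d77f573aeaeaff57de2f4b [Pt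
  0x45172e74351ce43aaae9d55777aaabafa2ebafabbbd555d7cb7fefbe6d57fd581650ebaba9d7575cebbaaba8bafbbbaef5f57572dfebeb9b55ff562d7
  []],Pt
  0x8bafae5d7d32beba79657d732ebe9bdf85d5df54d5755d72eaefa96dfde5f3515da6342fbeeab97df754dfbbefaa8beeeafbbf77df54deeeaf9b5577979113
  []],Pt 0x11cd960ca023a182cb [Pt 0x11e341e5085a007 [Pt 0x1006305941ce8cb [Pt 0x269be4d0a6e5cb694d372e4d031a59113 []],
  Pt 0x400218c9a05940b1a34b []],Pt 0x473658a258da80a1e5423e843ca8b4b [Pt 0x111c7a1d1dcedb75f03514f6ba11ad08e5b2a3cb
  []]]]],Pt 0x11cd9788f2c6ce58e2c86c64b1c6320b [Pt 0x46300475861687 [Pt 0x10016504c6ccc216561863268cb [Pt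
  0x1036325832847d02c6541 []],Pt 0x20cac6c64b0236816541 [Pt 0x41958c6ce421a00cb [Pt
  0x23be8ef9976aa997f37c3bebfb677d7f33bebfa7aefb96fd5e702aaffad9557fd37fafbea7faafad9575d74cabbea9bffd59e449 []]]],Pt
  0x1023c823438b2111ac718c88b [Pt 0x1038b125a028972a11b41ca37 []],Pt 0x11cd960ca1b39010d618a2cb [Pt
  0x46ce1eb18d9cb0d958d8c9618eb34b [Pt 0x8ab655c54b19cdfc06ce41c5930b64ca233098e2c98cb [],Pt
  0x1181b3902c9850b1984c2c98cb [Pt 0x402c62cd802859ca6118c87 []],Pt 0x23036723dd3f7769bf737bafdd842c660c2c98cb [Pt
  0x80c3c633600859ca6118c87 []]],Pt 0x8d9c3d62d93685b56367236d995154363246db368aa34b [Pt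
  0x47f7265f717cf6e9bd7818b261b3908e860cb [Pt 0x40d8c963fb932fb8be7b75debaf5e11ad0d9c541 []]]],Pt
  0x47365e23cb1b3908a182cb [Pt 0x46ce1eb18d9cb0d958d8c96334b [Pt 0x1156cab8a96339bf80d9c847164c2d93288cc18e2c98cb [],
  Pt 0x8c0d9c842c9842c660c2c98cb [Pt 0x100b18b3600859ca6118c87 []],Pt 0x1181b391aa6bb6d736a9d58163302c98cb [Pt
  0x8093166c0059ca6118c87 []]],Pt 0x408e3411a11b40c8d41 [],Pt 0x8d9c3d62d93685b56367236d995154363246db368aa34b [Pt
  0x23fb932fb8be7b74debc2163261b3908e860cb [Pt 0x40d8c963fb932fb8be7b75debaf5e11ad0d9c541 []]]]],Pt
  0x47162bc6c64b1162b1c64801 [Pt 0x47365e23cb065086800b [Pt 0x2318319422c81940c687 [Pt 0x40066d621eb18ccb [Pt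
  0x8cc96b08c513c690eabdf37be59d6113c6914b [Pt
  0x4d32ca594dc2eb975dffa7fe79d552dfede22c85d57d1755f2daeeaa6f7fdd33afaa6fdffb832d3 [],Pt 0x806536ca332d940c5a58113
  []],Pt 0x109b2d04c5935a11b32993422cb06cca64d031eb37 []]],Pt 0x118c739622cb065031a37 [Pt 0x103066d621eb18ccb [Pt
  0x23325a1f7f4eeaaae5dd5cdbffbe9bffbe7b5df54ceeaab239c5365a144f1a47193325a113c6914b [],Pt
  0x84d968262c9ad08d994c9a10c7ac1b3299340c7acd7 []],Pt 0x8c479031a34cc9934886342999326924b [Pt
  0x23ebaaa3ebaa96ddf7cdbbef9b57e3ddd7f53ddd7f4dfeabae65fdd5777afab57d6d510c7a15dd5caeeae757df4757df33befe9b55df532afba6fdd5b78353d3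
  []]]],Pt 0x11cd978e321ac1942d93699a03632268b4b [Pt
  0x23172d9ab819d0aafbeae7555ccffbaaa6fd5f5d4fd5f5d73aaaeb5df5602b8d9b45728bcb [Pt 0x103062ca11640b28463227 []],Pt
  0x8c639c85b26d331a1c6486c644c68b7 [Pt 0x118d066d0fbeaed9f7d5ccafafe8afafeed55736aaba757d80ad94ca9ae328bcb [Pt
  0x8d32ba064d6a39c87ff4ceb95d732bee8afbbb5dfe65581e50bafbbba65f7d572aefebe99577f5f53d7d5d5cf7fafae6f57d562f7 []]]],
  Pt 0x11c58657f8e6cbc19421a007 [Pt 0x200319438b2065031a0b [],Pt 0x401b39638b2c1940c68cb [Pt
  0x47fddcffbb9dd7f551dd7f54ceebfaa6f75ffcdbfbed84d33264d031a58113 [Pt 0x4512d98cc3098d0863d62e9aa6d32f031eb34b []]],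
  Pt 0x8036721b1944c9a065031a34b [],Pt
  0x20d576ab66b995b1b390eebabb6775d5cdabbfba6aefee6d5dfdcdfaaf03287757d5b3babea67757d535757d36aeafa6fd578b54b []]]]))"

lemma cert4_7: "check_top 5 [R1, R2, R3, R4] excluded4 roots4 [(11, 10, 11, 9), (11, 10, 6, 1), (1, 1, 4, 1)] cert4_7"
  by code_simp

definition cert4_8 :: cert where "cert4_8 =
  Sp 0x275eb (Ro 2 (Pt 0x4718cbc6c6484632f1c64a449 [Pt 0x47365f88f20c508690124b [Pt 0x20288c9899508b241940c69257 [],
  Pt 0x1014739622c9065031a497 [Pt 0x81c64c4b28d334da6d31bb36665946669b4da6132cd98b68b7 []],Pt
  0x20288b18e8431a41940c6927 []],Pt 0x47365e23c831421a4048b [Pt 0x404739622c9065031a497 [Pt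
  0x4526cccb2e018dac458e8f5f6debee6faa6f5f37afadf560c328cb [Pt 0x861e546db7132eb456cae19542d9461b32eb90b3 []]],Pt
  0x808e72c431a41940c6927 [Pt 0x80a39c8738a944342e519a9497 []]],Pt 0x111e5e39b2431421a40497 [Pt
  0x4718c741c7193132842d238c62650457 [],Pt 0x4051b39638b241940c6924b [Pt
  0x1005d6cba95dff315dff32bbfe6fd5d56efbc6b32628b46669b4da6359b3145a2cb []]],Pt 0x111e5e36321a0c508690127 [Pt
  0x1011b39638b241940c6924b [Pt 0x401ce5e0cac738632830ca37 [Pt 0x86ca3f33bfeed75571dff33bbbbff580b970ceb098c64d03 [],
  Pt 0x10651a0e34e1328d0591453 []]],Pt 0x808d9cb10c69065031a48b [Pt 0x22d97350d9c945b2e1b50e72591453 []]]])) (Ro 3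
  (Pt 0x471658d9c8459639ca703 [Pt 0x11cd9788f2c0115861a0b [Pt 0x118c195831ac432b118c87 [Pt 0x1006311b5e187accb [Pt
  0x1096326b1992d287263304ca6cc6910c6b118c897 [Pt 0x46792d60ce52852c6dca839316659113 [Pt
  0x213696d3305b6e95418f417f737feae7d5d5aeaa6777953775d1dd5ccbbba6f5daaab775e0cccb95669c957 []],Pt
  0x2189e2d0cc9634a231878b416449 []],Pt 0x2047d60ca1c6481e541 [],Pt
  0x21365ac31b235e66164d99845962aba955d32aba66abe6d7dd4caffa657de118cb37 [Pt
  0x44ccf25a3dd4c5eae5bdd4deae65f59c4ccc964c6830c5a59113 []]],Pt 0x429b366b0634a6b2c4d059113 [Pt
  0x235f6982a9bf737ee6f532eda22c8525996b932d3 []],Pt 0x419588dac086740c6541 [Pt 0x41942899c9a021a00cb []]],Pt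
  0x102e5c4d9a06560c6b1c64b118cb37 [Pt 0x815cae29b2d20c68664c9a446d0e4629b326924b [],Pt
  0x11555d31555d37feaa6ffd54daaf031a714c5329b34164525 []],Pt 0x1188eb1cd8ac719206541 [Pt
  0x111636bc7194726b41a8aed340d3729a3cb [Pt
  0x118d07faabfd572aefbea2baaaeb9577df5dfeaafddde07eebf776abee8afafb97d555dfbaf7762f4b [Pt
  0x45172e74351ce47faabfd572bfeefa2abbebb95ff77cb2befe6fd7d581651ebaabd755dbfabba8abeafae5d57d72cbbbb9bf5f562d7 []],
  Pt 0x13766d33699871bd475de96bc0baffbea6fbbebae5d7fdf4b7efaac0d75ffd535d7ff572aaaafa5bf7d562fcb []],Pt
  0x11cd960ca023a182cb [Pt 0x11e341e5085a007 [Pt 0x1006305941ce8cb [Pt 0x134df2685372e5b4a69b972683e4c6659113 []],Pt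
  0x1000a26366605940b1a34b []],Pt 0x473658a258da80a1e5423e843ca8b4b [Pt 0x4471eb183514f6ba11ad08e5b2a3cb [Pt
  0x1145cb6dd0566bd1ce42ebfaa9aebfe7975fd536afea5f574defab03775dd3775dcf2afbf9b7df4aeaa9bdf562d7 []]]]]],Pt
  0x11cd9788f2c6ce58e2c86c64b1c6320b [Pt 0x46300475861687 [Pt 0x800b2b0e758859589898d998cb [Pt
  0x8ea63a9b5fcdeea9675855cab9d7d4dfdff2dbfbfe6fdd754cebede8615a1545d4de9bf732fa656f93cbd [],Pt
  0x1036325832847d02c6541 []],Pt 0x20cac6c64b0236816541 [Pt 0x41958c6ce421a00cb [Pt
  0x22362d1a6db329ad06db36a36d326819469b65329a2d7 []]]],Pt 0x1023c823438b2111ac718c88b [Pt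
  0x885942b94b15696b40beeeaa9bfabfa5f775572fbbaaaff57846d1afebba6bfaee95d7df72bafbebfd5e2f7 []],Pt
  0x11cd960ca1b39010d618a2cb [Pt 0x46ce1eb18d9cb0d958d8c9618eb34b [Pt 0x1156cab8a96339bf80d9cb18b64ca233098e2c98cb
  [Pt 0x46d93584396c9a09966e59113 [Pt 0x235f6a52d05366b701f294c9ad64f353 []]],Pt 0x1181b3902c9850b1984c2c98cb [Pt
  0x402c62cd802859ca6118c87 []],Pt 0x118616319b00db66d15196118c87 [Pt 0x10015958c42c59830b398cb [Pt
  0x4317c6851c9a431cf8d623da6449 [Pt 0x11aefbf5b9b5dcbae35535f5d967772cbb7a187e82eaabed7d7bae65d5572baafef93cbd
  []]]]],Pt 0x8d9c3d621656367215b29b5354363246db368aa34b [Pt 0x26ab6d57354f6e67f818b261b3908e860cb [Pt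
  0x81b192cd56daae6a9eddcfe9fe11ad0d9c541 []]]],Pt 0x47365e23cb1b3908a182cb [Pt 0x46ce1eb18d9cb0d958d8c96334b [Pt
  0x455b2ae2a58ce6fe03672c3e562d93288cc18e2c98cb [Pt 0x269b64d611b65c9a09966e59113 [Pt
  0x235f6a52d05366b701f294c9ad64f353 []]],Pt 0x8c0d9c842c9842c660c2c98cb [Pt 0x100b18b3600859ca6118c87 []],Pt
  0x2309319b00db66d15196118c87 [Pt 0x400565623ac162cc0b398cb [Pt 0x222f8d0a39348d7725955f9b5ccec23da6449 []]]],Pt
  0x408e3411a11b40c8d41 [],Pt 0x8d9c3d621656367215b29b5354363246db368aa34b [Pt 0x1355b6ab9aa7b733fc2163261b3908e860cb
  [Pt 0x81b192cd56daae6a9eddcfe9fe11ad0d9c541 []]]]],Pt 0x47162bc6c64b1162b1c64801 [Pt 0x47365e23cb065086800b [Pt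
  0x2318319588b2c1940c687 [Pt 0x40066d621eb18ccb [Pt 0x22896326b1992d28339319855d4aba599bd532aa655e438b586ce897 [Pt
  0x4050672b144f1690efefbb7fd76dbfeba77f7e113c5a494b [Pt
  0x8d6cae82b8caafd1a65729b50d7cceefe6d5f74eeff7a26995ca6d434d653696d4b77 []],Pt 0x1113c5a1992c69445878b414449 []],Pt
  0x21365a098b26b428b26ccc22cb06cca64d031eb37 []],Pt 0x8e76a69b4da6b0634a6b2c4d058113 [Pt
  0x9acb17286eb7d36fa677e501114186914b []]],Pt 0x118c739622cb065031a37 [Pt 0x103066d621eb18ccb [Pt
  0x4664b43fbb9fdccafe8afe6dd72ba9d36af239c5365a144f1a47193325a113c6914b [],Pt
  0x21365a098b26b428b26ccc289b3166c1b3299340c7acd7 []],Pt 0x2311e40c6871b4cc98d20752aeb9f54ceaaa6ffa65f54cbf9bdf924b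
  [Pt 0x13534ca6d2d0502a29b3263322168514d99319927 []]]],Pt 0x11cd978e321ac1942d93699a03632268b4b [Pt
  0x231d573aad9fbab77819d0efbbaeff54deebea6557fd4557fd77faab775602b8d9b45728bcb [Pt 0x103062ca11640b28463227 []],Pt
  0x8c639c85b26d331a1c6486c644c68b7 [Pt 0x463419b43bbeed9ddf732beaaa2beaabbfd537faa9fdd80ad94ca9ae328bcb [Pt
  0x40d1ce42aeaaad95755532bfbea8afefab6ff556bea995dde07942aeeeb655ddd32aeeea2bffbb6f5d55bba995dde2d7 []]]],Pt
  0x11c58657f8e6cbc19421a007 [Pt 0x200319438b2065031a0b [],Pt 0x401b39638b2c1940c68cb [Pt
  0x8862d63bfae77f5cbbea8bbea65df537eeba6d776f10f58a26cd9ad832d3 [Pt 0x9a6e2da5b1a062a3b4b061acbcb [Pt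
  0x11eeaeb57533aba5bdd5cdaa65fd56151db96d08f18cc689b367ac4cd []],Pt 0x8c55cab9514da6f53799ef03150ced2c32d7 [Pt
  0x47babad5d4ceae96f75733bfe997f558d45329b4f5a11e2cc2a19db96c4cd []]]],Pt 0x200d9c86c6d33666065031a34b [],Pt
  0x817572ead9bb9b56c6ce46aeedb57736bbe9aef9b5df32bc0ca3f76dfb9bf74ffcdff9958b54b []]]]))"

lemma cert4_8: "check_top 5 [R1, R2, R3, R4] excluded4 roots4 [(11, 9, 5, 4), (11, 10, 6, 1), (1, 1, 4, 1)] cert4_8"
  by code_simp

definition cert4_9 :: cert where "cert4_9 =
  Sp 0x275eb (Sp 0x2d5e9 (Ro 4 (Pt 0x11c5963672c459639cb90b3 [Pt 0x47365e23cb0045061a2cb [Pt 0x40419588b2443284632497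
  [Pt 0x83286809932b932d3 []],Pt 0x100739031a10cac30c68b7 [Pt 0x808e7211488674127 []]],Pt 0x223cbc6ce1ac01141868b7
  [Pt 0x81c58e9065638b244328718c924b [Pt 0x809932b0650d932d3 []],Pt 0x1006ce40c68432b0c31a2cb [Pt
  0x4085948d9c8452219d048b []]]])) (Sp 0x2569 (Ro 4 (Pt 0x11c5963672c459639cb90b3 [Pt 0x47365e23cb0045061a2cb [Pt
  0x10106508b2443284632497 [],Pt 0x100739031a10cac30c68b7 [Pt 0x2219434450e72d932d3 []]],Pt 0x223cbc6ce1ac01141868b7
  [Pt 0x207163a419438b244328718c924b [],Pt 0x1006ce40c68432b0c31a2cb [Pt 0x10216520ce8452219d048b []]]])) (Sp 0x2d79
  (Ro 4 (Pt 0x11c5963672c459639cb90b3 [Pt 0x47365e23cb0045061a2cb [Pt 0x10106508b2443284632497 [],Pt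
  0x100739031a10cac30c68b7 [Pt 0x80833a11488674127 []]],Pt 0x223cbc6ce1ac01141868b7 [Pt 0x8e2c74140447438c62917 [],Pt
  0x401b3864c0c68432b0c31a2cb [Pt 0x22165040446d032917 []]]])) (Sp 137 (Ro 3 (Pt 0x11c5978d9cb4459639cb90b3 [Pt
  0x47365e23cb0045061a2cb [Pt 0x40065031a10cac463227 [Pt 0x40419d08a408632a497 []],Pt 0x40065031a1c64830c68b7 []],Pt
  0x473658e70d0d9c80d8c9061a2cb [Pt 0x8c0d9c80d8c906168cb [Pt 0x816cb87a511646db716ca79113 []]],Pt
  0x111e5f8e6cb401141868b7 [Pt 0x40065031a10cac30c688b [Pt 0x110b282810ca446d032917 []],Pt 0x40065031a1b1920c31a2cb
  [],Pt 0x106342d970c6941b6dc4d9a79113 []]])) (Sp 153 (Ro 3 (Pt 0x11cd9788f2c6ce58e2cb1b1921c6322cb [Pt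
  0x4606ce422c50d8c908c628cb [Pt 0x40c6ce284590d8c8a118c87 []],Pt 0x401ce588b2c7192118c8b7 [Pt 0x471640c68459090b3
  []],Pt 0x8e2c808b2c4786b90b3 [Pt 0x238b140c6801141868b7 []]])) (Ro 3 (Pt 0x447978e6cb473908b21c648463237 [Pt
  0x1031b390e2c86c648718c8cb [],Pt 0x818e72116436321a118c8b7 []]))))))) (Sp 0x2d5e9 (Ro 3 (Pt 0x471658d9c8459639ca703
  [Pt 0x11cd9788f2c0115861a0b [Pt 0x11818c4758616b2cb [Pt 0x463059588b2c42ca118c87 [Pt 0x1006311f58615accb [Pt
  0x46564d612e5b4a22c8364c6659113 [Pt 0x11162b08088a330ec9b914b [Pt
  0x426d3696609ecd2a831e86ff9bf74caae99f5736baca8a364c79b118c94957 [Pt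
  0x11fccdf3cae9637ee6fcdfc6eea8bbae9bdf5fccfaabe6575fccbbea6d75fb54d30eca6d3666134ca6cca5ad475d4cdff37ee9955d33eae6d7536bad353d
  []]]],Pt 0x85db6b0c7c8d78618d08b2c3b7266118cb37 [Pt
  0x4f7ff4cf7ff4dbea7bfff536fa997fe1a7936999714c5367b326875cc75cf6aa6fd54cbb9b776564715 []]],Pt
  0x41b76e86ee9b75cb6eb9956d11643932d3 []],Pt 0x400e5611a90b3 [Pt 0x46592d61b294459059113 [Pt
  0x46b5b4c3df74b3aaa6d7ded11643932d3 []]],Pt 0x226659341869445960ce99113 [Pt 0x80c2d00c45a90b3 []]],Pt
  0x26edc5366b1ce1a5063439c99113 [Pt 0x46b6d31aed70da64cda14db970e72d932d3 []],Pt 0x408e84632c719206541 [Pt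
  0x10635832808e846d02cb [Pt 0x11818c47d0728cb [Pt 0x118d0565087a007 [Pt 0x40068ecf66607940f1a34b []],Pt
  0x9a9ad94d61c43d0469e033e9453 [Pt 0x2126e0764ca22c81e516659113 []]]]]],Pt 0x8e6cbc7162b1b39638b2c6c64b1c632ccb [Pt
  0x118d006c645061687 [Pt 0x40059436712c9a1b1921b2312c9a34b []],Pt 0x8e2c75800475861687 [Pt 0x40059438b210b2b1c6320b
  [Pt 0x10223d032847d02c6541 []],Pt 0x8e2c2cac445a0236816541 [Pt 0x106508d8d02c65086800b []]],Pt 0x471658c6390b3 [Pt
  0x10d95e1c6b0045061a2cb [Pt 0x87cac6d94dabc032b932d3 [Pt 0x23f76caa6fdcdea9761aeccca029b46e59113 []],Pt
  0x871680063423e830c68b7 []],Pt 0x11c5899cd831ac01141868b7 [Pt 0x80018d087a0c31a2cb []]],Pt 0x47165861ac6390b3 [Pt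
  0x10d95e1c6b00061a2cb [Pt 0x10c7ca17d5cbea65d5f5315ff54dfafbad95ff557abb6a185684c4db6d5f019b2bcbd [],Pt
  0x87168006341b2830c68b7 []],Pt 0x117264c2d78430d08da6449 [Pt 0x89865c9857296298b2584c6c9871641b261c6320b [],Pt
  0x8e6cbc479626364c38b20d9300b [Pt 0x40618f4006c653061e87 [],Pt 0x473916c634140446b40c6917 []]]]],Pt
  0x47162bc6c64b1162b1c64801 [Pt 0x47365e23cb065086800b [Pt 0x2318319588b2c1940c687 [Pt 0x40066d621eb18ccb [Pt
  0x9a9a593699b1992d28339319845921c5a11635a497 [Pt 0x4050672b1161a439b282d9c66494b [Pt
  0x46d97435c9b536e1f5732abaedff37eead758195e29a65766530d3594da5b4f7 []]],Pt
  0x44589b2d07d75ebe7b5f733ebda22c830c6b832d3 []],Pt 0x13534ca6535e0c694459058113 [Pt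
  0x13535f698ddd4ddd33fb99fdcca9b56f11643832d3 [],Pt 0x4458a1badf4dbe99df94044507c6914b []]],Pt
  0x26bb4da9a653584739086348e325831a27 [Pt 0x1011ce284318d2029b3665924b [],Pt 0x80a6cca690e31a133264d2029b366924b
  []]],Pt 0x8e6cb0ce4ca26819421a00cb [Pt 0x20d6da6d4d72819d63632896b07bebeadbdf5f537bebea9fbafe965fff8bcb [Pt
  0x22b6536a69e868aebb5d4e7d547d533f96fd586ce3a00b3 []]],Pt 0x4716195f8d8c86b419421a007 [Pt 0x200319438b2065031a0b [],
  Pt 0x401b39638b2c1940c68cb [Pt 0x11e3ab9d5daaae9aaae6d55733bef9bf56f10f40c6b832d3 [Pt
  0x9bfbaa2ebba65d775b6feeabf5615336d955e9bfbaa2ebba6dfdd5b6feeabf5611b2b537f5d175fccbafed975fd7ead353d [],Pt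
  0x8fbaa3eeaef74b3eeab557818c6b03115861acbcb [Pt 0x4432d9d66a25b5b6994665316e11648863d0497 [Pt
  0x27e9e9b77265737ab58df7d4f7fcdfefb6df7d72e675fb54d5ff54775f7dabfea6ffddd33fba57f5635ddd35dfd33febbdd74b2aaead777b534729b5cd353d
  []]]]],Pt 0x8036721b19514ca6e065031a34b []]]])) (Sp 0x2d5eb (Sp 0x2569 (Ro 4 (Pt 0x11c5963672c459639cb90b3 [Pt
  0x118d11658e72d932d3 [Pt 0x1014459639c99113 [Pt 0x423586ca00474185a0b [Pt 0x2002ca02165061687 []]],Pt
  0x108d7872b00474185a2cb [Pt 0x21ca0ab76ad402caf934f3 [],Pt 0x800163423a0c2c68b7 []]],Pt 0x223cbc6ce1ac01141868b7
  [Pt 0x26ecb132a0652a38b141e45253 [],Pt 0x4016cb865c0c68432b0c31a2cb [Pt 0x2042ca419d08a4048b []]]])) (Sp 0x2d79 (Ro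
  3 (Pt 0x11c5963672c459639cb90b3 [Pt 0x47365e23cb0045061a2cb [Pt 0x100195831a10cac463227 [Pt
  0x10650d329955a819b32af934f3 [],Pt 0x832b11b5a0433ae4cd [Pt 0x20ca1810ceb0334b []]],Pt 0x100739031a1c64830c68b7 []],
  Pt 0x223cbc6ce1ac01141868b7 [Pt 0x46140447438c62917 [Pt 0x4041650e2c910b28718c914b []],Pt 0x401b39031a1b1920c31a2cb
  []]])) (Sp 137 (Ro 3 (Pt 0x11c5978d9cb4459639cb90b3 [Pt 0x47365e23cb0045061a2cb [Pt 0x40065031a10cac463227 [Pt
  0x110ca345366d5e228d14ca6d5b018cacd3 []],Pt 0x40065031a1c64830c68b7 []],Pt 0x8e6cb1ce1ac01141868b4b [Pt
  0x103065031a1c64830c68b7 []],Pt 0x111e5f8e6cb401141868b7 [Pt 0x40065031a10cac30c688b [Pt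
  0x88a3dd5d355fcdaafe6f7574fbb6a21946eba9eeb9b75d36eba9f5b5934f3 []],Pt 0x40065031a1b1920c31a2cb [],Pt
  0x1001940c686c64830c68b4b []]])) (Sp 153 (Ro 3 (Pt 0x11cd9788f2c6ce438b21b1921c6322cb [Pt
  0x4606ce422c50d8c908c628cb [Pt 0x40c6ce284590d8c8a118c87 []],Pt 0x200e721c58687192118c8b7 []])) (Ro 3 (Pt
  0x447978e6cb473908b21c648463237 [Pt 0x1031b390e2c86c648718c8cb [],Pt 0x818e72116436321a118c8b7 []])))))) (Sp 0x2569
  (Sp 0x256b (Ro 4 (Pt 0x11c5963672c459639cb90b3 [Pt 0x40d11658e72d932d3 [Pt 0x4235872b00474185a2cb [Pt
  0x800163423a0c2c68b7 []]],Pt 0x11c58ac6ce1ac01141868b7 [Pt 0x1001940c68432b0c31a2cb [Pt 0x221650f40f11b40cad357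
  []]]])) (Sp 0x2d7b (Ro 2 (Pt 0x11c59636724459639c99113 [Pt 0x239b2f1ce1ac01141868cb [Pt 0x10306508b210ca118c87 [],
  Pt 0x40404474185a44b []],Pt 0x238b15e39b201115861a17 [Pt 0x4041940c6910cac30c684b [Pt 0x20061a1c5901c6322cb []],Pt
  0x1006ce5831ac6c64830c68b4b [Pt 0x8316818c9af4031af934f3 []],Pt 0x4718c358e6cb0c340061687 [Pt
  0x200d9c816341ca0c2c68cb []]]])) (Sp 139 (Ro 6 (Pt 0x447978e6cbe4c739622cb2d7 [Pt 0x20622830d639c5638b2cb4b [Pt
  0x111e42406358328b7 [Pt 0x21b286018b588a0c316b2d []]],Pt 0x103114186b1ce2b1161acbcb [Pt 0x239b2038b24185a182cb [Pt
  0x118f64d062d0eeeb9ddd6cdd4b7faebfd7b2f7 [Pt 0x41646868e6c740b1ac432b0c2c6b2d [Pt 0x11551556e555eb0e41141868b7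
  []]]]],Pt 0x111e58e6cb9060b7 [Pt 0x10045061a0e5611a2cb [Pt 0x2185ac474c8861e8432923 [Pt 0x862820218f94124b []]],Pt
  0x4458cbc7164a4430b422923 [Pt 0x431421a40431b28446924b [],Pt 0x137659514d0e6c9e4501457 []]]])) (Ro 3 (Pt
  0x47365e23cb1b390e2c86c64b1c6322cb [Pt 0x1181b39638b2c6c64b1c632ccb [Pt 0x46346ce284590d8c8a118c87 [Pt
  0x1006ce58e2cb1b192c718cb34b [Pt 0x10018d08b210c68463227 [],Pt 0x400c31a11640c68463227 []]],Pt
  0x88b0d0b92c49a518e2c910d0b9318691cb [Pt 0x405caf1164116b932d3 []],Pt
  0x4718c87f773fb99fdccd754def7e23190b93262cd7c1c586bcbd []],Pt 0x4607390e2c3438c90e31868b7 [Pt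
  0x100738a1c590e3228718c88b []],Pt 0x239b2c719143672114363240cb [Pt 0x40ad94ca8a650d9cb11d63632436322e8bcb [Pt
  0x9ea3eef4dc3abfed9d5ff33abfe9ebefb6ff67c6c645168575f6caebe6d77551df5cdfeaad5737fab38d9c6d4525 []]]]))))) (Sp
  0x2d79 (Sp 0x256b (Ro 2 (Pt 0x11c59636724459639c99113 [Pt 0x11162b1ce1ac01141868cb [Pt 0x118404474185a44b [Pt
  0x40416508b2442ca0c316917 []]],Pt 0x8e2c578e6cb401141868b7 [Pt 0x4610111d0616917 [Pt 0x10105940b1a442cac718c84b [Pt
  0x20061a063d01c6322cb []]],Pt 0x1006ce40c686c64830c68b4b []]])) (Sp 0x2d7b (Ro 2 (Pt 0x11c59636724459639c99113 [Pt
  0x47365e23c80445061a44b [Pt 0x400047586168cb [Pt 0x2046d61ca10ce816541 []],Pt 0x103007190d06168cb []],Pt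
  0x238b15e39b201114186917 [Pt 0x4041940c6910cac30c684b [Pt 0x20061a062d01c6322cb []],Pt 0x1006ce40c686c64830c68b4b
  []]])) (Sp 139 (Ro 4 (Pt 0x11c5978d9cb4459639cb90b3 [Pt 0x222c5623cb0045061a2cb [Pt 0x118065031a10cac30c68b7 [Pt
  0x2071619d20da6d50e2c911b42e4c636914b [],Pt 0x4432b37658adadc450a66ccab5934f3 [Pt
  0x8afba7faa9b5d54daeaabf736af0fee8fe8ce55d5fef6a0545329b75e0c67534b5 []]]],Pt 0x11162b1ce1ac01141868b4b [Pt
  0x118c1940c686c6d136b830c68b7 [Pt 0x8536a82308d8c96187a24b [Pt 0x20738a46ce4111f418a44b [],Pt
  0x8615a0a18d9d031a6449 []]]],Pt 0x11c58af1b386b401141868b7 [Pt 0x1001940c68432b0c31a2cb [Pt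
  0x10216520ce8452219d044b []],Pt 0x1001940c686c64830c68b4b []]])) (Ro 3 (Pt 0x47365e23cb1b390e2c86c64b1c6322cb [Pt
  0x1181b39638b2c6c64b1c632ccb [Pt 0x46346ce284590d8c8a118c87 [Pt 0x1006ce58e2cb1b192c718cb34b [Pt
  0x10018d08b210c68463227 [],Pt 0x425b2d0eb99fd552aae995574cdff4caaba6d5db50c31a1165831a118cb37 []]],Pt
  0x222c342e4b126940e2c910d0b9318691cb [],Pt 0x11c63215ca65334d7e23190ae53298b4d7c1c586bcbd []],Pt
  0x4607390e2c3438c90e31868b7 [Pt 0x205278a4738a1c59238c8a1f7fd6bfe9b7fcdbfe66bfeadff91cb []],Pt
  0x11cd9619c994543672114363240cb [Pt 0x40baed975ccbae8bae6f55eb0d9cb11d63632436322e8bcb [Pt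
  0x46c6516d0d11642d97346e90b3 []]]]))))) (Sp 137 (Ro 3 (Pt 0x471658d9c8459639ca703 [Pt 0x11cd9788f2c0115861a2cb [Pt
  0x460011d6185a0b [Pt 0x11818c46d1ebccba66ee7757aa65d8cb [Pt 0x103079422c843ca118c87 [],Pt
  0x849682e726946b31a09e348868ddd3377d3caae6ddd914b []],Pt 0x4606311b40cb [Pt 0x231a0f28459087941ce87 [Pt
  0x200c6235a0b9c9a34b [Pt 0x41a2d637073e8431a4167d41 []]],Pt 0x810d073a11c6908d41 []]],Pt
  0x1172e2e5c0739031a1c64830c68b7 [],Pt 0x239b2c719432a02284740cb [Pt 0x41a66cca02a6657423685136e8bcb []]],Pt
  0x239b2c716286ce58e2c86c64b1c6320b [Pt 0x46300475861687 [Pt 0x4005940b1a1b1920c2c68cb [],Pt 0x20cac6c64b0236816541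
  [Pt 0x832846c686ce421a00cb []]],Pt 0x20c6bc1958d9c80d8c90628cb [Pt 0x118d006c645061e87 [Pt
  0x103670f2681e50d9c4f2686c6486c8c4f268bcb []],Pt 0x2019d071a0238d063a2cb []],Pt 0x11cd97886563672c456363240cb [Pt
  0x118d006c645061e87 [Pt 0x103670f2681e50d9c4f2686c6486c8c4f268bcb []],Pt 0x8c61c68474238d02cb [Pt
  0x10236341c6847d0338d41 []],Pt 0x1058d623cb023a10d02cb [Pt 0x4085a0e3423e822d41 []]]],Pt 0x47162bc6c64b1162b1c64801
  [Pt 0x47365e23cb065086800b [Pt 0x2318319422c81940c687 [Pt 0x800cdac43d60193268cb [Pt
  0x234ca5a144b1934a3144f1a42cd96844f1a494b [Pt
  0x21f37e7a05b76af51afaa6d55d36ffbb7752bb08b2d475d3ddf536feba6dd75debe9d78458f6bcb77 []]]],Pt 0x8c639c8431a065031a37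
  [Pt 0x2060cdac43d60193268cb [Pt 0x11a652d0a4f1d239c5365a144f1a42cd96844f1a494b []]]],Pt 0x11cd978e321ac19421a00cb
  [Pt 0x8cdb66d372819d0ad94da9a5a0363225a34b [Pt 0x81a0c59422c8165031687 []],Pt
  0x20d5d537fae555d32aaea2aae96ff6c19d6216b02b6532a6968bcb [Pt
  0x444b1a177d6cbbe99d7d4ddd5b2b7e5062d0be675dcfea67f54d5cdba5b7e4449 []]],Pt 0x4716195f8d8c86b419421a007 [Pt
  0x200319438b2065031a0b [],Pt 0x80367210c681940c68cb [],Pt 0x200d9c8431a065031a34b []]]])) (Sp 153 (Ro 3 (Pt
  0x47365e23cb1b390e2c86c64b1c6322cb [Pt 0x1181b3908b143632588c628cb [Pt 0x4606ce422c50d8c908c628b4b [Pt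
  0x101b2a1b3908b1b2a1b192118c6ca8bcb []],Pt 0x118d8c865636721b19454363240bcb [Pt 0x40d8c966db368a8d0e3243671d41 []]],
  Pt 0x8c0e721c58687192118c8b7 [Pt 0x4d679a98636721c599b50e3228718c328cb []],Pt 0x239b2f1c64563672114363240b4b [Pt
  0x4606ce422c50d8c9034b [Pt 0x4639b150d9c87692cd30d8c90e6c2ca3cb [Pt 0x2063671422c86c645047a27 []]],Pt
  0x4631ce4223438c90468b7 [Pt 0x46347390859438c902ca37 [Pt 0x818d9c842ca4d0d8c9034b []]]]])) (Sp 553 (Sp 0x979 (Ro 1
  (Pt 0x4736588f2c6ce58e2cb1f2436320b [Pt 0x408f21b39638b21f258d8c88b [Pt 0x22e5cdca84796367203e4b118accb [Pt
  0x466edc5dba46ce43b9dc777ba4636321cb [Pt 0x111e5e1777deaad5b71ce41c6b0e2d08c736b357 [Pt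
  0x10351ce2861cd942d930c66cf4b [],Pt 0x206a39c5073635873650d8c2b1acdcb []],Pt 0x223cbc25b769b71ce41cdac38b41f2b357
  [Pt 0x10351ce286173a1be5666cf4b [],Pt 0x1376e6972ee1958cce39c87eaae7f74aee575ae67f7935ee57156a5936b0e3217 []]]],Pt
  0x8be51ca847963672c722b1f240cb [Pt 0x8bbab65dd535d572eeaef6f0e88f0d0e473a46c9073a477 [Pt
  0x9beeeb57fdb2eaa2ea9677dd5fbac2abed955f4f77dcaafbb32b7b8aabeead9557dd53ff7d55caabeea9dd577eeea77561165e2baebab6575d7547dfd5577abbea96df755baec1cdad2f57
  [],Pt 0x101c478e5606c8a0e71a474b [Pt
  0x13776bfae5f7515f76dafe997d85ddf5f6cbbbebe8aefebeef7f55f72e96d7d6fd4f5fdd77ebabb977d4557f772aaeae5dddd37ebab997d5e17fdf5ccebeab9fdffdd3ffd75ddabfbeed9d7d536ffdee3496370aeaba6df7ddbbffa8aeabae57fdd6cabe6dffb53d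
  []]]]],Pt 0x8e6cb11e407164390d0d8c88b [Pt 0x137659b9410e508b21b258e3227 [Pt
  0x4df5dbe966fae5cc22c3d3a1ce845923e4741277 []]]])) (Ro 3 (Pt 0x47365f88f2d1b390e2c86c648718c8b4b [Pt
  0x23376d8aad86ce422c50d8c908c628bcb [Pt 0x207362a1b3908b14363242318a2d4b []],Pt 0x2318d9c8458a1b1921c63234b [Pt
  0x463c73908b21c648463237 [Pt 0x402c9ac6ce422c2c9a1b192118c2c9a2d4b []]],Pt 0x447898639c87161a1c64846322d7 []])))
  (Ro 1 (Pt 0x4736588f2c6ce438b21f2436320b [Pt 0x408f21b39638b21f258d8c88b [Pt 0x8e717284796367203e4b118accb [Pt
  0x23eae7d5cd75cfabbb1ce3af46ce58c57755debfeaf75cc57755debfea55f536ebc3632cdcb [Pt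
  0x231e8aaeb955d73ff573eeae33b0c4786343631f2b2fcb [Pt
  0x205d2e78fb6dff2deaf7e2ebfb975fdcfd5f76fbb9e775fbc1c5ac38f4231cfacb77 []],Pt
  0x462aefb9577dc55d776eefbb4caab28d9c8575f72bafb8aebeed5755da9957645b2e6e570d8c89cb [Pt
  0x10d6d3054739073e90d958e32257 [Pt 0x40d9c2cd932b71be32e85cb89f2bd08ad08cb33 []]]]],Pt
  0x41bbb6ddd35776ee96546ce59ffaa9bdd73baea9ffaab9dd755eec8f923d777debba7afe9559274b [Pt
  0x111e43671b2b1ce41b286c9073a2d7 []]]])))))))))"

lemma cert4_9: "check_top 5 [R1, R2, R3, R4] excluded4 roots4 [(5, 4, 7, 5), (11, 10, 6, 1), (1, 1, 4, 1)] cert4_9"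
  by code_simp

definition cert4_10 :: cert where "cert4_10 =
  Sp 0x2d5e9 (Ro 5 (Pt 0x4458cb1c592911c8cb139223 [Pt 0x10c50869011b3978e2c88b [Pt 0x4738a0c74b228e720c329457 [],Pt
  0x10c75885a00632cb [Pt 0x431b4140629431394124b [],Pt 0x2008b210b1a06740b1a2d []]],Pt 0x4479639b2e410d618acb7 [Pt
  0x8022830d08e578e2cb2cb [Pt 0x22365064443d032917 [],Pt 0x10c45a022c818d00c31a2d []],Pt 0x4479639b2d93018eb2d7 [Pt
  0x218e35872b431b430185acd [Pt 0x20163423a0c2c6802cb []]]]])) (Sp 0x2569 (Ro 6 (Pt 0x111e58e6c96451ce588b2457 [Pt
  0x101e451ce5e22c9257 [Pt 0x101591c07277 [],Pt 0x101591c05277 []],Pt 0x111e58e6c9910117 [Pt 0x40445061a439584684b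
  [Pt 0x118e406340b7 [Pt 0x81ac9e1766cd0d357 []]]]])) (Sp 0x2d79 (Ro 9 (Pt 0x19351ce32c4d92f1b232c7392d357 [Pt
  0x64d031b232c7392cd7 [Pt 0x19318c037 [Pt 0x64f0340cf7 []]],Pt 0x64f1ce32f1364bc0cf7 [Pt 0x193d03c0d3d7 [],Pt
  0x64f40d40d3d7 []]])) (Sp 137 (Ro 3 (Pt 0x11c5978d9cb4459639cb90b3 [Pt 0x47365e23cb0045061a2cb [Pt
  0x40065031a10cac463227 [Pt 0x40502864ca911b583284b [Pt
  0x2269b529a3dd535f4deea6f7573f6e2eba7aaf9bf5d55eabe65d7874f3799dd7b018ceb4b53 []]],Pt 0x40065031a1c64830c68b7 []],
  Pt 0x473658e70d0d9c80d8c9061a2cb [Pt 0x8ad95c531a0b9adb5c52d0717d756cbeba9bd7d35f7cb7afc185a5274b []],Pt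
  0x111e5f8e6cb401141868b7 [Pt 0x40065031a10cac30c688b [Pt 0x110b282810ca446d0864ca917 []],Pt
  0x40065031a1b1920c31a2cb [],Pt 0x106342d970c6941b6dc4d9a79113 []]])) (Sp 153 (Ro 4 (Pt
  0x111e5e39b2d1ce588b2c7192c463237 [Pt 0x40c6ce58e2cb1b192c718c8cb [Pt 0x40063422c8431a118c8b7 [],Pt
  0x206c64b0650e3258d9c541 []],Pt 0x2063670d08b21c64b118c8b7 [Pt 0x40d8c8ad1ce436328e5438c902d7 []],Pt
  0x47161af1cd968116421a118c8b7 [Pt 0x10039438b211ca1c6322cb [],Pt 0x10039422c342394231868b4b []],Pt
  0x4478ac6c64b038c9639c541 [Pt 0x1065623cb46ce421a00cb [Pt 0x818e7210c681940d7 []]]])) (Ro 3 (Pt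
  0x111e5e39b2d1ce422c87192c463237 [Pt 0x40c6ce438b21b192c718c8cb [Pt 0x206c64b0650e3258d9c541 []],Pt
  0x40c73908b21c64b118c8b7 [Pt
  0x13f76dfb99df477dcefae1b397aa7eedbf733be9fbb9df5c3670b5ff07f5f6cfebe6f7fd47f5f73fafaf5db2f3 []],Pt
  0x4478ac6c64b038c9639c541 [Pt 0x10650e321ac6ce421a00cb []]]))))))"

lemma cert4_10: "check_top 5 [R1, R2, R3, R4] excluded4 roots4 [(7, 5, 5, 3), (11, 10, 6, 1), (1, 1, 11, 10)]
    cert4_10"
  by code_simp

definition cert4_11 :: cert where "cert4_11 =
  Sp 0x2d5e9 (Ro 5 (Pt 0x4458cb1c592911c8cb139223 [Pt 0x10c50869011b3978e2c88b [Pt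
  0x26fbb7d6f99be655570ffbaab9ff7554ffbaa98ffbaa9bf57fd7eeb6e7aeaaef5d557eaea67eaea6fd5d52ef0ffb9ff5fb99fb9bf75f7a0ca1d77773aeee9d77733f7fd37effabdf6d4bd
  [],Pt 0x10c75885a0002cb [Pt 0x230c8a18e5033a493 [Pt 0x431f414050124b []]]],Pt 0x4479639b2e410d618acb7 [Pt
  0x8022830d08e578e2cb2cb [Pt 0x223650f93443d032b2f7 [],Pt 0x10c45a022c818d00c31a2d []],Pt 0x88b18eb1cd86b0c740061a2d
  [Pt 0x10c2ca06340b2830c6802cb []]]])) (Ro 3 (Pt 0x471658d9c8459639ca703 [Pt 0x11162b1ce1ac63115861accb [Pt
  0x40c195831ac432b118cb37 [Pt 0x118c63144633198e4cae2cb [Pt 0x4018c42d098d9198b7 [Pt 0x100c68459090b3 []],Pt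
  0x1004596390b3 [Pt 0x100c6801141868b7 []]],Pt 0x8c033ac4590118c87 [Pt 0x10000e50615a0b [],Pt 0x20f28001ce50615a0b
  []]],Pt 0x46311658e70c6b90b3 [Pt 0x47365e23cb0045061a2cb [Pt 0x1001e5031a10cac463227 [Pt
  0x222c6b41461dd5b6fb6df6446d0a26cda924b [Pt 0x1034ecaaf447434f16556b075ff47555cf7beaa6f7d54dfafad76d353 []]],Pt
  0x1001e5031a1726d0cb830c68b7 []],Pt 0x43657831ac01141868b7 [Pt 0x11b64ca8194a36c9b5619113 [Pt
  0x10d9b4140445066d936e917 []],Pt 0x80018d087a0c31a2cb []]],Pt 0x11cd9788f2c00185a0b [Pt 0x2002ca11641ca118c87 [],Pt
  0x800b2b1165872830b1a37 [Pt 0x4659326818d28cb664d619113 [Pt 0x41e2d05011141996cc96917 []]]]],Pt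
  0x8e2c578e6cb0045618687 [Pt 0x400650e2c8432b0c31a0b [Pt 0x46219d60cac46d60c6541 [Pt
  0x463c3146efeea9bfebe6dff5f76efeea657f56028997668bcb [Pt
  0x100f26b703efefea7feffab67dfdfd33efefe9bf75fb0650feebfa8feebfadb757ddcdbabeee6fdd7e377 []],Pt
  0x11874fdfd475f76dfbfa6f7e08efba8efbadbff54defc1157 [Pt 0x101737ddd15dfdb6fbb96f7e08abae8abaedb7774b7bf04957 []]]],
  Pt 0x81b385ac631b190d6185acb7 [Pt 0x1062d63670b1ac090b3 [Pt 0x21cdad9d4341672b1a2265b6a0c31eb3cb [Pt
  0x2019b235e06656caeb64cd3 []]],Pt 0x20c5ac311ac061a90b3 [Pt 0x439b5b3a868336558d059ca0c31eb3cb [Pt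
  0x21c98265b6eb40536b6732b058f532d3 []]]],Pt 0x447978e6cb46311d037 [Pt 0x2002ca111a0e5611a0b [Pt
  0x2060b3ac456216740cb [Pt 0x1021a028e2c66067d41 []]],Pt 0x800b2844683958468cb [Pt 0x8182ce86c65150859d034b []],Pt
  0x8e2c33af1b192c086819d41 [Pt 0x82ca1537194cb03165086800b [],Pt 0x11537194cb0d9c2b581b19471a10b40b7 []]]],Pt
  0x47162bc6c64b1162bc7192c41 [Pt 0x47365e23cb065086800b [Pt 0x200319422c81940c687 [],Pt 0x100739622cb065031a37 [Pt
  0x46146289931a4434299b326917 [Pt 0x2021cac512ce52239429965ca914b [Pt 0x101ce9419418113 []],Pt 0x416560c5a5018113
  [Pt 0x41941011141ac6914b []]]]],Pt 0x11cd978e321ac19421a00cb [Pt 0x818319422c81940c687 [],Pt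
  0x20639c85b26d331a065031a37 []],Pt 0x4716195e39b2c19421a007 [Pt 0x200319438b2065031a0b [],Pt
  0x401b39638b2c1940c68cb [Pt 0x46146289931a4434299b326924b [Pt
  0x102a296576add1d7753aeeb9d77f475dfcb7babebbdd5f57ebc215afc75d553aeaae7dd5d3fddd2caeebae5775d5faf0eefeea7fbefa59ddfdd73bbfbab755b52f57
  [],Pt 0x8c20c5a10b3948096726497 [Pt 0x80be578d76e61e22e75863ad2f4b [Pt 0x118f0b9b436c6dd68066b2bb2d4b [Pt
  0x20785c7940cdad0e73e83d949bb2f7 []]]]]]],Pt 0x111e5e39b2d0650868037 [Pt 0x818d9c85c9b4cc681940c68cb [],Pt
  0x206c642d6833a1b1944c6802d7 []]]]))"

lemma cert4_11: "check_top 5 [R1, R2, R3, R4] excluded4 roots4 [(7, 5, 5, 3), (11, 10, 6, 1), (11, 10, 11, 9)]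
    cert4_11"
  by code_simp

definition cert4_12 :: cert where "cert4_12 =
  Sp 0x2d5e9 (Sp 0x256b (Ro 5 (Pt 0x4458cb1c592911c8cb139223 [Pt 0x431421a404723158e2c88b [Pt 0x46191418d60ca493 [Pt
  0x86368434a0280646924b [],Pt 0x86ca086284316900c5a49 []]],Pt 0x4479639b2e410d618acb7 [Pt 0x103e4d10b5863ad2f7 [Pt
  0x4011d06168235872b2cb [Pt 0x10c47a022c81634030b1a2d []]],Pt 0x88b18eb1cd86b0c740061a2d [Pt
  0x10c2ca06340b2830c6802cb []]]])) (Sp 0x2d7b (Ro 6 (Pt 0x111e58e6cb64c739622cb2d7 [Pt 0x2008ac30d0d9cb1161a0b [Pt
  0x811d32239c32b139223 [Pt 0x20474236808e340ca2cb []],Pt 0x10311d0616b18cb4b [Pt 0x40c16560b1ac4e4b0c2c6b2d [Pt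
  0x4192ca0794833682219b418a49 [],Pt 0x40066d08a181 [Pt 0x83ca11ad031e54003 []]]]],Pt 0x111e58e6cb9060b7 [Pt
  0x10045061a0e5611a2cb [Pt 0x4044742619c991844b [Pt 0x80e6d682ca1885941856b2d []]],Pt 0x4478ac73616b40c450616b2d [Pt
  0x106502c6b10ca0c2c6b00b4b []]]])) (Sp 139 (Ro 5 (Pt 0x111632f1c592911c8cb139223 [Pt 0x9acb262a0c508f150739622c87
  [Pt 0x88f20c74b2222c6234117 []],Pt 0x431421a404723158e2c88b [Pt 0x118591418d60ca493 [Pt 0x4315886940518494b [Pt
  0x9999e4c000c4b64d8ccb [Pt 0x46b6534170c533b342626d1a74699ca68311a5495 []],Pt 0x431d6215a007beb6ff4bfc0cb [Pt
  0x10c3194135ff5335ff537ffaa677d7ffab07ca419d0315a49 []]],Pt 0x86ca086284316900c5a49 []]],Pt 0x111e58e6c99110d618a17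
  [Pt 0x20222830d223958e2c84b [Pt 0x20288eb0c2d230c45a494b [Pt 0x430f41e4518493 [Pt
  0x4063650336543d4cd5cdabb6f54ff06287 []],Pt 0x21394044e5061e82e502cb []]],Pt 0x111632fc7164991430d0493 [Pt
  0x218a11e40458c831ca3596cc4b262cb [],Pt 0x431588694050d95871a494b [Pt 0x8ee76c5b01cd86506287361e830f28cb [],Pt
  0x4d335ca6d50564700ca5253 []],Pt 0x8b92c8684346ecb6866039b0b41c68cb []]]])) (Sp 155 (Ro 3 (Pt
  0x47365e23cb1b390e2c86c64b1c6322cb [Pt 0x1181b39638b2c6c64b1c632ccb [Pt 0x46346ce2b11658d8c8a118c87 [Pt
  0x200d9c3422c87192c463227 [Pt 0x11846ce65b2d08e52363241ca494b [Pt 0x80e3670f423a46c643d0497 []]],Pt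
  0x118022c843418a27 [Pt 0x26ecb172a1aab5cfab654459059113 []]],Pt 0x8b92c3587116411a59113 [Pt
  0x1116282acd996501115861a1cb [Pt 0x8986cb30e3189a5c46320c464c9a780c6945 []]],Pt 0x11c59061a4459062348e2c3503 []],Pt
  0x4607390e2c3438c90e31868b7 [Pt 0x200e71438b21b192c718c88b [Pt 0x20d678ba4738e8452363246b3ccca494b []]],Pt
  0x8e6cb1c64523672c45236324114b [Pt 0x8c0d9c8474363240cb [Pt 0x230367211b4363240b4b [Pt 0x2308d9c6ca11f48d8c90494b
  [Pt 0x1144f2330d9cb447c686ce3a90b3 []]]],Pt 0x102d9715a22cb1ce5c15b2994cca33 [Pt
  0x45b2e6e8556caa6fd3f6d3e2b657151a0a8fbeb67df4cffea6aba6dd76fd1473 []]]])) (Ro 6 (Pt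
  0x11cd908f21c592116321b39638b22cb [Pt 0x4736423c871648458c860cb [Pt 0x11cd908f247164b1163218494b [Pt
  0x222c641e44458c3d046923 [],Pt 0x8039b1423c2d0e2c8a1c8c89 []]]])))))) (Sp 0x256b (Sp 0x2569 (Ro 5 (Pt
  0x111e58e6c96451ce588b2457 [Pt 0x10364c739622cb2d7 [Pt 0x118d64d032f7 [Pt 0x40e400b7 []]],Pt 0x111e58e6c9910117 [Pt
  0x40445061a439584684b [Pt 0x103e4d06358d2f7 [Pt 0x207a236830f5a8dc9b33047af2fcb []]]]])) (Sp 0x2d79 (Ro 3 (Pt
  0x11c5963672c459639cb90b3 [Pt 0x47365e23cb0045061a2cb [Pt 0x40065031a10cac463227 [Pt 0x221941445033a59113 []],Pt
  0x40065031a1c64830c68b7 []],Pt 0x223cbc6ce1ac01141868b7 [Pt 0x40065031a10cac30c688b [Pt 0x81e0ce84568867433cb []],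
  Pt 0x40065031a1b1920c31a2cb []]])) (Sp 137 (Ro 3 (Pt 0x11c5978d9cb4459639cb90b3 [Pt 0x47365e23cb0045061a2cb [Pt
  0x40065031a10cac463227 [Pt 0x110b282810ca446d0864ca924b []],Pt 0x40065031a1c64830c68b7 []],Pt
  0x8e6cb1ce1ac01141868b4b [Pt 0x103065031a1c64830c68b7 []],Pt 0x111e5f8e6cb401141868b7 [Pt 0x40065031a10cac30c688b
  [Pt 0x1015067439da9a6d36a9c62a2994daa5274b [Pt 0x13534da677428992cad05942898b2b61fbba6fa9b7d4b6faa7756cd []]],Pt
  0x40065031a16c9b432e0c31a2cb [],Pt 0x1001940c686c64830c68b4b []]])) (Ro 3 (Pt 0x47365e23cb1b390e2c86c64b1c6322cb
  [Pt 0x231a39cb11658d8c8a118c8b7 [Pt 0x200d9cb1c59636324231868b4b [Pt 0x222c2d0c459031a90b3 []],Pt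
  0x200116421ac463227 [Pt 0x103d34576a1a2a2bb50cb57 []]],Pt 0x8039c87161a1c64b118c8b7 [Pt 0x231a39c85c9b4d438c902d7
  [Pt 0x40c6ce42e4da68d0d8c90468b4b []]],Pt 0x239b2f11e5a3672114363240b4b [Pt 0x20639c844683958468b7 [Pt
  0x40d8c8ad1ce43632865438c902d7 []],Pt 0x40c739088d0e32411a2d7 []]]))))) (Sp 0x2d7b (Sp 0x2569 (Ro 3 (Pt
  0x11c5963672c459639cb90b3 [Pt 0x4614459639c99113 [Pt 0x88b1588f2404450616914b [Pt 0x4000474185a0b []],Pt
  0x4235872b00474185a2cb [Pt 0x4000b1a11d06168b7 []]],Pt 0x223cbc6ce1ac01141868b7 [Pt 0x40065031a10cac30c688b [Pt
  0x2020ceb11488674114b [Pt 0x100cda5059419113 []]],Pt 0x40065031a1b1920c31a2cb []]])) (Sp 0x2d79 (Ro 3 (Pt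
  0x11c5963672c459639cb90b3 [Pt 0x47365e23cb0045061a2cb [Pt 0x40065031a10cac463227 [Pt 0x10140446d032924b []],Pt
  0x40065031a1c64830c68b7 []],Pt 0x223cbc6ce1ac01141868b7 [Pt 0x40065031a10cac30c688b [Pt 0x80833a11488674114b []],Pt
  0x40065031a1b1920c31a2cb []]])) (Sp 137 (Ro 3 (Pt 0x11c5978d9cb4459639cb90b3 [Pt 0x47365e23cb0045061a2cb [Pt
  0x40065031a10cac463227 [Pt 0x10140a1932a446d0a26cda924b []],Pt 0x40065031a1c64830c68b7 []],Pt
  0x8e6cb1ce1ac01141868b4b [Pt 0x103065031a1c64830c68b7 []],Pt 0x111e5f8e6cb401141868b7 [Pt 0x40065031a10cac30c688b
  [Pt 0x4431950a264ca510c99508da6449 []],Pt 0x40065031a16c9b432e0c31a2cb [],Pt 0x1001940c686c64830c68b4b []]])) (Ro 3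
  (Pt 0x47365e23cb1b390e2c86c64b1c6322cb [Pt 0x1031b39638b2c6c64b1c632cbcb [Pt 0x1181b3908b1d0b64da1b8718c8cb [Pt
  0x2063671422c85b26d1dae118c87 []],Pt 0x1180c3422c740718c8cb [Pt 0x1006ce284590728463227 []]],Pt
  0x8039c87161a1c64b118c8b7 [Pt 0x2068d9cb10cac6c648dd9b432a8bcb [Pt 0x8c6367210ce85b26d0dc0ce8cb [Pt
  0x818e7211b438ca393037 []]]],Pt 0x239b2f11e5a3672114363240b4b [Pt 0x20639c844683958468b7 [Pt
  0x81a367217fd6cbfe9bd7f4f5fcdebfafde1b1921b19132a2d4b []],Pt 0x40c739088d0e32411a2d7 []]]))))) (Sp 139 (Sp 0x2569
  (Ro 7 (Pt 0x111632f1c592911c8cb139223 [Pt 0x4315886801b39638b20b [Pt 0x1018e81950739622c87 [Pt 0x1018da5910117 []],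
  Pt 0x10c7423c9011824b [Pt 0x101430ce842c6906740b1a49 []]],Pt 0x431421a4046ce58e2c88b [Pt 0x11cd9085a0060cb [Pt
  0x40430b284316905940c5a49 []]],Pt 0x447978e6cb6410d618acb7 [Pt 0x8022830d08e578e2cb2cb [Pt
  0x451726d4239d20ca10f48865049 [],Pt 0x238b2022c818d00c31a2d []],Pt 0x239b2038b241868472b0c468cb [Pt
  0x2071643d639b1421e87164501 []],Pt 0x8e2cbc7361ad0c740061a2d [Pt 0x4458a06340b2830c6802cb [],Pt
  0x8e6c818d02ca0c31a00b4b []]]])) (Sp 0x2d79 (Ro 6 (Pt 0x111e58e6cb90739788b2cb7 [Pt 0x10045061a1b3978e2cb2cb [Pt
  0x118f930635832b2d7 [Pt 0x40c456186b18cbcb [Pt 0x42e2d0447d0444d94124b [],Pt 0x40d066d031ac4336830c6b2d []],Pt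
  0x8c38d7833a188674186b2d [Pt 0x8063588fac30c6b00bcb [Pt 0x106895b5788d6842b2ad028b672acdcb []]]],Pt
  0x471640459031a13920c31a2d []],Pt 0x447978e6cbe4c02d7 [Pt 0x2047908a116320e5611a0b [Pt
  0x10311d6185ac552a78aafcdfc1168b4b [Pt 0x40e9cf1b6c88dac011e3e924b [Pt 0x111e1674164439d08d6923 []]]],Pt
  0x8e6c80e2c9061a0e5611a2cb [Pt 0x40c4758616b01168bcb [Pt 0x462b94b2a2e64439423e923 [Pt 0x218a08087194124b []]]]],Pt
  0x11c59639b0d622c809c9061a2d [Pt 0x239b206342722830c6802cb []]])) (Sp 137 (Sp 0xb69 (Ro 3 (Pt
  0x11c5978d9cb4459639cb90b3 [Pt 0x47365e23cb0045061a2cb [Pt 0x23c7162ebd1164292ccdab64cd3 [Pt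
  0x222c50d034456186b4d4b [Pt 0x1130b1661a2319071ae031acd []],Pt 0x88b1b411b8cc045618688b [Pt
  0x222c5c5a0a1716845223e8432ae494b []]],Pt 0x118065031a1c64830c68b7 [Pt 0x8039c5011b5861e88b [Pt
  0x429b5d0473865d08a447d0e2c3ca494b []]]],Pt 0x239b2f1ce1ac01141868b4b [Pt
  0x9aeed76cdd4b074f7777be9955cf7d4ab1acb136a71b192cff57fa6d4c7d4dfead6527cb [Pt
  0x4736411b39015fdcba65d732eba2e9bd6fec187a2cb []],Pt 0x463065031a1c64830c68b7 [Pt 0x1006ce4046d6187a2cb [Pt
  0x214dae82367211488fa1d474f6aaf924b []]]],Pt 0x223cbf1b386b401141868b7 [Pt
  0x40abae55d2c55d37eaad6541942eb974b354daab9c432b17df72fbe6f73357736aeebde525cb [Pt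
  0x400674228575d15d732bae6d55fbec08b []],Pt 0x40065031a1d56cea9bff4df36faffe0c31a2cb [],Pt 0x1001940c686c64830c68b4b
  []]])) (Ro 3 (Pt 0x47365e23cb1b390e2c86c64b1c6322cb [Pt 0x4606ce422c50d8c908c628cb [Pt 0x40c6ce284590d8c8a118c87
  []],Pt 0x4607390e2c3438c90e31868b7 [Pt 0x1031b39638b2c6c648718c328cb [Pt 0x1000e2c843586288b [Pt
  0x8a31616829b5b4e39c842ca4719209b4b6b917 []]]],Pt 0x239b2f1c64563672114363240b4b [Pt 0x4736406ce422c50d8c9034b [],
  Pt 0x4631ce4223438c90468b7 [Pt 0x818d9cb11b58d8c9034b [Pt 0x23aa3a9bdcea6f829b5d2831a10b3a4431a19936bb917 []]]]])))
  (Sp 153 (Ro 3 (Pt 0x47365e23cb1b390e2c86c64b1c6322cb [Pt 0x8c63672c71658d8c908c628b4b [Pt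
  0x200d9c8458e85b2651198718c8cb [],Pt 0x222c34008b1d0868718c8cb []],Pt 0x8c639cb11658e32438c61a37 [Pt
  0x2063672c71658e3228718c8cb [Pt 0x238b0c68031a1c58e8431a118c8b7 []],Pt 0x238b0d0038b0b421a118c8b7 []],Pt
  0x239b2f1c64563672114363240b4b [Pt 0x4736406ce422c50d8c9034b [],Pt 0x8c68d9cb11d6363240bcb [Pt
  0x818d9cb11b58d8c9034b [Pt 0x1116c68fd156df9bef36d9b45716850ce4d69a2b653532d []],Pt 0x118c234222d0d8ca28cc1168b7
  [Pt 0x40c1a66f2deb842d034b []]]]])) (Ro 3 (Pt 0x47365e23cb46ce58e2cb1b1921c63234b [Pt 0x8c78e721164363228463237 [Pt
  0x1006ce438b21b192c718c8b4b [Pt 0x2029b4b5a367216c9b4d4363240f4b []]],Pt 0x8c68d9c8716438c868718c8b4b [Pt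
  0x1031ce438b0d0e32438c61a2d7 []],Pt 0x11161ac47960716421a1c6322cb [Pt 0x45c962ed56b00e508b211ca118c8b7 []]]))))))
  (Sp 0x2569 (Sp 155 (Ro 6 (Pt 0x11cd9623cb1c592116321b3978e2cb2cb [Pt 0x408f210d06286ce58e2c88b [Pt
  0x408f2442d0a4b185a408f1ca494b []],Pt 0x11cd9623c91c592c458c86114b [Pt 0x8e6c8238b2418a40e6c32924b [],Pt
  0x21868479011632180b [Pt 0x88b1961644458c34116923 [Pt 0x10c508690118494b [Pt
  0x117d2f965f317cdae0badb5577b861946bad72cfa62eb9f4daabb70650bbea5df4b2efa62eeaef5d4debeb55bd3d []]]],Pt
  0x4051cd8ac739238b22b1c8c85 [Pt 0x419439b25910117 [],Pt 0x8018685ca30d01c8c89 []]],Pt 0x11161a11e42721a11632038b20b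
  []])) (Ro 6 (Pt 0x11cd908f21c592116321b39638b22cb [Pt 0x4736423c871648458c860cb [Pt 0x4736423c91c592c458c80494b [Pt
  0x222c641e44458c3d046923 []]]]))) (Sp 0x2d79 (Ro 3 (Pt 0x47365e23cb1b390e2c86c64b1c6322cb [Pt
  0x4606ce58e2cb1b192c718c8cb [Pt 0x8c68d9c508b21c64b118c87 [Pt 0x803672c71658d8c908c61a34b [Pt
  0x800c684590a16cc99830ca27 []],Pt 0x20ca35b69b514caa7036323a6449 []],Pt 0x222c342e4b126940e2c910d618a1cb [Pt
  0x471641116411691725863503 []],Pt 0x106db3686d4367216c9b4d4363240bcb []],Pt 0x4607390e2c3438c90e31868b7 [Pt
  0x238b2c56e735638b1439cb90b3 [Pt 0x1028c58a40e2c9115861a1cb [Pt 0x8e2c8238b1b41ce85c9623503 []]]],Pt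
  0x8e6cbc47963672114363240b4b [Pt 0x8c0d9cb11d6363240bcb [Pt 0x4ddb62a0a6e4ce2a11b48b8c645049cb [],Pt
  0x111b58d116411a90b3 [Pt 0x473646998b6a50289e5222844f2914b []]],Pt 0x4631ce4223438c90468b7 [Pt
  0x2063672c46d6363240bcb [Pt 0x231726d4d6d999188fa46c648d35b666494b [Pt 0x1196543c73996543444e50ad94ca9ad6b2fcb [],
  Pt 0x8b65c2b2a35b69b515ad2a0b368533b4ca99594b0d6da6d452b2945 []]]]]])) (Sp 137 (Ro 3 (Pt
  0x47365e23cb1b390e2c86c64b1c6322cb [Pt 0x1181b39638b2c6c64b1c632cb4b [Pt 0x46346ce284590d8c8a118c87 [Pt
  0x803672c71658d8c908c61a34b [Pt 0x10018d08b210c68463227 []]],Pt 0x11c5963116411a90b3 [Pt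
  0x4cc94b15434dd962a868b9726a1c632cf4b []],Pt 0x11c59061a4459062348e2c3503 []],Pt 0x4607390e2c3438c90e31868b7 [Pt
  0x45279a863672c71658e3228718c8cb [Pt 0x137658b343cdd9629a1a2e5c99a1c632cf4b []]],Pt 0x8e6cbc47963672114363240b4b
  [Pt 0x8c0d9cb11d6363240bcb [Pt 0x4606ce42ed55f966aafe1b19209ca3cb [Pt 0x2063671422c86c645047a27 []],Pt
  0x111b58d116411a90b3 [Pt 0x8fe8fe7bf57c1513b4cf6a0594e6a29e554493 []]],Pt 0x4631ce4223438c90468b7 [Pt
  0x2063672c46d6363240bcb [Pt 0x223eb1a216740c6b90b3 [Pt 0x47f47f2b7eaf82a2a2962da836529a8a56554493 []]]]]])) (Ro 1
  (Pt 0x4736588f2c6ce438b21f2436320b [Pt 0x408f21b39638b21f258d8c88b [Pt 0x20d76b8aed5236721f5cfae3ebb5d723e4b118a1cb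
  [Pt 0x1023cb1b3901f258cb4b [Pt 0x1188f2f36db8a94dc3093432dcb [Pt 0x10eb6fd7e6cdbc3c6ce292d071e56125a0d8b2b2fcb
  []]]],Pt 0x81d6cea6ae754a3672c5532ba9bddffa8aeaeffd5f23e48fdf7e9aa99254b [Pt
  0x102eb65d45d77abaf439d0abab9d33eaa9eaabb5fcceadef1b38e855b2a8abbccacd []]]]))))))))"

lemma cert4_12: "check_top 5 [R1, R2, R3, R4] excluded4 roots4 [(7, 5, 5, 3), (11, 10, 6, 1), (11, 9, 4, 1)] cert4_12"
  by code_simp

definition cert4_13 :: cert where "cert4_13 =
  Sp 0x2d5e9 (Ro 5 (Pt 0x4458cb1c592911c8cb139223 [Pt 0x431421a404723158e2c88b [Pt 0x431d621680182cb [Pt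
  0x80c6d2c8a1ca0c33a457 [],Pt 0x40430b284316905940c5a49 []]],Pt 0x4479639b2e410d0628b7 [Pt 0x10045061a11cac311a2cb
  [Pt 0x11864443d032917 [Pt 0x21b3a115c9810ca33 []]]]])) (Sp 0x2569 (Ro 6 (Pt 0x111e58e6c96451ce588b2457 [Pt
  0x407914739622c9257 [Pt 0x101591c05277 []],Pt 0x111e58e6c9910117 [Pt 0x40445061a439584684b [Pt 0x101c6a406340b7
  []]]])) (Sp 0x2d79 (Ro 9 (Pt 0x191c738cb1364946c8cb1ce49257 [Pt 0x191011b232c458a27 [Pt 0x6474054614957 [Pt
  0x19318c037 [Pt 0x10c7d086940508f411a493 []]]],Pt 0x1914738cb1364918497 [Pt 0x191501c61277 [Pt
  0x10c6d0869501508b411a725 []],Pt 0x10c5085a701c738c5626c85a525 [Pt 0x191058d03290127 []]]])) (Sp 137 (Ro 3 (Pt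
  0x11c5978d9cb4459639cb90b3 [Pt 0x47365e23cb0045061a2cb [Pt 0x40065031a10cac463227 [Pt 0x8859430311b5832b34b [Pt
  0x405022651a4604b [Pt 0x23526cdb0518866d2026516924b [Pt 0x106532bb728366caf065c5a065cb64da34de6f76bb4d34d []]]]],Pt
  0x40065031a10cac30c68b7 [Pt 0x442ca1a06236877399d0dea34b []]],Pt 0x8e6cb1ce1ac01141868b4b [Pt
  0x2060ca063436322830c68b7 []],Pt 0x111e5f8e6cb401141868b7 [Pt 0x40065031a10cac30c688b [Pt 0x110b282810ca446d60ca17
  [Pt 0x818181a6d5998d7 []]],Pt 0x1001940c68432b0c31a2cb [Pt 0x10340c46d60cacd7 [Pt 0x10651a1b192469b526e11f48319d449
  []]],Pt 0x81cd97a05b2e664d68d8c868db68c5366b357 []]])) (Ro 1 (Pt 0x4736588f2c6ce58e2cb1f258d8cb0b [Pt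
  0x408f21b39638b21f258d8c88b [Pt 0x10073907286c9638cb37 [Pt 0x111e41473961ce80e3217 [Pt
  0x1023c941e3581b9464d0d8c894b [Pt 0x102a9575caeae6aeb6d4cabb3808728b26846289cb []]]],Pt 0x100739622cb1b241ca37 [Pt
  0x103416358e2cb1f240b4b [Pt 0x40be975db2baa2baafddfaf5f9c65b72ac0f9214cad954576ada49cb [Pt
  0x118702bfb9b5d76abfa2bfbbb55fcf2eb7791c8685557caaa9beafb79254b [Pt
  0x45278686e2bbead95df54577d56ba795df536bb0518d68ba6575db2fee9abbbedff4dec0b231acbf7 []]]]]],Pt
  0x4736588f2038b21f258d8c88b [Pt 0x1010e508b21b258e3227 [Pt 0x81161eb0e7588b2c6c902d7 [Pt
  0x4574ae59ee6d6da5561a2aab9554b37d4adbc0b2b1f24176632a34b []]],Pt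
  0x4736588f2507eefd3777e991f242faab97d5517d55dfababdf91cb [Pt 0x80e1b2b1164364857f572bfaa2bfabbd7f57be6f7e457 [Pt
  0x40aee675cebe8ebe6d3a6ddf9c18d0aae9b7775d76effba9faebabb77fdd2caaea7f5f91f242b9515dada49cb []]]],Pt
  0x11cd9623c86ce58e2c80d8c88b [Pt 0x4051b39638b20363214b [Pt 0x809adb4cd723422c839d0e3227 []],Pt
  0x239b2c47920d6da66b948118a24b [Pt 0x80a39c8cce5315ce90d9438c897 []]]])))))"

lemma cert4_13: "check_top 5 [R1, R2, R3, R4] excluded4 roots4 [(5, 3, 2, 1), (11, 10, 6, 1), (1, 1, 11, 10)]
    cert4_13"
  by code_simp

definition cert4_14 :: cert where "cert4_14 =
  Ro 7 (Pt 0x4458cbf1c592911c8cb139223 [Pt 0x9abfaad5fd4b2bee62beeb5f5e0c508f150739622c87 [Pt 0x44790a4b666e95910117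
  []],Pt 0x431421a4046ce5e38b224b [Pt 0x2335dab4cd32a830ca1ce40ca1c8c89 [Pt
  0x23abe9d5f6da9aed7fd36bfeafd7e0c6d3c8a39c830ce9457 []],Pt 0x10c7588f24611814b [Pt 0x1018da5910e5611a17 [Pt
  0x89896dd7879140457 [Pt 0x10965199be3304b65934007 [],Pt
  0x8ebb9d772aaea62aaeafb75d36fafc23c8337c66116323336c98cc7aaf53c554f7aa5560b []]],Pt 0x21896508f2096508b190d2ed3630b
  [Pt 0x88f23f5f966ab95537f72623c3422cb2d7 []],Pt 0x10c6d623c91846094b [Pt 0x4618fa5910e5611a17 [Pt
  0x46293c5062f8d0a4b18a1e32cb [Pt 0x9a66fb4b30e99aa56cdbaf9d91418ed0cd9e32e493 [],Pt
  0x4736432cbb4c06595f2ae0c739b40b4b [],Pt 0x111e1e7404590a4f11a13921496311a2d []],Pt 0x26999ed737885a791430d622893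
  [Pt 0x23ae75dfe98faad6fd36bf07c59436b1982f650e7266fb31b8363ca2cb [],Pt 0x1188694050c7287ba657df7ba657e49cb [Pt
  0x10c6cf9423c8367ca11632065f2a0e2b3a0b []],Pt 0x10a6d7ca6842c69c08694474149 []]],Pt
  0x10c7d623c82af9ef756eac22c64372ed3630b [Pt 0x134c52b6a869e575ac9a7a62a9677777fa9bd4eef06664f26cd3 [],Pt
  0x439b1a0f2284682e31a493 []],Pt 0x223cbc31f4b2221e3588b217 [Pt 0x8149e280a4b18a06b3c4f698b4b [],Pt
  0x473626bc478a9591418d02ca457 [Pt 0x114c56b1b86e540159ca0e46836728cb [],Pt
  0x2146854a78b825646635964c4c1c8d1feabfd4f17552b7faa5d562cb []],Pt 0x447978e6cb9c007 [Pt 0x401861a0e505c7a0b [Pt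
  0x811d032a0719423683 []],Pt 0x4063593404c6b26809899f268b4b [],Pt 0x478c00e508e83 [Pt 0x83284340071941715a0b [],Pt
  0x419423d93403d9340266b268b4b []]]]]]],Pt 0x10c50869011b3978e2c88b [Pt 0x4738a1555df9b5773575fdb2639c830ca2d7 [],Pt
  0x431d62169184604b [Pt 0x406369910e5611a17 [Pt 0x22e5b375859140457 [Pt
  0x475ceb61b580c0feeee7f776cf72ceffa65dcdbbaf02cb [Pt 0x4ddb616611419be2cc0ddb6262cc7fea6ffa7bff4dffab7fd8cb []]]],
  Pt 0x88a0c6d322239588b217 [Pt 0x45dcb9644b6ef611d0c0b96c2c93302cb [Pt 0x86259b4228259b406976d98263ca8cb []]],Pt
  0x887af1cd93222163588b217 [Pt 0x22baee575cb6ffa8eef9ef4dbec7ffee8ffaefbfff75aaff2b22831e842ca493 [],Pt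
  0x23fb9fdc67a9eff32ed88a591418f43b9cb6aa39bf4b7abf6493 [Pt 0x26edb0b36315ca5950dc16b285c96532c9b838f28cb [Pt
  0x2152d9b60fbbe33eeb5ccef3c8a3ae9aaa5bf5b7ebdcdfb08b2457 []]],Pt 0x442b58e6cb9c007 [Pt
  0x1005c9650ed061a0e50e516268cb [],Pt 0x231c592c00e508e83 [Pt 0x419421a0038ca099f268cb []]]]]],Pt
  0x111e5f8e6cbe410d0628b7 [Pt 0x10045061a11cac311a2cb [Pt 0x21b2b13645d6c9810ca33 [Pt 0x10c56340c3e56334b [Pt
  0x8fa8b657e99f4dc21a59140493 [],Pt 0x885a065c9af9344464d0336b2f7 []]]],Pt 0x401141868472b0c468b4b [Pt
  0x118e6c4b5a23ac5c96536dab11ce85c96516da8d4b [Pt 0x4572b62e096348ae52da2e0672348e2c8568391a44b [],Pt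
  0x204d916d6b260433a33 []]],Pt 0x401141868472b0c468bcb [Pt 0x22e5b0b41172590b41b291718c8d94124b []]]])"

lemma cert4_14: "check_top 5 [R1, R2, R3, R4] excluded4 roots4 [(5, 3, 2, 1), (11, 10, 11, 9), (11, 10, 4, 1)]
    cert4_14"
  by code_simp

definition cert4_15 :: cert where "cert4_15 =
  Sp 0x2569 (Ro 5 (Pt 0x4458cb1c592911c8cb139223 [Pt 0x431421a404723158e2c88b [Pt 0x1186450635832893 [Pt
  0x221a0c6d2c8a39cb0c33a457 [Pt
  0x111ca1ffd4fd2ebe6df5dcffea7d6dc0faba3eae67d5ddaaeadd6f4450fbaa7bfa6f7f5cfbaadd6d4bd []],Pt
  0x4736422340234066d5998cb []]],Pt 0x4479639b2e410d0628b7 [Pt 0x10045061a11cac311a2cb [Pt 0x118564710f40ca5277 [Pt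
  0x8088a0d9d223e5044b []]]]])) (Sp 0x2d79 (Ro 8 (Pt 0x1911ce32c4d921b232c739227 [Pt 0x6470146c8cb1ce49257 [Pt
  0x64442d623c843586284b [Pt 0x6450c34118497 [Pt 0x11336da9843d06ca80639411e89 []],Pt 0x6410f588f2c063a2cb [Pt
  0x223c800c3418e2d07368b3 []]]],Pt 0x1914736588f24435862914b [Pt 0x1906310b5863a2cb [Pt 0x20288e830d28e72c31c6913
  [Pt 0x10594215a443282046ce89 []],Pt 0x6446043d044b [Pt 0x6450c342369023a497 []]],Pt 0x2042d2228239b1589b21689 [Pt
  0x32221635832843d044b [Pt 0x833a0a219d061a50113 []]]]])) (Sp 137 (Ro 3 (Pt 0x11c5978d9cb4459639cb90b3 [Pt
  0x47365e23cb0045061a2cb [Pt 0x40065031a10cac463227 [Pt 0x8c2810ca446d60ca24b [Pt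
  0x22896cda8512c6568144b19560b19532d [],Pt 0x833a0a038d28319d449 []]],Pt 0x40065031a10cac30c68b7 [Pt
  0x40b93685b528e7211488674117 []]],Pt 0x8e6cb1ce1ac01141868b4b [Pt 0x2060ca063436322830c68b7 []],Pt
  0x111e5f8e6cb401141868b7 [Pt 0x40065031a10cac30c688b [Pt 0x118419d08a4433a15ca58a6536b914b [Pt 0x80a0433a447d611a17
  [Pt 0x22e4b0cfac19f4a2e4b0cbe81932e4d2c05916913 [Pt 0x214dae52d099b7c9af469b5ca5a1a6d6c9b4cde84da65766353cb5 []]]]],
  Pt 0x1001940c68432b0c31a2cb [Pt 0x118d8c920cac46d20c65449 [Pt 0x234da610cdaf064ca11f5a0c67532d [],Pt
  0x8c22b65734da6d4b08e90594124b [Pt 0x10146ce19d040497 []]]],Pt 0x1001940c686c64830c68b4b []]])) (Sp 153 (Ro 3 (Pt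
  0x47365e23cb1b390e2c86c64b1c6322cb [Pt 0x8c0d9c8458a1b192c718c8cb [Pt 0x818d9c508b21c64b118c87 [Pt
  0x83286c64b036323a1b386541 []],Pt 0x11b194543672d16c9b476a1b38eb90b3 []],Pt 0x8039c87161a1c64b118c8b7 [Pt
  0x8c6367210ca1c642d0328cb [Pt 0x20639c847438c9037 []]],Pt 0x47365e38c8ac6ce422860cb [Pt 0x2063671422c839584687 [Pt
  0x41943632581b191d0d9c6d41 []],Pt 0x40c739088d0e32411a37 [],Pt 0x8e322b1cd968e723719369a871921cd8a37 [Pt
  0x103632583286c64343671d41 []]]])) (Ro 3 (Pt 0x111e5e39b2d1ce422c87192c463237 [Pt 0x40c6ce438b21b192c718c8cb [Pt
  0x231b192d0650e3258d9c541 [Pt 0x115dcae65745776b9a1b192d547fdd5cffba99ff754ffd75dffae9b5561c64bdcd6da654d3534d []]],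
  Pt 0x2063672c71658d8c908c61a34b [Pt 0x103063422c8431a118c8b7 []],Pt 0x4478af1b192d038c9639c541 [Pt
  0x1065623cb46ce421a00cb [Pt 0x1031ce423681940d7 []],Pt 0x46c64758e321af1b390d8ca26803cb [Pt
  0x2078e721b1944c681940f7 []]]])))))"

lemma cert4_15: "check_top 5 [R1, R2, R3, R4] excluded4 roots4 [(5, 3, 2, 1), (11, 9, 6, 1), (11, 10, 11, 9)]
    cert4_15"
  by code_simp

definition cert4_16 :: cert where "cert4_16 =
  Sp 0x256b (Ro 1 (Pt 0x4736588f2c6ce58e2cb1f258d8cb0b [Pt 0x408f21b39638b21f258d8c88b [Pt 0x10073907286c9638cb37 [Pt
  0x1023c91b39607c96363224b [Pt 0x101c478e4d61f28638c897 [Pt 0x44790fc7390d76b653581c62b95b29acbf7 [],Pt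
  0x85364c142e5364c23c2d21c8f423223 []],Pt 0x80a3672c3939482c5a059ca91cb [Pt
  0x852caed741da2d9a751a595dae83abaaf5d2ceaea6f5d9f1b96e549a0e47a7495 []]]],Pt 0x100739622cb1b241ca37 [Pt
  0x40c163582cac7c902cb [Pt 0x408f2c631f240cb [Pt 0x111e4318c6c9638cb2d7 [Pt 0x811e5a30d8cac7c96334b [Pt
  0x106bed4d715ad0de50ad9515ca8ed68e48391da33 [],Pt 0x223c86a3495b33057daeb4478d64d072d7daeb357 []],Pt
  0x201d8d61cd6861c8ad06c6b2d []]]]]],Pt 0x4736588f2038b21f258d8c88b [Pt 0x1010e508b21b258e3227 [Pt
  0x40d155caa59eaeddd88b2d1b258cd7 [Pt 0x207364e314961a466b2c55996457 [Pt 0x20f2b0a039f4a3920e336913 [Pt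
  0x44585e82a01d934e3e4b08b1a474b [Pt 0x10b8cd92d03b18d2a16cd92d073e31a70e335a0764c6945 []]],Pt
  0x41e50b945c79581728b93cac38f285ca38f2b2d []],Pt 0x80e31c588d23e4b0651a49cb [Pt 0x4736414158cc38b15c8f92c462894b
  [Pt 0x4393259cc1c364b3983e34a1c67d0e2c566e49 []],Pt 0x239b20a31c8a47c90494b [Pt 0x44585e82a03d9538f920d6329474b
  []]]]],Pt 0x8e6cb11e58c722b1f240cb [Pt 0x40c365622cb1b2422c73a37 [Pt 0x8328dda2bb6d60dda2bb33ac7241cda33 []],Pt
  0x4736588f271ad9547aaef5537ddeab9e4726b6550ae54576ba454b [Pt
  0x40546b653285775feeebbf5754fd5d5dfabab657791c9ad94ca16b9535dada477 []]]],Pt 0x238c3423c91b39638b20363224b [Pt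
  0x11cd9623c8d6da6698d0e2c80d8c88b [Pt 0x1010e5622c83650e3227 [Pt 0x135b699ad8ca0a6db337cac21b19423223 [Pt
  0x10345dddcb6eaad7d7ccd7d7db6ea96556fac34caac5fff2caea5d754cfffd5b7aaae574defb0e32cd7 []]]]]])) (Sp 0x2d7b (Ro 1
  (Pt 0x4736588f2c6ce58e2cb1f258d8cb0b [Pt 0x408f21b39638b21f258d8c88b [Pt 0x10073907286c9638cb37 [Pt
  0x23632c163438cb188c8391a2d [Pt 0x40d118ac62595398a5bd4334b [Pt
  0x43e55c2ffa59d4fab98faba37b79aafad57ccdfdd7daaf99ffd55bfbb0babeae955f5defeabff5d5ccffd7575ba9955f6f06508cb2d3 []],
  Pt 0x408f2c6ce58c3e561b1accb [Pt 0x81a3df6cfba9bdf618f92c462b34b [Pt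
  0x202ecb2b2cda1eca1965659b456ca66ed95d77eaf783915acd []],Pt 0x10346ce58c6334b [Pt 0x2022d971435f26e46363214b [Pt
  0x103671f1674a1bca1b3859d22d970ca0e47691 []],Pt 0x2303672c05f2594363224b [Pt 0x80a39cb116412c8d027 [Pt
  0x88f20e36b66d33606097 [Pt 0x8aeee5777377dacfae5b737f0d51ce435dade53581bb735929acbf7 [],Pt
  0x10a6f26062d285ca6f2608723f41ca23 []]],Pt 0x202303118a14b [Pt 0x1023c943d93581ad93da66118a1cb [Pt
  0x408f270de4d042d8ac9a118a254b []],Pt 0x405f2565687b368697caed1abaff7d73ffaaff7d83917acd []]]]]]],Pt
  0x100739622cb1b241ca37 [Pt 0x40c163582cac7c902cb [Pt 0x408f2c631f240cb [Pt 0x111e4318c6c9638cb2d7 [Pt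
  0x2068c478ac7c96334b [Pt 0x835f6a6b8ad686f28d7da9a8ed68e48391da33 [],Pt 0x111e41c6be57432b2b3323648396b1a497 []],Pt
  0x201d8d61cd6861c8ad06c6b2d []]]]]],Pt 0x4736588f2038b21f258d8c88b [Pt 0x1010e508b21b258e3227 [Pt
  0x2062ae54b353d6347c960cacb4b [Pt 0x40502e4b0d23e48716191a494b [],Pt 0x40518e2c860ce894b [Pt
  0x471619c68638b1c6838b58719b42e4b0c6b2d [],Pt 0x84cb8d0c1971a0e2d61c66d0b92c319b2d []]]],Pt
  0x8e6cb11e58c722b1f240cb [Pt 0x40c365622cb1b2422c73a37 [Pt 0x8328dda2bb6d60dda2bb33ac7241cda33 []],Pt
  0x11cd9623c946d951fbbf4dddfb991f23650febb9fd747f5ddaffbbdd91cb [Pt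
  0x11871ad95d1fbbbf747f5dfbb6d64726b65742b9515dada454b [Pt
  0x40546b652ca1575afeaed7554d75576baabe55e4726b652ca16b9535dafa477 []]]]],Pt 0x11cd9623c86ce58e2c80d8c88b [Pt
  0x4046ce58e2c80d8c84b [Pt 0x47187a08c0118a24b [Pt
  0x40e30ad68abe96d55aab99aabbb55b6ad873ad1fd5b3fa99afaef5b7b0e32cd7 [Pt 0x818e30ac6b1a2ad953353b43632cb4b [Pt
  0x10311641f1ac367d08cb2d3 []]]]],Pt 0x47185ac4790d9c8d6da66b948118a24b [Pt 0x4051ce46b6d335c8d223c3d0e3227 []]]]))
  (Sp 139 (Sp 0xb6b (Sp 0x2569 (Ro 6 (Pt 0x111e58e6cb90739622c8b7 [Pt 0x8022830d0d9cb1161a2cb [Pt 0x118f930635832b2d7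
  [Pt 0x103114186b18cbcb [Pt 0x8d32d2d05769add066d0d32a7369adc43368314cab4da6bd3d []],Pt 0x1011a446d0623480651a44b
  []]],Pt 0x111632f1c592910c3422923 [Pt 0x218a10d2023672c446924b [Pt 0x431d06ca006ce410b []],Pt
  0x218a10d2023672111a48b []]])) (Sp 0x2d79 (Ro 6 (Pt 0x111e58e6cb90739622c8b7 [Pt 0x8022830d0d9cb1161a2cb [Pt
  0x430b588e9911c8cb10ca23 [Pt 0x10c504046124b [Pt 0x800f2818f40ca0c31e89 []],Pt 0x8c2236823488e34124b [Pt
  0x404f2b64c36561c6b2d7 [Pt 0x1013c8d6871686219f432d []]]]],Pt 0x111632f1c592910c3588a23 [Pt
  0x218a10d2023672f111a24b [Pt 0x10c7586ca006ce410b [Pt 0x2031b40b2a00c33a47 []],Pt 0x4445a0a0431a446d031a49 []],Pt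
  0x218a10d2023672c44688b [Pt 0x11116820431a446d031a49 []],Pt 0x88f1d78e2c868086911d049 [Pt 0x82ca11e4885940c690124b
  [],Pt 0x20c68dd96d1326b64c08da33 []]]])) (Sp 137 (Ro 3 (Pt 0x11c5978d9cb4459639cb90b3 [Pt 0x47365e23cb0045061a2cb
  [Pt 0x20458eb4458995031ac432b118cb37 [Pt 0x8c033a11640463227 [Pt 0x231e8eaa754b35736aedbf83e568118cb2f7 [Pt
  0x81a30f91ad11638f423186b2f4b [Pt 0x4046764c043586288b [Pt 0x41db73072e4f2adc19d05caed3654df0676329b2f3 []]]]]],Pt
  0x118065031a10cac30c68b7 [Pt 0x8039c5011b5861e88b [Pt 0x2029b5d38e7210ca438d60ca17 [Pt
  0x45729629ed66e1a99d6d2e2e5c339b56998433a509b4dad330477 []]],Pt 0x408595a2264ca115886740d7 []]],Pt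
  0x8e6cb1ce1ac01141868b4b [Pt 0x463065031a1b194329830c68b7 [Pt 0x1006ce4046d6187a2cb [Pt 0x80a308d8c90494b [Pt
  0x40536b69473902ca438b5833a17 [Pt 0x2078b65c3ce8367d60265c68d7 []]]]]],Pt 0x111e5f8e6cb401141868b7 [Pt
  0x45729666d58329c75ce96799d5c164493 [Pt 0x80e35e1328d0d11328d061acd4b []],Pt 0x1001940c68432b0c31a2cb [Pt
  0x2042ca419d1a99b36a64604b [Pt 0x118d066d08eb0356663cb [Pt 0x40f030e5611acd7 [Pt 0x4610219f480996c6917 [Pt
  0x81b5935e8319b1684335ad00acacb57 []]]]]],Pt 0x1001940c686c64830c68b4b []]])) (Ro 1 (Pt
  0x4736588f2c6ce58e2cb1f2436320b [Pt 0x408f21b39638b21f258d8c88b [Pt 0x204796367203e4b118accb [Pt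
  0x223c82845ac39d08f0d0e3227 [Pt 0x408f24606363214b [Pt 0x230817f72fee2feefd57dec8c46289cb [Pt
  0x45278687a2ab955cfdf7e682b6cc6b1755cbaae2eaad3dff9b61b186b357 [],Pt 0x408f2f18c7fefb5d3eb0cd4b [Pt
  0x40d9c7ceb50de50e71f3af0af55f6e65d4fb08cb33 []]],Pt 0x20286b28231690f9411e91 []]]],Pt 0x2047963672c722b1f240cb [Pt
  0x408f2d1532abad95dd45575caeeaf54deac31f258cbcb [Pt 0x206873684786b422d046b2d []]]],Pt 0x4736588f2038b21f258d8c88b
  [Pt 0x11cd9040e2c87c96363224b [Pt 0x44587a0e057dcaf966ee7b91f258254b [Pt
  0x238b21572a59a95ac52588cc2fab97d4b3f75deb6f6c7241b3a33 []]],Pt 0x88b0b588f241fbbf4dddfa640fbb9f747dddaaabd91cb [Pt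
  0x238b23768aedd63911a0db9515caeb1c9073a33 []]]]))))) (Sp 0xb5ab (Ro 1 (Pt 0x4736588f2c6ce58e2cb1f258d8cb0b [Pt
  0x408f21b39638b21f258d8c88b [Pt 0x2063672c63e4b118accb [Pt 0x88f20a39c8394691b258e3227 [Pt
  0x20479280ab2d28f92c478a5ca454b [Pt 0x207c9286b2821b287c8fa49 []]],Pt 0x1023c91b39606363214b [Pt
  0x44790711e1ac3e50a4f3526d330e3217 [Pt
  0x1023cbd157f72afee2afeed7ddf7ec376b8d9ac5d75cbaeb8baeb975d5fa7bf61c66e56ca6b354b []],Pt 0x408f2d1b38e56346b95c33cb
  [Pt 0x811e4a02d8d280591a454b []]]],Pt 0x2063672c722b1f240cb [Pt
  0x2047928c5fd32bba6d776feaa2bbaedfd576bc8c7ff7cffe9feabb56454b [Pt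
  0x111e41c5dd752ffbae575cff736ebaa65ff760ad8da591b258e3217 [Pt 0x101728b26950f9d0728b269472411e913 []],Pt
  0x20479231c8a40494b [Pt 0x81f24a87ce86c92873a1f22945 []]]]],Pt 0x4736588f2038b21f258d8c88b [Pt
  0x44585a18ab952cd4b438b2c7c963632cb4b [Pt 0x10118e2c86363224b [Pt 0x239b21a15f6a1a12ce5432d4b [],Pt
  0x11cd90518e2c7290176ae49cb [Pt 0x239b21a16b28682cd9432d4b []]]],Pt 0x111616b11e5a6ed15da8722b1f240b4b [Pt
  0x88f21865da6edd0e446b1b2411a2d7 []]],Pt 0x11cd9623c86ce58e2c80d8c88b [Pt
  0x8e6c838d9cb1577777aa6df75ccdf75cb7ab283ff5db7feb99aeae59f6474b [Pt
  0x239b20e88c3d0beadb7756a66ad9d775bff2a0755cb2a7d5ccfff5b2af94954b []],Pt 0x239b2c479236723599b9548118a14b [Pt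
  0x102e4c5b2b4554b6bad7ccd7ddea674f0e6c758eeea7774cf75dceee9b555aac38cb2d7 []]]])) (Ro 1 (Pt
  0x4736588f2c6ce58e2cb1f258d8cb0b [Pt 0x408f21b39638b21f258d8c88b [Pt 0x2063672c63e4b118accb [Pt
  0x10159af0e7423c566b472588cb2d3 [Pt 0x21dacb43c694b4347c8a94b40b2b2f4b []],Pt 0x811e48e70f5818d8c894b [Pt
  0x117dd72fbae2fbaef55db7ec1c55cab9abb56d08f0d21463423223 [],Pt 0x1023cb46ce58c633cb [Pt
  0x115d32eaab97dd5c5d557deee997dd57bbb07577bbdbcddb9af936985df4bbe79eaaed5f573bfbbf7db4574cbaaae5f75717555f7bba6d5557bbb047acd
  [],Pt 0x203abbddede1aca177d2ef9e7aabb57d5cefeefdf6d15d32eaab97dd5c5d557deee9b5554beeb047acd []]]],Pt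
  0x2047963672c722b1f240b4b [Pt 0x40c631f240cb [Pt 0x811e4a31755ccaba6df5daaaaa2aebb55556dbec8cf7de8ab69254b [Pt
  0x118418cc0da591f242bad95d4575debbb76bd91cb [Pt 0x101c19ca60af8db9646c90ab6553576ad6917 []],Pt
  0x2047978f91ca1a2f9450cf4b []]]]],Pt 0x4736588f2038b21f258d8c88b [Pt 0x8e6c867bbcb152d0e2cb1f258d8cb34b [Pt
  0x10118e2c86363224b [Pt 0x8e6c86857da8684b3950cd4b [],Pt 0x8e6c828c7228609cb [Pt
  0x11ee7577b0babaed55776fe8aab96d55736fff2a2efb977db3ccebaedf5ddeff1bb2c525b33287ce85d5d76aabbb7f4555cb2eaa6dffe49
  [],Pt 0x47b9d5dec15177dcbbed9e675d76faeef7f83634a1f3a17575daaaeedfd15572cbaa9b555e49 []]]],Pt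
  0x239b2c47966ed15da8722b1f240b4b [Pt 0x47364141eebbdd4dd5deeb9e47c91aabb554d55caebbe49cb []]],Pt
  0x238c3588f21b39638b20363214b [Pt
  0x8be8b7b99ee5a359e29a5d1ce58efaeaef54dfbfaa67efea9bd537ab388f0b46bbbb6d77731ff5cde9bd94957 [Pt
  0x11b190ab654cd4f58d8c2d1bfafaa9757573aaf77dfccdfd7d56cea9d7d5b17fdfd2abaed5d6faef98fbfee67d5ccfa9bf761c587acd []],
  Pt 0x11cd9623cb17d2cb7d337d326e1c5962ad953352d0cb4b [Pt
  0x22fee5fcc5fdb7eaaf61dccef733dcf5fa2beea9975cdafff7533ffdd4caaefdf5eb08b2f4fd5556dfaaaa66feaab67d4fb0e32f377
  []]]])))) (Sp 155 (Sp 0x96b (Ro 1 (Pt 0x4736588f2c6ce58e2cb1f2436320b [Pt 0x408f21b39638b21f258d8c88b [Pt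
  0x206367203e4b118accb [Pt 0x1023c918fae7d71f5daeee4636321cb [Pt 0x408f2d16cb8ac68d9c728462b2d4b [Pt
  0x20787ce84786b439d08cb2d3 []],Pt 0x118f1b38e56347ebb54fc3632cd4b [Pt 0x10293c348d9c829ce646094b [Pt
  0x10293c2d28d9cb09f2901f2a474b [Pt 0x11ebe95bff55ebe9bff582f9d786ce468478be75a39c728cc11dacd []]],Pt
  0x2047968c68458d0d8cb2d4b [Pt 0x2078735a11e1ad08ad08cb2d3 []]]]],Pt 0x2063672c722b1f240cb [Pt 0x408f2c631f240b4b
  [Pt 0x811e48f1c590f92133b6551ddab691cb [Pt 0x4070d650e72472411e913 [],Pt
  0x4635177d6cbbea2efae5df56a58cec146b455ddb2aee8abbbb7574b657b0cdcb [Pt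
  0x40a4f0d28177cceddf4ddf3cfa977cdfb2390b42bad95d4f5d2ad954ae9bd9254b []]]]]],Pt 0x4736588f2038b21f258d8c88b [Pt
  0x4040e2c87c96363224b [Pt 0x239b20a3175cba59ea7a47c96054b [Pt 0x202a39b141cda51c906ce913 [],Pt
  0x239b218baae5d52cff52b7b0e2c46b1f258cbcb [Pt 0x10a2d0d172d9ab2cc1b1ac366d0b92c319b2d []]]],Pt
  0x239b2c47966ed15da8722b1f240b4b [Pt 0x118cdda2bb7438b2c7c9034b [Pt 0x1034dda2bb2ca11658d921cd8da37 []]]]])) (Sp
  0x2569 (Ro 6 (Pt 0x11cd908f21c592116321b39638b22cb [Pt 0x11cd9623c91c592c458c80494b [Pt 0x239b208e2c906291814b [Pt
  0x135dad86d7415da69dc7363687362995a69d1c591b418a65a69515 []],Pt 0x1116320f223919046923 []]])) (Ro 1 (Pt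
  0x4736588f2c6ce58e2cb1f2436320b [Pt 0x408f21b39638b21f258d8c88b [Pt 0x20479239c2d1a99ddfb8eed54c8f92c46289cb [Pt
  0x1023cb1b39631f258cb4b [Pt 0x20479280aecd2809926925cb [],Pt 0x1023cb46ce58c632f4b [Pt
  0x23670b2863671b16508f0b588c8397262d [],Pt 0x20b26185b164c23c2d62320bb7262d []]]],Pt
  0x1023c91ce1685f32bbe6d776feaa2bbeedfd55af20554cab65751576fab649cb []],Pt 0x8e6cb11e407164390d0d8c88b [Pt
  0x239b20a07555ceaa967bf96f91f258d8c874b [Pt 0x118702bae574b3f53d283f773ee631f76c99154b [Pt
  0x1039b2550f959aeaa67d5ffaa59aeaa567d90e51aeba99553baea6fcc775d5b3956477 [Pt
  0x814962f9d6e2eee5dcb15f729e5c22cb46c963faadf36ae66f9b57b2f7 [Pt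
  0x22bfaae57f54b35fd572a9e37ebf8555caa966aa595c672ca2bee57cb1df727936b8557fdcaaff966fffee5774afeedf4dbee57f917772ee58afb94f1b5c3921
  []]]]]]])))) (Ro 1 (Pt 0x4736588f2c6ce58e2cb1f2436320b [Pt 0x204790d9cb1c590d90d0d8c88b [Pt
  0x20479239c2d1fb6fdcd54c8f92c462854b [Pt 0x107bbbddcd777bb9946ce42fb97dc5f76fba51827cb [Pt
  0x205572ab8aae5571a5436747faab9fd54c9bffb9fd55daa67591b38a342eaee555cca8babbbdd7779bd91 []]]],Pt
  0x8e6cb11e407164390d0d8c88b [Pt 0x204585a50e508b21b258e3227 [Pt
  0x11cd91eeef72cf772e6506febb7f4b15f4f6c8f923fd5dfea59feaed36ad9274b []]]])))))"

lemma cert4_16: "check_top 5 [R1, R2, R3, R4] excluded4 roots4 [(5, 3, 2, 1), (11, 9, 6, 1), (11, 9, 4, 1)] cert4_16"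
  by code_simp

definition cert4_17 :: cert where "cert4_17 =
  Ro 1 (Pt 0x4736588f2c6ce58e2cb1f258d8cb0b [Pt 0x408f21b39638b21f258d8c88b [Pt 0x10073961cac6c9638cb37 [Pt
  0x20234a0b1a1bbebbd5556efa67f5947c978d8c894b [Pt 0x2056ca8afb56e1f28ccd95357e0b3942be542dab73d [],Pt
  0x2022d230e51691824b [Pt 0x818336506b2b1b258e32cd7 [Pt 0x20165b2e9d032db6574e8c3aebabed757f5cebaea6fdff79274b [Pt
  0x406cda7058ed02cd96d381ee5d6cba6f737fe9df649cb []]],Pt 0x818724f58d1b258e32cd7 [Pt 0x203e34e0ec682edf269c609cb [Pt
  0x118d0762d0c7c905c68cb [Pt 0x857ca5b341f035f296d34b872e5633cb2ca69177 [Pt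
  0x8df2c65d32ea75e0a87db3eef56bc1f18f4e357cbaf4b6e552ec37c98c969c9 []]]],Pt
  0x4614162b585da4ad280babead6df7ff52eafa9b5dd7e49cb [Pt 0x40540d4a56d34e1b15a1afffa9d5f536bffe9bf75f9257 [],Pt
  0x2354b6ab595555fef0546bb529da1fba55cadfb99579c3b7cae0aeb99df7effa575cdaeea6ff759253 []]]]],Pt
  0x111e4108b5873a038c87 [Pt 0x1023c91e07c96363224b [Pt 0x1030ce5c506b2b18cd7 [Pt
  0x4073a7078f46db735cce0b2bed58d8c89cb [Pt 0x408f25187cb6946094b [Pt
  0x404f3595e33cad6d41fcaf09653ce5dc3dfd6cabfaaf7f5defeaddf7b357 [],Pt 0x463c33971f58737ad0e96fd3cb6757f0cf7 [Pt
  0x115cae2b5b5ad0cf1d934b8ad95c56b6becd07438f58319ecba4953 [Pt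
  0x26db714f164c1515d56caeab9afbb59d7d3dffa55f73bab5de058b4e2315c33db95c569c9 []],Pt
  0x4478a1a7b5cad6b40d5adabe5d537bf785d2debb92b2e9b7d7fc232cd3 []]]]],Pt 0x20479286c9ac0768b668462894b [Pt
  0x44639456838a4cdda4ad08f0d28722b423223 []],Pt 0x461c61d76bdd9bd3ca06965b6ae457 [Pt 0x103c26726d417365685b195634bcb
  [Pt 0x10b8d07ce9d0991a0a872646827ce9525 []],Pt 0x811e4a311e2946094b [Pt 0x87ca0b81b6d733a30e96f6ceb6e51d7 [Pt
  0x2069ed7caeb70de741335957e17c594232f373 []],Pt 0x230b81b6d733a23c5d9a0e96f6ceb6e51d7 [Pt
  0x10d93ca0e32cb653c984785a5066c9e5613e459949 [Pt 0x8cb265da63da60d9d2a3d7cb2fe6f55cfba98b7aa677d4afc1c0473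
  []]]]]]]],Pt 0x100739622cb1b241ca37 [Pt 0x40c163582cac7c902cb [Pt 0x47165811658c7241c68b3 [Pt
  0x206197699ed58d1b258e32cd7 [Pt 0x84c8d0c0c6c9071633a2d7 [],Pt 0x46995d05c9e49af0f933a0bb4f6b4dde1716d32a4d03ceb2f3
  []],Pt 0x103478d1f258cb4b [Pt 0x102be97f5b2ea8ba9ed4daadd79c6b655065532ef545577ab59905b6da8532b65515dab5a49cb [],Pt
  0x118d031f258ccb [Pt 0x40c3958d1b258e32cd7 [Pt 0x1023c9063417525b737e6f91824b [Pt 0x2047928316b0b645a46094b [Pt
  0x119b4dad97f4bbc1c6b6d329e8478694725846893 [Pt 0x20683c95a1b64f166d1b2435ac9ecd998f7 []],Pt
  0x20683c9eb1e36486b593d998f7 [Pt 0x8c2a0697b333833f92d0abe55356b1da477 [Pt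
  0x8bfefbbe995d5f572eaefffa9feaabfbb5bfddd5f52b2babeaeddd77d57bafafc1c5ff5ffccaeeeb975ff55537ff7dd5acefbafb9595ddd77abaeead7d7d611e1e94d556daaa9eead67dcacebb753b0db278c96949
  []]]]],Pt 0x88f20a30d8b18d206b5b4c9b917 [Pt 0x811e4a1c7ac165230b58c5a494b [Pt 0x10f673a0e1bcba11e1a51c905ece49a493
  [],Pt 0x40ad9515f6adc3e51bed1b6afc39f28ccd950dab73d []]]],Pt 0x811e4a1acda0966c9a5016b1a494b []],Pt
  0x811e4a1aceb0967269185f1a494b [Pt 0x88f20a30959b2b91b258e3217 [Pt 0x20b665c1c1e5423c2d28e482f8c5a493 [],Pt
  0x102faa5f53cdf5f3a96f737ebce30f95dca35dbdb4cc17c7a49cb [Pt 0x80e35f1d956c23c3d28e482f8c7a493 []]],Pt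
  0x2056ca8aded5b86f28ccd95357e1ac5942be543dab73d []]]]]]],Pt 0x4736588f2038b21f258d8c88b [Pt 0x40439588b21b258e3227
  [Pt 0x21b2868f55576efa6ddf53fac0cad1f258d8cb34b [Pt 0x2028c38cba46c9638c897 [Pt 0x86b2878dc9e540f2bc633cb [Pt
  0x86b3a182cd9d03ceb18ccb [Pt 0x2308084adad330e3217 [Pt 0x202b595b66b71aed3cafa1b8dadb8ca6b0a72b4bf7 [Pt
  0x405555dbbab774dbbbde1ac67d07ccf9bd36bde3727933e86a56f5cb9b32a65dbcd []]]]],Pt 0x21b36861719b58d18ccb [Pt
  0x8536db341d0f8d0ccadb34a8c7eefdcfabbf64957 [Pt 0x84cd8b41c3e2d032d8b4a07aea9bd754caf5d577aaba95f5f9257 []],Pt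
  0x463c6e4cbeb067d785d5f53cbabeab7dffd36bbafc33cb [Pt 0x103c6b652b6a878757d56bffebb5fff57eebf06cfacf7 [],Pt
  0x206a9b55f2aaa6ff7bc7eed9572b7ee95786bb4cad6bc3995d73caebafdff76bbaaff7583edb26ecf3 []]]]],Pt
  0x81161e839d6116b1b240b7 [Pt 0x88b0ad0c78d1f25833accb [Pt 0x231a2aab9554b37d4edbc1acab1f243718b6a34b [Pt
  0x814ae535b2795588b1ace857d4aeeb957535776caba7b5775aed8e48363ca33 []],Pt 0x108d0d0f93438b2d1f258336b34b [Pt
  0x238b1b168386c5a37658b2d28c7ee67755b7ee6f5d9257 [Pt 0x4dd9627a0a39141b1e947241f2913 []]],Pt
  0x80a31c58671a460cda14b [Pt 0x46342f650e2cb46334b [Pt 0x41e5057b6ebd015ed995e8dcae36a0d8acad3d3 [],Pt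
  0x8c78d7b6e61e0ce4f433cb [Pt 0x4159415edb6bd015ed9657a372b8b6a0d8ecad3d3 []]],Pt
  0x47ae6f5db7aa655819c96b426db2686997696ed0aabbd737aedbd4caad8319c96bcd [Pt
  0x117259a6d6da64cc336e53d7a2bafee575fcb35ffddcaebf9b557dd36bffbc1d37b9d3dde8aeb95d2c5732a9b774dbec38b14caed6c9bd35
  []]]]]],Pt 0x11cd9623cb18c7c902cb [Pt 0x400d95871ac6c90468b7 [Pt 0x8c5ca6e5b58cdda2bb33ac7241cda33 [Pt
  0x11161da1818f920e6c68cb [],Pt 0x222c3b4311635958d1f258ccb [Pt
  0x8b92c6c9a0e1b1a132cb134a364b17dddcbeee9aefedb7f36bbf9b7f9257 [Pt 0x4dd9625a0a39141b16947240b2913 []],Pt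
  0x21cd8c686872f93438b2d0f934334b []]]],Pt 0x11161eb11e5a318f920e328cb [Pt 0x40c32ed376da0d946b1b25871acd7 [Pt
  0x42e31a0ad9518d28d7699370d92439718d06ca31a49 []],Pt
  0x11cd962b65472964b3857da8555d72aaea6eaab95575b7bf23336d42aa59572ba9abb7d2cb649cb [Pt
  0x81729b97d622c7ce8dda2bb3cac7241cfa33 []]]]],Pt 0x11cd9623c86ce58e2c80d8c88b [Pt 0x4046ce58e2c80d8c84b [Pt
  0x404235872839d0e3227 [Pt 0x8c69aefa59fd5fbae67eeb959fdb0595a2efed977f33d754adff0d8cb34b [Pt
  0x101c3650ea995fdcefa98efabef4cafebd9435958e32257 [Pt
  0x457299a370aae5533f5acea656d8e3215d72ba67eed6fdccabdb15d732ee97ff33ddd2dbed95d776aec2aaafb95557ccddf555f7aea9b77d5533aabd756cd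
  []],Pt 0x1038c3b58dc6ccb6346c9638cb2d7 [Pt 0x80b31bb461c9ad157f5b2afe99eaeee74b3a6d75debc232cd3 [Pt
  0x1062ca1c63795818afea65555cafee67fbfbef4dfbe96f7557ef08cb2d3 []],Pt 0x101460da2dc8d7695b4c38c897 [Pt
  0x2308085c959d0e3217 [Pt 0x80aaab6d55aa6ff7b47eedbf72cabb95786b59569ad1ddf6ceef99eeaad65f2dab4daac232cd3 []]]]]]],
  Pt 0x8e6cb11e430046284b [Pt 0x1010e5611a0d9438c87 [Pt 0x20479230b2b3376da46363224b [Pt
  0x40729c18b46db735338c46289cb [Pt
  0x205f552faa66eaa7b775ddaaeaaf36eebca831e8d5b3fadd3375acbeb9f9502fab65f5335d5ecad9254b []],Pt
  0x20478d653831682e3ca9c06b2a49cb []]],Pt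
  0x457298ae465b11e5e6bbe967f57eeb99fbae79fd86a5358bbfb65dfccf5d53dff0d8cb34b [Pt 0x408f24059599bb6d21c8b4363224b
  []]]]])"

lemma cert4_17: "check_top 5 [R1, R2, R3, R4] excluded4 roots4 [(2, 1, 10, 1), (11, 10, 6, 1), (1, 1, 11, 10)]
    cert4_17"
  by code_simp

definition cert4_18 :: cert where "cert4_18 =
  Sp 0x2d5e9 (Ro 5 (Pt 0x4458cb1c592911c8cb139223 [Pt 0x431421a4046ce58e2c88b [Pt 0x431d621680182cb [Pt
  0x431b40062860cb [Pt 0x2031f4b22873a0c3ca457 []],Pt 0x431b588f2d18c034b [Pt 0x810d2c8a0c7a111a493 [],Pt
  0x40d930d940b3a33 []]]],Pt 0x111e58e6cb904358628b7 [Pt 0x10045061a11cac311a2cb [Pt 0x118d9310f5832b2d7 [Pt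
  0x2186b114b22810ca493 [Pt 0x1030185ac60b4b [Pt 0x406b3a4165085e9065049 []]],Pt 0x2038d6833a188674186b2d []]],Pt
  0x111e58e6c964518457 [Pt 0x430d6229645023a493 [Pt 0x2298ae5c393188da33 [Pt 0x10e561f3a431421da4049 [Pt
  0x45315c6ddc30c741f2b031 []]]],Pt 0x1149e193638b21e8087a445049 [Pt 0x20c6530878d221940f1a4048b []]]]])) (Ro 1 (Pt
  0x4736588f2c6ce58e2cb1f258d8cb0b [Pt 0x408f21b39638b21f258d8c88b [Pt 0x10073961cac6c9638cb37 [Pt
  0x808d20b1a0e51a47c96363224b [Pt 0x215da94b40b16951aed4a5a0e392c16729253 [Pt
  0x43eefd7e7a0b81bbbaedddd5aaea7977951b242abfabe557f54d7f575d76beafeeadf7ddd56cbeefaa97d7d794957 []]],Pt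
  0x1023c91b39607c96363224b [Pt 0x2308726b01da3668462894b [Pt 0x4071bb5ca6c234346cb438c897 [Pt
  0x45262ed256818d388c728b16828458b423223 []],Pt 0x45552bab95d737d6da657583a39cdb6683e748d16cd0e32277 []],Pt
  0x20479684c65cab1a12cb94334b [Pt 0x4073af0d934343916358d3cb [Pt 0x101464d7e1cd68738b935f82ce4d08cbcb73 []]]]],Pt
  0x100739622cb1b241ca37 [Pt 0x40c163582cac7c902cb [Pt 0x811e5a2b654d72a2d6347c96334b [Pt 0x118c631b241cfa2d7 [Pt
  0x8188f0b58d1b258e32cd7 [Pt 0x8d2ca94d0469c696d4a6828e481591a493 [],Pt 0x212b2358425651a0853e51a1b225946649 [Pt
  0x206b326bd0e343645264d7a1f38d04dab4d99b535 []]],Pt 0x402ce5588f0b431b241cb7da8d7 []],Pt 0x118c631b241cfa2d7 [Pt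
  0x2061258b363418d60cacd7 [Pt 0x8d2ca94d0469c696d4a6828e481591a493 [],Pt 0x212b2358425651a0853e51a1b225946649 [Pt
  0x81acc9af438d0d9149935e87ce3412dab4d99b535 []]],Pt 0x8c684962cc31b241cb7da8d7 [Pt
  0x1032f26951be5d61b39d236457cae82d9b29257 [Pt
  0x11eaee95d54defa995d561aecda56ed46e3305dab2da592dda86dbb498cc1c76b2f3 []]]]]]]],Pt 0x4736588f2038b21f258d8c88b [Pt
  0x40439588b21b258e3227 [Pt 0x80d94a038ca91b258e3217 [Pt 0x21b3a185c6740ceb1f2582caccb [Pt
  0x10d9b41c0dca656d28c6afaa5b57d54aaf9b577649cb [Pt 0x10372adc363ca065cab70f65033b72af4bd []]]],Pt
  0x4630e7588b2c6c9037 [Pt 0x40c638b2c7c9611accb [Pt 0x40ab952cd4ed60cac5c966e7d68e483645a33 [Pt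
  0x8c68aaa6574afa59eaef6575eac0b1ac7c90dc62dba34b [Pt 0x20780765cac6c90db36dda8f7 []]],Pt
  0x407038b132e4d28c2931a49cb [Pt 0x2376a60ba1dbb503169d415976a1c585a7c9d []]],Pt
  0x118ab952cd4ad6317259b9b5a3920e33a33 [Pt 0x41943031f24176632e8cb [],Pt
  0x8c68aaa6574afa59eaed6575eac1b1ac7c905d99c9a34b [Pt 0x1022c2f5e015972b1b2436cedda8f7 []]]]],Pt
  0x4479622c2d0e72c4596364873628b7 [Pt 0x10318c7c902cb [Pt 0x118c18d60cac6c9033a2d7 [Pt
  0x40c32ed376fa0f932b1b2583cacd7 [Pt 0x84f2343937cb69427946821c9e4686c89946649 []],Pt
  0x22ea575db2efa9aeeb977d3caebaff855d572aeaa6ebab95755f6ede8a94f15adaa1f7cdbabfaef7f574f7f5777bfabbe7dfbd157d532bfeab95dddd35775ddabbae7957d55fbb0716b2f3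
  []]],Pt 0x8c5ca6e5d631df573bea8efab9df55ef9bdfb1c9073a33 [Pt 0x1065788f2d031f240cb [Pt 0x8183286364838cda37 [],Pt
  0x2060ca064c9ac6c904993668d7 []],Pt 0x83cac7365818d920e71a37 [Pt 0x1030650e2cb1f240cb []]]]],Pt
  0x11cd9623c86ce58e2c80d8c88b [Pt 0x1011ce588b20e50e3227 [Pt 0x101063583280d8c84b [Pt 0x461180e6d0e3217 [Pt
  0x11cd905466aedb5733576cae532ca31f7f5b3efe99eafa76f59254b [Pt 0x1014665319609632e46c9638c897 [Pt
  0x8d8c82e3b2b012b2d958d8c4cd9305b396cacd []],Pt 0x81af6d36e38c865672adc3650db39cabd3d []],Pt
  0x46140ad94c56cda438dbb3438c897 [Pt
  0x232b2a1e7faa967f56ffa99bfeae7f5acfed8dc96b4fffd6dfffa67efbb95f6b2bf0e315ca5acf7 [Pt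
  0x4662b2b85f55b2faa62faa56f72a8cada0ac9855d6caba62aeb9d6cae751b6d17d56cbea99aeebb7cdf959f5bf08cb2d3 []]]]]],Pt
  0x4736588f246ce4165666ed48118a24b [Pt 0x11cd904600d8c84b [Pt 0x1014192684ceccdcda46c9638c897 [Pt
  0x236320b62cac05b25958d8c4b9305c62cacd []]]]]]))"

lemma cert4_18: "check_top 5 [R1, R2, R3, R4] excluded4 roots4 [(2, 1, 4, 1), (11, 10, 6, 1), (11, 10, 11, 9)]
    cert4_18"
  by code_simp

definition cert4_19 :: cert where "cert4_19 =
  Sp 0x256b (Ro 1 (Pt 0x4736588f2c6ce58e2cb1f258d8cb0b [Pt 0x408f21b39638b21f258d8c88b [Pt 0x10073961cac6c9638cb37
  [Pt 0x808d20b1a0e51a47c96363224b [Pt 0x808b4e36720aed4a5a718ddadca454b [Pt 0x20282c7a1b9567a5011cb []]],Pt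
  0x111e411ce5873a038c87 [Pt 0x1023c9078d607c96363224b [Pt 0x20388f1b26b0345b3438c897 [Pt
  0x8a4c5da4ad03b1a7118b9456828722b423223 []],Pt 0x2028c2e4b654a0166ca91cb [Pt 0x4070f65050e504b19cba453 []]]]],Pt
  0x100739622cb1b241ca37 [Pt 0x40c163582cac7c902cb [Pt 0x408f2c631f240cb [Pt 0x111e4318c6c9638cb2d7 [Pt
  0x408f2d15b2a6b9515a0d8cac7c96334b [Pt 0x88f15f6ba1aecf69bb50afb5d0515935a84ad8ca9341b1eb2f3 []],Pt
  0x100ec6b0e6b430e3d06c6b2d []]]]]],Pt 0x4736588f2038b21f258d8c88b [Pt 0x40439588b21b258e3227 [Pt
  0x80d94a038ca91b258e3217 [Pt 0x80d9d3a1cda0ae536ba718dd9b329277 [Pt 0x20381b94cada51f2583ca49cb [Pt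
  0x47c9a60d9c5a74dc964d3054726f6d306dadb26725 []]]],Pt 0x40d155caa59eaeddd88b2d1b258cd7 [Pt
  0x2318f7f5defeb955537bfac22cb1b241726ccae37 [Pt 0x2060f3930e2cb1f25871accb [Pt
  0x80eadb74cea67d5ba6dfe7c2b94b6da157f72afe59aabe67dd5ddbae67dd5ccabfca8777ddebea59ddf76ba9b5d60aecd9a51d7 []]],Pt
  0x40e6c9c39b58aae955cb35d56ba9955e47239b43526e457 [Pt 0x23185729e5c22cb00ce637 [Pt 0x20636c8f70e2cb0d95871accb [Pt
  0x407038b132f934a306515a49cb [Pt 0x206bb4df80d6dcab70fe50e45cab73d []]]]]]],Pt 0x8e6cb11e58c722b1f240cb [Pt
  0x8186cac459636487363a37 [Pt
  0x235b399d42bafb95d7d375fdcaebedb7edc6b6d33a85fdfdcbfbfa7beaab97f7f37feeffef45572aa6ebbf3399d41cdacf3 []],Pt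
  0x81729b97588b2c32ed376eb1c9073a33 [Pt
  0x419439b2fc54a59aa1572ad9aaadb5d52676f175dd4afeabae5dd7d54fd555577eaaaa96d5f555beaf0bb976c575ddae6f7f56e6d7b377
  []]]],Pt 0x238c3423c91b39638b20363224b [Pt 0x8e6cb11e41656666370e2c80d8c88b [Pt 0x1010e5622c83650e3227 [Pt
  0x115b298ad8ca0a2d9317cac21b19423223 [Pt
  0x83699546ffae65d4ceaf77dccf77ddacbaa7f6d1a6550fafe965d53baae63baaed9752deaff6d155b2a99eadb37a655708cb2d3 []]]]]]))
  (Sp 0x2d7b (Sp 0x2d5e9 (Ro 6 (Pt 0x111e58e6cb90739622c8b7 [Pt 0x8022830d0d9cb1161a2cb [Pt 0x40447586168604b [Pt
  0x430d04061e913131935824b [Pt 0x4cccb25a1f26846828c68d3 []],Pt 0x118d93058d033a2d7 [Pt 0x40c45061ac60b4b [Pt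
  0x82cd943d818d95e0c682e36a357 []]]]],Pt 0x4479639b2d93182d7 [Pt 0x40c45061ac3958468b4b [Pt 0x463e4d00ca2f7 [Pt
  0x40114187a180b [Pt 0x10111d6185a0124b [Pt 0x2187a0b22391906c6923 []]]]],Pt 0x4458cbc7164a4430b422923 [Pt
  0x862843480862e328446924b [],Pt 0x218a10d2023672111a48b []]]])) (Ro 1 (Pt 0x4736588f2c6ce58e2cb1f258d8cb0b [Pt
  0x408f21b39638b21f258d8c88b [Pt 0x10073907286c9638cb37 [Pt 0x811e4a3672c7d53ea63eaeddd3ea6fe47c9636321cb [Pt
  0x4046ce26e059323e4b118a14b [Pt 0x202e498b3286b282367176b8391e91 []],Pt 0x10118729c991814b [Pt
  0x40d9c94359439c90e5611a13 [Pt 0x20ca058c7994358ca080e45691 []],Pt 0x402c62cca1aca087cac391e91 [Pt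
  0x83286ce4a1ac650e724013 []]]]],Pt 0x100739622cb1b241ca37 [Pt 0x111e4318c6c9073a2d7 [Pt
  0x40d15b2a6b95168478ac7c96334b [Pt 0x85bb7416da6ef0e5bb742eea5dd3cccefb6d5d4dfbb78723d08f12ed26b4d []]]]],Pt
  0x4736588f2038b21f258d8c88b [Pt 0x1010e508b21b258e3227 [Pt 0x2062ae54b353d6347c960cacb4b [Pt
  0x11c590c459071ac72588cb2d3 [Pt 0x44585a1e2b94b3cb70f0649935832b4d4b [Pt 0x20cfa066c9af404cd935a8719f40c6726b535
  []]],Pt 0x80a0716191a460ce894b [Pt 0x84ca2d070651683634a1c66d62e4b0c6649 [Pt
  0x81aafb65ffd4afa9b76abe97ff6d43aee7f537ee97db7bafd8459784c93d07193cacb57 []]]]],Pt 0x8e6cb11e58c722b1f240cb [Pt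
  0x8186cac459636487363a37 [Pt 0x20ca3768aedb581729b933ac7241cda33 []],Pt 0x20dda2bb7588b2c32ed376eb1c9073a33 [Pt
  0x83287365818d920e71a37 []]]],Pt 0x11cd9623c86ce58e2c80d8c88b [Pt 0x81c616944639588b20e50e3217 [Pt 0x4046039d0e3227
  [Pt 0x8d8c855b2a66a56b1c642ad95335736b35dccaa675d7bba66bb96552ceab0bab65d4cf75de9d5daebecd []]],Pt
  0x238c2d623c86ce4165666ed48118a24b [Pt 0x2028e720b2b33768d223c3d0e3227 []]]]))) (Sp 139 (Sp 0xb6b (Sp 0x2d5e9 (Ro 7
  (Pt 0x111632f1c592911c8cb139223 [Pt 0x10c5086801b39638b20b [Pt 0x10c7423c9011824b [Pt 0x218dac4796811632c051a34b
  [Pt 0x1023cb10d0c4786340b4b []]]],Pt 0x431421a4046ce58e2c88b [Pt 0x431d085a0060cb [Pt 0x47365887a51842e50494b [Pt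
  0x431f431cd879431cd8d940bcb [],Pt 0x40791418f411a493 []]]],Pt 0x111e5e39b2d904358628b7 [Pt 0x10045061a11cac311a2cb
  [Pt 0x118f9310f40ca2d7 [Pt 0x103114186b11cda06468bcb []]],Pt 0x40e6cbe4c42d618eb2d7 [Pt 0x8023a0c2d046831168b4b []],
  Pt 0x447978e6cbe4c42d02d7 [Pt 0x40c45061ac3958468b4b [Pt 0x811e2ebe4d00ca2f7 []],Pt 0x40c45061ac3958468bcb [Pt
  0x87cac475ac9a04328d3 [Pt 0x46ffbedff33feaff87164964500ca493 []]]]]])) (Ro 1 (Pt 0x4736588f2c6ce58e2cb1f258d8cb0b
  [Pt 0x408f21b39638b21f258d8c88b [Pt 0x2047963672c63e4b118accb [Pt 0x223c828e721efae7dd57be6f7d91b258e3227 [Pt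
  0x118c739073686c9037 [Pt 0x2068f7d3eea5bdf4defb073eb1b258cd7 [Pt 0x101376e6e5674b70515a4235845a14b [Pt
  0x40d093b58d08b58cbcb [Pt 0x118541593c68279b1a51b2435c9ee457 [Pt 0x80a33cbb4c17b16946054b [Pt
  0x85b6d6dcc17b67afc1f9d05b27b73af43633a096d5a7b2ca6b353 []]],Pt 0x874ada95a0e39c52b656b1a4bd28c39ce9274b [Pt
  0x47e567ced07437b330df5aede5b2a15ad965376145a4954b [Pt 0x8c2a0b2562cc35ceaf2c97b946c90d7276e457 [Pt
  0x40505e3cc0fdb65946054b [Pt 0x461c07f3b3b5df336f75e7058cc125cb [Pt 0x407c73961fceced77ccdbdd737baf3849f92d06c69277
  [Pt 0x106505c0e7270e328391769253 []]]]]],Pt 0x80a30d66ca4049cb [Pt 0x872f9f3982a37d72aafb72ce7dcaac0ec69472411a493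
  []]]]]]]],Pt 0x4479051ce5873a0e358e3227 [Pt 0x1023c9078d606ed1b34363214b [Pt
  0x1184364d0bfb97f717f77eabef6468b66846289cb [Pt 0x202a1c62d0ae5735f69a468c64b438c897 []]],Pt 0x118c739073686c9037
  [Pt 0x2078e71ceb1a1723411acd4b [Pt 0x1039c5ca2d6a1eca1ce2e525af0b9394232cd3 []]]]],Pt 0x2047963672c722b1f240cb [Pt
  0x8c233f532ae99f76eaa8abaedd55cfc8f9217532eb657d175dffbbe49cb [Pt
  0x223c83872b35ccaaa99d5deeea7bbae75d4ceb236485d32eed95d53575dbf9b5917 [Pt 0x2028e70b42b739a651b21686c8a6ca454b []],
  Pt 0x46106ccb046094b [Pt 0x1035ac960d95846b1b241b1a37 [Pt 0x1035df29b52e9956c611b3368e4839f1a33 [Pt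
  0x47ed6f5b2c3d1aef9736a5d2cac1da974dae65bc5d5d5b2eaea8febabbd5d52ceb9d2daad8d2fcb [Pt
  0x8d72b952a9974b6c371aed72e52f99fcb6c1b1af439f1e83b52e9b5cca65bcb5 []]]],Pt 0x1023cb46e736347c90d6d998bcb [Pt
  0x40c367d61ac6b47241f1a33 [Pt 0x40d023c2d68e486b6cc9662d3 []]]]]]],Pt 0x4736588f2038b21f258d8c88b [Pt
  0x8e6c862ae54b352d6347c963632cb4b [Pt 0x4716234108d08b21b258e3227 [Pt 0x1039b2c22d08b2c6c9037 []],Pt
  0x47364118e2c86363224b [Pt 0x20736587dd5defa5bdf5efb08b2c22d61ceb37 [Pt 0x118439f422c80e3227 [Pt
  0x80e1cd687bef9f752defabdf64638c897 [Pt 0x46350ebb4b7965dd88b2f1ad95c38cb2f7 [Pt 0x40d0afb6b42b94b37665b4632d4b [Pt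
  0x10b8b4150f6716b0beded28d6f2a836516925cb [Pt 0x101d9e6d42f5958e2cb5066f2838f2eb2fcb [Pt
  0x1172585a1b88b2c3b3c99b50e7f41c7971acb53 [Pt 0x86496283e292c502c7a54295da7b3ca0d93b29253 []]]]],Pt
  0x4572966b94d0715ca59aed3412ce34a2efbb977dcb355ddbbaab977dcdaaf61ce874b [Pt
  0x102fbbae5f774b1f5ddfbee6fffd2fbba6d7d4cbfb7e12dbb2d0bbeebb977dd72c75d5dbabee9b7df52abbfa6f7dccbbab6e1726ca2d0d554ce56d555debe65db4b5cb
  []]]]]],Pt 0x1039b2c6ed39708b2c22d61b2b37 [Pt 0x118439f422c80e3227 [Pt 0x80e311622d21ca0a729254b [Pt
  0x11775ddcbbaee59eeaf9b5d5783e52e5d7a22c83bbeddd5bbae75d6a6f56f1161e82fb6c6ecf3 []]]]]],Pt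
  0x4736588f2d3768aed58d1f240b4b [Pt 0x223c8619769bb75871ad1b2411a2d7 [Pt
  0x11c590ae52cd369ad502b94b14da6b715df772bbee9febbaff5dcdfebb9b5e08c6b4b73 []],Pt
  0x22659666847978ae52cf370f15f5cafa9eba95f4db0cd4b []]],Pt 0x11cd9623c86ce58e2c80d8c88b [Pt
  0x4736411b39638b20363224b [Pt 0x46c642ad953353d638c875756ceaea67eaebb7576eb679656a63963761b2b4d [Pt
  0x22b94b33ca6855db2ae66ae56bd45d5cdaeadf7cb17573dbef9b5d8557f76caafee66eaafbb756dbadf8ae52c53da685fdff5772ef995df7d5cc5fdff577dabfeb75f5b73d
  []]],Pt 0x4736588f20165666ed48118a24b [Pt 0x4479051ce4165666ed1a43650e3227 []]]]))) (Sp 0x2d5e9 (Ro 6 (Pt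
  0x111e58e6cb90739622c8b7 [Pt 0x8022830d0d9cb1161a2cb [Pt 0x4011d6185a180b [Pt 0x10111b411824b [Pt 0x118d11f4300bcb
  [Pt 0x26a3bb4d086b64c4518d047a33 []]],Pt 0x40446d6187a1824b [Pt 0x10c3410185691814b [Pt 0x1031861dac034b [Pt
  0x86ca86b2687286b936598d3 []]],Pt 0x463e4c1e340cda2d7 [Pt 0x103114186b00bcb []]]]],Pt 0x111632c71649910c3588a23 [Pt
  0x10c50869010c72b111a24b [Pt 0x218e842d28c20445a49cb [Pt 0x405645062d08fa493 []]],Pt 0x111e5e39b2f9310d02d7 [Pt
  0x811e4a2285258c5286cac478da454b [Pt 0x10239d2a0ca10f4a2194145 []],Pt 0x40c45061ac36561c68bcb [Pt
  0x8c223a0d9488e74124b [Pt 0x10632871642b4833a10ad2219d049 []]]]]])) (Sp 0xb5ab (Ro 1 (Pt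
  0x4736588f2c6ce58e2cb1f2436320b [Pt 0x408f21b39638b21f258d8c88b [Pt 0x2063672c63e4b118accb [Pt
  0x88f20a39c8394691b258e3227 [Pt 0x811e4e06a52d38f92c479adca45cb [Pt 0x1023c940559e947c90454b []]],Pt
  0x1023c946ce58ae5715dae918d8c854b [Pt 0x408f246ce40b264694d996118a14b [],Pt 0x1023c91b396026cdb014b [Pt
  0x81a2d9a543e7423cd16cd282c93411e91 []]]],Pt 0x2047928d9cb3f754b3aaed7f54d7f54eac8f923ddd7deeea6aae9f6454b [Pt
  0x88f20e6a97f73e6dd53754fe997f8726e32b91b25873a17 [Pt 0x102ad954d5c6d6718ad9515ca674a1739342b8da2b94ce9274b [Pt
  0x205d4beb6574f7765bfdb1ad95431f240b4b []]]]],Pt 0x4736588f2038b21f258d8c88b [Pt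
  0x44585a18ab952cd4b438b2c7c963632cb4b [Pt 0x10118e2c86363224b [Pt 0x8e6c878d7caa1e32ced58d2dcb [Pt
  0x47364342bedd0d032d4b []],Pt 0x8e6c868cb2b9570e2cb46b95c32d4b []]],Pt 0x111616b11e5a6ed15da8722b1f240b4b [Pt
  0x88f21865da6edd0e446b1b2411a2d7 []]]])) (Ro 1 (Pt 0x4736588f2c6ce58e2cb1f2436320b [Pt 0x408f21b39638b21f258d8c88b
  [Pt 0x2063672c63e4b118accb [Pt 0x1023c9014691f258d8c894b [Pt 0x811e4e06a52d38c6b72925cb [Pt 0x408f2501567a501254b
  []]],Pt 0x811e48e70f5818d8c894b [Pt 0x8beeb97dd717dd77aaedbf60e2ae55cd5dab684786908b423223 [],Pt
  0x811e4a36721fba55572aaafde518254b [Pt 0x21cba0e8f5f54b7efeb9dddf77afab08f0d286ceb0ab2c65949 [Pt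
  0x815cae2965da5b56e1cd68ddb896765956a115a35dae6bed2caacf3 []]]]],Pt
  0x811e4a3672cff2caef553d54b23e487d5f3ea9eead9254b [Pt 0x408f2c6ce58e2cb1f240b4b [Pt
  0x8a65d6cae8baef76dd8f925156caa6aed5b4364915d76caeba2baeedd7d2e9b536fc2be54369649 [Pt
  0x137da2cd074db68af96684787a51c9031a493 []]]]],Pt 0x4736588f2038b21f258d8c88b [Pt
  0x8e6c867bbcb152d0e2cb1f258d8cb34b [Pt 0x10118e2c86363224b [Pt 0x239b21e35f2a878cb3b5634dcb [Pt
  0x11cd90d0afb74340cd4b []],Pt 0x11cd905038b1ca4609cb [Pt 0x10e5d0545df72efb6799d75dbebbbdfe0d8d287ceb1c587a49 [Pt
  0x11c590d2cbb4b69bd11643725ca595785c96507cdacf3 []]]]],Pt 0x239b2c47966ed15da8722b1f240b4b [Pt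
  0x4736431729b97438b2c7c9034b []]]]))))) (Sp 0x2d5e9 (Sp 155 (Sp 0x96b (Ro 5 (Pt 0x11cd9623c91c592c458c86ce58e2c84b
  [Pt 0x8e6c8238b2418a46ce58e2c88b [Pt 0x47364315ca5937418eb376d9a358cd4b [Pt 0x239b2038b2418da00b4b []]],Pt
  0x88f20c3423c350739622c87 [Pt 0x2185a11e4811632430c6b10ca24b [Pt 0x223cb0c3d2b2288f0d0457 [Pt 0x4050186946054b [Pt
  0x2047901163200cb []]]]],Pt 0x4736588f2c7164b11632c60b4b [Pt 0x111e43903958468b7 [Pt 0x44796159145278b650457 [Pt
  0x40511418694478b67411a454b []]],Pt 0x88f20c35c839cb0c468b7 [Pt 0x10c2d08f2c08b196310ca3cb [Pt
  0x811630c7af0c6ca11e15ac36508b1856b1 []]],Pt 0x88f2f1cd93c8a23c5ca1cd8a457 [Pt 0x101445061a50b9d0454b [],Pt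
  0x405114186940e6c4691cb []]]])) (Ro 6 (Pt 0x11cd908f21c592116321b39638b22cb [Pt 0x11cd9623c91c5921163246094b [Pt
  0x239b208e2c906291814b [Pt 0x473643172591d063ac05c68d4b []],Pt 0x11cd9623cb47164b11632c02d4b [Pt
  0x88f21f2623c2d071a2d7 [],Pt 0x4736422b18c05168d4b [Pt 0x40e2c96b261b2828c5a33 []]]]]))) (Sp 0x97b (Ro 5 (Pt
  0x11cd908f2471648458c91b39638b224b [Pt 0x11cd908f21c592116321834b [Pt 0x11cd9623cb47164b11632c02dcb [Pt
  0x88f21ec988f0f411a2d7 [],Pt 0x8e6c845638b24301cba2fcb []]]])) (Ro 7 (Pt 0x4736423c871648458c86ce58e2c8b4b [Pt
  0x4736423c91c5921163246094b [Pt 0x11cd908f2c7164b11632c02dcb [Pt 0x8e6c845638b2430145a2fcb []]]])))) (Sp 155 (Sp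
  0x96b (Ro 1 (Pt 0x4736588f2c6ce58e2cb1f2436320b [Pt 0x408f21b39638b21f258d8c88b [Pt 0x206367203e4b118accb [Pt
  0x1023c918eab975498eabb5d49b64636321cb [Pt 0x1039c52367208c462894b [Pt 0x40e71d28d9c838ca501b2a474b []],Pt
  0x408f2d1b38e5634632d4b [Pt 0x1023c5b269c0d6d999c072e925cb [],Pt 0x8c0d9c829ce642d94094b [Pt
  0x8dd76eed95586abb65d576fcb8a4f1cbb3423c5b3a515b9c72ecd0456949 []]]]],Pt
  0x811e48d9cb0caa65dea8aaef54c8133b6551ddaa91cb [Pt 0x45cb9b65423cbcddb9b654345d6cba8baef57432dcb []]],Pt
  0x4736588f2038b21f258d8c88b [Pt 0x4040e2c87c96363224b [Pt 0x8e6c866ab9f5da8eedb52d8d1f258cbcb [Pt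
  0x8e6c871638d38376589a518b92c49a45cb [Pt 0x115b937261e3937261c5978be51432fcb []],Pt 0x4736414638b11a46054b [Pt
  0x4459b5950f1ad6d30f092d0cdcb [],Pt 0x10b8d0d1cd8b8d0716b0d9b586c5ad2d [Pt 0x8e2c81635a22c838b1ac02d3 []]]]],Pt
  0x116b9535caac47969bb4576a1c8ac7c9034b [Pt 0x22d9456686a2eaeae5d5d535df572eaeaedd61c5979ae59776ea8bbbd5730cfcb
  []]]])) (Ro 1 (Pt 0x4736588f2c6ce58e2cb1f2436320b [Pt 0x204790d9cb1c590d90d0d8c88b [Pt
  0x1023c919a99ddfb8eed54c8f92c46289cb [Pt 0x239c5071ce41b291b258e3227 [Pt
  0x2054cafab955d715f56dfbbb5dec367419cb8eb1c96232cb3 [Pt 0x4478e854cafab955d715f56dfbbb5dcdaef6033971c6b11902d []]],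
  Pt 0x1023cb1b39631f258cb4b [Pt 0x81873684786b1c9611acb3 [Pt 0x811e2b94b4e06b94b4e30a31a4954b [Pt
  0x2069b5da6d543d9439c4db957e1b2826dcabd3d []]],Pt 0x2047928c7ae9955d2ab9bd7651825cb [Pt
  0x87cab86ce4aa0cf950e7270e50d9c5169253 [],Pt 0x447961c73905c99166452786330e3227 [Pt
  0x46ffaa7ff3dffec1f1aaaa9f5db7beabdf5818d28af9b5dd76abee7efea7dd5b6bbab55f82bb3165949 []]]]]],Pt
  0x8e6cb11e407164390d0d8c88b [Pt 0x239b21a2aaee555cb3f572df0e2cb47c963632cdcb [Pt 0x8e6c863b9cb3cf438b2c633cb [Pt
  0x4600e2c86b4cc363224b [Pt 0x101439f422c83958e3227 [Pt 0x4072d95b81ab9d71953da1c5650ab952c33bbf6ceb5b4d []]]]]]])))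
  (Ro 1 (Pt 0x4736588f2c6ce58e2cb1f2436320b [Pt 0x204790d9cb1c590d90d0d8c88b [Pt 0x20479239c2d1fb6fdcd54c8f92c462854b
  [Pt 0x111e431ce41ce86c961b2b37 [Pt 0x1023cb46ce3646b1a16c93432dcb [Pt 0x40db699b7c39f423c5b66bd0ae3694b4232d353
  []]]]],Pt 0x8e6cb11e407164390d0d8c88b [Pt 0x204585a50e508b21b258e3227 [Pt
  0x26b995ee59ee79866aaed54b1f53db0e2cb1f25832b3cb [Pt 0x109b59a1e1d9b59a1c5978324d033acb74b []]]]]))))))"

lemma cert4_19: "check_top 5 [R1, R2, R3, R4] excluded4 roots4 [(2, 1, 4, 1), (11, 10, 6, 1), (11, 9, 4, 1)] cert4_19"
  by code_simp

definition cert4_20 :: cert where "cert4_20 =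
  Ro 1 (Pt 0x4736588f2c6ce58e2cb1f2436320b [Pt 0x408f21b39638b21f258d8c88b [Pt 0x2318d9cb18f92c462b2cb [Pt
  0x118c6ce58c7c963632ccb [Pt 0x818e720b8b286c9638cb37 [Pt 0x235f2ba11e48ccdb758a4c5db64d215f68d0d8c854b [Pt
  0x223cb1bfafb555b2fce39c86be52ca40e3227 [Pt 0x815f5f72bebee6eee5d5576fafe97f5d654164da61ce48719423213 []]]],Pt
  0x21324d636cba51ce415c9b4691b258e3227 [Pt 0x20b2a11e6ecb4a2ffb97fdcfdf56aaef5f55bfac15d96947c963632254b [Pt
  0x23d773beb9df4da59fd8259d68727ac18ceb47c9633cb [Pt
  0x235aca6855d5572aeaab9aaedd75752dbbeafadb55d565f1aeaa6df7cb3abab977736ef0e727c725853933a4973 [Pt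
  0x21dfcb7fbafb7783eeadbdf4b3eea5bdf6545757dcaeafb9afab95d5dd2cabaafbed575587feaad655fd2dfeeca84b28f41d77dcadbeaaa5dfdd73feeaf77de4954b
  []],Pt 0x2023672c65646e46094b [Pt
  0x11eeb967dd5f6ef04f6b5b536a8beb97d717d3abb5f3dfeafe0795a8fddd4b2bfb99ddd6baa96ffd619933bb3d7 [],Pt
  0x1197b5dab82fee5bf5d7dbbde84f6ed30a4f35cdafa5bdf5f6bda85ca0a594f2b3d4b []]]],Pt
  0x42db6d61cb92d78dc6549686e4b3bb1b240d7 [Pt 0x40d0e4f58738d68f920eab5b5d557bba9b5d563cb [Pt
  0x42be329a1a7652d3e8e721ae57ca6cd3a30afbaed7553ceee95f74daeaa677791d7 [Pt
  0x11ae6ddf6b96de19d93d2e39c85d7cba8feeeae5ddfdf6ebae6fdf55cbab7f5e701257 []]]]],Pt 0x460600d8c84b [Pt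
  0x435950db2da51ce5847a0e50e3227 [Pt 0x10b5b7435b2be9c6023d0e3217 [Pt
  0x856b6b687fedbf76b2b3a1cd64d073da43971e4d0e32257 []]],Pt 0x8c0c0118a24b [Pt 0x8d6cafa1bd955b23c0d25b330d8c894b [Pt
  0x230a39c83e5c990d9d0e3227 [Pt 0x436ae75cdbceb9e076d32a39c873899528f7755aeaad67556baac38c897 []],Pt
  0x45b26392b41c4639715ac6f65569b6439b423223 [Pt 0x22bfa57f33f577aaee57f6da5bdd56bb0d6dad8f4e871795042e3ce50e32257
  []]],Pt 0x11ad95f580f93580e2c68462894b [Pt 0x461c739611a08ad0e3227 [Pt 0x2022576e2ae1499b93b484d650d8c89cb [],Pt
  0x22d931c9da0634e2d931c9e2d0439f423223 []],Pt 0x85b35ac575caeb8fabb7d6b699902d931c95a438f1a118a1cb [Pt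
  0x230fe55ca1c9685266e4ed21dbb2d0d8c854b [Pt
  0x8d76b7a96786aaad5b55d2ab6b8aaeea55774c77f54dfeba955dd2b6bbe59f5e1aebeee77f55dacbeaeeb6f7d5d4feef68aabb6555ccd554afb95b5d2caf0d8cddad6d6cab2f57
  []]]]]]],Pt 0x88f149ac239c82eeaeddfd6ab9977591b258e3227 [Pt 0x4046145a47c96363224b [Pt
  0x20738d95280d9528f92c462894b [Pt 0x1033c79873906b3a1b241eca37 []],Pt 0x10045960c5ac7241b28b3 [Pt
  0x8c278f58715950c6c9033a2d7 [Pt 0x80fb4d84f9d03b2b1b240b28d7 []]]],Pt 0x8022cb0e2d63920e728b3 [Pt
  0x1185dacf361c7950c6c902d7 [Pt 0x1013d9b560aca0a5b3ad1c9033a2d3 []]]],Pt 0x11b1901c65871ac465846b2d [Pt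
  0x4623c8600d8c84b [Pt 0x1010f9588b2007 [Pt 0x1186b2e918b64c495a4073a14b [Pt 0x80a316c99b8b2fa4017 [Pt
  0x41958404159423213 [Pt 0x80764f26946ce40fc9a50f9ed0d8c894b []]],Pt 0x201d8c6650d9584359423213 [Pt 0x41941404017
  []]]],Pt 0x8c4790c0118a24b [Pt 0x11818b64c495a406ca14b [Pt 0x40decabb646293349da436341f2894b [Pt
  0x22ebffa975ffd3cf5ff5acbaffe96f5ff617f72fee6e5eff5dfbadbf0e50ababe977777f72eaebeee6affaaeed57fd757abeaf6a3bae92caeb98aeabb5f5b7bebb5d6bc232cb53
  []],Pt 0x4050e50e724359423213 []],Pt 0x8b64c495a0a2d9337165b58e720f9423223 [Pt 0x10635802d93127690363214b [Pt
  0x1180f93d0a4cd25e90f8d06b2894b [Pt 0x461c04027 [Pt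
  0x46e759d370aaeaa55754f373aceabebdded4fdcb2af7ccf7cab2c3dcdebfe9dbf5f53ceaaea5f56f3ddd52cfafad5d5ccdf57cacfaf9e7d7ccbff1a94b18aacb5cb
  []]]]]]],Pt 0x88f1499358473905dd5dbbfad5736ab9977590e2d0e3227 [Pt 0x20230a316901c5a24b [Pt 0x2018f41eca06316b00b3
  []]]]],Pt 0x106db4d7698739622cb1b241ca37 [Pt 0x136da6bb730c163582cac7c902cb [Pt 0x118ad9535cadac631b241cda2d7 [Pt
  0x83dccbefeb6fd55d3f5575fedbdd575ff6e0f32aaaedbf5574fd55d7fb65555d7fdb9febeeb6ff5f753df55d2cbbe9bfd7dd4bbec1c5acb73
  [],Pt
  0x10fabd576deaba7d85d32baed97f74575ddabbbef6dc2fae5f57efeb6fdfd4bec2e995d76cbfba6ffaed5ddf7b6e1c96ca17dccabed97f74dd776aeebd5db3fbaf6d4d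
  []]]]],Pt 0x4736588f2038b21f258d8c88b [Pt 0x460638b21f258d8c84b [Pt 0x11818e2c87c96363224b [Pt
  0x80a1cb8d08b21b258e3227 [Pt 0x46febb554b2fd88b0ed79ee5dda8aae7ddaed4b08b2c6c9037 [Pt
  0x2062bb95d3f576f9e5736afe15fd2bf962eb6f72deba997d5b1f2411a3cb []]],Pt 0x10b8b2ac2b2d385db8dc1da572a46c9638c897 [Pt
  0x114966bedcc13cac2f9d638b2d1f258d8cb34b [Pt 0x41e5d0aaae5552cfdcb6aaed5737ef38727974171a51f258d8c874b [Pt
  0x119e6cc6a9b554eb967a9d72cbed84f22d08b2c6c960b2b37 [Pt
  0x455572aa967aea96f74debaafbdde1fee57cf6bdb88b20faa967f4daae9775c8cfade3772ae99f7cb7aebd5532aec232cb53 []]],Pt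
  0x4610e3ce87baf97ddb6aac84f28d0d8c894b [Pt 0x80a1c59587cbe918d8c89cb [Pt
  0x11ae5bdedaebe0eaea7b7df7dbbdb8d7d5fcfbebd5869636beb719d9b6ac279336b4b5cb [Pt
  0x8d2cbdb5cc14f6d6b50ae3c7b7414f29e75a83c661b18aecb54b []],Pt
  0x119ed6dab82fee7bf5d7dbbda84edb6d30ae52cd5572dfae6d5577deef6a16ca0a794f2b354b []]]],Pt
  0x2349eb09672eb42e55b9d08b2c6c9037 [Pt 0x20617cdac7165a3e483aadb5d557bba9b5d5634b [Pt
  0x83d96615552aa966afbbf7d6dfbf9b57dbc39d9b3308b2d1b258cd7 [Pt
  0x8babfa5d5fcb1f5ddd3ceefafbb5f576feeac16d96b544590a94b35db9733a5bb50aaeeeb955f7537abbb96555d5eabbaa655777608c5acbd3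
  []]]]],Pt 0x118d25ac55ca966a56b1a3e482728b4b [Pt 0x1186cabb3d577aa8efbef55dfb622c568f920b8ca8bcb [Pt
  0x436cb30c5ca6f96d0aaebe955d7cb1d7d77feebefffd553aeffd8f920e2ca3cb [],Pt 0x8e2cb1a22c836559bb1c907cda2d3 [Pt
  0x86db663fd4dafe95d72c575d6bfde22c4b2a1165a36487bbabb5d54ceab6d7558d7 []]],Pt 0x238b2188b21a4b1ac7241f3a2d3 []]],Pt
  0x1010e561ce872588c83 [Pt 0x46e4db9b080e72691b258e3217 [Pt 0x1078c9a0a0ac683645a46c9638c897 [Pt
  0x84f262d0c2d9f40c5ac7c90728cb []],Pt 0x11cd9630b66d0716b1f240f28cb [Pt 0x1016c8f585b1e50c6c9037 []]],Pt
  0x11cd9630b67438b2c7c90328cb [Pt 0x1022cdb2dac2d8b2845963648191a37 []]],Pt 0x11cd96318e2cb1f240cb [Pt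
  0x118c55caa6ed9576d8d1f240b4b [Pt 0x8dca96d862f946cb6b1c5968f9209ca34b [Pt
  0x11cd8ba37dd36faa77fcb3d5cb3bfe655f6f116293422cb46c91bb6c4b398d7 []],Pt 0x11c590c459046b1c9071a2d3 []],Pt
  0x817ca3e4c873ac6c905b1943921 [Pt 0x81572a9bb655b6d88b2c5555caaaa6aeeed5ddb2aaa6d5db1c9045a33 [Pt
  0x460b2b1572a9bb655f6c31f240b4b [Pt 0x118c5ca6d96b41f2fac38d06ca34b [Pt 0x463c0c037 [Pt
  0x107e542e5b335a2feae5fd51f5d6cbfa9ed73daebd58676d3da66d1f2436cdb3d9a2fcb []]]]]]]],Pt
  0x47228572a6b95588b2c36e54572ab47241ca2d3 [Pt 0x22b9535ca8d60b2b45f28e5d0e2cb1f240cb [Pt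
  0x2055df5f5d32aebb955f5fd753fdff7574cabae955f5fd74dabfaadea1c6857fffd5d32abaee57d5f75d4fd77755d32abaebf5ddd574dabfaadea1cda37fd57dccabbebb7d57fdd37fd57dddbfeabee655df6d535
  []]]]])"

lemma cert4_20: "check_top 5 [R1, R2, R3, R4] excluded4 roots4 [(4, 1, 10, 1), (11, 10, 6, 1), (11, 10, 4, 1)]
    cert4_20"
  by code_simp

definition cert4_21 :: cert where "cert4_21 =
  Ro 1 (Pt 0x11cd9623c86ce58e2c87c90d8c88b [Pt 0x4736406ce58e2cb1f2436320b [Pt 0x118423588b21b258e3227 [Pt
  0x10118e2c87c96363224b [Pt 0x46318c7c91b6cc52caee2cb [Pt 0x1003e560ceb1b2438c8b7 [Pt
  0x46597d07c96b0a97666d0c6c9638cb37 [Pt 0x215f67a096dad38d258adc3ad9d3377b9975b3a6d59038c897 []]],Pt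
  0x118c3ed9d1b5863e4b118accb [Pt 0x118c395846b1b2438c8b7 [Pt 0x23185b3e825b726ec7c963632cb4b [Pt
  0x21df4dae77d3debb9fd81d956856db5a15fd4afe966eee5b553dbeaeb5f7b47c963632cd4b [Pt
  0x10b6ded61c7674e1fddea99572b6ab9d6096f39943e3423213 [Pt 0x47ad76f2aed737f0d3b6d99d08eb41da76dd999422d0e32257 []]],
  Pt 0x85aceb0be2d3849d8b307265b169063438c897 [Pt 0x42db7b584fe5385b653b2a093b1e650d8b423213 [Pt
  0x43be95fcfde657f36aac1b2e9f08eb40ecd949a7063d0e32277 []]]],Pt 0x118d0fb672caa36b0c6c9638cb37 [Pt
  0x40c2d9ad02c5b4a65b1f258d8cb34b [Pt 0x8dac96b0a37d73a56ff5ae967e1b657b4a1ac6343632274b [Pt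
  0x85b6de825e2c66542db7b1a092f1e650f8b423213 []]],Pt 0x213c7ac69e5b73856d66dc1dcf9bf2dadb59038c897 [Pt
  0x42db7b584fe5385b653b2a0ab7f2e508b423213 [Pt 0x10efa57f3f7995fcdaab0cab6b99f08eb434bfb52999c0e32277 []]]]],Pt
  0x1099cb6b096df4e34963dc34e532da41e3438c897 [Pt 0x42db7d613d94e16d94f2a0ab7b2e508b423213 [Pt
  0x43be95fcede657f36aac32f6b99f08fd0d2f6d4a667062d0e32277 []]]]],Pt
  0x232cbac4b916cad1572a8eaaf577e9955ec22cb1b240ca37 [Pt 0x222c3599675dba6ab6dddf688b20b6e54d7195666c7241b3a2d3 [Pt
  0x8bffa97ff4b155d75cbfaee6d7d4dbbaac6ecb155aa22c857f4afe59faed7f5ceaea776d47241b368bd3 []]]],Pt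
  0x46a572ab0809ca91b258e3217 [Pt 0x10baee5d75ffe9bdf60e11e86e559a51b258e32257 [Pt 0x46bb5659868576b2d045ad1f241ca34b
  []],Pt 0x118d2b95d614b9d0c6c9037 [Pt 0x20615b96d6347c90468cb [Pt 0x438b438b135a039326b47241cda2f3 []]]],Pt
  0x8cd76a2ad76ab0b2ed3d3bb4b08b2c6c9037 [Pt 0x818b9456e5d6347c90468cb [Pt 0x11c590e2c4d688b21c5864d68e48231a2f3
  []]]]],Pt 0x8e6cb11e58d9c80f92118a0b [Pt 0x118c739611ac6c9638cb37 [Pt 0x40c6ce58c7c963632ccb [Pt
  0x85c64d63325a51ce414a6cc691b258e3227 [Pt 0x86ca8479b6cb4a2ffb97fdcfdf4daabbd7d56feb056d96947c963632254b [Pt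
  0x10e6ceb0b6cf5e14f9cc1fddea995776ab9d6d1c906ca2d3 [Pt
  0x8aaa554f35ddabb6d5d6daf0ff2f2beb5efc22f41fddbbadb7f2cfba57b51c904ce4ce8b53 []]],Pt
  0x426cf584b24b5e1665325a0adb3bb1b240d7 [Pt 0x21158d616d9ebc2b6cdb868b2964d68e48391a2d3 [Pt
  0x84ad9686a5eda9b543aad72b6eae7f4bc117ad46c903d7 []]]],Pt 0x9acf1758cc96947390ad94cd4f9b5329b6418d0e3227 [Pt
  0x21b2ac22aaaab955555cd54b2ebfed975ffd6abaac6db31b65a503632254b [Pt 0x22d931b27a376e364dce29336c963439c90d8f423213
  []]]],Pt 0x42acca6b080a4c691b258e3227 [Pt 0x808c69325a47c96363224b [Pt 0x100cb654a1ce8359528f92c462894b [Pt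
  0x10336d975833a0b8ceb47241ca2d3 []],Pt 0x8c258b58464f431b240ca2d7 [Pt 0x202eb974dedbf74bf68dcafb503b2b46c90328f7
  []]],Pt 0x11855a652d61192d0c6c902d7 [Pt 0x405d772ebb6fff57beda372b6d40acad1b240f7 []]],Pt
  0x9edbcc5e6f35845b262cc9a1ce48463423213 [Pt 0x8d9c4d08c3169c4626326873928318d08c853 []]]]])"

lemma cert4_21: "check_top 5 [R1, R2, R3, R4] excluded4 roots4 [(10, 1, 1, 0), (11, 10, 6, 1), (1, 1, 4, 1)] cert4_21"
  by code_simp

definition cert4 :: cert where "cert4 =
  Sp 0x275e9 (Sp 0x9d7a (cert4_1) (Sp 0xb57a (cert4_2) (Sp 0x95a (cert4_3) (Sp 0xb5e (cert4_4) (cert4_5))))) (Sp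
  0x9d7a (cert4_6) (Sp 0xb57a (cert4_7) (Sp 0x95a (cert4_8) (Sp 0xb5e (cert4_9) (Sp 34 (Sp 730 (Sp 0x275eb (cert4_10)
  (Sp 0x2d5eb (cert4_11) (cert4_12))) (Sp 0x275eb (cert4_13) (Sp 0x2d5e9 (cert4_14) (Sp 0x2d5eb (cert4_15)
  (cert4_16))))) (Sp 570 (Sp 0x275eb (cert4_17) (Sp 138 (Sp 0x2d5eb (cert4_18) (cert4_19)) (cert4_20)))
  (cert4_21)))))))"

text \<open>Only the upper splits are evaluated here. They are simplified until the boxes of the
  pieces appear literally, with \<open>num_of_numeral\<close> in the role of the code
  equation.\<close>

lemma cert4: "check_top 5 [R1, R2, R3, R4] excluded4 roots4 [(1, 1, 1, 0), (1, 1, 6, 1), (1, 1, 4, 1)] cert4"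
  unfolding cert4_def
  by (simp add: num_of_numeral read_split_def cert4_1 cert4_2 cert4_3 cert4_4 cert4_5 cert4_6 cert4_7 cert4_8 cert4_9
      cert4_10 cert4_11 cert4_12 cert4_13 cert4_14 cert4_15 cert4_16 cert4_17 cert4_18 cert4_19 cert4_20 cert4_21)

theorem lonely4:
  fixes v s :: "node \<Rightarrow> real"
  assumes v: "0 < v R1" "v R1 < v R2" "v R2 < v R3" "v R3 < v R4"
  shows "lonely (1/5) {R1, R2, R3, R4} v s"
proof (rule ccontr)
  assume no: "\<not> lonely (1/5) {R1, R2, R3, R4} v s"
  define w where "w k = (if k = Og then 1 else v k)" for k
  have w: "0 < w k" for k using v by (cases k) (auto simp: w_def)
  have ww: "w R1 = v R1" "w R2 = v R2" "w R3 = v R3" "w R4 = v R4" by (simp_all add: w_def)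
  have "lonely (1 / real_of_int 5) (set ([R1, R2, R3] @ [R4])) w s"
  proof (rule lonely_by_certificate[where X = excluded4 and R = roots4 and z = cert4])
    show "check_top 5 ([R1, R2, R3] @ [R4]) excluded4 roots4 [(1, 1, 1, 0), (1, 1, 6, 1), (1, 1, 4, 1)] cert4"
      using cert4 by simp
    show "lonely (1 / real_of_int (5 - 1)) (set [R1, R2, R3]) w s" for s
      using lonely3[of w s] v by (simp add: ww)
    \<comment> \<open>The two lemmas on much faster runners bound the second and third ratio of the
      initial box.\<close>
    have "\<not> 6 * v R2 \<le> v R3" "\<not> 4 * v R3 \<le> v R4"
      using lonely_fast_pair[OF v] lonely_very_fast_runner[OF v] no by blast+
    then show "box_ok [(1, 1, 1, 0), (1, 1, 6, 1), (1, 1, 4, 1)] (\<lambda>k. 1 / (real_of_int (5 - 1) * w k))"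
      using v w by (simp add: box_ok_def ratios_def ww field_simps)
    have "\<not> (9 * v R4 \<le> 11 * v R2 \<and> 2 * v R4 \<le> 5 * v R1)" using lonely_slowest_triple[OF v] no by blast
    moreover have "\<not> (9 * v R3 \<le> 11 * v R1 \<and> 5 * v R4 \<le> 8 * v R1)" using lonely_fastest_triple[OF v] no by blast
    moreover have "\<not> 11 / v R1 + 12 / v R4 \<le> 19 / v R3" using lonely_close_triple[OF v] no by blast
    moreover have "\<not> (9 * v R4 \<le> 11 * v R2 \<and> 10 * v R1 \<le> v R2)" using lonely_slow_and_triple[OF v] no by blast
    moreover have "\<not> (6 / v R2 + 5 / v R4 \<le> 10 / v R3 \<and> 10 * v R1 \<le> v R2)" using lonely_slow_and_pair[OF v] no
        by blast
    \<comment> \<open>The negated hypotheses are divided by the speeds to match the forms in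
      \<open>Q\<close>.\<close>
    ultimately have "9 / v R2 > 11 / v R4 \<or> 2 / v R1 > 5 / v R4" "9 / v R1 > 11 / v R3 \<or> 5 / v R1 > 8 / v R4"
      "11 / v R1 + 12 / v R4 > 19 / v R3" "9 / v R2 > 11 / v R4 \<or> 10 / v R2 > 1 / v R1"
      "6 / v R2 + 5 / v R4 > 10 / v R3 \<or> 10 / v R2 > 1 / v R1"
      using v by (simp_all add: not_le divide_less_eq less_divide_eq mult.commute)
    then show "\<exists>f\<in>set (excluded4 k). 0 < form_val (\<lambda>k. 1 / (real_of_int (5 - 1) * w k)) (\<lambda>_. 0) f" for k
      by (cases k rule: excluded4.cases) (auto simp: ww algebra_simps)
    show "roots4 t = good_edges 5 [R1, R2, R3] R4 \<or>
        (\<exists>i j x. i \<in> set ([R1, R2, R3] @ [R4]) \<and> j \<in> set ([R1, R2, R3] @ [R4]) \<and>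
      w i < w j \<and> roots4 t = meet_edges (5 * (5 - 1) div 2) ([R1, R2, R3] @ [R4]) i j x)" for t
    proof -
      have "roots4 t = good_edges 5 [R1, R2, R3] R4 \<or> (\<exists>x. roots4 t = meet_edges 10 [R1, R2, R3, R4] R1 R2 x) \<or>
        (\<exists>x. roots4 t = meet_edges 10 [R1, R2, R3, R4] R2 R3 x) \<or> (\<exists>x. roots4 t = meet_edges 10 [R1, R2, R3, R4] R3 R4
            x)"
        by (cases t rule: roots4.cases) (auto simp: good_edges_def meet_edges_def intro:
            exI[of _ 4] exI[of _ "-4"] exI[of _ 0])
      then show ?thesis using v ww by fastforce
    qed
  qed (use w in auto)
  then show False using no by (simp add: lonely_def ww)
qed

section \<open>Lonely Runner zonotopes\<close>

lemma lonely4_list: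
  fixes ps :: "(real \<times> real) list"
  assumes "length ps = 4" "\<forall>p\<in>set ps. 0 < fst p" "distinct (map fst ps)"
  shows "\<exists>t. \<forall>p\<in>set ps. far (1/5) (fst p * t + snd p)"
proof -
  define qs where "qs = sort_key fst ps"
  have qs: "set qs = set ps" "length qs = 4" "sorted (map fst qs)" using assms(1) by (simp_all add: qs_def)
  have "mset (map fst qs) = mset (map fst ps)" by (simp add: qs_def)
  then have "distinct (map fst qs)" using assms(3) mset_eq_imp_distinct_iff by blast
  moreover obtain p1 p2 p3 p4 where p: "qs = [p1, p2, p3, p4]"
    using qs(2) by (auto simp: length_Suc_conv eval_nat_numeral)
  ultimately have less: "fst p1 < fst p2" "fst p2 < fst p3" "fst p3 < fst p4" using qs(3) by auto
  define pick :: "node \<Rightarrow> real \<times> real" where "pick k = (case k of R1 \<Rightarrow> p1 | R2 \<Rightarrow> p2 | R3 \<Rightarrow> p3 | _ \<Rightarrow> p4)" for k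
  have "0 < fst p1" using assms(2) qs(1) p by auto
  then have "lonely (1/5) {R1, R2, R3, R4} (fst \<circ> pick) (snd \<circ> pick)" using less
      by (intro lonely4) (simp_all add: pick_def)
  then show ?thesis unfolding qs(1)[symmetric] p by (simp add: lonely_def pick_def)
qed

text \<open>The relation between the generators has coefficients of both signs; reflecting the
  runners with negative velocity changes only their starting points.\<close>

lemma lonely4_signed:
  fixes ps :: "(real \<times> real) list"
  assumes "length ps = 4" "\<forall>p\<in>set ps. fst p \<noteq> 0" "distinct (map (\<lambda>p. \<bar>fst p\<bar>) ps)"
  shows "\<exists>t. \<forall>p\<in>set ps. far (1/5) (fst p * t + snd p)"
proof -
  obtain r where r: "\<And>a s t. far (1/5) (a * t + s) \<longleftrightarrow> far (1/5) (\<bar>a\<bar> * t + r a s)"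
    using far_abs_velocity[of "1/5"] by metis
  obtain t where "\<forall>p\<in>set ps. far (1/5) (\<bar>fst p\<bar> * t + r (fst p) (snd p))"
    using lonely4_list[of "map (\<lambda>p. (\<bar>fst p\<bar>, r (fst p) (snd p))) ps"] assms by (auto simp: comp_def)
  then show ?thesis using r by blast
qed

lemma far_fractional_part:
  assumes "far \<theta> x"
  obtains m :: int where "\<theta> \<le> x - m" "x - m \<le> 1 - \<theta>"
proof
  show "\<theta> \<le> x - \<lfloor>x\<rfloor>" using assms[unfolded far_def, rule_format, of "\<lfloor>x\<rfloor>"] by linarith
  show "x - \<lfloor>x\<rfloor> \<le> 1 - \<theta>" using assms[unfolded far_def, rule_format, of "\<lfloor>x\<rfloor> + 1"] by linarith
qed

text \<open>Each coordinate is the expansion of a 4 by 4 determinant in which one row of coordinates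
  occurs twice.\<close>

lemma cramer_relation:
  fixes u1 u2 u3 u4 :: "real^3"
  shows "det (vector [u2, u3, u4] :: real^3^3) *\<^sub>R u1 + (- det (vector [u1, u3, u4] :: real^3^3)) *\<^sub>R u2
    + det (vector [u1, u2, u4] :: real^3^3) *\<^sub>R u3 + (- det (vector [u1, u2, u3] :: real^3^3)) *\<^sub>R u4 = 0"
  by (simp add: vec_eq_iff forall_3 det_3 algebra_simps)

lemma in_zonotope:
  assumes "\<And>l. l \<in> {l1, l2, l3, l4} \<Longrightarrow> 0 \<le> l \<and> l \<le> (1::real)"
  shows "c + (l1 *\<^sub>R u1 + l2 *\<^sub>R u2 + l3 *\<^sub>R u3 + l4 *\<^sub>R u4) \<in> zonotope c [u1, u2, u3, u4]"
proof -
  have seg: "l *\<^sub>R u \<in> closed_segment 0 u" if "l \<in> {l1, l2, l3, l4}" for l u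
    using assms[OF that] by (auto simp: in_segment)
  have "l1 *\<^sub>R u1 + (l2 *\<^sub>R u2 + (l3 *\<^sub>R u3 + (l4 *\<^sub>R u4 + 0))) \<in> (\<Sum>u\<leftarrow>[u1, u2, u3, u4]. closed_segment 0 u)"
    unfolding list.map sum_list.Cons sum_list.Nil by (intro set_plus_intro seg) auto
  then show ?thesis unfolding zonotope_def by (simp add: add.assoc set_plus_intro)
qed

section \<open>The covering radius is attained\<close>

lemma compact_set_plus:
  fixes S T :: "'a::real_normed_vector set"
  assumes "compact S" "compact T"
  shows "compact (S + T)"
proof -
  have "S + T = (\<Union>x\<in>S. \<Union>y\<in>T. {x + y})" by (auto simp: set_plus_def)
  then show ?thesis using compact_sums'[OF assms] by simp
qed

lemma compact_zonotope: "compact (zonotope c us)"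
proof -
  have "compact (\<Sum>u\<leftarrow>us. closed_segment 0 u)"
    by (induction us) (auto intro: compact_set_plus compact_segment)
  then show ?thesis by (simp add: zonotope_def compact_set_plus)
qed

lemma integer_lattice_add: "x \<in> integer_lattice \<Longrightarrow> y \<in> integer_lattice \<Longrightarrow> x + y \<in> integer_lattice"
  and integer_lattice_scale: "x \<in> integer_lattice \<Longrightarrow> of_int m *\<^sub>R x \<in> integer_lattice"
  by (auto simp: integer_lattice_def)

lemma closed_integer_lattice: "closed (integer_lattice :: (real^'n) set)"
proof -
  have "closed ((\<lambda>x::real^'n. x $ i) -` \<int>)" for i
    by (intro closed_vimage closed_Ints continuous_intros)
  then have "closed (\<Inter>i. (\<lambda>x::real^'n. x $ i) -` \<int>)" by blast
  also have "(\<Inter>i. (\<lambda>x::real^'n. x $ i) -` \<int>) = integer_lattice" by (auto simp: integer_lattice_def)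
  finally show ?thesis .
qed

text \<open>A \<open>LEAST\<close> over the reals is informative only if the minimum exists. The
  infimum of the admissible scales is itself admissible: compactness of \<open>Z\<close> and
  closedness of the lattice carry the covering to the limit.\<close>

lemma covering_radius_le:
  fixes Z :: "(real^'n) set"
  assumes Z: "compact Z" and \<rho>: "0 < \<rho>" "((*\<^sub>R) \<rho> ` Z) + integer_lattice = UNIV"
  shows "covering_radius Z \<le> \<rho>"
proof -
  define S where "S = {\<rho>. 0 < \<rho> \<and> ((*\<^sub>R) \<rho> ` Z) + integer_lattice = UNIV}"
  define I where "I = Inf S"
  have S: "\<rho> \<in> S" "bdd_below S" "\<And>r. r \<in> S \<Longrightarrow> 0 \<le> r" using \<rho> by (auto simp: S_def intro!: bdd_belowI[of _ 0])
  have I: "0 \<le> I" "\<And>r. r \<in> S \<Longrightarrow> I \<le> r" unfolding I_def using S by (auto intro: cInf_greatest cInf_lower)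
  have "I \<in> closure S" unfolding I_def using S by (intro closure_contains_Inf) auto
  then obtain r where r: "\<And>n. r n \<in> S" "r \<longlonglongrightarrow> I" unfolding closure_sequential by blast
  have cover: "\<exists>z\<in>Z. x - I *\<^sub>R z \<in> integer_lattice" for x
  proof -
    have "\<exists>z\<in>Z. x - r n *\<^sub>R z \<in> integer_lattice" for n
    proof -
      have "x \<in> ((*\<^sub>R) (r n) ` Z) + integer_lattice" using r(1)[of n] by (simp add: S_def)
      then obtain z y where "z \<in> Z" "y \<in> integer_lattice" "x = r n *\<^sub>R z + y" by (auto elim: set_plus_elim)
      then show ?thesis by (intro bexI[of _ z]) simp_all
    qed
    then obtain z where z: "\<And>n. z n \<in> Z" "\<And>n. x - r n *\<^sub>R z n \<in> integer_lattice" by metis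
    from Z z(1) obtain l f where l: "l \<in> Z" "strict_mono f" "(z \<circ> f) \<longlonglongrightarrow> l" unfolding compact_def by blast
    have "(\<lambda>n. x - (r \<circ> f) n *\<^sub>R (z \<circ> f) n) \<longlonglongrightarrow> x - I *\<^sub>R l"
      by (intro tendsto_diff tendsto_const tendsto_scaleR LIMSEQ_subseq_LIMSEQ[OF r(2) l(2)] l(3))
    then have "x - I *\<^sub>R l \<in> integer_lattice"
      using closed_integer_lattice by (rule closed_sequentially[rotated -1]) (use z in simp)
    then show ?thesis using l(1) by blast
  qed
  have "I \<noteq> 0"
  proof
    assume "I = 0"
    \<comment> \<open>At scale 0 only lattice points would be covered, and the point with all
      coordinates 1/2 is none.\<close>
    then have "(\<chi> i. 1/2) \<in> (integer_lattice :: (real^'n) set)" using cover[of "\<chi> i. 1/2"] by simp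
    then have "(1/2::real) \<in> \<int>" by (simp add: integer_lattice_def)
    then obtain m :: int where "(1/2::real) = m" by (rule Ints_cases)
    then have "real_of_int (2 * m) = of_int 1" by simp
    then have "2 * m = 1" by (simp only: of_int_eq_iff)
    then show False by presburger
  qed
  moreover have "x \<in> ((*\<^sub>R) I ` Z) + integer_lattice" for x
    using cover[of x] by (metis imageI set_plus_intro add.commute diff_add_cancel)
  ultimately have "I \<in> S" using I(1) by (auto simp: S_def)
  then have "covering_radius Z = I" unfolding covering_radius_def using I(2)
      by (intro Least_equality) (auto simp: S_def)
  then show ?thesis using I(2) S(1) by simp
qed

text \<open>Coefficients of a point with respect to four generators are determined only up to
  multiples of the relation. Moving along it turns each coefficient into a runner with velocity
  \<open>a1\<close>, ..., \<open>a4\<close>, and integer parts of coefficients belong to the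
  lattice.\<close>

lemma zonotope_covers:
  fixes u1 u2 u3 u4 :: "real^3"
  assumes lattice: "{u1, u2, u3, u4} \<subseteq> integer_lattice" and span: "span {u1, u2, u3} = UNIV"
    and rel: "a1 *\<^sub>R u1 + a2 *\<^sub>R u2 + a3 *\<^sub>R u3 + a4 *\<^sub>R u4 = 0"
    and a: "0 \<notin> {a1, a2, a3, a4}" "distinct [\<bar>a1\<bar>, \<bar>a2\<bar>, \<bar>a3\<bar>, \<bar>a4\<bar>]"
  shows "((*\<^sub>R) (3/5) ` zonotope c [u1, u2, u3, u4]) + integer_lattice = UNIV"
proof -
  have "x \<in> ((*\<^sub>R) (3/5) ` zonotope c [u1, u2, u3, u4]) + integer_lattice" for x
  proof -
    have "x - (3/5) *\<^sub>R c \<in> span {u1, u2, u3}" by (simp add: span)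
    then obtain y1 y2 y3 where y: "x - (3/5) *\<^sub>R c = y1 *\<^sub>R u1 + y2 *\<^sub>R u2 + y3 *\<^sub>R u3"
      by (auto simp: span_breakdown_eq algebra_simps)
    \<comment> \<open>The offset 1/5 turns fractional parts in [1/5, 4/5] into remainders in
      [0, 3/5]. The fourth coefficient starts at 0 because the point was expanded in the other three
      generators.\<close>
    obtain t where t: "far (1/5) (a1 * t + (y1 + 1/5))" "far (1/5) (a2 * t + (y2 + 1/5))"
        "far (1/5) (a3 * t + (y3 + 1/5))" "far (1/5) (a4 * t + 1/5)"
      using lonely4_signed[of "[(a1, y1 + 1/5), (a2, y2 + 1/5), (a3, y3 + 1/5), (a4, 1/5)]"] a by auto
    obtain m1 m2 m3 m4 :: int where m: "1/5 \<le> a1 * t + (y1 + 1/5) - m1" "a1 * t + (y1 + 1/5) - m1 \<le> 1 - 1/5"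
        "1/5 \<le> a2 * t + (y2 + 1/5) - m2" "a2 * t + (y2 + 1/5) - m2 \<le> 1 - 1/5"
        "1/5 \<le> a3 * t + (y3 + 1/5) - m3" "a3 * t + (y3 + 1/5) - m3 \<le> 1 - 1/5"
        "1/5 \<le> a4 * t + 1/5 - m4" "a4 * t + 1/5 - m4 \<le> 1 - 1/5"
      using t by (elim far_fractional_part) blast
    \<comment> \<open>The factor 5/3 stretches the remainders from [0, 3/5] to [0, 1], the
      coefficients of a point of the zonotope.\<close>
    define z where "z = c + ((5/3 * (a1 * t + y1 - m1)) *\<^sub>R u1 + (5/3 * (a2 * t + y2 - m2)) *\<^sub>R u2
      + (5/3 * (a3 * t + y3 - m3)) *\<^sub>R u3 + (5/3 * (a4 * t - m4)) *\<^sub>R u4)"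
    define w where "w = of_int m1 *\<^sub>R u1 + of_int m2 *\<^sub>R u2 + of_int m3 *\<^sub>R u3 + of_int m4 *\<^sub>R u4"
    have "z \<in> zonotope c [u1, u2, u3, u4]" unfolding z_def using m by (intro in_zonotope) auto
    moreover have "w \<in> integer_lattice"
      unfolding w_def using lattice by (intro integer_lattice_add integer_lattice_scale) auto
    moreover have "x = (3/5) *\<^sub>R z + w"
    proof -
      have scale: "(3/5) *\<^sub>R ((5/3 * p) *\<^sub>R u) = p *\<^sub>R u" for p and u :: "real^3" by simp
      have "(3/5) *\<^sub>R z = (3/5) *\<^sub>R c + ((a1 * t + y1 - m1) *\<^sub>R u1 + (a2 * t + y2 - m2) *\<^sub>R u2
          + (a3 * t + y3 - m3) *\<^sub>R u3 + (a4 * t - m4) *\<^sub>R u4)"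
        by (simp only: z_def scaleR_add_right scale)
      then have "(3/5) *\<^sub>R z + w = (3/5) *\<^sub>R c + (y1 *\<^sub>R u1 + y2 *\<^sub>R u2 + y3 *\<^sub>R u3)
          + t *\<^sub>R (a1 *\<^sub>R u1 + a2 *\<^sub>R u2 + a3 *\<^sub>R u3 + a4 *\<^sub>R u4)"
        by (simp add: w_def algebra_simps)
      then show ?thesis unfolding rel y[symmetric] by simp
    qed
    ultimately show ?thesis by (auto intro: set_plus_intro)
  qed
  then show ?thesis by blast
qed

lemma covering_radius_sLR_zonotope:
  assumes Z: "sLR_zonotope Z c us" and pos: "\<forall>w\<in>set (volume_vector us). 0 < w"
  shows "covering_radius Z \<le> 3/5"
proof -
  have us: "length us = 4" "set us \<subseteq> integer_lattice" "basis_list (omit_nth 3 us)" "distinct (volume_vector us)"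
    using Z by (auto simp: sLR_zonotope_def LR_generators_def)
  obtain u1 u2 u3 u4 where u: "us = [u1, u2, u3, u4]" using us(1) by (auto simp: length_Suc_conv eval_nat_numeral)
  \<comment> \<open>The signs alternate as \<open>cramer_relation\<close> requires; the absolute
    values are the entries of the volume vector.\<close>
  define a1 a2 a3 a4 where "a1 = det (vector [u2, u3, u4] :: real^3^3)" "a2 = - det (vector [u1, u3, u4] :: real^3^3)"
    "a3 = det (vector [u1, u2, u4] :: real^3^3)" "a4 = - det (vector [u1, u2, u3] :: real^3^3)"
  note a_def = this
  have vol: "volume_vector us = [\<bar>a1\<bar>, \<bar>a2\<bar>, \<bar>a3\<bar>, \<bar>a4\<bar>]"
    by (simp add: volume_vector_def u omit_nth_def a_def eval_nat_numeral)
  have "((*\<^sub>R) (3/5) ` zonotope c [u1, u2, u3, u4]) + integer_lattice = UNIV"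
  proof (rule zonotope_covers)
    show "span {u1, u2, u3} = UNIV" using us(3) by (simp add: basis_list_def u omit_nth_def eval_nat_numeral)
    show "a1 *\<^sub>R u1 + a2 *\<^sub>R u2 + a3 *\<^sub>R u3 + a4 *\<^sub>R u4 = 0" unfolding a_def by (rule cramer_relation)
  qed (use us(2,4) pos vol u in auto)
  moreover have "Z = zonotope c [u1, u2, u3, u4]" using Z by (simp add: sLR_zonotope_def u)
  ultimately show ?thesis using covering_radius_le[OF compact_zonotope, of "3/5"] by simp
qed

section \<open>The number of admissible volume vectors\<close>

definition increasing :: "int \<Rightarrow> (int \<times> int \<times> int \<times> int) set" where
  "increasing n = {(a, b, c, d). 1 \<le> a \<and> a < b \<and> b < c \<and> c < d \<and> a + b + c + d \<le> n}"

definition primitive :: "int \<Rightarrow> (int \<times> int \<times> int \<times> int) set" where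
  "primitive n = {(a, b, c, d) \<in> increasing n. gcd a (gcd b (gcd c d)) = 1}"

lemma int_le_div_iff:
  fixes g m n :: int
  assumes "0 < g"
  shows "m \<le> n div g \<longleftrightarrow> g * m \<le> n"
proof
  assume "m \<le> n div g"
  then have "g * m \<le> g * (n div g)" using assms by simp
  also have "\<dots> \<le> n" using assms pos_mod_sign[of g n] minus_mod_eq_mult_div[of n g] by linarith
  finally show "g * m \<le> n" .
next
  assume "g * m \<le> n"
  then have "g * m div g \<le> n div g" using assms by (rule zdiv_mono1)
  then show "m \<le> n div g" using assms by simp
qed

lemma sum_arith_progression: "(\<Sum>i=1..int j. m - 2 * i) = int j * (m - int j - 1)"
proof (induction j)
  case (Suc j)
  have "{1..int (Suc j)} = insert (int j + 1) {1..int j}" by auto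
  then show ?case using Suc by (simp add: algebra_simps)
qed simp

lemma finite_increasing: "finite (increasing n)"
  by (rule finite_subset[of _ "{1..n} \<times> {1..n} \<times> {1..n} \<times> {1..n}"]) (auto simp: increasing_def)

text \<open>For fixed \<open>a\<close> and \<open>b\<close> the pairs \<open>(c, d)\<close> are
  counted in closed form, which leaves a double sum short enough for evaluation.\<close>

definition count_increasing :: "int \<Rightarrow> int" where
  "count_increasing n = (\<Sum>a\<leftarrow>[1..n div 4]. \<Sum>b\<leftarrow>[a + 1..(n - a) div 3]. (n - a - 3 * b - 1)\<^sup>2 div 4)"

lemma card_increasing: "int (card (increasing n)) = count_increasing n"
proof -
  \<comment> \<open>The upper limits guarantee that the innermost interval has exactly
    \<open>n - a - b - 2 * c\<close> elements, a nonnegative number.\<close>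
  have "increasing n = (SIGMA a:{1..n div 4}. SIGMA b:{a + 1..(n - a) div 3}. SIGMA c:{b + 1..(n - a - b) div 2}.
      {c + 1..n - a - b - c})"
    unfolding increasing_def by auto
  then have "int (card (increasing n)) =
      (\<Sum>a\<in>{1..n div 4}. \<Sum>b\<in>{a + 1..(n - a) div 3}. \<Sum>c\<in>{b + 1..(n - a - b) div 2}. n - a - b - 2 * c)"
    by (simp; intro sum.cong refl; auto)
  also have "\<dots> = (\<Sum>a\<in>{1..n div 4}. \<Sum>b\<in>{a + 1..(n - a) div 3}. (n - a - 3 * b - 1)\<^sup>2 div 4)"
  proof (intro sum.cong refl)
    fix a b assume "b \<in> {a + 1..(n - a) div 3}"
    define r where "r = n - a - b"
    define j where "j = nat (r div 2 - b)"
    define e where "e = r mod 2"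
    have j: "r = 2 * (b + int j) + e" "r div 2 = b + int j" using \<open>b \<in> _\<close> by (auto simp: j_def e_def r_def)
    have "(\<Sum>c\<in>{b + 1..r div 2}. r - 2 * c) = (\<Sum>i=1..int j. r - 2 * (i + b))"
      unfolding j(2) by (rule sum.reindex_bij_witness[of _ "\<lambda>i. i + b" "\<lambda>c. c - b"]) auto
    also have "\<dots> = int j * (int j - 1) + e * int j"
      using sum_arith_progression[where m = "r - 2 * b" and j = j] unfolding j(1) by (simp add: algebra_simps)
    also have "\<dots> = (r - 2 * b - 1)\<^sup>2 div 4"
    proof -
      \<comment> \<open>The square exceeds four times the sum by \<open>1 - e\<close>, and this
        remainder disappears in the division by 4.\<close>
      have "e = 0 \<or> e = 1" unfolding e_def by auto
      then have "(r - 2 * b - 1)\<^sup>2 = 4 * (int j * (int j - 1) + e * int j) + (1 - e)"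
        unfolding j(1) by (auto simp: power2_eq_square algebra_simps)
      then show ?thesis using \<open>e = 0 \<or> e = 1\<close> by auto
    qed
    finally show "(\<Sum>c\<in>{b + 1..(n - a - b) div 2}. n - a - b - 2 * c) = (n - a - 3 * b - 1)\<^sup>2 div 4"
      by (simp add: r_def algebra_simps)
  qed
  finally show ?thesis by (simp add: count_increasing_def sum_list_distinct_conv_sum_set)
qed

text \<open>Dividing by the greatest common divisor \<open>g\<close> sends quadruples with sum at
  most \<open>n\<close> to primitive ones with sum at most \<open>n div g\<close>, and
  multiplication by \<open>g\<close> is the inverse.\<close>

lemma card_increasing_by_gcd: "card (increasing n) = (\<Sum>g\<in>{1..n}. card (primitive (n div g)))"
proof -
  have "bij_betw (\<lambda>(g, a, b, c, d). (g * a, g * b, g * c, g * d)) (SIGMA g:{1..n}. primitive (n div g))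
      (increasing n)"
  proof (rule bij_betwI[where g = "\<lambda>(a, b, c, d). let g
      = gcd a (gcd b (gcd c d)) in (g, a div g, b div g, c div g, d div g)"])
    show "(\<lambda>(g, a, b, c, d). (g * a, g * b, g * c, g * d)) \<in> (SIGMA g:{1..n}. primitive (n div g)) \<rightarrow> increasing n"
    proof clarsimp
      fix g a b c d assume g: "1 \<le> g" "g \<le> n" and p: "(a, b, c, d) \<in> primitive (n div g)"
      then have p: "1 \<le> a" "a < b" "b < c" "c < d" "a + b + c + d \<le> n div g"
          by (auto simp: primitive_def increasing_def)
      have "g * (a + b + c + d) \<le> n" using p(5) g by (simp add: int_le_div_iff)
      then show "(g * a, g * b, g * c, g * d) \<in> increasing n"
        using p g by (auto simp: increasing_def distrib_left intro: mult_pos_pos int_one_le_iff_zero_less[THEN iffD2])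
    qed
    show "(\<lambda>(a, b, c, d). let g = gcd a (gcd b (gcd c d)) in (g, a div g, b div g, c div g, d div g))
      \<in> increasing n \<rightarrow> (SIGMA g:{1..n}. primitive (n div g))"
    proof clarify
      fix a b c d assume "(a, b, c, d) \<in> increasing n"
      then have p: "1 \<le> a" "a < b" "b < c" "c < d" "a + b + c + d \<le> n" by (auto simp: increasing_def)
      define g where "g = gcd a (gcd b (gcd c d))"
      have g: "0 < g" "g dvd a" "g dvd b" "g dvd c" "g dvd d" using p(1) by (auto simp: g_def intro: dvd_trans)
      then obtain a' b' c' d' where e: "a = g * a'" "b = g * b'" "c = g * c'" "d = g * d'" by (auto elim!: dvdE)
      have "g * gcd a' (gcd b' (gcd c' d')) = g"
        using g(1) gcd_mult_distrib_int[of g] by (metis abs_of_pos e g_def)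
      then have "gcd a' (gcd b' (gcd c' d')) = 1" using g(1) by simp
      moreover have "a' + b' + c' + d' \<le> n div g" using p(5) g(1) by (simp add: e int_le_div_iff algebra_simps)
      moreover have "0 < g * a'" using p(1) by (simp add: e)
      then have "1 \<le> a'" using g(1) by (simp add: zero_less_mult_iff)
      moreover have "a' < b'" "b' < c'" "c' < d'" using p g(1) by (auto simp: e)
      moreover have "g \<le> a" using p(1) g by (auto intro: zdvd_imp_le)
      then have "g \<le> n" using p by linarith
      ultimately show "(let g = gcd a (gcd b (gcd c d)) in (g, a div g, b div g, c div g, d div g)) \<in> (SIGMA g:{1..n}.
          primitive (n div g))"
        using p g(1) unfolding g_def[symmetric] by (simp add: e primitive_def increasing_def Let_def)
    qed
    show "(\<lambda>(a, b, c, d). let g = gcd a (gcd b (gcd c d)) in (g, a div g, b div g, c div g, d div g))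
      ((\<lambda>(g, a, b, c, d). (g * a, g * b, g * c, g * d)) x) = x" if "x \<in> (SIGMA g:{1..n}. primitive (n div g))" for x
      using that by (auto simp: primitive_def gcd_mult_distrib_int[symmetric] Let_def)
    show "(\<lambda>(g, a, b, c, d). (g * a, g * b, g * c, g * d))
      ((\<lambda>(a, b, c, d). let g = gcd a (gcd b (gcd c d)) in (g, a div g, b div g, c div g, d div g)) y) = y"
      for y :: "int \<times> int \<times> int \<times> int"
    proof (cases y)
      case (fields a b c d)
      have "gcd a (gcd b (gcd c d)) dvd x" if "x \<in> {a, b, c, d}" for x
        using that by (auto intro: dvd_trans)
      then show ?thesis by (simp add: fields Let_def)
    qed
  qed
  then have "card (increasing n) = card (SIGMA g:{1..n}. primitive (n div g))" by (simp add: bij_betw_same_card)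
  also have "\<dots> = (\<Sum>g\<in>{1..n}. card (primitive (n div g)))"
    by (rule card_SigmaI) (auto simp: primitive_def intro: finite_subset[OF _ finite_increasing])
  finally show ?thesis .
qed

text \<open>Moebius inversion as a recursion: the term of divisor 1 is isolated. Since 1 + 2 + 3 + 4
  = 10 is the smallest possible sum, only divisors up to \<open>n div 10\<close> contribute.\<close>

lemma card_primitive:
  "int (card (primitive n)) = (if n < 10 then 0
      else count_increasing n - (\<Sum>g\<leftarrow>[2..n div 10]. int (card (primitive (n div g)))))"
proof (cases "n < 10")
  case True
  then have "primitive n = {}" by (auto simp: primitive_def increasing_def)
  then show ?thesis using True by simp
next
  case False
  have "card (primitive (n div g)) = 0" if "g \<in> {1..n} - {1..n div 10}" for g
  proof -
    have "0 < g" "n < g * 10" using that by auto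
    then have "n div g < 10" using int_le_div_iff[of g 10 n] by linarith
    then have "primitive (n div g) = {}" by (auto simp: primitive_def increasing_def)
    then show ?thesis by simp
  qed
  then have "card (increasing n) = (\<Sum>g\<in>{1..n div 10}. card (primitive (n div g)))"
    unfolding card_increasing_by_gcd using False by (intro sum.mono_neutral_right) auto
  also have "{1..n div 10} = insert 1 {2..n div 10}" using False by auto
  finally have "int (card (increasing n))
      = int (card (primitive n)) + (\<Sum>g\<in>{2..n div 10}. int (card (primitive (n div g))))"
    by simp
  then show ?thesis using False by (simp add: card_increasing sum_list_distinct_conv_sum_set)
qed

text \<open>The arguments are the values of \<open>195 div g\<close> that are at least 10. Iterated
  floor divisions compose, so the recursion of \<open>card_primitive\<close> started at 195 stays
  within this list.\<close>

lemma count_increasing_values: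
  "count_increasing 10 = 1"
  "count_increasing 11 = 2"
  "count_increasing 12 = 4"
  "count_increasing 13 = 7"
  "count_increasing 15 = 18"
  "count_increasing 16 = 27"
  "count_increasing 17 = 38"
  "count_increasing 19 = 71"
  "count_increasing 21 = 121"
  "count_increasing 24 = 241"
  "count_increasing 27 = 431"
  "count_increasing 32 = 973"
  "count_increasing 39 = 2427"
  "count_increasing 48 = 6166"
  "count_increasing 65 = 23160"
  "count_increasing 97 = 126868"
  "count_increasing 195 = 2285448"
  by code_simp+

lemma card_primitive_195: "card (primitive 195) = 2133561"
proof -
  have p10: "int (card (primitive 10)) = 1"
    by (subst card_primitive) (simp add: upto.simps count_increasing_values)
  have p11: "int (card (primitive 11)) = 2"
    by (subst card_primitive) (simp add: upto.simps count_increasing_values)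
  have p12: "int (card (primitive 12)) = 4"
    by (subst card_primitive) (simp add: upto.simps count_increasing_values)
  have p13: "int (card (primitive 13)) = 7"
    by (subst card_primitive) (simp add: upto.simps count_increasing_values)
  have p15: "int (card (primitive 15)) = 18"
    by (subst card_primitive) (simp add: upto.simps count_increasing_values)
  have p16: "int (card (primitive 16)) = 27"
    by (subst card_primitive) (simp add: upto.simps count_increasing_values)
  have p17: "int (card (primitive 17)) = 38"
    by (subst card_primitive) (simp add: upto.simps count_increasing_values)
  have p19: "int (card (primitive 19)) = 71"
    by (subst card_primitive) (simp add: upto.simps count_increasing_values)
  have p21: "int (card (primitive 21)) = 120"
    by (subst card_primitive) (simp add: upto.simps count_increasing_values p10)
  have p24: "int (card (primitive 24)) = 237"
    by (subst card_primitive) (simp add: upto.simps count_increasing_values p12)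
  have p27: "int (card (primitive 27)) = 424"
    by (subst card_primitive) (simp add: upto.simps count_increasing_values p13)
  have p32: "int (card (primitive 32)) = 945"
    by (subst card_primitive) (simp add: upto.simps count_increasing_values p10 p16)
  have p39: "int (card (primitive 39)) = 2349"
    by (subst card_primitive) (simp add: upto.simps count_increasing_values p13 p19)
  have p48: "int (card (primitive 48)) = 5898"
    by (subst card_primitive) (simp add: upto.simps count_increasing_values p12 p16 p24)
  have p65: "int (card (primitive 65)) = 22060"
    by (subst card_primitive) (simp add: upto.simps count_increasing_values p10 p13 p16 p21 p32)
  have p97: "int (card (primitive 97)) = 119678"
    by (subst card_primitive) (simp add: upto.simps count_increasing_values p10 p12 p13 p16 p19 p24 p32 p48)
  have p195: "int (card (primitive 195)) = 2133561"
    by (subst card_primitive) (simp add: upto.simps count_increasing_values p10 p11 p12 p13 p15 p16 p17 p19 p21 p24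
        p27 p32 p39 p48 p65 p97)
  show ?thesis using p195 by simp
qed

lemma admissible_vectors_eq: "admissible_vectors = primitive 195"
  by (auto simp: admissible_vectors_def primitive_def increasing_def)

theorem theorem4p3:
  shows "card admissible_vectors = 2133561 \<and>
    (\<forall>v1 v2 v3 v4 :: int. (v1, v2, v3, v4) \<in> admissible_vectors \<longrightarrow>
      (\<forall>(Z :: (real^3) set) c us.
         sLR_zonotope Z c us \<and>
         sort (volume_vector us) = map real_of_int [v1, v2, v3, v4] \<longrightarrow>
         covering_radius Z \<le> 3/5))"
proof (intro conjI allI impI)
  show "card admissible_vectors = 2133561" by (simp add: admissible_vectors_eq card_primitive_195)
next
  fix v1 v2 v3 v4 :: int and Z :: "(real^3) set" and c us
  assume v: "(v1, v2, v3, v4) \<in> admissible_vectors"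
    and Z: "sLR_zonotope Z c us \<and> sort (volume_vector us) = map real_of_int [v1, v2, v3, v4]"
  \<comment> \<open>Sorting keeps the entries, and positivity of the volumes does not depend on
    their order.\<close>
  have "set (volume_vector us) = set (map real_of_int [v1, v2, v3, v4])" using Z by (metis set_sort)
  then have "\<forall>w\<in>set (volume_vector us). 0 < w" using v by (auto simp: admissible_vectors_def)
  then show "covering_radius Z \<le> 3/5" using Z covering_radius_sLR_zonotope by blast
qed

end
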